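(* Let $1\le p_1,p_2,q_1,q_2\le\infty$, $s_1,s_2,t_1,t_2\in\mathbb{R}$, $\tau\in[0,1]$. Then $$(\ast)\qquad\forall\sigma\in M^{\infty,1}(\mathbb{R}^{2d})\Longrightarrow OP_\tau(\sigma):\mathcal{M}^{p_1,q_1}_{v_{s_1,t_1}}(\mathbb{R}^d)\longrightarrow M^{p_2,q_2}_{v_{s_2,t_2}}(\mathbb{R}^d)$$ if and only if both of the following hold: (a) either $s_1=s_2=0$ and $p_1=p_2$, or $$\begin{cases}s_2\le0\le s_1,\\ \frac1{p_2}+\frac{s_2}d<\frac1{p_1}+\frac{s_1}d,\\ (p_1,s_1)=(\infty,0)\ \text{ if }\ \frac1{p_1}+\frac{s_1}d=0,\\ (p_2,s_2)=(1,0)\ \text{ if }\ \frac1{p_2}+\frac{s_2}d=1;\end{cases}$$ (b) either $t_1=t_2=0$ and $q_1=q_2$, or $$\begin{cases}t_2\le0\le t_1,\\ \frac1{q_2}+\frac{t_2}d<\frac1{q_1}+\frac{t_1}d,\\ (q_1,t_1)=(\infty,0)\ \text{ if }\ \frac1{q_1}+\frac{t_1}d=0,\\ (q_2,t_2)=(1,0)\ \text{ if }\ \frac1{q_2}+\frac{t_2}d=1.\end{cases}$$ In particular, when $s_i=t_i=0$, $i=1,2$, $(\ast)$ holds if and only if $p_1\le p_2$ and $q_1\le q_2$.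
   Context: $1/\infty=0$. $\langle\cdot,\cdot\rangle$ extends $\langle f,g\rangle=\int f\bar g$ to $\mathcal{S}'\times\mathcal{S}$. $\langle x\rangle=(1+|x|^2)^{1/2}$ and $v_{s,t}(z)=\langle z_1\rangle^s\langle z_2\rangle^t$ for $z=(z_1,z_2)\in\mathbb{R}^{2d}$. $\tau$-Wigner distribution: $W_\tau(f_1,f_2)(x,\xi)=\int_{\mathbb{R}^d}f_1(x+\tau t)\overline{f_2(x-(1-\tau)t)}e^{-2\pi i\xi\cdot t}\,dt$. $\tau$-pseudodifferential operator with symbol $\sigma\in\mathcal{S}'(\mathbb{R}^{2d})$: $\langle OP_\tau(\sigma)f,g\rangle=\langle\sigma,W_\tau(g,f)\rangle$ for $f,g\in\mathcal{S}(\mathbb{R}^d)$. Modulation spaces: for $f\in\mathcal{S}'(\mathbb{R}^n)$ and a fixed nonzero $\phi\in\mathcal{S}(\mathbb{R}^n)$, $V_\phi f(x,\xi)=\langle f,M_\xi T_x\phi\rangle$ with $T_xg(t)=g(t-x)$, $M_\xi g(t)=e^{2\pi it\cdot\xi}g(t)$. $M^{p,q}_m(\mathbb{R}^n)$ is the set of $f\in\mathcal{S}'(\mathbb{R}^n)$ with $\|f\|_{M^{p,q}_m}=\big(\int(\int|V_\phi f(x,\xi)|^pm(x,\xi)^pdx)^{q/p}d\xi\big)^{1/q}<\infty$ (usual modification if $p$ or $q$ is $\infty$; different $\phi$ give equivalent norms); $M^{p,q}$ is the case $m\equiv1$. $M^{\infty,1}(\mathbb{R}^{2d})$ is Sjöstrand's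 class. $\mathcal{M}^{p,q}_m(\mathbb{R}^n)$ is the closure of $\mathcal{S}(\mathbb{R}^n)$ in $M^{p,q}_m(\mathbb{R}^n)$. The notation "$\forall\sigma\in X\Longrightarrow OP_\tau(\sigma):\mathcal{M}^{p_1,q_1}_{m_1}\to M^{p_2,q_2}_{m_2}$" means that for every $\sigma\in X$ there is $C_\sigma$ with $\|OP_\tau(\sigma)f\|_{M^{p_2,q_2}_{m_2}}\le C_\sigma\|f\|_{M^{p_1,q_1}_{m_1}}$ for all $f\in\mathcal{S}(\mathbb{R}^d)$. *)

theory Defs
  imports "HOL-Analysis.Analysis" "HOL-Probability.Essential_Supremum"
begin

definition japanese_bracket :: "'a::real_normed_vector \<Rightarrow> real" where
  "japanese_bracket x = sqrt (1 + (norm x)\<^sup>2)"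

definition weight :: "real \<Rightarrow> real \<Rightarrow> 'a::real_normed_vector \<times> 'a \<Rightarrow> real" where
  "weight s t = (\<lambda>(x, \<xi>). japanese_bracket x powr s * japanese_bracket \<xi> powr t)"


subsection \<open>Schwartz functions and tempered distributions\<close>

text \<open>A multi-index is encoded as a list of coordinate vectors, one per differentiation.\<close>

fun iterated_partial :: "'a::euclidean_space list \<Rightarrow> ('a \<Rightarrow> complex) \<Rightarrow> 'a \<Rightarrow> complex" where
  "iterated_partial [] f = f"
| "iterated_partial (b # bs) f = (\<lambda>x. frechet_derivative (iterated_partial bs f) (at x) b)"

definition schwartz :: "('a::euclidean_space \<Rightarrow> complex) set" where
  "schwartz = {f. \<forall>bs. set bs \<subseteq> Basis \<longrightarrow>
     (\<forall>x. iterated_partial bs f differentiable (at x)) \<and>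
     (\<forall>k::nat. bounded (range (\<lambda>x. of_real (japanese_bracket x ^ k) * iterated_partial bs f x)))}"

definition schwartz_seminorm :: "nat \<Rightarrow> 'a::euclidean_space list \<Rightarrow> ('a \<Rightarrow> complex) \<Rightarrow> real" where
  "schwartz_seminorm k bs f = (SUP x. japanese_bracket x ^ k * cmod (iterated_partial bs f x))"

text \<open>
  Tempered distributions are functionals on arbitrary functions that are linear and continuous on
  the Schwartz space; their values at functions outside the Schwartz space carry no meaning.
  Continuity is boundedness by a finite sum of the seminorms that define the Schwartz topology.
\<close>

definition tempered_distributions :: "(('a::euclidean_space \<Rightarrow> complex) \<Rightarrow> complex) set" where
  "tempered_distributions = {u.
     (\<forall>f\<in>schwartz. \<forall>g\<in>schwartz. u (\<lambda>x. f x + g x) = u f + u g) \<and>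
     (\<forall>c. \<forall>f\<in>schwartz. u (\<lambda>x. c * f x) = c * u f) \<and>
     (\<exists>C k. \<forall>f\<in>schwartz. cmod (u f) \<le>
        C * (\<Sum>bs\<in>{bs. set bs \<subseteq> Basis \<and> length bs \<le> k}. schwartz_seminorm k bs f))}"

text \<open>The distribution given by a function, and the sesquilinear extension of
  the inner product \<open>\<integral> f (cnj g)\<close>.\<close>

definition distribution_of :: "('a::euclidean_space \<Rightarrow> complex) \<Rightarrow> ('a \<Rightarrow> complex) \<Rightarrow> complex" where
  "distribution_of f g = (LINT x|lborel. f x * g x)"

definition pairing :: "(('a \<Rightarrow> complex) \<Rightarrow> complex) \<Rightarrow> ('a \<Rightarrow> complex) \<Rightarrow> complex" where
  "pairing u g = u (\<lambda>x. cnj (g x))"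


subsection \<open>Modulation spaces\<close>

definition translation :: "'a::euclidean_space \<Rightarrow> ('a \<Rightarrow> complex) \<Rightarrow> 'a \<Rightarrow> complex" where
  "translation x g = (\<lambda>t. g (t - x))"

definition modulation :: "'a::euclidean_space \<Rightarrow> ('a \<Rightarrow> complex) \<Rightarrow> 'a \<Rightarrow> complex" where
  "modulation \<xi> g = (\<lambda>t. cis (2 * pi * (t \<bullet> \<xi>)) * g t)"

definition STFT :: "('a::euclidean_space \<Rightarrow> complex) \<Rightarrow> (('a \<Rightarrow> complex) \<Rightarrow> complex) \<Rightarrow> 'a \<Rightarrow> 'a \<Rightarrow> complex" where
  "STFT \<phi> u x \<xi> = pairing u (modulation \<xi> (translation x \<phi>))"

text \<open>The power \<open>x ^ r\<close> of an extended nonnegative number, for real exponents \<open>r > 0\<close>.\<close>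

definition ennreal_powr :: "ennreal \<Rightarrow> real \<Rightarrow> ennreal" where
  "ennreal_powr x r = (if x = \<infinity> then \<infinity> else ennreal (enn2real x powr r))"

definition Lp_norm :: "ennreal \<Rightarrow> ('a::euclidean_space \<Rightarrow> ennreal) \<Rightarrow> ennreal" where
  "Lp_norm p F =
     (if p = \<infinity> then esssup lborel F
      else ennreal_powr (\<integral>\<^sup>+ x. ennreal_powr (F x) (enn2real p) \<partial>lborel) (1 / enn2real p))"

definition modulation_norm ::
  "('a::euclidean_space \<Rightarrow> complex) \<Rightarrow> ('a \<times> 'a \<Rightarrow> real) \<Rightarrow> ennreal \<Rightarrow> ennreal \<Rightarrow>
   (('a \<Rightarrow> complex) \<Rightarrow> complex) \<Rightarrow> ennreal" where
  "modulation_norm \<phi> m p q u =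
     Lp_norm q (\<lambda>\<xi>. Lp_norm p (\<lambda>x. ennreal (cmod (STFT \<phi> u x \<xi>) * m (x, \<xi>))))"

definition modulation_space ::
  "('a::euclidean_space \<Rightarrow> complex) \<Rightarrow> ('a \<times> 'a \<Rightarrow> real) \<Rightarrow> ennreal \<Rightarrow> ennreal \<Rightarrow>
   (('a \<Rightarrow> complex) \<Rightarrow> complex) set" where
  "modulation_space \<phi> m p q = {u \<in> tempered_distributions. modulation_norm \<phi> m p q u < \<infinity>}"


subsection \<open>Pseudodifferential operators\<close>

definition Wigner ::
  "real \<Rightarrow> ('a::euclidean_space \<Rightarrow> complex) \<Rightarrow> ('a \<Rightarrow> complex) \<Rightarrow> 'a \<times> 'a \<Rightarrow> complex" where
  "Wigner \<tau> f1 f2 = (\<lambda>(x, \<xi>). LINT t|lborel.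
     f1 (x + \<tau> *\<^sub>R t) * cnj (f2 (x - (1 - \<tau>) *\<^sub>R t)) * cis (- 2 * pi * (\<xi> \<bullet> t)))"

definition OP ::
  "real \<Rightarrow> (('a::euclidean_space \<times> 'a \<Rightarrow> complex) \<Rightarrow> complex) \<Rightarrow> ('a \<Rightarrow> complex) \<Rightarrow>
   ('a \<Rightarrow> complex) \<Rightarrow> complex" where
  "OP \<tau> \<sigma> f = (\<lambda>h. pairing \<sigma> (Wigner \<tau> (\<lambda>x. cnj (h x)) f))"

lemma pairing_OP: "pairing (OP \<tau> \<sigma> f) g = pairing \<sigma> (Wigner \<tau> g f)"
  by (simp add: OP_def pairing_def)

text \<open>
  Every symbol in \<open>X\<close> gives an operator that is bounded from the closure of the Schwartz space in
  \<open>M(p1,q1;m1)\<close> to \<open>M(p2,q2;m2)\<close>. By convention this means the norm estimate on Schwartz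
  functions, so the closure itself does not occur. The function \<open>\<phi>\<close> is the window of both norms.
\<close>

definition all_OP_bounded ::
  "('a::euclidean_space \<Rightarrow> complex) \<Rightarrow> real \<Rightarrow> (('a \<times> 'a \<Rightarrow> complex) \<Rightarrow> complex) set \<Rightarrow>
   ('a \<times> 'a \<Rightarrow> real) \<Rightarrow> ennreal \<Rightarrow> ennreal \<Rightarrow>
   ('a \<times> 'a \<Rightarrow> real) \<Rightarrow> ennreal \<Rightarrow> ennreal \<Rightarrow> bool" where
  "all_OP_bounded \<phi> \<tau> X m1 p1 q1 m2 p2 q2 \<longleftrightarrow>
     (\<forall>\<sigma>\<in>X. \<exists>C::real. \<forall>f\<in>schwartz.
        modulation_norm \<phi> m2 p2 q2 (OP \<tau> \<sigma> f)
          \<le> ennreal C * modulation_norm \<phi> m1 p1 q1 (distribution_of f))"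


subsection \<open>The condition on the indices\<close>

text \<open>The reciprocal of an exponent, with \<open>1 / \<infinity> = 0\<close>.\<close>

definition recip :: "ennreal \<Rightarrow> real" where
  "recip p = enn2real (1 / p)"

definition index_condition :: "nat \<Rightarrow> ennreal \<Rightarrow> real \<Rightarrow> ennreal \<Rightarrow> real \<Rightarrow> bool" where
  "index_condition d p1 s1 p2 s2 \<longleftrightarrow>
     (s1 = 0 \<and> s2 = 0 \<and> p1 = p2) \<or>
     (s2 \<le> 0 \<and> 0 \<le> s1 \<and>
      recip p2 + s2 / real d < recip p1 + s1 / real d \<and>
      (recip p1 + s1 / real d = 0 \<longrightarrow> (p1, s1) = (\<infinity>, 0)) \<and>
      (recip p2 + s2 / real d = 1 \<longrightarrow> (p2, s2) = (1, 0)))"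

end

theory Submission
  imports Defs "HOL-Probability.Characteristic_Functions"
begin

text \<open>
  Sufficiency: inserting the inversion formula \<open>f = |\<phi>|^-2 \<integral> V f(v) \<pi>(v) \<phi> dv\<close> into \<open>OP \<tau> \<sigma> f\<close> gives the STFT of the image as an
  integral of \<open>V f\<close> against the matrix \<open>\<langle>OP \<tau> \<sigma> \<pi>(v) \<phi>, \<pi>(w) \<phi>\<rangle>\<close>. By covariance of the Wigner distribution this
  entry is a value of the STFT of \<open>\<sigma>\<close> with window \<open>W \<phi> \<phi>\<close>, at a frequency that is the rotated
  difference \<open>w - v\<close>. For \<open>\<sigma>\<close> in Sjostrand's class the matrix is therefore dominated by a convolution
  kernel that is integrable after a regularisation by a rapidly decaying factor, and the weighted
  mixed norms are controlled by Minkowski, Hoelder and Jensen.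

  Necessity: the symbol \<open>exp(2 \<pi> i \<zeta> \<bullet> z)\<close> is quantised to a time-frequency shift, so absolutely
  convergent trigonometric series lie in Sjostrand's class and act as superpositions of shifts. A
  series with lacunary frequencies moves \<open>\<phi>\<close> arbitrarily far at the
  cost of an arbitrarily small power of the distance, which forces the signs of the weight exponents. The identity operator then leaves an embedding of
  weighted spaces, which is tested on superpositions of separated time-frequency shifts of \<open>\<phi>\<close> with the
  borderline decay.
\<close>

text \<open>The hinge on both sides is uniformity under translation. Sjostrand's class makes
  \<open>sup_STFT \<Phi> \<sigma>\<close> integrable but gives it no weight, so the operator behaves
  like an average of time-frequency shifts by vectors of unbounded length, and each shift has to be
  bounded with a constant independent of the vector. This is the meaning of
  \<open>s2 \<le> 0 \<le> s1\<close>: for \<open>s1 = s2 > 0\<close> and equal exponents every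
  single shift is bounded, and only a superposition of ever longer shifts shows the failure.
  Integrability alone cannot raise the exponent from \<open>p1\<close> to \<open>p2\<close> either;
  the decaying kernel that does so comes from exchanging \<Phi> for the window
  \<open>Wigner \<tau> \<phi> \<phi>\<close>, because the STFT of one window against the other is a
  Schwartz function. Half of that decay goes to position and half to frequency, so that the two
  index conditions decouple, the weights being products. The main fact about distributions is that
  they commute with integrals of Schwartz families; \<open>OP \<tau> \<sigma> f\<close> itself is
  only ever seen through its STFT.\<close>

notation japanese_bracket (\<open>\<langle>_\<rangle>\<close>)

subsection \<open>The Japanese bracket\<close>

lemma jb_ge_1: "1 \<le> \<langle>x\<rangle>"
  by (simp add: japanese_bracket_def)

lemma jb_pos: "0 < \<langle>x\<rangle>"
  using jb_ge_1[of x] by linarith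

lemma jb_powr_pos: "0 < \<langle>x\<rangle> powr s"
  unfolding powr_gt_zero by (rule less_imp_neq[OF jb_pos, symmetric])

lemma jb_nonneg: "0 \<le> \<langle>x\<rangle>"
  using jb_pos[of x] by simp

lemma jb_power2: "\<langle>x\<rangle>\<^sup>2 = 1 + (norm x)\<^sup>2"
  by (simp add: japanese_bracket_def)

lemma norm_le_jb: "norm x \<le> \<langle>x\<rangle>"
  unfolding japanese_bracket_def by (rule real_le_rsqrt) simp

lemma jb_le_norm: "\<langle>x\<rangle> \<le> 1 + norm x"
  unfolding japanese_bracket_def by (rule real_le_lsqrt) (simp_all add: power2_eq_square algebra_simps)

lemma jb_mono: "norm x \<le> norm y \<Longrightarrow> \<langle>x\<rangle> \<le> \<langle>y\<rangle>"
  by (simp add: japanese_bracket_def power_mono)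

lemma jb_minus [simp]: "\<langle>- x\<rangle> = \<langle>x\<rangle>"
  by (simp add: japanese_bracket_def)

lemma jb_minus_commute: "\<langle>x - y\<rangle> = \<langle>y - x\<rangle>"
  by (simp add: japanese_bracket_def norm_minus_commute)

lemma jb_add: "\<langle>x + y\<rangle> \<le> 2 * \<langle>x\<rangle> * \<langle>y\<rangle>"
proof -
  have "\<langle>x + y\<rangle>\<^sup>2 \<le> (2 * \<langle>x\<rangle> * \<langle>y\<rangle>)\<^sup>2"
  proof -
    \<comment> \<open>The gap between the two sides, in brackets, is visibly nonnegative; the
      constant 2 of the lemma is the square root of this 4.\<close>
    have id: "4 * ((1 + a\<^sup>2) * (1 + b\<^sup>2)) = 1 + (a + b)\<^sup>2 + (3 + 2 * a\<^sup>2 + 2 * b\<^sup>2 + (a - b)\<^sup>2 + 4 * (a * b)\<^sup>2)"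
      for a b :: real
      by (simp add: power2_eq_square algebra_simps)
    have "1 + (norm (x + y))\<^sup>2 \<le> 1 + (norm x + norm y)\<^sup>2"
      by (simp add: norm_triangle_ineq power_mono)
    also have "\<dots> \<le> 4 * ((1 + (norm x)\<^sup>2) * (1 + (norm y)\<^sup>2))"
      unfolding id by simp
    finally show ?thesis
      unfolding power_mult_distrib jb_power2 by (simp add: algebra_simps)
  qed
  then show ?thesis
    by (rule power2_le_imp_le) (simp add: jb_nonneg)
qed

text \<open>Peetre's inequality, the tool by which weights are moved between points. For
  \<open>s < 0\<close> the roles of \<open>x\<close> and \<open>y\<close> are exchanged and
  reciprocals are taken.\<close>

lemma jb_peetre:
  fixes x y :: "'a::real_normed_vector"
  shows "\<langle>x\<rangle> powr s \<le> 2 powr \<bar>s\<bar> * \<langle>x - y\<rangle> powr \<bar>s\<bar> * \<langle>y\<rangle> powr s"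
proof (cases "0 \<le> s")
  case True
  have "\<langle>x\<rangle> powr s \<le> (2 * \<langle>x - y\<rangle> * \<langle>y\<rangle>) powr s"
    using jb_add[of "x - y" y] True by (intro powr_mono2) (auto simp: jb_nonneg)
  then show ?thesis using True by (simp add: powr_mult jb_nonneg)
next
  case False
  have "\<langle>y\<rangle> powr (-s) \<le> (2 * \<langle>x - y\<rangle> * \<langle>x\<rangle>) powr (-s)"
    using jb_add[of "y - x" x] False
    by (intro powr_mono2) (auto simp: jb_nonneg jb_minus_commute)
  then have "\<langle>y\<rangle> powr (-s) \<le> 2 powr (-s) * \<langle>x - y\<rangle> powr (-s) * \<langle>x\<rangle> powr (-s)"
    by (simp add: powr_mult jb_nonneg)
  moreover have "0 < \<langle>x\<rangle> powr (-s)" "0 < \<langle>y\<rangle> powr (-s)"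
    using jb_pos[of x] jb_pos[of y] by simp_all
  ultimately have "1 / \<langle>x\<rangle> powr (-s) \<le> 2 powr (-s) * \<langle>x - y\<rangle> powr (-s) * (1 / \<langle>y\<rangle> powr (-s))"
    by (simp add: field_simps)
  then show ?thesis using False by (simp add: powr_minus_divide)
qed

text \<open>Peetre's inequality with \<open>\<langle>y - x\<rangle> \<le> 2\<close>: one factor 2 of
  the 4 is its constant, the other bounds the distance. It makes a weight comparable to its value at
  the centre of a small ball.\<close>

lemma jb_powr_near:
  assumes "x \<in> cball y \<delta>" "\<delta> \<le> 1"
  shows "4 powr (-\<bar>r\<bar>) * \<langle>y\<rangle> powr r \<le> \<langle>x\<rangle> powr r"
proof -
  have "\<langle>y - x\<rangle> \<le> 2" using jb_le_norm[of "y - x"] assms by (simp add: dist_norm)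
  then have "\<langle>y - x\<rangle> powr \<bar>r\<bar> \<le> 2 powr \<bar>r\<bar>" by (intro powr_mono2) (auto simp: jb_nonneg)
  then have "\<langle>y\<rangle> powr r \<le> 2 powr \<bar>r\<bar> * 2 powr \<bar>r\<bar> * \<langle>x\<rangle> powr r"
    by (intro order_trans[OF jb_peetre[of y r x]] mult_right_mono mult_left_mono) auto
  also have "2 powr \<bar>r\<bar> * 2 powr \<bar>r\<bar> = (4::real) powr \<bar>r\<bar>" by (simp flip: powr_mult)
  finally show ?thesis by (simp add: powr_minus field_simps)
qed

lemma jb_fst_le: "\<langle>fst z\<rangle> \<le> \<langle>z\<rangle>"
  by (rule jb_mono) (use norm_fst_le[of "fst z" "snd z"] in simp)

lemma jb_snd_le: "\<langle>snd z\<rangle> \<le> \<langle>z\<rangle>"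
  by (rule jb_mono) (use norm_snd_le[of "snd z" "fst z"] in simp)

lemma borel_measurable_jb [measurable]:
  fixes f :: "'b \<Rightarrow> 'a::real_normed_vector"
  assumes [measurable]: "f \<in> borel_measurable M"
  shows "(\<lambda>x. \<langle>f x\<rangle>) \<in> borel_measurable M"
  unfolding japanese_bracket_def by measurable


subsection \<open>Closure properties of the Schwartz space\<close>

abbreviation dirder :: "'a::real_normed_vector \<Rightarrow> ('a \<Rightarrow> 'b::real_normed_vector) \<Rightarrow> 'a \<Rightarrow> 'b" where
  "dirder b f \<equiv> \<lambda>x. frechet_derivative f (at x) b"

text \<open>The Leibniz rule leaves a parametrised class of functions only through finite sums.
  Closing under sums separately lets each coinduction class \<open>P\<close> below be written as a
  plain set of expressions.\<close>

inductive_set sums_of :: "('a \<Rightarrow> complex) set \<Rightarrow> ('a \<Rightarrow> complex) set" for P where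
  base: "f \<in> P \<Longrightarrow> f \<in> sums_of P"
| add: "f \<in> sums_of P \<Longrightarrow> g \<in> sums_of P \<Longrightarrow> (\<lambda>x. f x + g x) \<in> sums_of P"

lemma dirder_eqI:
  assumes "\<And>x. (f has_derivative D x) (at x)"
  shows "dirder b f = (\<lambda>x. D x b)"
  using frechet_derivative_at[OF assms] by metis

lemma schwartz_differentiable: "f \<in> schwartz \<Longrightarrow> f differentiable (at x)"
  unfolding schwartz_def by (auto dest!: spec[of _ "[]"])

lemma bounded_jb_iff:
  "bounded (range (\<lambda>x. of_real (\<langle>x\<rangle> ^ k) * f x)) \<longleftrightarrow> (\<exists>C. \<forall>x. \<langle>x\<rangle> ^ k * cmod (f x) \<le> C)"
  unfolding bounded_iff by (simp add: norm_mult norm_power jb_nonneg)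

lemma schwartz_bound: "f \<in> schwartz \<Longrightarrow> \<exists>C. \<forall>x. \<langle>x\<rangle> ^ k * cmod (f x) \<le> C"
  unfolding bounded_jb_iff[symmetric] schwartz_def by (auto dest!: spec[of _ "[]"])

text \<open>The head of the list is the last derivative taken, so a derivative applied beforehand
  goes to the end.\<close>

lemma iterated_partial_snoc:
  "iterated_partial bs (dirder b f) = iterated_partial (bs @ [b]) f"
  by (induction bs) simp_all

lemma schwartz_dirder: "f \<in> schwartz \<Longrightarrow> b \<in> Basis \<Longrightarrow> dirder b f \<in> schwartz"
  unfolding schwartz_def mem_Collect_eq iterated_partial_snoc by simp

lemma schwartz_iterated_partial:
  "f \<in> schwartz \<Longrightarrow> set bs \<subseteq> Basis \<Longrightarrow> iterated_partial bs f \<in> schwartz"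
  by (induction bs) (auto intro: schwartz_dirder)

lemma schwartz_has_derivative: "f \<in> schwartz \<Longrightarrow> (f has_derivative (\<lambda>h. dirder h f x)) (at x)"
  using schwartz_differentiable frechet_derivative_works by metis

text \<open>
  A class of functions that is closed under partial derivatives up to finite sums and whose members
  decay rapidly consists of Schwartz functions. All closure properties are instances.
\<close>

lemma schwartz_coinduct:
  assumes "f \<in> P"
    and deriv: "\<And>f. f \<in> P \<Longrightarrow>
      \<exists>D. (\<forall>x. (f has_derivative D x) (at x)) \<and> (\<forall>b\<in>Basis. (\<lambda>x. D x b) \<in> sums_of P)"
    and decay: "\<And>f k. f \<in> P \<Longrightarrow> \<exists>C. \<forall>x. \<langle>x\<rangle> ^ k * cmod (f x) \<le> C"
  shows "f \<in> schwartz"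
proof -
  have der: "\<exists>D. (\<forall>x. (f has_derivative D x) (at x)) \<and> (\<forall>b\<in>Basis. (\<lambda>x. D x b) \<in> sums_of P)"
    if "f \<in> sums_of P" for f
    using that
  proof induction
    case (base f)
    then show ?case by (rule deriv)
  next
    case (add f g)
    then obtain D E where "\<And>x. (f has_derivative D x) (at x)" "\<And>x. (g has_derivative E x) (at x)"
      "\<And>b. b \<in> Basis \<Longrightarrow> (\<lambda>x. D x b) \<in> sums_of P" "\<And>b. b \<in> Basis \<Longrightarrow> (\<lambda>x. E x b) \<in> sums_of P"
      by blast
    then show ?case
      by (intro exI[of _ "\<lambda>x h. D x h + E x h"])
        (auto intro!: sums_of.add[of "\<lambda>x. D x _"] intro: has_derivative_add)
  qed
  have dec: "\<exists>C. \<forall>x. \<langle>x\<rangle> ^ k * cmod (f x) \<le> C" if "f \<in> sums_of P" for f k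
    using that
  proof induction
    case (base f)
    then show ?case by (rule decay)
  next
    case (add f g)
    then obtain C D where *: "\<And>x. \<langle>x\<rangle> ^ k * cmod (f x) \<le> C" "\<And>x. \<langle>x\<rangle> ^ k * cmod (g x) \<le> D"
      by blast
    have "\<langle>x\<rangle> ^ k * cmod (f x + g x) \<le> C + D" for x
    proof -
      have "\<langle>x\<rangle> ^ k * cmod (f x + g x) \<le> \<langle>x\<rangle> ^ k * (cmod (f x) + cmod (g x))"
        by (intro mult_left_mono norm_triangle_ineq) (simp add: jb_nonneg)
      then show ?thesis using *[of x] by (simp add: distrib_left)
    qed
    then show ?case by blast
  qed
  have it: "iterated_partial bs f \<in> sums_of P" if "set bs \<subseteq> Basis" for bs
    using that
  proof (induction bs)
    case Nil
    then show ?case using assms(1) by (simp add: sums_of.base)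
  next
    case (Cons b bs)
    then obtain D where "\<And>x. (iterated_partial bs f has_derivative D x) (at x)"
      "\<And>b. b \<in> Basis \<Longrightarrow> (\<lambda>x. D x b) \<in> sums_of P"
      using der[of "iterated_partial bs f"] by auto
    with Cons show ?case by (simp add: dirder_eqI[of "iterated_partial bs f" D])
  qed
  show ?thesis
    unfolding schwartz_def mem_Collect_eq bounded_jb_iff
    using it der dec unfolding differentiable_def by blast
qed

text \<open>Meant for Fourier transforms, where boundedness comes cheaply and decay is traded for
  it: \<open>\<langle>x\<rangle>^2\<close> is 1 plus the sum of the squared coordinates, so two
  coordinate multiplications inside \<open>P\<close> raise the order of decay by two.\<close>

lemma schwartz_coinduct_bounded:
  assumes "f \<in> P"
    and deriv: "\<And>f. f \<in> P \<Longrightarrow>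
      \<exists>D. (\<forall>x. (f has_derivative D x) (at x)) \<and> (\<forall>b\<in>Basis. (\<lambda>x. D x b) \<in> sums_of P)"
    and bound: "\<And>f. f \<in> P \<Longrightarrow> \<exists>C. \<forall>x. cmod (f x) \<le> C"
    and coord: "\<And>f b. f \<in> P \<Longrightarrow> b \<in> Basis \<Longrightarrow> (\<lambda>x. of_real (x \<bullet> b) * f x) \<in> P"
  shows "f \<in> schwartz"
proof (rule schwartz_coinduct[OF assms(1)])
  fix f k
  assume f: "f \<in> P"
  \<comment> \<open>Only even powers of the bracket are polynomials in the coordinates; a general
    power \<open>k\<close> is then dominated by the power \<open>2 * k\<close>.\<close>
  have even: "\<exists>C. \<forall>x. \<langle>x\<rangle> ^ (2 * m) * cmod (f x) \<le> C" if "f \<in> P" for f m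
    using that
  proof (induction m arbitrary: f)
    case 0
    then show ?case using bound by simp
  next
    case (Suc m)
    have P: "(\<lambda>x. of_real (x \<bullet> b) * (of_real (x \<bullet> b) * f x)) \<in> P" if "b \<in> Basis" for b
      using Suc.prems that by (auto intro!: coord)
    have "\<forall>b\<in>Basis. \<exists>C. \<forall>x. \<langle>x\<rangle> ^ (2 * m) * cmod (of_real (x \<bullet> b) * (of_real (x \<bullet> b) * f x)) \<le> C"
      using Suc.IH[OF P] by blast
    then obtain C where C: "\<And>b x. b \<in> Basis \<Longrightarrow>
        \<langle>x\<rangle> ^ (2 * m) * cmod (of_real (x \<bullet> b) * (of_real (x \<bullet> b) * f x)) \<le> C b"
      by metis
    obtain K where K: "\<And>x. \<langle>x\<rangle> ^ (2 * m) * cmod (f x) \<le> K"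
      using Suc.IH[OF Suc.prems] by blast
    have "\<langle>x\<rangle> ^ (2 * Suc m) * cmod (f x) \<le> K + (\<Sum>b\<in>Basis. C b)" for x
    proof -
      have nx: "(norm x)\<^sup>2 = (\<Sum>b\<in>Basis. (x \<bullet> b)\<^sup>2)"
        by (simp add: norm_eq_sqrt_inner euclidean_inner[of x x] power2_eq_square sum_nonneg)
      have "\<langle>x\<rangle> ^ (2 * Suc m) * cmod (f x) = \<langle>x\<rangle> ^ (2 * m) * cmod (f x) * (1 + (\<Sum>b\<in>Basis. (x \<bullet> b)\<^sup>2))"
        unfolding nx[symmetric] jb_power2[symmetric] by (simp add: power_add power2_eq_square)
      also have "\<dots> = \<langle>x\<rangle> ^ (2 * m) * cmod (f x)
          + (\<Sum>b\<in>Basis. \<langle>x\<rangle> ^ (2 * m) * cmod (of_real (x \<bullet> b) * (of_real (x \<bullet> b) * f x)))"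
        by (simp add: distrib_left sum_distrib_left norm_mult power2_eq_square mult_ac)
      also have "\<dots> \<le> K + (\<Sum>b\<in>Basis. C b)"
        by (intro add_mono K sum_mono C)
      finally show ?thesis .
    qed
    then show ?case by blast
  qed
  obtain C where C: "\<And>x. \<langle>x\<rangle> ^ (2 * k) * cmod (f x) \<le> C"
    using even[OF f] by blast
  have "\<langle>x\<rangle> ^ k * cmod (f x) \<le> C" for x
    using C[of x] mult_right_mono[OF power_increasing[OF _ jb_ge_1[of x], of k "2 * k"], of "cmod (f x)"]
    by simp
  then show "\<exists>C. \<forall>x. \<langle>x\<rangle> ^ k * cmod (f x) \<le> C" by blast
qed (rule deriv)

text \<open>Coinduction with \<open>sums_of schwartz\<close> as the class; the nested
  \<open>sums_of (sums_of schwartz)\<close> in the proof is only the form in which the rule asks for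
  derivatives.\<close>

lemma schwartz_add:
  assumes "f \<in> schwartz" "g \<in> schwartz"
  shows "(\<lambda>x. f x + g x) \<in> schwartz"
proof -
  have *: "f \<in> schwartz" if "f \<in> sums_of schwartz" for f :: "'a \<Rightarrow> complex"
  proof (rule schwartz_coinduct[OF that])
    fix f :: "'a \<Rightarrow> complex" and k
    assume "f \<in> sums_of schwartz"
    then show "\<exists>D. (\<forall>x. (f has_derivative D x) (at x)) \<and> (\<forall>b\<in>Basis. (\<lambda>x. D x b) \<in> sums_of (sums_of schwartz))"
    proof induction
      case (base f)
      then show ?case
        by (intro exI[of _ "\<lambda>x h. dirder h f x"])
          (auto intro: schwartz_has_derivative sums_of.base schwartz_dirder)
    next
      case (add f g)
      then obtain D E where "\<And>x. (f has_derivative D x) (at x)" "\<And>x. (g has_derivative E x) (at x)"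
        "\<And>b. b \<in> Basis \<Longrightarrow> (\<lambda>x. D x b) \<in> sums_of (sums_of schwartz)"
        "\<And>b. b \<in> Basis \<Longrightarrow> (\<lambda>x. E x b) \<in> sums_of (sums_of schwartz)"
        by blast
      then show ?case
        by (intro exI[of _ "\<lambda>x h. D x h + E x h"])
          (auto intro!: sums_of.add[of "\<lambda>x. D x _"] intro: has_derivative_add)
    qed
    from \<open>f \<in> sums_of schwartz\<close> show "\<exists>C. \<forall>x. \<langle>x\<rangle> ^ k * cmod (f x) \<le> C"
    proof induction
      case (base f)
      then show ?case by (rule schwartz_bound)
    next
      case (add f g)
      then obtain C D where *: "\<And>x. \<langle>x\<rangle> ^ k * cmod (f x) \<le> C" "\<And>x. \<langle>x\<rangle> ^ k * cmod (g x) \<le> D"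
        by blast
      have "\<langle>x\<rangle> ^ k * cmod (f x + g x) \<le> C + D" for x
      proof -
        have "\<langle>x\<rangle> ^ k * cmod (f x + g x) \<le> \<langle>x\<rangle> ^ k * (cmod (f x) + cmod (g x))"
          by (intro mult_left_mono norm_triangle_ineq) (simp add: jb_nonneg)
        then show ?thesis using *[of x] by (simp add: distrib_left)
      qed
      then show ?case by blast
    qed
  qed
  show ?thesis
    by (rule *) (intro sums_of.add sums_of.base assms)
qed

lemma schwartz_cmult: "f \<in> schwartz \<Longrightarrow> (\<lambda>x. c * f x) \<in> schwartz"
proof (rule schwartz_coinduct[where P = "{\<lambda>x. c * f x | f. f \<in> schwartz}"])
  fix g k
  assume "g \<in> {\<lambda>x. c * f x | f. f \<in> schwartz}"
  then obtain f where f: "f \<in> schwartz" and g: "g = (\<lambda>x. c * f x)" by blast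
  have "(g has_derivative (\<lambda>h. c * dirder h f x)) (at x)" for x
    unfolding g using schwartz_has_derivative[OF f] by (rule has_derivative_mult_right)
  moreover have "(\<lambda>x. c * dirder b f x) \<in> {\<lambda>x. c * f x | f. f \<in> schwartz}" if "b \<in> Basis" for b
    unfolding mem_Collect_eq by (rule exI[of _ "dirder b f"]) (simp add: schwartz_dirder[OF f that])
  ultimately show "\<exists>D. (\<forall>x. (g has_derivative D x) (at x)) \<and>
      (\<forall>b\<in>Basis. (\<lambda>x. D x b) \<in> sums_of {\<lambda>x. c * f x | f. f \<in> schwartz})"
    by (intro exI[of _ "\<lambda>x h. c * dirder h f x"] conjI allI ballI sums_of.base)
  obtain C where "\<And>x. \<langle>x\<rangle> ^ k * cmod (f x) \<le> C" using schwartz_bound[OF f] by blast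
  then have "\<langle>x\<rangle> ^ k * cmod (g x) \<le> cmod c * C" for x
    using mult_left_mono[of "\<langle>x\<rangle> ^ k * cmod (f x)" C "cmod c"] by (simp add: g norm_mult mult_ac)
  then show "\<exists>C. \<forall>x. \<langle>x\<rangle> ^ k * cmod (g x) \<le> C" by blast
qed auto

lemma schwartz_zero: "(\<lambda>x. 0) \<in> schwartz"
  by (rule schwartz_coinduct[where P = "{\<lambda>x. 0}"])
    (auto intro!: exI[of _ "\<lambda>x h. 0"] sums_of.base exI[of _ 0])

lemma schwartz_sum:
  "(\<And>i. i \<in> I \<Longrightarrow> f i \<in> schwartz) \<Longrightarrow> (\<lambda>x. \<Sum>i\<in>I. f i x) \<in> schwartz"
  by (induction I rule: infinite_finite_induct) (auto intro: schwartz_zero schwartz_add)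

lemma schwartz_diff: "f \<in> schwartz \<Longrightarrow> g \<in> schwartz \<Longrightarrow> (\<lambda>x. f x - g x) \<in> schwartz"
  using schwartz_add[OF _ schwartz_cmult[of g "-1"], of f] by simp

lemma schwartz_cnj: "f \<in> schwartz \<Longrightarrow> (\<lambda>x. cnj (f x)) \<in> schwartz"
proof (rule schwartz_coinduct[where P = "{\<lambda>x. cnj (f x) | f. f \<in> schwartz}"])
  fix g k
  assume "g \<in> {\<lambda>x. cnj (f x) | f. f \<in> schwartz}"
  then obtain f where f: "f \<in> schwartz" and g: "g = (\<lambda>x. cnj (f x))" by blast
  have "(g has_derivative (\<lambda>h. cnj (dirder h f x))) (at x)" for x
    unfolding g using schwartz_has_derivative[OF f] by (rule has_derivative_cnj)
  moreover have "(\<lambda>x. cnj (dirder b f x)) \<in> {\<lambda>x. cnj (f x) | f. f \<in> schwartz}" if "b \<in> Basis" for b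
    unfolding mem_Collect_eq by (rule exI[of _ "dirder b f"]) (simp add: schwartz_dirder[OF f that])
  ultimately show "\<exists>D. (\<forall>x. (g has_derivative D x) (at x)) \<and>
      (\<forall>b\<in>Basis. (\<lambda>x. D x b) \<in> sums_of {\<lambda>x. cnj (f x) | f. f \<in> schwartz})"
    by (intro exI[of _ "\<lambda>x h. cnj (dirder h f x)"] conjI allI ballI sums_of.base)
  show "\<exists>C. \<forall>x. \<langle>x\<rangle> ^ k * cmod (g x) \<le> C"
    using schwartz_bound[OF f] by (simp add: g)
qed auto

lemma dirder_linear: "f \<in> schwartz \<Longrightarrow> linear (\<lambda>h. dirder h f x)"
  using has_derivative_linear schwartz_has_derivative by blast

lemma dirder_basis_sum:
  fixes f :: "'a::euclidean_space \<Rightarrow> complex"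
  assumes "f \<in> schwartz"
  shows "dirder h f x = (\<Sum>b\<in>Basis. of_real (h \<bullet> b) * dirder b f x)"
proof -
  have "dirder h f x = dirder (\<Sum>b\<in>Basis. (h \<bullet> b) *\<^sub>R b) f x"
    by (simp add: euclidean_representation)
  also have "\<dots> = (\<Sum>b\<in>Basis. (h \<bullet> b) *\<^sub>R dirder b f x)"
    by (simp only: linear_sum[OF dirder_linear[OF assms]] linear_cmul[OF dirder_linear[OF assms]])
  finally show ?thesis by (simp add: scaleR_conv_of_real)
qed

lemma schwartz_dirder_vector:
  fixes f :: "'a::euclidean_space \<Rightarrow> complex"
  shows "f \<in> schwartz \<Longrightarrow> dirder h f \<in> schwartz"
proof -
  assume f: "f \<in> schwartz"
  have "(\<lambda>x. \<Sum>b\<in>Basis. of_real (h \<bullet> b) * dirder b f x) \<in> schwartz"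
    by (intro schwartz_sum schwartz_cmult schwartz_dirder f)
  then show ?thesis by (simp only: dirder_basis_sum[OF f, where h = h])
qed

lemma schwartz_bound_nonneg:
  fixes f :: "'a::euclidean_space \<Rightarrow> complex"
  assumes "f \<in> schwartz"
  obtains C where "0 \<le> C" "\<And>x. \<langle>x\<rangle> ^ k * cmod (f x) \<le> C"
proof -
  obtain C where C: "\<And>x. \<langle>x\<rangle> ^ k * cmod (f x) \<le> C"
    using schwartz_bound[OF assms] by blast
  have "0 \<le> \<langle>0 :: 'a\<rangle> ^ k * cmod (f 0)" by (simp add: jb_nonneg)
  with C[of 0] have "0 \<le> C" by linarith
  with C that show ?thesis by blast
qed

lemma schwartz_decay:
  assumes "f \<in> schwartz"
  obtains C where "0 \<le> C" "\<And>x. cmod (f x) \<le> C * \<langle>x\<rangle> powr (-r)"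
proof -
  obtain C where C: "0 \<le> C" "\<And>x. \<langle>x\<rangle> ^ nat \<lceil>r\<rceil> * cmod (f x) \<le> C"
    using schwartz_bound_nonneg[OF assms] by blast
  have "cmod (f x) \<le> C * \<langle>x\<rangle> powr (-r)" for x
  proof -
    have "\<langle>x\<rangle> powr r \<le> \<langle>x\<rangle> powr real (nat \<lceil>r\<rceil>)"
      using jb_ge_1[of x] by (intro powr_mono) linarith+
    also have "\<dots> = \<langle>x\<rangle> ^ nat \<lceil>r\<rceil>" by (rule powr_realpow[OF jb_pos])
    finally have "\<langle>x\<rangle> powr r * cmod (f x) \<le> C"
      using C(2)[of x] mult_right_mono[of "\<langle>x\<rangle> powr r" "\<langle>x\<rangle> ^ nat \<lceil>r\<rceil>" "cmod (f x)"] by simp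
    moreover have "0 < \<langle>x\<rangle> powr r" using jb_pos[of x] by simp
    ultimately show ?thesis by (simp add: powr_minus_divide field_simps)
  qed
  with C(1) that show ?thesis by blast
qed

text \<open>Expanding \<open>h\<close> over the basis gives one constant for all directions. This
  provides the dominating functions when differentiating under an integral.\<close>

lemma schwartz_dirder_bound:
  fixes f :: "'a::euclidean_space \<Rightarrow> complex"
  assumes "f \<in> schwartz"
  obtains C where "0 \<le> C" "\<And>x h. cmod (dirder h f x) \<le> C * \<langle>x\<rangle> powr (-r) * norm h"
proof -
  have "\<forall>b\<in>Basis. \<exists>C. \<forall>x. cmod (dirder b f x) \<le> C * \<langle>x\<rangle> powr (-r)"
    using schwartz_decay[OF schwartz_dirder[OF assms]] by blast
  then obtain C where C: "\<And>b x. b \<in> Basis \<Longrightarrow> cmod (dirder b f x) \<le> C b * \<langle>x\<rangle> powr (-r)"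
    by metis
  have "cmod (dirder h f x) \<le> (\<Sum>b\<in>Basis. \<bar>C b\<bar>) * \<langle>x\<rangle> powr (-r) * norm h" for x h
  proof -
    have "cmod (dirder h f x) \<le> (\<Sum>b\<in>Basis. cmod (of_real (h \<bullet> b) * dirder b f x))"
      by (subst dirder_basis_sum[OF assms, where h = h]) (rule norm_sum)
    also have "\<dots> \<le> (\<Sum>b\<in>Basis. norm h * (\<bar>C b\<bar> * \<langle>x\<rangle> powr (-r)))"
    proof (rule sum_mono)
      fix b :: 'a assume b: "b \<in> Basis"
      have "cmod (dirder b f x) \<le> \<bar>C b\<bar> * \<langle>x\<rangle> powr (-r)"
        using C[OF b, of x] mult_right_mono[OF abs_ge_self[of "C b"], of "\<langle>x\<rangle> powr (-r)"] by simp
      then show "cmod (of_real (h \<bullet> b) * dirder b f x) \<le> norm h * (\<bar>C b\<bar> * \<langle>x\<rangle> powr (-r))"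
        unfolding norm_mult norm_of_real
        by (rule mult_mono[OF Basis_le_norm[OF b]]) simp_all
    qed
    finally show ?thesis by (simp add: sum_distrib_right sum_distrib_left mult_ac)
  qed
  then show ?thesis by (intro that[of "\<Sum>b\<in>Basis. \<bar>C b\<bar>"]) (auto intro: sum_nonneg)
qed

text \<open>The product rule produces \<open>l b\<close> times \<open>f\<close>, a constant multiple
  that is no longer \<open>l x\<close> times a function. The coinduction class therefore carries an
  additive Schwartz remainder \<open>g\<close>.\<close>

lemma schwartz_linear_mult:
  fixes f :: "'a::euclidean_space \<Rightarrow> complex"
  assumes "f \<in> schwartz" and l: "bounded_linear (l :: 'a \<Rightarrow> real)"
  shows "(\<lambda>x. of_real (l x) * f x) \<in> schwartz"
proof (rule schwartz_coinduct[where P = "{\<lambda>x. of_real (l x) * f x + g x | f g. f \<in> schwartz \<and> g \<in> schwartz}"])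
  fix F :: "'a \<Rightarrow> complex" and k
  assume "F \<in> {\<lambda>x. of_real (l x) * f x + g x | f g. f \<in> schwartz \<and> g \<in> schwartz}"
  then obtain f g where fg: "f \<in> schwartz" "g \<in> schwartz" and F: "F = (\<lambda>x. of_real (l x) * f x + g x)"
    by blast
  define D where "D = (\<lambda>x h. of_real (l x) * dirder h f x + (of_real (l h) * f x + dirder h g x))"
  have "(F has_derivative D x) (at x)" for x
    unfolding F D_def
    by (rule has_derivative_eq_rhs, rule has_derivative_add, rule has_derivative_mult,
        rule has_derivative_of_real, rule bounded_linear_imp_has_derivative[OF l],
        rule schwartz_has_derivative[OF fg(1)], rule schwartz_has_derivative[OF fg(2)]) (simp add: algebra_simps)
  moreover have "(\<lambda>x. D x b) \<in> {\<lambda>x. of_real (l x) * f x + g x | f g. f \<in> schwartz \<and> g \<in> schwartz}"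
    if "b \<in> Basis" for b
    unfolding D_def mem_Collect_eq using fg that
    by (intro exI[of _ "dirder b f"] exI[of _ "\<lambda>x. of_real (l b) * f x + dirder b g x"])
      (auto intro!: schwartz_add schwartz_cmult schwartz_dirder)
  ultimately show "\<exists>D. (\<forall>x. (F has_derivative D x) (at x)) \<and> (\<forall>b\<in>Basis. (\<lambda>x. D x b) \<in>
      sums_of {\<lambda>x. of_real (l x) * f x + g x | f g. f \<in> schwartz \<and> g \<in> schwartz})"
    by (intro exI[of _ D] conjI allI ballI sums_of.base)
  obtain K where K: "0 < K" "\<And>x. norm (l x) \<le> norm x * K"
    using bounded_linear.pos_bounded[OF l] by blast
  obtain C where C: "0 \<le> C" "\<And>x. \<langle>x\<rangle> ^ Suc k * cmod (f x) \<le> C" using schwartz_bound_nonneg[OF fg(1)] by blast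
  obtain E where E: "0 \<le> E" "\<And>x. \<langle>x\<rangle> ^ k * cmod (g x) \<le> E" using schwartz_bound_nonneg[OF fg(2)] by blast
  have "\<langle>x\<rangle> ^ k * cmod (F x) \<le> K * C + E" for x
  proof -
    have "cmod (F x) \<le> \<bar>l x\<bar> * cmod (f x) + cmod (g x)"
      unfolding F by (rule order_trans[OF norm_triangle_ineq]) (simp add: norm_mult)
    also have "\<dots> \<le> (K * \<langle>x\<rangle>) * cmod (f x) + cmod (g x)"
    proof -
      have "\<bar>l x\<bar> \<le> K * \<langle>x\<rangle>"
        using order_trans[OF K(2)[of x] mult_right_mono[OF norm_le_jb[of x] less_imp_le[OF K(1)]]]
        by (simp add: mult.commute)
      then show ?thesis by (intro add_right_mono mult_right_mono) auto
    qed
    finally have "\<langle>x\<rangle> ^ k * cmod (F x) \<le> \<langle>x\<rangle> ^ k * ((K * \<langle>x\<rangle>) * cmod (f x) + cmod (g x))"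
      by (rule mult_left_mono) (simp add: jb_nonneg)
    also have "\<dots> = K * (\<langle>x\<rangle> ^ Suc k * cmod (f x)) + \<langle>x\<rangle> ^ k * cmod (g x)"
      by (simp add: algebra_simps)
    also have "\<dots> \<le> K * C + E" using K(1) by (intro add_mono mult_left_mono C E) auto
    finally show ?thesis .
  qed
  then show "\<exists>C. \<forall>x. \<langle>x\<rangle> ^ k * cmod (F x) \<le> C" by blast
next
  show "(\<lambda>x. of_real (l x) * f x) \<in> {\<lambda>x. of_real (l x) * f x + g x | f g. f \<in> schwartz \<and> g \<in> schwartz}"
    unfolding mem_Collect_eq by (rule exI[of _ f], rule exI[of _ "\<lambda>x. 0"]) (simp add: assms(1) schwartz_zero)
qed

text \<open>Differentiation reproduces the phase times a derivative of \<open>q\<close>, so the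
  phase only has to satisfy that its partial derivatives multiply the Schwartz space into itself.
  Applied to linear phases and to the bilinear phase of \<open>tf_shift\<close>.\<close>

lemma schwartz_character_mult:
  fixes f :: "'a::euclidean_space \<Rightarrow> complex"
  assumes "f \<in> schwartz"
    and q: "\<And>x. (q has_derivative q' x) (at x)"
    and mult: "\<And>f b. f \<in> schwartz \<Longrightarrow> (\<lambda>x. of_real (q' x b) * f x) \<in> schwartz"
  shows "(\<lambda>x. cis (q x) * f x) \<in> schwartz"
proof (rule schwartz_coinduct[where P = "{\<lambda>x. cis (q x) * f x | f. f \<in> schwartz}"])
  fix F :: "'a \<Rightarrow> complex" and k
  assume "F \<in> {\<lambda>x. cis (q x) * f x | f. f \<in> schwartz}"
  then obtain f where f: "f \<in> schwartz" and F: "F = (\<lambda>x. cis (q x) * f x)" by blast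
  define D where "D = (\<lambda>x h. cis (q x) * (\<i> * (of_real (q' x h) * f x) + dirder h f x))"
  have cis: "((\<lambda>x. cis (q x)) has_derivative (\<lambda>h. of_real (q' x h) * (\<i> * cis (q x)))) (at x)" for x
    by (rule has_derivative_eq_rhs[OF has_derivative_cis[OF q]]) (simp add: scaleR_conv_of_real)
  have "(F has_derivative D x) (at x)" for x
    unfolding F D_def
    by (rule has_derivative_eq_rhs, rule has_derivative_mult, rule cis, rule schwartz_has_derivative[OF f])
      (simp add: algebra_simps)
  moreover have "(\<lambda>x. D x b) \<in> {\<lambda>x. cis (q x) * f x | f. f \<in> schwartz}"
    if "b \<in> Basis" for b
    unfolding D_def mem_Collect_eq using f that
    by (intro exI[of _ "\<lambda>x. \<i> * (of_real (q' x b) * f x) + dirder b f x"])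
      (auto intro!: schwartz_add schwartz_cmult mult schwartz_dirder)
  ultimately show "\<exists>D. (\<forall>x. (F has_derivative D x) (at x)) \<and> (\<forall>b\<in>Basis. (\<lambda>x. D x b) \<in>
      sums_of {\<lambda>x. cis (q x) * f x | f. f \<in> schwartz})"
    by (intro exI[of _ D] conjI allI ballI sums_of.base)
  show "\<exists>C. \<forall>x. \<langle>x\<rangle> ^ k * cmod (F x) \<le> C"
    using schwartz_bound[OF f] by (simp add: F norm_mult)
qed (use assms(1) in blast)

lemma jb_linear_le:
  assumes "linear l" "\<And>y. norm y \<le> C * norm (l y)"
  shows "\<langle>y\<rangle> \<le> (1 + \<bar>C\<bar>) * \<langle>l y\<rangle>"
proof -
  have "\<langle>y\<rangle> \<le> 1 + norm y" by (rule jb_le_norm)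
  also have "\<dots> \<le> 1 + \<bar>C\<bar> * norm (l y)"
    using assms(2)[of y] mult_right_mono[OF abs_ge_self[of C] norm_ge_zero[of "l y"]] by simp
  also have "\<dots> \<le> \<langle>l y\<rangle> + \<bar>C\<bar> * \<langle>l y\<rangle>"
    by (intro add_mono mult_left_mono jb_ge_1 norm_le_jb) simp
  finally show ?thesis by (simp add: algebra_simps)
qed

text \<open>The bound \<open>norm y \<le> C * norm (l y)\<close> is injectivity in quantitative form
  and carries the decay of \<open>f\<close> back to \<open>y\<close>. As \<open>l\<close> may map
  into a larger space, sections of functions of several variables are included; a basis vector goes
  to the arbitrary direction \<open>l b\<close>.\<close>

lemma schwartz_affine_comp:
  fixes f :: "'a::euclidean_space \<Rightarrow> complex" and l :: "'b::euclidean_space \<Rightarrow> 'a"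
  assumes "f \<in> schwartz" and l: "linear l" and inj: "\<And>y. norm y \<le> C * norm (l y)"
  shows "(\<lambda>y. f (l y + c)) \<in> schwartz"
proof (rule schwartz_coinduct[where P = "{\<lambda>y. f (l y + c) | f. f \<in> schwartz}"])
  fix F :: "'b \<Rightarrow> complex" and k
  assume "F \<in> {\<lambda>y. f (l y + c) | f. f \<in> schwartz}"
  then obtain f where f: "f \<in> schwartz" and F: "F = (\<lambda>y. f (l y + c))" by blast
  have "((\<lambda>y. l y + c) has_derivative l) (at y)" for y
    by (intro has_derivative_eq_rhs[OF has_derivative_add_const[OF bounded_linear.has_derivative[OF linear_conv_bounded_linear[THEN iffD1, OF l] has_derivative_ident]]]) simp
  then have "(F has_derivative (\<lambda>h. dirder (l h) f (l y + c))) (at y)" for y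
    unfolding F using has_derivative_compose[OF _ schwartz_has_derivative[OF f]] by blast
  moreover have "(\<lambda>y. dirder (l b) f (l y + c)) \<in> {\<lambda>y. f (l y + c) | f. f \<in> schwartz}" for b
    unfolding mem_Collect_eq by (rule exI[of _ "dirder (l b) f"]) (simp add: schwartz_dirder_vector[OF f])
  ultimately show "\<exists>D. (\<forall>x. (F has_derivative D x) (at x)) \<and> (\<forall>b\<in>Basis. (\<lambda>x. D x b) \<in>
      sums_of {\<lambda>y. f (l y + c) | f. f \<in> schwartz})"
    by (intro exI[of _ "\<lambda>y h. dirder (l h) f (l y + c)"] conjI allI ballI sums_of.base)
  obtain E where E: "0 \<le> E" "\<And>x. \<langle>x\<rangle> ^ k * cmod (f x) \<le> E" using schwartz_bound_nonneg[OF f] by blast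
  define K where "K = (1 + \<bar>C\<bar>) * 2 * \<langle>c\<rangle>"
  have "\<langle>y\<rangle> ^ k * cmod (F y) \<le> K ^ k * E" for y
  proof -
    have "\<langle>y\<rangle> \<le> (1 + \<bar>C\<bar>) * \<langle>l y\<rangle>" by (rule jb_linear_le[OF l inj])
    also have "\<dots> \<le> (1 + \<bar>C\<bar>) * (2 * \<langle>l y + c\<rangle> * \<langle>c\<rangle>)"
      using jb_add[of "l y + c" "- c"] by (intro mult_left_mono) auto
    finally have "\<langle>y\<rangle> \<le> K * \<langle>l y + c\<rangle>" by (simp add: K_def mult_left_mono algebra_simps)
    then have "\<langle>y\<rangle> ^ k * cmod (F y) \<le> (K * \<langle>l y + c\<rangle>) ^ k * cmod (F y)"
      by (intro mult_right_mono power_mono) (auto simp: jb_nonneg)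
    also have "\<dots> = K ^ k * (\<langle>l y + c\<rangle> ^ k * cmod (f (l y + c)))"
      by (simp add: F power_mult_distrib)
    also have "\<dots> \<le> K ^ k * E"
      by (intro mult_left_mono E) (simp add: K_def jb_nonneg)
    finally show ?thesis .
  qed
  then show "\<exists>C. \<forall>y. \<langle>y\<rangle> ^ k * cmod (F y) \<le> C" by blast
qed (use assms(1) in blast)

text \<open>Joint injectivity of the pair \<open>l\<close>, \<open>m\<close> suffices, since
  \<open>\<langle>y\<rangle>\<close> is bounded by a multiple of
  \<open>\<langle>l y\<rangle> * \<langle>m y\<rangle>\<close>. The kernels of the STFT and of the
  Wigner distribution are pullbacks of this kind, and so are pointwise products.\<close>

lemma schwartz_linear_tensor:
  fixes f :: "'a::euclidean_space \<Rightarrow> complex" and g :: "'b::euclidean_space \<Rightarrow> complex"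
    and l :: "'c::euclidean_space \<Rightarrow> 'a" and m :: "'c \<Rightarrow> 'b"
  assumes "f \<in> schwartz" "g \<in> schwartz" and l: "linear l" and m: "linear m"
    and inj: "\<And>y. norm y \<le> C * (norm (l y) + norm (m y))"
  shows "(\<lambda>y. f (l y) * g (m y)) \<in> schwartz"
proof (rule schwartz_coinduct[where P = "{\<lambda>y. f (l y) * g (m y) | f g. f \<in> schwartz \<and> g \<in> schwartz}"])
  fix F :: "'c \<Rightarrow> complex" and k
  assume "F \<in> {\<lambda>y. f (l y) * g (m y) | f g. f \<in> schwartz \<and> g \<in> schwartz}"
  then obtain f g where fg: "f \<in> schwartz" "g \<in> schwartz" and F: "F = (\<lambda>y. f (l y) * g (m y))" by blast
  have lm: "(l has_derivative l) (at y)" "(m has_derivative m) (at y)" for y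
    using l m by (simp_all add: linear_imp_has_derivative)
  have "(F has_derivative (\<lambda>h. dirder (l h) f (l y) * g (m y) + f (l y) * dirder (m h) g (m y))) (at y)" for y
    unfolding F
    by (rule has_derivative_eq_rhs, rule has_derivative_mult)
      (auto intro!: has_derivative_compose[OF lm(1)] has_derivative_compose[OF lm(2)] schwartz_has_derivative fg)
  moreover have "(\<lambda>y. dirder (l b) f (l y) * g (m y)) \<in> {\<lambda>y. f (l y) * g (m y) | f g. f \<in> schwartz \<and> g \<in> schwartz}"
    "(\<lambda>y. f (l y) * dirder (m b) g (m y)) \<in> {\<lambda>y. f (l y) * g (m y) | f g. f \<in> schwartz \<and> g \<in> schwartz}" for b
    unfolding mem_Collect_eq
    by (rule exI[of _ "dirder (l b) f"], rule exI[of _ g], simp add: schwartz_dirder_vector fg)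
      (rule exI[of _ f], rule exI[of _ "dirder (m b) g"], simp add: schwartz_dirder_vector fg)
  ultimately show "\<exists>D. (\<forall>x. (F has_derivative D x) (at x)) \<and> (\<forall>b\<in>Basis. (\<lambda>x. D x b) \<in>
      sums_of {\<lambda>y. f (l y) * g (m y) | f g. f \<in> schwartz \<and> g \<in> schwartz})"
    by (intro exI[of _ "\<lambda>y h. dirder (l h) f (l y) * g (m y) + f (l y) * dirder (m h) g (m y)"] conjI ballI allI
        sums_of.add[OF sums_of.base sums_of.base])
  obtain A where A: "0 \<le> A" "\<And>x. \<langle>x\<rangle> ^ k * cmod (f x) \<le> A" using schwartz_bound_nonneg[OF fg(1)] by blast
  obtain B where B: "0 \<le> B" "\<And>x. \<langle>x\<rangle> ^ k * cmod (g x) \<le> B" using schwartz_bound_nonneg[OF fg(2)] by blast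
  define K where "K = 1 + 2 * \<bar>C\<bar>"
  have "\<langle>y\<rangle> ^ k * cmod (F y) \<le> K ^ k * (A * B)" for y
  proof -
    have *: "1 \<le> \<langle>l y\<rangle> * \<langle>m y\<rangle>" "norm (l y) \<le> \<langle>l y\<rangle> * \<langle>m y\<rangle>" "norm (m y) \<le> \<langle>l y\<rangle> * \<langle>m y\<rangle>"
      using mult_mono[OF jb_ge_1[of "l y"] jb_ge_1[of "m y"]] mult_mono[OF norm_le_jb[of "l y"] jb_ge_1[of "m y"]]
        mult_mono[OF jb_ge_1[of "l y"] norm_le_jb[of "m y"]] by (simp_all add: jb_nonneg)
    have "\<langle>y\<rangle> \<le> 1 + norm y" by (rule jb_le_norm)
    also have "\<dots> \<le> 1 + \<bar>C\<bar> * (norm (l y) + norm (m y))"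
      using inj[of y] mult_right_mono[OF abs_ge_self[of C], of "norm (l y) + norm (m y)"] by simp
    also have "\<dots> \<le> \<langle>l y\<rangle> * \<langle>m y\<rangle> + \<bar>C\<bar> * (\<langle>l y\<rangle> * \<langle>m y\<rangle> + \<langle>l y\<rangle> * \<langle>m y\<rangle>)"
      by (intro add_mono mult_left_mono *) simp
    also have "\<dots> = K * \<langle>l y\<rangle> * \<langle>m y\<rangle>" by (simp add: K_def algebra_simps)
    finally have "\<langle>y\<rangle> ^ k * cmod (F y) \<le> (K * \<langle>l y\<rangle> * \<langle>m y\<rangle>) ^ k * cmod (F y)"
      by (intro mult_right_mono power_mono) (auto simp: jb_nonneg)
    also have "\<dots> = K ^ k * ((\<langle>l y\<rangle> ^ k * cmod (f (l y))) * (\<langle>m y\<rangle> ^ k * cmod (g (m y))))"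
      by (simp add: F power_mult_distrib norm_mult)
    also have "\<dots> \<le> K ^ k * (A * B)"
      by (intro mult_left_mono mult_mono A B) (auto simp: K_def jb_nonneg A)
    finally show ?thesis .
  qed
  then show "\<exists>C. \<forall>y. \<langle>y\<rangle> ^ k * cmod (F y) \<le> C" by blast
qed (use assms(1,2) in blast)

subsection \<open>Integration\<close>

text \<open>Dyadic decomposition: the set where \<open>\<langle>x\<rangle> \<le> 2^k\<close> lies in
  a cube of side \<open>2^(k+1)\<close>, the integrand on the k-th shell is at most
  \<open>2 powr (r - k * r)\<close>, and the products form a geometric series whose ratio
  \<open>q\<close> is below 1 because \<open>r\<close> exceeds the dimension.\<close>

lemma nn_integral_jb_finite:
  assumes r: "real DIM('a) < r"
  shows "(\<integral>\<^sup>+x. ennreal (\<langle>x::'a::euclidean_space\<rangle> powr (-r)) \<partial>lborel) < \<infinity>"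
proof -
  let ?d = "DIM('a)"
  have r0: "0 < r" using r by linarith
  define S where "S k = {x::'a. \<langle>x\<rangle> \<le> 2 ^ k}" for k :: nat
  have [measurable]: "S k \<in> sets borel" for k
    unfolding S_def by measurable
  have S: "emeasure lborel (S k) \<le> ennreal ((2 ^ Suc k) ^ ?d)" for k
  proof -
    have "S k \<subseteq> cbox (- (2 ^ k) *\<^sub>R One) (2 ^ k *\<^sub>R One)"
    proof
      fix x assume "x \<in> S k"
      then have "norm x \<le> 2 ^ k" using norm_le_jb[of x] by (simp add: S_def)
      then have "\<bar>x \<bullet> b\<bar> \<le> 2 ^ k" if "b \<in> Basis" for b
        using Basis_le_norm[OF that, of x] by linarith
      then show "x \<in> cbox (- (2 ^ k) *\<^sub>R One) (2 ^ k *\<^sub>R One)"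
        by (auto simp: mem_box abs_le_iff) (smt (verit, best))
    qed
    then have "emeasure lborel (S k) \<le> emeasure lborel (cbox (- (2 ^ k) *\<^sub>R One) (2 ^ k *\<^sub>R One :: 'a))"
      by (intro emeasure_mono) auto
    also have "\<dots> = ennreal ((2 ^ Suc k) ^ ?d)"
      by (subst emeasure_lborel_cbox) (auto simp: inner_simps intro: order_trans[of _ 0])
    finally show ?thesis .
  qed
  have term_le: "g k \<le> suminf g" for g :: "nat \<Rightarrow> ennreal" and k
    using sum_le_suminf[of g "{k}"] by simp
  have le: "ennreal (\<langle>x\<rangle> powr (-r)) \<le> (\<Sum>k. ennreal (2 powr (r - real k * r)) * indicator (S k) x)" for x :: 'a
  proof -
    \<comment> \<open>The smallest admissible \<open>k\<close>: for \<open>k > 0\<close> it gives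
      \<open>2^(k-1) < \<langle>x\<rangle>\<close>, and this shift by one is the summand
      \<open>r\<close> in the exponent \<open>r - k * r\<close>.\<close>
    define k where "k = (LEAST k. \<langle>x\<rangle> \<le> 2 ^ k)"
    have "\<exists>k. \<langle>x\<rangle> \<le> 2 ^ k"
      using real_arch_pow[of 2 "\<langle>x\<rangle>"] by (auto intro: less_imp_le)
    then have k: "\<langle>x\<rangle> \<le> 2 ^ k" unfolding k_def by (rule LeastI_ex)
    have "\<langle>x\<rangle> powr (-r) \<le> 2 powr (r - real k * r)"
    proof (cases k)
      case 0
      have "\<langle>x\<rangle> powr (-r) \<le> \<langle>x\<rangle> powr 0" using jb_ge_1[of x] r0 by (intro powr_mono) auto
      also have "\<dots> \<le> 2 powr r" using jb_pos[of x] r0 by (simp add: ge_one_powr_ge_zero)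
      finally show ?thesis using 0 by simp
    next
      case (Suc j)
      then have "\<not> \<langle>x\<rangle> \<le> 2 ^ j" unfolding k_def by (intro not_less_Least) simp
      then have "\<langle>x\<rangle> powr (-r) \<le> (2 ^ j) powr (-r)" using r0 by (intro powr_mono2') auto
      also have "\<dots> = 2 powr (r - real k * r)"
        by (simp add: Suc powr_powr flip: powr_realpow) (simp add: algebra_simps)
      finally show ?thesis .
    qed
    then have "ennreal (\<langle>x\<rangle> powr (-r)) \<le> ennreal (2 powr (r - real k * r)) * indicator (S k) x"
      using k by (simp add: S_def ennreal_leI)
    also have "\<dots> \<le> (\<Sum>k. ennreal (2 powr (r - real k * r)) * indicator (S k) x)"
      by (rule term_le)
    finally show ?thesis .
  qed
  define q where "q = 2 powr (real ?d - r)"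
  have q: "0 \<le> q" "q < 1" using r by (simp_all add: q_def powr_less_one)
  have summand: "2 powr (r - real k * r) * (2 ^ Suc k) ^ ?d = 2 powr (r + real ?d) * q ^ k" for k
  proof -
    have "(2::real) ^ (Suc k * ?d) = 2 powr real (Suc k * ?d)"
      by (rule powr_realpow[symmetric]) simp
    then have "(2 ^ Suc k) ^ ?d = 2 powr (real (Suc k) * real ?d)"
      unfolding power_mult of_nat_mult .
    moreover have "q ^ k = 2 powr (real k * (real ?d - r))"
      by (simp add: q_def powr_power mult.commute)
    ultimately show ?thesis
      by (simp add: algebra_simps flip: powr_add)
  qed
  have "(\<integral>\<^sup>+x. ennreal (\<langle>x::'a\<rangle> powr (-r)) \<partial>lborel)
      \<le> (\<integral>\<^sup>+x. (\<Sum>k. ennreal (2 powr (r - real k * r)) * indicator (S k) x) \<partial>lborel)"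
    by (intro nn_integral_mono le)
  also have "\<dots> = (\<Sum>k. \<integral>\<^sup>+x. ennreal (2 powr (r - real k * r)) * indicator (S k) x \<partial>lborel)"
    by (rule nn_integral_suminf) measurable
  also have "\<dots> = (\<Sum>k. ennreal (2 powr (r - real k * r)) * emeasure lborel (S k))"
    by (simp add: nn_integral_cmult_indicator)
  also have "\<dots> \<le> (\<Sum>k. ennreal (2 powr (r - real k * r)) * ennreal ((2 ^ Suc k) ^ ?d))"
    by (intro suminf_le summableI mult_left_mono S) auto
  also have "\<dots> = (\<Sum>k. ennreal (2 powr (r + real ?d) * q ^ k))"
    by (simp only: ennreal_mult[symmetric] powr_ge_zero zero_le_power zero_le_numeral summand)
  also have "\<dots> = ennreal (\<Sum>k. 2 powr (r + real ?d) * q ^ k)"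
    using q by (intro suminf_ennreal2 summable_mult summable_geometric) auto
  also have "\<dots> < \<infinity>" by simp
  finally show ?thesis .
qed

lemma integrable_jb:
  "real DIM('a) < r \<Longrightarrow> integrable lborel (\<lambda>x::'a::euclidean_space. \<langle>x\<rangle> powr (-r))"
  using nn_integral_jb_finite[of r] by (intro integrableI_bounded) auto

lemma schwartz_continuous: "f \<in> schwartz \<Longrightarrow> continuous_on S f"
  by (intro continuous_at_imp_continuous_on ballI differentiable_imp_continuous_within schwartz_differentiable)

lemma schwartz_measurable: "f \<in> schwartz \<Longrightarrow> f \<in> borel_measurable borel"
  by (intro borel_measurable_continuous_onI schwartz_continuous)

lemma schwartz_integrable:
  fixes f :: "'a::euclidean_space \<Rightarrow> complex"
  assumes "f \<in> schwartz"
  shows "integrable lborel f"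
proof -
  obtain C where C: "0 \<le> C" "\<And>x. cmod (f x) \<le> C * \<langle>x\<rangle> powr (- (real DIM('a) + 1))"
    using schwartz_decay[OF assms] by blast
  show ?thesis
    by (rule Bochner_Integration.integrable_bound[of _ "\<lambda>x. C * \<langle>x\<rangle> powr (- (real DIM('a) + 1))"])
      (use C integrable_jb[of "real DIM('a) + 1", where 'a = 'a] in \<open>auto simp: schwartz_measurable[OF assms] abs_mult jb_nonneg\<close>)
qed

text \<open>Dominated convergence along sequences, applied to the normalised remainder of the
  Frechet expansion. The mean value inequality bounds the increment of \<open>F\<close> by
  \<open>B t\<close> times the distance, and the linear term obeys the same bound, so
  \<open>2 * B\<close> dominates.\<close>

lemma has_derivative_lebesgue_integral:
  fixes F :: "'a::euclidean_space \<Rightarrow> 'b \<Rightarrow> 'c::{banach, second_countable_topology}"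
  assumes e: "0 < e"
    and deriv: "\<And>y t. y \<in> ball y0 e \<Longrightarrow> ((\<lambda>y. F y t) has_derivative F' y t) (at y)"
    and bound: "\<And>y t h. y \<in> ball y0 e \<Longrightarrow> norm (F' y t h) \<le> B t * norm h"
    and B: "integrable M B"
    and int: "\<And>y. y \<in> ball y0 e \<Longrightarrow> integrable M (F y)"
    and meas: "\<And>h. (\<lambda>t. F' y0 t h) \<in> borel_measurable M"
  shows "((\<lambda>y. \<integral>t. F y t \<partial>M) has_derivative (\<lambda>h. \<integral>t. F' y0 t h \<partial>M)) (at y0)"
proof -
  have y0: "y0 \<in> ball y0 e" using e by simp
  have lin: "linear (F' y0 t)" for t by (rule has_derivative_linear[OF deriv[OF y0]])
  have int': "integrable M (\<lambda>t. F' y0 t h)" for h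
    by (rule Bochner_Integration.integrable_bound[OF integrable_mult_left[OF B, of "norm h"]])
      (use bound[OF y0] meas in \<open>auto intro!: AE_I2 order_trans[OF _ abs_ge_self]\<close>)
  have B0: "norm (F' y0 t h) \<le> B t * norm h" for t h by (rule bound[OF y0])
  have bl: "bounded_linear (\<lambda>h. \<integral>t. F' y0 t h \<partial>M)"
  proof (rule bounded_linear_intro[where K = "\<integral>t. B t \<partial>M"])
    show "(\<integral>t. F' y0 t (x + y) \<partial>M) = (\<integral>t. F' y0 t x \<partial>M) + (\<integral>t. F' y0 t y \<partial>M)" for x y
      by (simp add: linear_add[OF lin] Bochner_Integration.integral_add[OF int' int'])
    show "(\<integral>t. F' y0 t (r *\<^sub>R x) \<partial>M) = r *\<^sub>R (\<integral>t. F' y0 t x \<partial>M)" for r x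
      by (simp add: linear_cmul[OF lin])
    show "norm (\<integral>t. F' y0 t x \<partial>M) \<le> norm x * (\<integral>t. B t \<partial>M)" for x
    proof -
      have "norm (\<integral>t. F' y0 t x \<partial>M) \<le> (\<integral>t. B t * norm x \<partial>M)"
        by (rule order_trans[OF integral_norm_bound integral_mono]) (auto intro: int' B B0)
      then show ?thesis by (simp add: mult.commute)
    qed
  qed
  have "((\<lambda>y. norm ((\<integral>t. F y t \<partial>M) - (\<integral>t. F y0 t \<partial>M) - (\<integral>t. F' y0 t (y - y0) \<partial>M)) / norm (y - y0)) \<longlongrightarrow> 0) (at y0)"
    unfolding tendsto_at_iff_sequentially comp_def
  proof (intro allI impI)
    fix Y assume Y: "\<forall>i. Y i \<in> UNIV - {y0}" "Y \<longlonglongrightarrow> y0"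
    \<comment> \<open>Outside the ball nothing is known about \<open>F\<close>, so the remainder is
      replaced by 0 there; along a convergent sequence this changes only finitely many
      terms.\<close>
    define s where "s n t = (if Y n \<in> ball y0 e then (F (Y n) t - F y0 t - F' y0 t (Y n - y0)) /\<^sub>R norm (Y n - y0) else 0)" for n t
    have "(\<lambda>n. \<integral>t. norm (s n t) \<partial>M) \<longlonglongrightarrow> (\<integral>t. 0 \<partial>M)"
    proof (rule integral_dominated_convergence[where w = "\<lambda>t. 2 * B t"])
      show "(\<lambda>t. norm (s n t)) \<in> borel_measurable M" for n
        unfolding s_def using borel_measurable_integrable[OF int[of "Y n"]] borel_measurable_integrable[OF int[OF y0]] meas
        by (cases "Y n \<in> ball y0 e") auto
      show "AE t in M. (\<lambda>n. norm (s n t)) \<longlonglongrightarrow> 0"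
      proof (rule AE_I2)
        fix t
        have "(\<lambda>n. norm (F (Y n) t - F y0 t - F' y0 t (Y n - y0)) / norm (Y n - y0)) \<longlonglongrightarrow> 0"
          using deriv[OF y0, of t] Y unfolding has_derivative_at_within[unfolded has_derivative_iff_norm] has_derivative_iff_norm
            tendsto_at_iff_sequentially comp_def by auto
        then show "(\<lambda>n. norm (s n t)) \<longlonglongrightarrow> 0"
          by (rule Lim_null_comparison[rotated]) (auto simp: s_def divide_inverse mult.commute)
      qed
      show "AE t in M. norm (norm (s n t)) \<le> 2 * B t" for n
      proof (rule AE_I2)
        fix t
        show "norm (norm (s n t)) \<le> 2 * B t"
        proof (cases "Y n \<in> ball y0 e")
          case True
          have "norm (F (Y n) t - F y0 t) \<le> B t * norm (Y n - y0)"
          proof (rule differentiable_bound[OF convex_ball _ _ True y0])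
            show "((\<lambda>y. F y t) has_derivative F' y t) (at y within ball y0 e)" if "y \<in> ball y0 e" for y
              using deriv[OF that] by (rule has_derivative_at_withinI)
            show "onorm (F' y t) \<le> B t" if "y \<in> ball y0 e" for y
              by (rule onorm_le) (rule bound[OF that])
          qed
          then have "norm (F (Y n) t - F y0 t - F' y0 t (Y n - y0)) \<le> 2 * B t * norm (Y n - y0)"
            using B0[of t "Y n - y0"] norm_triangle_ineq4[of "F (Y n) t - F y0 t" "F' y0 t (Y n - y0)"] by linarith
          moreover have "0 < norm (Y n - y0)" using Y(1) by auto
          ultimately have "norm (F (Y n) t - F y0 t - F' y0 t (Y n - y0)) / norm (Y n - y0) \<le> 2 * B t"
            by (subst pos_divide_le_eq)
          moreover have "norm (s n t) = norm (F (Y n) t - F y0 t - F' y0 t (Y n - y0)) / norm (Y n - y0)"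
            using True by (simp add: s_def divide_inverse mult.commute)
          ultimately show ?thesis by simp
        next
          case False
          have "0 \<le> B t * norm (Y n - y0)" using B0[of t "Y n - y0"] norm_ge_zero order_trans by blast
          moreover have "0 < norm (Y n - y0)" using Y(1) by auto
          ultimately show ?thesis using False by (simp add: s_def zero_le_mult_iff)
        qed
      qed
    qed (use B in auto)
    then have lim: "(\<lambda>n. \<integral>t. norm (s n t) \<partial>M) \<longlonglongrightarrow> 0" by simp
    have "\<forall>\<^sub>F n in sequentially. Y n \<in> ball y0 e"
      using Y(2) e by (simp add: tendsto_iff dist_commute)
    then have "\<forall>\<^sub>F n in sequentially. norm (norm ((\<integral>t. F (Y n) t \<partial>M) - (\<integral>t. F y0 t \<partial>M) - (\<integral>t. F' y0 t (Y n - y0) \<partial>M)) / norm (Y n - y0))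
        \<le> (\<integral>t. norm (s n t) \<partial>M)"
    proof eventually_elim
      case (elim n)
      have "(\<integral>t. s n t \<partial>M) = ((\<integral>t. F (Y n) t \<partial>M) - (\<integral>t. F y0 t \<partial>M) - (\<integral>t. F' y0 t (Y n - y0) \<partial>M)) /\<^sub>R norm (Y n - y0)"
        using elim by (simp add: s_def int int[OF y0] int')
      then have "norm ((\<integral>t. F (Y n) t \<partial>M) - (\<integral>t. F y0 t \<partial>M) - (\<integral>t. F' y0 t (Y n - y0) \<partial>M)) / norm (Y n - y0)
          = norm (\<integral>t. s n t \<partial>M)"
        by (simp add: divide_inverse mult.commute)
      then show ?case using integral_norm_bound[of M "s n"] by simp
    qed
    then show "(\<lambda>n. norm ((\<integral>t. F (Y n) t \<partial>M) - (\<integral>t. F y0 t \<partial>M) - (\<integral>t. F' y0 t (Y n - y0) \<partial>M)) / norm (Y n - y0)) \<longlonglongrightarrow> 0"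
      by (rule Lim_null_comparison[OF _ lim])
  qed
  with bl show ?thesis by (simp add: has_derivative_iff_norm)
qed

section \<open>Affine substitutions and integration by parts\<close>

lemma lborel_integral_affine:
  fixes f :: "'a::euclidean_space \<Rightarrow> 'b::{banach, second_countable_topology}"
  assumes [measurable]: "f \<in> borel_measurable borel" and c: "c \<noteq> 0"
  shows "(\<integral>x. f x \<partial>lborel) = \<bar>c\<bar> ^ DIM('a) *\<^sub>R (\<integral>x. f (t + c *\<^sub>R x) \<partial>lborel)"
  by (subst lborel_affine[OF c, of t], subst integral_density)
    (auto simp: integral_distr)

lemma lborel_integral_translate:
  fixes f :: "'a::euclidean_space \<Rightarrow> 'b::{banach, second_countable_topology}"
  assumes "f \<in> borel_measurable borel"
  shows "(\<integral>x. f (x + t) \<partial>lborel) = (\<integral>x. f x \<partial>lborel)"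
  using lborel_integral_affine[OF assms, of 1 t] by (simp add: add.commute)

lemma lborel_nn_integral_affine:
  fixes f :: "'a::euclidean_space \<Rightarrow> ennreal"
  assumes [measurable]: "f \<in> borel_measurable borel" and c: "\<bar>c\<bar> = 1"
  shows "(\<integral>\<^sup>+x. f (t + c *\<^sub>R x) \<partial>lborel) = (\<integral>\<^sup>+x. f x \<partial>lborel)"
proof -
  have "c \<noteq> 0" using c by auto
  then have "(\<integral>\<^sup>+x. f x \<partial>lborel) = (\<integral>\<^sup>+x. f x \<partial>density (distr lborel borel (\<lambda>x. t + c *\<^sub>R x)) (\<lambda>_. \<bar>c\<bar> ^ DIM('a)))"
    by (simp flip: lborel_affine)
  also have "\<dots> = (\<integral>\<^sup>+x. f (t + c *\<^sub>R x) \<partial>lborel)"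
    by (simp add: nn_integral_density nn_integral_distr c)
  finally show ?thesis by simp
qed

text \<open>By translation invariance the integral of \<open>f (x + s *\<^sub>R b)\<close> does not
  depend on \<open>s\<close>; differentiate at \<open>s = 0\<close> under the integral. This is the
  form in which integration by parts is used.\<close>

lemma integral_dirder_eq_0:
  fixes f :: "'a::euclidean_space \<Rightarrow> complex"
  assumes f: "f \<in> schwartz"
  shows "(\<integral>x. dirder b f x \<partial>lborel) = 0"
proof -
  let ?r = "real DIM('a) + 1"
  obtain C where C: "0 \<le> C" "\<And>x h. cmod (dirder h f x) \<le> C * \<langle>x\<rangle> powr (-?r) * norm h"
    using schwartz_dirder_bound[OF f] by blast
  \<comment> \<open>For \<open>\<bar>s\<bar> < 1\<close> Peetre's inequality bounds the decay at
    \<open>x + s *\<^sub>R b\<close> by the decay at \<open>x\<close>, with this constant.\<close>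
  define K where "K = C * (2 * \<langle>b\<rangle>) powr ?r * norm b"
  have lin: "linear (\<lambda>h. dirder h f x)" for x by (rule dirder_linear[OF f])
  have "((\<lambda>s. \<integral>x. f (x + s *\<^sub>R b) \<partial>lborel) has_derivative (\<lambda>h. \<integral>x. dirder (h *\<^sub>R b) f (x + 0 *\<^sub>R b) \<partial>lborel)) (at 0)"
  proof (rule has_derivative_lebesgue_integral[where e = 1 and B = "\<lambda>x. K * \<langle>x\<rangle> powr (-?r)"])
    fix s :: real assume s: "s \<in> ball 0 1"
    show "((\<lambda>s. f (x + s *\<^sub>R b)) has_derivative (\<lambda>h. dirder (h *\<^sub>R b) f (x + s *\<^sub>R b))) (at s)" for x
    proof (rule has_derivative_compose[OF _ schwartz_has_derivative[OF f]])
      show "((\<lambda>s. x + s *\<^sub>R b) has_derivative (\<lambda>h. h *\<^sub>R b)) (at s)"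
        by (auto intro!: derivative_eq_intros)
    qed
    show "cmod (dirder (h *\<^sub>R b) f (x + s *\<^sub>R b)) \<le> K * \<langle>x\<rangle> powr (-?r) * norm h" for x h
    proof -
      have "\<langle>x + s *\<^sub>R b\<rangle> powr (-?r) \<le> 2 powr ?r * \<langle>s *\<^sub>R b\<rangle> powr ?r * \<langle>x\<rangle> powr (-?r)"
        using jb_peetre[of "x + s *\<^sub>R b" "-?r" x] by (simp add: add.commute)
      also have "\<dots> \<le> 2 powr ?r * \<langle>b\<rangle> powr ?r * \<langle>x\<rangle> powr (-?r)"
      proof -
        have "\<langle>s *\<^sub>R b\<rangle> \<le> \<langle>b\<rangle>" using s by (intro jb_mono) (simp add: mult_left_le_one_le)
        then show ?thesis by (intro mult_left_mono mult_right_mono powr_mono2) (auto simp: jb_nonneg)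
      qed
      finally have "\<langle>x + s *\<^sub>R b\<rangle> powr (-?r) \<le> (2 * \<langle>b\<rangle>) powr ?r * \<langle>x\<rangle> powr (-?r)"
        by (simp add: powr_mult jb_nonneg)
      then have "C * \<langle>x + s *\<^sub>R b\<rangle> powr (-?r) * norm (h *\<^sub>R b) \<le> C * ((2 * \<langle>b\<rangle>) powr ?r * \<langle>x\<rangle> powr (-?r)) * norm (h *\<^sub>R b)"
        using C(1) by (intro mult_left_mono mult_right_mono) auto
      with C(2)[of "x + s *\<^sub>R b" "h *\<^sub>R b"] show ?thesis by (simp add: K_def mult_ac)
    qed
    show "integrable lborel (\<lambda>x. f (x + s *\<^sub>R b))"
      by (rule schwartz_integrable) (rule schwartz_affine_comp[OF f, where l = "\<lambda>x. x" and C = 1], auto simp: linear_id[unfolded id_def])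
  next
    show "integrable lborel (\<lambda>x::'a. K * \<langle>x\<rangle> powr (-?r))"
      using integrable_jb[of ?r, where 'a = 'a] by simp
    show "(\<lambda>t. dirder (h *\<^sub>R b) f (t + 0 *\<^sub>R b)) \<in> borel_measurable lborel" for h
      using schwartz_measurable[OF schwartz_dirder_vector[OF f]] by simp
  qed simp
  moreover have "((\<lambda>s::real. \<integral>x. f (x + s *\<^sub>R b) \<partial>lborel) has_derivative (\<lambda>h. 0)) (at 0)"
    using lborel_integral_translate[OF schwartz_measurable[OF f]] by simp
  ultimately have "(\<lambda>h. \<integral>x. dirder (h *\<^sub>R b) f (x + 0 *\<^sub>R b) \<partial>lborel) = (\<lambda>h. 0)"
    by (rule has_derivative_unique)
  from fun_cong[OF this, of 1] show ?thesis by simp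
qed

subsection \<open>Partial Fourier transforms\<close>

text \<open>Only the second variable is transformed, the first is a parameter. The STFT and the
  Wigner distribution both have this form after a linear change of variables in the kernel, so that
  the Schwartz property and inversion are proved once for both.\<close>

definition partial_fourier :: "('a::euclidean_space \<times> 'b::euclidean_space \<Rightarrow> complex) \<Rightarrow> 'a \<times> 'b \<Rightarrow> complex" where
  "partial_fourier k = (\<lambda>z. \<integral>t. k (fst z, t) * cis (- 2 * pi * (snd z \<bullet> t)) \<partial>lborel)"

lemma schwartz_section:
  fixes k :: "'a::euclidean_space \<times> 'b::euclidean_space \<Rightarrow> complex"
  assumes "k \<in> schwartz"
  shows "(\<lambda>t. k (x, t)) \<in> schwartz"
  using schwartz_affine_comp[OF assms, where l = "\<lambda>t. (0, t)" and C = 1 and c = "(x, 0)"]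
  by (simp add: linear_iff norm_Pair)

lemma schwartz_translate:
  fixes f :: "'a::euclidean_space \<Rightarrow> complex"
  shows "f \<in> schwartz \<Longrightarrow> (\<lambda>t. f (t - x)) \<in> schwartz"
  using schwartz_affine_comp[where l = "\<lambda>t. t" and C = 1 and c = "- x"] by (simp add: linear_iff)

lemma schwartz_modulate:
  fixes f :: "'a::euclidean_space \<Rightarrow> complex"
  assumes "f \<in> schwartz"
  shows "(\<lambda>t. cis (c * (\<xi> \<bullet> t)) * f t) \<in> schwartz"
proof (rule schwartz_character_mult[OF assms])
  show "((\<lambda>t. c * (\<xi> \<bullet> t)) has_derivative (\<lambda>h. c * (\<xi> \<bullet> h))) (at x)" for x
    by (auto intro!: derivative_eq_intros)
qed (rule schwartz_cmult)

lemma jb_powr_snd_le: "0 \<le> r \<Longrightarrow> \<langle>(x, t)\<rangle> powr (-r) \<le> \<langle>t\<rangle> powr (-r)"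
  using jb_snd_le[of "(x, t)"] by (intro powr_mono2') (auto simp: jb_pos)

text \<open>The derivative is again the partial Fourier transform of a Schwartz kernel, as the
  coinduction needs: a direction in the parameter differentiates \<open>k\<close>, a direction in
  the frequency multiplies it by a coordinate.\<close>

lemma partial_fourier_has_derivative:
  fixes k :: "'a::euclidean_space \<times> 'b::euclidean_space \<Rightarrow> complex"
  assumes k: "k \<in> schwartz"
  shows "(partial_fourier k has_derivative
    (\<lambda>h. partial_fourier (\<lambda>p. dirder (fst h, 0) k p + of_real (snd h \<bullet> snd p) * (- 2 * pi * \<i> * k p)) z)) (at z)"
proof -
  let ?r = "real DIM('b) + 1"
  obtain C1 where C1: "0 \<le> C1" "\<And>x h. cmod (dirder h k x) \<le> C1 * \<langle>x\<rangle> powr (-?r) * norm h"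
    using schwartz_dirder_bound[OF k] by blast
  \<comment> \<open>One power of decay more than for the derivative, to be spent on the factor
    \<open>snd h \<bullet> t\<close>.\<close>
  obtain C2 where C2: "0 \<le> C2" "\<And>x. cmod (k x) \<le> C2 * \<langle>x\<rangle> powr (- (?r + 1))"
    using schwartz_decay[OF k] by blast
  have k': "(\<lambda>t. k (x, t)) \<in> schwartz" for x by (rule schwartz_section[OF k])
  define F where "F z t = k (fst z, t) * cis (- 2 * pi * (snd z \<bullet> t))" for z t
  define F' where "F' z t h = (dirder (fst h, 0) k (fst z, t) + of_real (snd h \<bullet> t) * (- 2 * pi * \<i> * k (fst z, t)))
    * cis (- 2 * pi * (snd z \<bullet> t))" for z t h
  have "((\<lambda>z. \<integral>t. F z t \<partial>lborel) has_derivative (\<lambda>h. \<integral>t. F' z t h \<partial>lborel)) (at z)"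
  proof (rule has_derivative_lebesgue_integral[where e = 1 and B = "\<lambda>t. (C1 + 2 * pi * C2) * \<langle>t\<rangle> powr (-?r)"])
    fix z :: "'a \<times> 'b"
    show "((\<lambda>z. F z t) has_derivative F' z t) (at z)" for t
    proof -
      have "((\<lambda>z. (fst z, t)) has_derivative (\<lambda>h. (fst h, 0))) (at z)"
        by (auto intro!: derivative_eq_intros)
      then have 1: "((\<lambda>z. k (fst z, t)) has_derivative (\<lambda>h. dirder (fst h, 0) k (fst z, t))) (at z)"
        by (rule has_derivative_compose) (rule schwartz_has_derivative[OF k])
      have "((\<lambda>z. - 2 * pi * (snd z \<bullet> t)) has_derivative (\<lambda>h. - 2 * pi * (snd h \<bullet> t))) (at z)"
        by (auto intro!: derivative_eq_intros)
      then have 2: "((\<lambda>z. cis (- 2 * pi * (snd z \<bullet> t))) has_derivative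
          (\<lambda>h. (- 2 * pi * (snd h \<bullet> t)) *\<^sub>R (\<i> * cis (- 2 * pi * (snd z \<bullet> t))))) (at z)"
        by (rule has_derivative_cis)
      show ?thesis
        unfolding F_def F'_def
        by (rule has_derivative_eq_rhs[OF has_derivative_mult[OF 1 2]])
          (simp add: fun_eq_iff scaleR_conv_of_real algebra_simps)
    qed
    show "cmod (F' z t h) \<le> (C1 + 2 * pi * C2) * \<langle>t\<rangle> powr (-?r) * norm h" for t h
    proof -
      have "cmod (dirder (fst h, 0) k (fst z, t)) \<le> C1 * \<langle>(fst z, t)\<rangle> powr (-?r) * norm (fst h, 0 :: 'b)"
        by (rule C1(2))
      also have "\<dots> \<le> C1 * \<langle>t\<rangle> powr (-?r) * norm h"
        using C1(1) norm_fst_le[of "fst h" "snd h"]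
        by (intro mult_mono mult_left_mono jb_powr_snd_le) (auto simp: norm_Pair)
      finally have 1: "cmod (dirder (fst h, 0) k (fst z, t)) \<le> C1 * \<langle>t\<rangle> powr (-?r) * norm h" .
      have "\<bar>snd h \<bullet> t\<bar> \<le> norm (snd h) * norm t" by (rule Cauchy_Schwarz_ineq2)
      also have "\<dots> \<le> norm h * \<langle>t\<rangle>"
        using norm_snd_le[of "snd h" "fst h"] by (intro mult_mono norm_le_jb) auto
      finally have 2: "\<bar>snd h \<bullet> t\<bar> \<le> norm h * \<langle>t\<rangle>" .
      have "cmod (k (fst z, t)) \<le> C2 * \<langle>(fst z, t)\<rangle> powr (- (?r + 1))" by (rule C2(2))
      also have "\<dots> \<le> C2 * \<langle>t\<rangle> powr (- (?r + 1))"
        using C2(1) by (intro mult_left_mono jb_powr_snd_le) auto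
      finally have 3: "cmod (k (fst z, t)) \<le> C2 * \<langle>t\<rangle> powr (- (?r + 1))" .
      have "\<bar>snd h \<bullet> t\<bar> * cmod (k (fst z, t)) \<le> (norm h * \<langle>t\<rangle>) * (C2 * \<langle>t\<rangle> powr (- (?r + 1)))"
        by (intro mult_mono 2 3) (auto simp: jb_nonneg)
      also have "\<dots> = C2 * (\<langle>t\<rangle> powr 1 * \<langle>t\<rangle> powr (- (?r + 1))) * norm h"
        using jb_pos[of t] by simp
      also have "\<dots> = C2 * \<langle>t\<rangle> powr (- ?r) * norm h"
        by (subst powr_add[symmetric]) (simp add: algebra_simps)
      finally have 4: "\<bar>snd h \<bullet> t\<bar> * cmod (k (fst z, t)) \<le> C2 * \<langle>t\<rangle> powr (- ?r) * norm h" .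
      have "cmod (F' z t h) \<le> cmod (dirder (fst h, 0) k (fst z, t)) + 2 * pi * (\<bar>snd h \<bullet> t\<bar> * cmod (k (fst z, t)))"
        unfolding F'_def norm_mult norm_cis mult_1_right
        by (rule order_trans[OF norm_triangle_ineq]) (simp add: norm_mult)
      also have "\<dots> \<le> C1 * \<langle>t\<rangle> powr (-?r) * norm h + 2 * pi * (C2 * \<langle>t\<rangle> powr (- ?r) * norm h)"
        by (intro add_mono 1 mult_left_mono 4) auto
      finally show ?thesis by (simp add: algebra_simps)
    qed
    show "integrable lborel (F z)"
      using schwartz_integrable[OF schwartz_modulate[OF k', where c = "- 2 * pi" and \<xi> = "snd z"]]
      by (simp add: F_def[abs_def] mult.commute)
  next
    show "integrable lborel (\<lambda>t::'b. (C1 + 2 * pi * C2) * \<langle>t\<rangle> powr (-?r))"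
      using integrable_jb[of ?r, where 'a = 'b] by simp
    have [measurable]: "k \<in> borel_measurable borel" "\<And>h. dirder h k \<in> borel_measurable borel"
      using schwartz_measurable schwartz_dirder_vector k by blast+
    show "(\<lambda>t. F' z t h) \<in> borel_measurable lborel" for h
      unfolding F'_def cis_conv_exp by measurable
  qed simp
  then show ?thesis
    by (simp add: partial_fourier_def[abs_def] F_def[abs_def] F'_def[abs_def])
qed

text \<open>Dual to the derivative formula: a coordinate of the parameter multiplies the kernel, a
  coordinate of the frequency becomes a derivative of the kernel. With \<open>b\<close> a pair both
  cases are one identity.\<close>

lemma partial_fourier_coord:
  fixes k :: "'a::euclidean_space \<times> 'b::euclidean_space \<Rightarrow> complex"
  assumes k: "k \<in> schwartz"
  shows "of_real (z \<bullet> b) * partial_fourier k z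
    = partial_fourier (\<lambda>p. of_real (fst p \<bullet> fst b) * k p + 1 / (2 * pi * \<i>) * dirder (0, snd b) k p) z"
proof -
  define x where "x = fst z"
  define f where "f t = cis (- 2 * pi * (snd z \<bullet> t)) * k (x, t)" for t
  have k': "(\<lambda>t. k (x, t)) \<in> schwartz" "(\<lambda>t. dirder (0, snd b) k (x, t)) \<in> schwartz"
    using schwartz_section schwartz_dirder_vector k by blast+
  have f: "f \<in> schwartz" unfolding f_def by (rule schwartz_modulate[OF k'(1)])
  have f2: "(\<lambda>t. cis (- 2 * pi * (snd z \<bullet> t)) * dirder (0, snd b) k (x, t)) \<in> schwartz"
    by (rule schwartz_modulate[OF k'(2)])
  have "((\<lambda>t. (x, t)) has_derivative (\<lambda>h. (0, h))) (at t)" for t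
    by (auto intro!: derivative_eq_intros)
  then have 1: "((\<lambda>t. k (x, t)) has_derivative (\<lambda>h. dirder (0, h) k (x, t))) (at t)" for t
    by (rule has_derivative_compose) (rule schwartz_has_derivative[OF k])
  have "((\<lambda>t. - 2 * pi * (snd z \<bullet> t)) has_derivative (\<lambda>h. - 2 * pi * (snd z \<bullet> h))) (at t)" for t
    by (auto intro!: derivative_eq_intros)
  then have 2: "((\<lambda>t. cis (- 2 * pi * (snd z \<bullet> t))) has_derivative
      (\<lambda>h. (- 2 * pi * (snd z \<bullet> h)) *\<^sub>R (\<i> * cis (- 2 * pi * (snd z \<bullet> t))))) (at t)" for t
    by (rule has_derivative_cis)
  have "dirder (snd b) f = (\<lambda>t. cis (- 2 * pi * (snd z \<bullet> t)) * dirder (0, snd b) k (x, t)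
      + (- 2 * pi * (snd z \<bullet> snd b)) *\<^sub>R (\<i> * cis (- 2 * pi * (snd z \<bullet> t))) * k (x, t))"
    unfolding f_def by (rule dirder_eqI[OF has_derivative_mult[OF 2 1]])
  also have "\<dots> = (\<lambda>t. cis (- 2 * pi * (snd z \<bullet> t)) * dirder (0, snd b) k (x, t)
      + (- 2 * pi * \<i> * (snd z \<bullet> snd b)) * f t)"
    by (simp add: fun_eq_iff f_def scaleR_conv_of_real)
  finally have "(\<integral>t. cis (- 2 * pi * (snd z \<bullet> t)) * dirder (0, snd b) k (x, t)
      + (- 2 * pi * \<i> * (snd z \<bullet> snd b)) * f t \<partial>lborel) = 0"
    using integral_dirder_eq_0[OF f] by metis
  \<comment> \<open>The integral of the derivative of the modulated section \<open>f\<close>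
    vanishes; the product rule splits it into these two terms.\<close>
  then have ibp: "(\<integral>t. cis (- 2 * pi * (snd z \<bullet> t)) * dirder (0, snd b) k (x, t) \<partial>lborel)
      = 2 * pi * \<i> * (snd z \<bullet> snd b) * (\<integral>t. f t \<partial>lborel)"
    by (subst (asm) Bochner_Integration.integral_add)
      (use schwartz_integrable[OF f] schwartz_integrable[OF f2] in \<open>auto simp: add_eq_0_iff\<close>)
  have "partial_fourier (\<lambda>p. of_real (fst p \<bullet> fst b) * k p + 1 / (2 * pi * \<i>) * dirder (0, snd b) k p) z
      = (\<integral>t. of_real (x \<bullet> fst b) * f t + 1 / (2 * pi * \<i>) * (cis (- 2 * pi * (snd z \<bullet> t)) * dirder (0, snd b) k (x, t)) \<partial>lborel)"
    unfolding partial_fourier_def f_def by (intro Bochner_Integration.integral_cong) (auto simp: x_def algebra_simps)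
  also have "\<dots> = of_real (x \<bullet> fst b) * (\<integral>t. f t \<partial>lborel)
      + 1 / (2 * pi * \<i>) * (\<integral>t. cis (- 2 * pi * (snd z \<bullet> t)) * dirder (0, snd b) k (x, t) \<partial>lborel)"
    by (subst Bochner_Integration.integral_add)
      (use schwartz_integrable[OF f] schwartz_integrable[OF f2] in auto)
  also have "\<dots> = of_real (z \<bullet> b) * (\<integral>t. f t \<partial>lborel)"
    unfolding ibp by (simp add: x_def inner_prod_def algebra_simps)
  also have "(\<integral>t. f t \<partial>lborel) = partial_fourier k z"
    by (simp add: partial_fourier_def f_def x_def mult.commute)
  finally show ?thesis by simp
qed

text \<open>Coinduction on the image of the Schwartz space, which the two preceding identities show
  to be closed under derivatives and coordinate multiplications.\<close>

lemma partial_fourier_schwartz: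
  fixes k :: "'a::euclidean_space \<times> 'b::euclidean_space \<Rightarrow> complex"
  assumes "k \<in> schwartz"
  shows "partial_fourier k \<in> schwartz"
proof (rule schwartz_coinduct_bounded[where P = "partial_fourier ` (schwartz :: ('a \<times> 'b \<Rightarrow> complex) set)"])
  fix F assume "F \<in> partial_fourier ` (schwartz :: ('a \<times> 'b \<Rightarrow> complex) set)"
  then obtain k where k: "k \<in> schwartz" and F: "F = partial_fourier k" by blast
  have lin: "bounded_linear (\<lambda>p::'a \<times> 'b. b \<bullet> snd p)" "bounded_linear (\<lambda>p::'a \<times> 'b. fst p \<bullet> c)" for b c
    by (intro bounded_linear_inner_right_comp bounded_linear_inner_left_comp bounded_linear_snd bounded_linear_fst)+
  have "(\<lambda>p. dirder (fst h, 0) k p + of_real (snd h \<bullet> snd p) * (- 2 * pi * \<i> * k p)) \<in> schwartz" for h :: "'a \<times> 'b"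
    by (intro schwartz_add schwartz_linear_mult lin schwartz_cmult schwartz_dirder_vector k)
  then show "\<exists>D. (\<forall>x. (F has_derivative D x) (at x)) \<and>
      (\<forall>b\<in>Basis. (\<lambda>x. D x b) \<in> sums_of (partial_fourier ` (schwartz :: ('a \<times> 'b \<Rightarrow> complex) set)))"
    unfolding F
    by (intro exI[of _ "\<lambda>z h. partial_fourier (\<lambda>p. dirder (fst h, 0) k p + of_real (snd h \<bullet> snd p) * (- 2 * pi * \<i> * k p)) z"]
        conjI allI ballI sums_of.base partial_fourier_has_derivative k imageI) 
  show "(\<lambda>z. of_real (z \<bullet> b) * F z) \<in> partial_fourier ` (schwartz :: ('a \<times> 'b \<Rightarrow> complex) set)" if "b \<in> Basis" for b
    unfolding F partial_fourier_coord[OF k]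
    by (intro imageI schwartz_add schwartz_linear_mult lin schwartz_cmult schwartz_dirder_vector k)
  let ?r = "real DIM('b) + 1"
  obtain C where C: "0 \<le> C" "\<And>x. cmod (k x) \<le> C * \<langle>x\<rangle> powr (- ?r)"
    using schwartz_decay[OF k] by blast
  have "cmod (F z) \<le> (\<integral>t. C * \<langle>t::'b\<rangle> powr (- ?r) \<partial>lborel)" for z
    unfolding F partial_fourier_def
  proof (rule order_trans[OF integral_norm_bound integral_mono])
    show "integrable lborel (\<lambda>t. cmod (k (fst z, t) * cis (- 2 * pi * (snd z \<bullet> t))))"
      using integrable_norm[OF schwartz_integrable[OF schwartz_section[OF k, of "fst z"]]] by (simp add: norm_mult)
    show "integrable lborel (\<lambda>t::'b. C * \<langle>t\<rangle> powr (- ?r))"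
      using integrable_jb[of ?r, where 'a = 'b] by simp
    show "cmod (k (fst z, t) * cis (- 2 * pi * (snd z \<bullet> t))) \<le> C * \<langle>t\<rangle> powr (- ?r)" for t
      using order_trans[OF C(2)[of "(fst z, t)"] mult_left_mono[OF jb_powr_snd_le C(1)]] by (simp add: norm_mult)
  qed
  then show "\<exists>C. \<forall>x. cmod (F x) \<le> C" by blast
qed (use assms in blast)

subsection \<open>Fourier inversion\<close>

text \<open>Lebesgue measure is the image of a product measure over the coordinates, so Fubini's
  theorem for finite products applies. It reduces the Gaussian in any dimension to the real
  line.\<close>

lemma lborel_integral_prod_Basis:
  fixes f :: "'a::euclidean_space \<Rightarrow> real \<Rightarrow> complex"
  assumes f: "\<And>b. b \<in> Basis \<Longrightarrow> integrable lborel (f b)"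
  shows "integrable lborel (\<lambda>x::'a. \<Prod>b\<in>Basis. f b (x \<bullet> b))"
    and "(\<integral>x. (\<Prod>b\<in>Basis. f b ((x::'a) \<bullet> b)) \<partial>lborel) = (\<Prod>b\<in>Basis. \<integral>s. f b s \<partial>lborel)"
proof -
  interpret product_sigma_finite "\<lambda>_::'a. lborel :: real measure" ..
  have [measurable]: "f b \<in> borel_measurable borel" if "b \<in> Basis" for b
    using borel_measurable_integrable[OF f[OF that]] by simp
  have coord: "(\<Sum>b\<in>Basis. g b *\<^sub>R b) \<bullet> c = g c" if "c \<in> Basis" for g :: "'a \<Rightarrow> real" and c
    using that by (simp add: inner_sum_left_Basis)
  have T: "(\<lambda>g. \<Sum>b\<in>Basis. g b *\<^sub>R b) \<in> (\<Pi>\<^sub>M b\<in>Basis. lborel) \<rightarrow>\<^sub>M (borel :: 'a measure)"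
    by measurable
  have M: "(\<lambda>x::'a. \<Prod>b\<in>Basis. f b (x \<bullet> b)) \<in> borel_measurable borel"
    by measurable
  have *: "(\<lambda>g. \<Prod>b\<in>Basis. f b ((\<Sum>b\<in>Basis. g b *\<^sub>R b) \<bullet> b)) = (\<lambda>g. \<Prod>b\<in>Basis. f b (g b))"
    by (intro ext prod.cong refl) (simp add: coord)
  show "integrable lborel (\<lambda>x::'a. \<Prod>b\<in>Basis. f b (x \<bullet> b))"
    by (subst lborel_eq, subst integrable_distr_eq[OF T M], subst *)
      (rule product_integrable_prod[OF finite_Basis f])
  show "(\<integral>x. (\<Prod>b\<in>Basis. f b ((x::'a) \<bullet> b)) \<partial>lborel) = (\<Prod>b\<in>Basis. \<integral>s. f b s \<partial>lborel)"
    by (subst lborel_eq, subst integral_distr[OF T M], subst *)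
      (rule product_integral_prod[OF finite_Basis f])
qed

lemma integrable_gaussian_real: "integrable lborel (\<lambda>s::real. exp (- pi * s\<^sup>2))"
proof (rule Bochner_Integration.integrable_bound)
  show "integrable lborel (\<lambda>s::real. \<langle>s\<rangle> powr (- 2))"
    by (rule integrable_jb) simp
  show "AE s in lborel. norm (exp (- pi * s\<^sup>2)) \<le> norm (\<langle>s\<rangle> powr (- 2))"
  proof (rule AE_I2)
    fix s :: real
    have "1 + s\<^sup>2 \<le> 1 + pi * s\<^sup>2"
      using pi_ge_two mult_right_mono[of 1 pi "s\<^sup>2"] by simp
    also have "\<dots> \<le> exp (pi * s\<^sup>2)" by (rule exp_ge_add_one_self)
    finally have "inverse (exp (pi * s\<^sup>2)) \<le> inverse (1 + s\<^sup>2)"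
      by (rule le_imp_inverse_le) (auto intro: add_pos_nonneg)
    moreover have "\<langle>s\<rangle> powr (- 2) = inverse (1 + s\<^sup>2)"
      using jb_pos[of s] jb_power2[of s] by (simp add: powr_minus)
    ultimately show "norm (exp (- pi * s\<^sup>2)) \<le> norm (\<langle>s\<rangle> powr (- 2))"
      by (simp add: exp_minus)
  qed
qed simp

text \<open>The characteristic function of the standard normal law, rescaled by
  \<open>sqrt (2 * pi)\<close> so that the Gaussian becomes its own Fourier transform.\<close>

lemma gaussian_fourier_real:
  "(\<integral>s. complex_of_real (exp (- pi * s\<^sup>2)) * cis (2 * pi * (y * s)) \<partial>lborel) = of_real (exp (- pi * y\<^sup>2))"
proof -
  define c where "c = sqrt (2 * pi)"
  have c: "0 < c" "c * c = 2 * pi" by (simp_all add: c_def)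
  have "of_real (exp (- (c * y)\<^sup>2 / 2)) = char std_normal_distribution (c * y)"
    by (simp add: char_std_normal_distribution)
  also have "\<dots> = (\<integral>x. std_normal_density x *\<^sub>R cis (c * y * x) \<partial>lborel)"
    unfolding char_def by (subst integral_density) (auto simp: cis_conv_exp mult.assoc)
  also have "\<dots> = \<bar>c\<bar> *\<^sub>R (\<integral>s. std_normal_density (0 + c *\<^sub>R s) *\<^sub>R cis (c * y * (0 + c *\<^sub>R s)) \<partial>lborel)"
    using c(1) by (subst lborel_integral_affine[of _ c 0]) (auto simp: cis_conv_exp)
  also have "\<dots> = (\<integral>s. c *\<^sub>R (std_normal_density (c * s) *\<^sub>R cis (c * y * (c * s))) \<partial>lborel)"
    using c(1) by (subst integral_scaleR_right) simp
  also have "\<dots> = (\<integral>s. complex_of_real (exp (- pi * s\<^sup>2)) * cis (2 * pi * (y * s)) \<partial>lborel)"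
  proof (rule Bochner_Integration.integral_cong[OF refl])
    fix s
    have "c * y * (c * s) = (c * c) * (y * s)" by (simp only: mult_ac)
    then have 1: "c * y * (c * s) = 2 * pi * (y * s)" by (simp only: c(2))
    have "(c * s)\<^sup>2 = (c * c) * s\<^sup>2" by (simp add: power2_eq_square)
    then have "- (c * s)\<^sup>2 / 2 = - pi * s\<^sup>2" unfolding c(2) by simp
    then have "std_normal_density (c * s) = 1 / c * exp (- pi * s\<^sup>2)"
      unfolding std_normal_density_def c_def[symmetric] by simp
    then have 2: "c * std_normal_density (c * s) = exp (- pi * s\<^sup>2)"
      using c(1) by simp
    show "c *\<^sub>R (std_normal_density (c * s) *\<^sub>R cis (c * y * (c * s)))
        = complex_of_real (exp (- pi * s\<^sup>2)) * cis (2 * pi * (y * s))"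
      by (simp only: 1 2 scaleR_scaleR) (simp add: scaleR_conv_of_real)
  qed
  also have "- (c * y)\<^sup>2 / 2 = - pi * y\<^sup>2"
    using c(2) by (simp add: power2_eq_square algebra_simps)
  finally show ?thesis by simp
qed

lemma cis_sum: "cis (\<Sum>i\<in>I. f i) = (\<Prod>i\<in>I. cis (f i))"
  by (induction I rule: infinite_finite_induct) (simp_all flip: cis_mult)

lemma norm_power2_eq_sum: "(norm x)\<^sup>2 = (\<Sum>b\<in>Basis. (x \<bullet> b)\<^sup>2)" for x :: "'a::euclidean_space"
  by (simp add: norm_eq_sqrt_inner euclidean_inner[of x x] power2_eq_square sum_nonneg)

lemma
  fixes y :: "'a::euclidean_space"
  shows integrable_gaussian: "integrable lborel (\<lambda>s::'a. exp (- pi * (norm s)\<^sup>2))"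
    and gaussian_fourier: "(\<integral>s. complex_of_real (exp (- pi * (norm s)\<^sup>2)) * cis (2 * pi * (s \<bullet> y)) \<partial>lborel)
      = of_real (exp (- pi * (norm y)\<^sup>2))"
proof -
  define f where "f b s = complex_of_real (exp (- pi * s\<^sup>2)) * cis (2 * pi * ((y \<bullet> b) * s))" for b :: 'a and s
  have f: "integrable lborel (f b)" for b
  proof (rule Bochner_Integration.integrable_bound[OF integrable_gaussian_real])
    show "f b \<in> borel_measurable lborel" unfolding f_def[abs_def] cis_conv_exp by measurable
  qed (simp add: f_def norm_mult)
  have prod: "(\<Prod>b\<in>Basis. f b (s \<bullet> b)) = complex_of_real (exp (- pi * (norm s)\<^sup>2)) * cis (2 * pi * (s \<bullet> y))" for s
  proof -
    have "cis (2 * pi * (s \<bullet> y)) = (\<Prod>b\<in>Basis. cis (2 * pi * ((y \<bullet> b) * (s \<bullet> b))))"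
      by (simp add: euclidean_inner[of s y] sum_distrib_left mult_ac flip: cis_sum)
    moreover have "exp (- pi * (norm s)\<^sup>2) = (\<Prod>b\<in>Basis. exp (- pi * (s \<bullet> b)\<^sup>2))"
      by (simp add: norm_power2_eq_sum sum_distrib_left sum_negf flip: exp_sum)
    ultimately show ?thesis by (simp add: f_def prod.distrib)
  qed
  from lborel_integral_prod_Basis[of f, OF f]
  have 1: "integrable lborel (\<lambda>s. complex_of_real (exp (- pi * (norm s)\<^sup>2)) * cis (2 * pi * (s \<bullet> y)))"
    and 2: "(\<integral>s. complex_of_real (exp (- pi * (norm s)\<^sup>2)) * cis (2 * pi * (s \<bullet> y)) \<partial>lborel) = (\<Prod>b\<in>Basis. \<integral>s. f b s \<partial>lborel)"
    unfolding prod by simp_all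
  show "integrable lborel (\<lambda>s::'a. exp (- pi * (norm s)\<^sup>2))"
    using integrable_norm[OF 1] by (simp add: norm_mult)
  show "(\<integral>s. complex_of_real (exp (- pi * (norm s)\<^sup>2)) * cis (2 * pi * (s \<bullet> y)) \<partial>lborel) = of_real (exp (- pi * (norm y)\<^sup>2))"
    unfolding 2 f_def gaussian_fourier_real
    by (simp add: norm_power2_eq_sum sum_distrib_left exp_sum flip: sum_negf of_real_prod)
qed

lemma lborel_integral_Pair:
  fixes f :: "'a::euclidean_space \<times> 'b::euclidean_space \<Rightarrow> complex"
  assumes "integrable lborel f"
  shows "(\<integral>z. f z \<partial>lborel) = (\<integral>x. (\<integral>y. f (x, y) \<partial>lborel) \<partial>lborel)"
    and "(\<integral>z. f z \<partial>lborel) = (\<integral>y. (\<integral>x. f (x, y) \<partial>lborel) \<partial>lborel)"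
  using lborel_pair.integral_fst'[of f] lborel_pair.Fubini_integral[of "\<lambda>x y. f (x, y)"] assms
  by (simp_all add: lborel_prod)

lemma integrable_tensor:
  fixes f :: "'a::euclidean_space \<Rightarrow> complex" and g :: "'b::euclidean_space \<Rightarrow> complex"
  assumes f: "integrable lborel f" and g: "integrable lborel g"
  shows "integrable lborel (\<lambda>z. f (fst z) * g (snd z))"
proof -
  have [measurable]: "f \<in> borel_measurable borel" "g \<in> borel_measurable borel"
    using borel_measurable_integrable[OF f] borel_measurable_integrable[OF g] by simp_all
  have "integrable (lborel \<Otimes>\<^sub>M lborel) (\<lambda>z. f (fst z) * g (snd z))"
    by (rule lborel_pair.Fubini_integrable)
      (use f g in \<open>auto simp: norm_mult intro!: integrable_mult_left integrable_norm\<close>)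
  then show ?thesis by (simp add: lborel_prod)
qed

text \<open>Gaussian summation: with the damping \<open>E (\<epsilon> n *\<^sub>R \<xi>)\<close>
  inserted, the integral converges to the left-hand side because \<open>F\<close> is integrable;
  after Fubini it is an average of \<open>f\<close> near \<open>x\<close>, which converges to
  \<open>f x\<close> because \<open>f\<close> is bounded and continuous.\<close>

lemma fourier_inversion:
  fixes f F :: "'a::euclidean_space \<Rightarrow> complex"
  assumes f: "integrable lborel f" and cont: "continuous_on UNIV f" and bound: "\<And>t. cmod (f t) \<le> K"
    and F: "\<And>\<xi>. F \<xi> = (\<integral>t. f t * cis (- 2 * pi * (\<xi> \<bullet> t)) \<partial>lborel)"
    and F_int: "integrable lborel F"
  shows "(\<integral>\<xi>. F \<xi> * cis (2 * pi * (\<xi> \<bullet> x)) \<partial>lborel) = f x"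
proof (rule LIMSEQ_unique)
  define E where "E s = complex_of_real (exp (- pi * (norm s)\<^sup>2))" for s :: 'a
  define \<epsilon> where "\<epsilon> n = inverse (real (Suc n))" for n
  have \<epsilon>: "0 < \<epsilon> n" for n by (simp add: \<epsilon>_def)
  have \<epsilon>_lim: "\<epsilon> \<longlonglongrightarrow> 0" unfolding \<epsilon>_def by (rule LIMSEQ_inverse_real_of_nat)
  have E_int: "integrable lborel E"
    unfolding E_def by (intro integrable_of_real integrable_gaussian)
  have E_le: "cmod (E s) \<le> 1" for s by (simp add: E_def)
  have E_lim: "(\<lambda>n. E (\<epsilon> n *\<^sub>R s)) \<longlonglongrightarrow> 1" for s
  proof -
    have "(\<lambda>n. complex_of_real (exp (- pi * (norm (\<epsilon> n *\<^sub>R s))\<^sup>2))) \<longlonglongrightarrow> of_real (exp (- pi * (norm (0 *\<^sub>R s))\<^sup>2))"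
      by (intro tendsto_intros \<epsilon>_lim)
    then show ?thesis by (simp add: E_def)
  qed
  have [measurable]: "f \<in> borel_measurable borel" "F \<in> borel_measurable borel" "E \<in> borel_measurable borel"
    using borel_measurable_integrable f F_int E_int by auto
  have [measurable]: "(\<lambda>x. cis (g x)) \<in> borel_measurable M" if "g \<in> borel_measurable M" for g :: "'c \<Rightarrow> real" and M
    using that unfolding cis_conv_exp by measurable
  show "(\<lambda>n. \<integral>\<xi>. F \<xi> * cis (2 * pi * (\<xi> \<bullet> x)) * E (\<epsilon> n *\<^sub>R \<xi>) \<partial>lborel)
      \<longlonglongrightarrow> (\<integral>\<xi>. F \<xi> * cis (2 * pi * (\<xi> \<bullet> x)) \<partial>lborel)"
  proof (rule integral_dominated_convergence[where w = "\<lambda>\<xi>. cmod (F \<xi>)"])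
    show "AE \<xi> in lborel. (\<lambda>n. F \<xi> * cis (2 * pi * (\<xi> \<bullet> x)) * E (\<epsilon> n *\<^sub>R \<xi>)) \<longlonglongrightarrow> F \<xi> * cis (2 * pi * (\<xi> \<bullet> x))"
      using tendsto_mult[OF tendsto_const E_lim] by (intro AE_I2) fastforce
  qed (use F_int E_le in \<open>auto simp: norm_mult mult_left_le\<close>)
  have inner: "(\<integral>\<xi>. cis (2 * pi * (\<xi> \<bullet> v)) * E (e *\<^sub>R \<xi>) \<partial>lborel) = E ((1 / e) *\<^sub>R v) /\<^sub>R e ^ DIM('a)"
    if e: "0 < e" for e and v :: 'a
  proof -
    have "E ((1 / e) *\<^sub>R v) = (\<integral>s. E s * cis (2 * pi * (s \<bullet> ((1 / e) *\<^sub>R v))) \<partial>lborel)"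
      unfolding E_def gaussian_fourier by simp
    also have "\<dots> = \<bar>e\<bar> ^ DIM('a) *\<^sub>R (\<integral>\<xi>. E (0 + e *\<^sub>R \<xi>) * cis (2 * pi * ((0 + e *\<^sub>R \<xi>) \<bullet> ((1 / e) *\<^sub>R v))) \<partial>lborel)"
      using e by (subst lborel_integral_affine[of _ e 0]) auto
    also have "\<dots> = e ^ DIM('a) *\<^sub>R (\<integral>\<xi>. cis (2 * pi * (\<xi> \<bullet> v)) * E (e *\<^sub>R \<xi>) \<partial>lborel)"
      using e by (simp add: mult.commute)
    finally show ?thesis using e by simp
  qed
  \<comment> \<open>The damping makes the double integral absolutely convergent, so Fubini applies;
    the inner integral over \<xi> is a Gaussian of width \<open>e\<close> about
    \<open>x\<close>.\<close>
  have eq: "(\<integral>\<xi>. F \<xi> * cis (2 * pi * (\<xi> \<bullet> x)) * E (e *\<^sub>R \<xi>) \<partial>lborel) = (\<integral>s. f (x + e *\<^sub>R s) * E s \<partial>lborel)"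
    if e: "0 < e" for e
  proof -
    define G where "G z = f (fst z) * (cis (2 * pi * (snd z \<bullet> (x - fst z))) * E (e *\<^sub>R snd z))" for z
    have Ee: "integrable lborel (\<lambda>\<xi>. E (e *\<^sub>R \<xi>))"
    proof -
      have "integrable lborel E \<longleftrightarrow> integrable lborel (\<lambda>\<xi>. \<bar>e\<bar> ^ DIM('a) *\<^sub>R E (0 + e *\<^sub>R \<xi>))"
        using e by (subst lborel_affine[of e 0], simp, subst integrable_density) (auto simp: integrable_distr_eq)
      then have "integrable lborel (\<lambda>\<xi>. \<bar>e\<bar> ^ DIM('a) *\<^sub>R E (e *\<^sub>R \<xi>))" using E_int by simp
      then have "integrable lborel (\<lambda>\<xi>. (1 / \<bar>e\<bar> ^ DIM('a)) *\<^sub>R (\<bar>e\<bar> ^ DIM('a) *\<^sub>R E (e *\<^sub>R \<xi>)))"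
        by (rule integrable_scaleR_right)
      then show ?thesis using e by simp
    qed
    have "G \<in> borel_measurable (borel \<Otimes>\<^sub>M borel)"
      unfolding G_def by measurable
    then have [measurable]: "G \<in> borel_measurable borel" by (simp add: borel_prod)
    have "integrable lborel G"
      by (rule Bochner_Integration.integrable_bound[OF integrable_tensor[OF f Ee]])
        (auto simp: G_def norm_mult)
    note G = lborel_integral_Pair[OF this]
    have "(\<integral>\<xi>. F \<xi> * cis (2 * pi * (\<xi> \<bullet> x)) * E (e *\<^sub>R \<xi>) \<partial>lborel) = (\<integral>\<xi>. (\<integral>t. G (t, \<xi>) \<partial>lborel) \<partial>lborel)"
    proof (rule Bochner_Integration.integral_cong[OF refl])
      fix \<xi>
      have "F \<xi> * (cis (2 * pi * (\<xi> \<bullet> x)) * E (e *\<^sub>R \<xi>))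
          = (\<integral>t. f t * cis (- 2 * pi * (\<xi> \<bullet> t)) * (cis (2 * pi * (\<xi> \<bullet> x)) * E (e *\<^sub>R \<xi>)) \<partial>lborel)"
        unfolding F by simp
      also have "\<dots> = (\<integral>t. G (t, \<xi>) \<partial>lborel)"
      proof (rule Bochner_Integration.integral_cong[OF refl])
        fix t
        have "cis (2 * pi * (\<xi> \<bullet> (x - t))) = cis (- 2 * pi * (\<xi> \<bullet> t)) * cis (2 * pi * (\<xi> \<bullet> x))"
          by (simp add: cis_mult algebra_simps inner_diff_right)
        then show "f t * cis (- 2 * pi * (\<xi> \<bullet> t)) * (cis (2 * pi * (\<xi> \<bullet> x)) * E (e *\<^sub>R \<xi>)) = G (t, \<xi>)"
          by (simp add: G_def)
      qed
      finally show "F \<xi> * cis (2 * pi * (\<xi> \<bullet> x)) * E (e *\<^sub>R \<xi>) = (\<integral>t. G (t, \<xi>) \<partial>lborel)"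
        by (simp add: mult.assoc)
    qed
    also have "\<dots> = (\<integral>t. (\<integral>\<xi>. G (t, \<xi>) \<partial>lborel) \<partial>lborel)"
      using G by simp
    also have "\<dots> = (\<integral>t. f t * (E ((1 / e) *\<^sub>R (x - t)) /\<^sub>R e ^ DIM('a)) \<partial>lborel)"
      using inner[OF e] by (simp add: G_def)
    also have "\<dots> = \<bar>e\<bar> ^ DIM('a) *\<^sub>R (\<integral>s. f (x + e *\<^sub>R s) * (E ((1 / e) *\<^sub>R (x - (x + e *\<^sub>R s))) /\<^sub>R e ^ DIM('a)) \<partial>lborel)"
      using e by (subst lborel_integral_affine[of _ e x]) auto
    also have "\<dots> = (\<integral>s. f (x + e *\<^sub>R s) * E s \<partial>lborel)"
      using e by (simp add: E_def)
    finally show ?thesis .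
  qed
  have "(\<lambda>n. \<integral>s. f (x + \<epsilon> n *\<^sub>R s) * E s \<partial>lborel) \<longlonglongrightarrow> (\<integral>s. f x * E s \<partial>lborel)"
  proof (rule integral_dominated_convergence[where w = "\<lambda>s. K * cmod (E s)"])
    show "AE s in lborel. (\<lambda>n. f (x + \<epsilon> n *\<^sub>R s) * E s) \<longlonglongrightarrow> f x * E s"
    proof (rule AE_I2)
      fix s
      have "(\<lambda>n. x + \<epsilon> n *\<^sub>R s) \<longlonglongrightarrow> x + 0 *\<^sub>R s"
        by (intro tendsto_intros \<epsilon>_lim)
      then have "(\<lambda>n. f (x + \<epsilon> n *\<^sub>R s)) \<longlonglongrightarrow> f x"
        using continuous_on_tendsto_compose[OF cont, of _ x] by simp
      then show "(\<lambda>n. f (x + \<epsilon> n *\<^sub>R s) * E s) \<longlonglongrightarrow> f x * E s"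
        by (intro tendsto_intros)
    qed
  qed (use E_int bound in \<open>auto simp: norm_mult mult_right_mono\<close>)
  moreover have "(\<integral>s. f x * E s \<partial>lborel) = f x"
  proof -
    have "(\<integral>s. E s \<partial>lborel) = 1" using gaussian_fourier[of "0::'a"] by (simp add: E_def)
    then show ?thesis by simp
  qed
  ultimately show "(\<lambda>n. \<integral>\<xi>. F \<xi> * cis (2 * pi * (\<xi> \<bullet> x)) * E (\<epsilon> n *\<^sub>R \<xi>) \<partial>lborel) \<longlonglongrightarrow> f x"
    by (simp only: eq[OF \<epsilon>])
qed

lemma partial_fourier_inversion:
  fixes k :: "'a::euclidean_space \<times> 'b::euclidean_space \<Rightarrow> complex"
  assumes k: "k \<in> schwartz"
  shows "(\<integral>\<xi>. partial_fourier k (x, \<xi>) * cis (2 * pi * (\<xi> \<bullet> t)) \<partial>lborel) = k (x, t)"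
proof -
  obtain C where C: "\<And>z. \<langle>z\<rangle> ^ 0 * cmod (k z) \<le> C" using schwartz_bound[OF k] by blast
  show ?thesis
    by (rule fourier_inversion[where f = "\<lambda>t. k (x, t)" and K = C])
      (use C schwartz_section[OF k] schwartz_section[OF partial_fourier_schwartz[OF k]]
        in \<open>auto simp: partial_fourier_def intro: schwartz_integrable schwartz_continuous\<close>)
qed


subsection \<open>The short-time Fourier transform of Schwartz functions\<close>

definition tf_shift :: "'a::euclidean_space \<times> 'a \<Rightarrow> ('a \<Rightarrow> complex) \<Rightarrow> 'a \<Rightarrow> complex" where
  "tf_shift w g = modulation (snd w) (translation (fst w) g)"

lemma tf_shift_apply: "tf_shift w g t = cis (2 * pi * (t \<bullet> snd w)) * g (t - fst w)"
  by (simp add: tf_shift_def modulation_def translation_def)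

text \<open>A version for functions, with phase space as one argument. Written as a
  \<open>partial_fourier\<close> it inherits the Schwartz property; on the distributions given by
  functions it agrees with \<open>STFT\<close>.\<close>

definition stft :: "('a::euclidean_space \<Rightarrow> complex) \<Rightarrow> ('a \<Rightarrow> complex) \<Rightarrow> 'a \<times> 'a \<Rightarrow> complex" where
  "stft \<phi> f = partial_fourier (\<lambda>p. f (snd p) * cnj (\<phi> (snd p - fst p)))"

lemma stft_eq_integral: "stft \<phi> f w = (\<integral>t. f t * cnj (tf_shift w \<phi> t) \<partial>lborel)"
  unfolding stft_def partial_fourier_def tf_shift_apply
  by (intro Bochner_Integration.integral_cong) (auto simp: cis_cnj inner_commute mult_ac)

lemma STFT_distribution_of: "STFT \<phi> (distribution_of f) x \<xi> = stft \<phi> f (x, \<xi>)"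
  by (simp add: STFT_def pairing_def distribution_of_def stft_eq_integral tf_shift_def)

lemma tf_shift_schwartz:
  fixes g :: "'a::euclidean_space \<Rightarrow> complex"
  assumes "g \<in> schwartz"
  shows "tf_shift w g \<in> schwartz"
  using schwartz_modulate[OF schwartz_translate[OF assms, of "fst w"], of "2 * pi" "snd w"]
  by (simp add: tf_shift_apply[abs_def] inner_commute)

lemma schwartz_stft_kernel:
  fixes f g :: "'a::euclidean_space \<Rightarrow> complex"
  assumes "f \<in> schwartz" "g \<in> schwartz"
  shows "(\<lambda>p. f (snd p) * cnj (g (snd p - fst p))) \<in> schwartz"
proof (rule schwartz_linear_tensor[where f = f and l = snd and g = "\<lambda>x. cnj (g x)" and m = "\<lambda>p. snd p - fst p" and C = 2])
  fix y :: "'a \<times> 'a"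
  have "norm y \<le> norm (fst y) + norm (snd y)" by (metis norm_Pair_le prod.collapse)
  moreover have "norm (fst y) \<le> norm (snd y - fst y) + norm (snd y)"
    using norm_triangle_ineq[of "fst y - snd y" "snd y"] by (simp add: norm_minus_commute)
  ultimately show "norm y \<le> 2 * (norm (snd y) + norm (snd y - fst y))"
    using norm_ge_zero[of "snd y - fst y"] by argo
qed (use assms in \<open>auto simp: linear_iff algebra_simps intro: schwartz_cnj\<close>)

lemma stft_schwartz:
  fixes f g :: "'a::euclidean_space \<Rightarrow> complex"
  shows "f \<in> schwartz \<Longrightarrow> g \<in> schwartz \<Longrightarrow> stft g f \<in> schwartz"
  unfolding stft_def by (intro partial_fourier_schwartz schwartz_stft_kernel)

text \<open>A modulated translate of \<open>g\<close> does not decay in its parameter; the factor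
  \<open>A\<close> supplies that decay and makes the family Schwartz jointly in parameter and
  variable.\<close>

lemma schwartz_tf_shift_family:
  fixes A :: "'a::euclidean_space \<times> 'a \<Rightarrow> complex" and g :: "'a \<Rightarrow> complex"
  assumes A: "A \<in> schwartz" and g: "g \<in> schwartz"
  shows "(\<lambda>q. A (fst q) * tf_shift (fst q) g (snd q)) \<in> schwartz"
proof -
  have 1: "(\<lambda>q::('a \<times> 'a) \<times> 'a. A (fst q) * g (snd q - fst (fst q))) \<in> schwartz"
  proof (rule schwartz_linear_tensor[where C = 2, OF A g])
    fix y :: "('a \<times> 'a) \<times> 'a"
    have "norm y \<le> norm (fst y) + norm (snd y)" by (metis norm_Pair_le prod.collapse)
    moreover have "norm (snd y) \<le> norm (snd y - fst (fst y)) + norm (fst (fst y))"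
      using norm_triangle_ineq[of "snd y - fst (fst y)" "fst (fst y)"] by simp
    moreover have "norm (fst (fst y)) \<le> norm (fst y)" using norm_fst_le[of "fst (fst y)" "snd (fst y)"] by simp
    ultimately show "norm y \<le> 2 * (norm (fst y) + norm (snd y - fst (fst y)))"
      using norm_ge_zero[of "snd y - fst (fst y)"] by argo
  qed (auto simp: linear_iff algebra_simps)
  have "(\<lambda>q::('a \<times> 'a) \<times> 'a. cis (2 * pi * (snd q \<bullet> snd (fst q))) * (A (fst q) * g (snd q - fst (fst q)))) \<in> schwartz"
  proof (rule schwartz_character_mult[OF 1])
    \<comment> \<open>The phase is bilinear, so its derivative in a fixed direction is a sum of two
      linear functionals of \<open>q\<close>.\<close>
    show "((\<lambda>q::('a \<times> 'a) \<times> 'a. 2 * pi * (snd q \<bullet> snd (fst q))) has_derivative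
        (\<lambda>h. 2 * pi * (snd q \<bullet> snd (fst h)) + 2 * pi * (snd h \<bullet> snd (fst q)))) (at q)" for q
      by (auto intro!: derivative_eq_intros simp: algebra_simps)
    fix f :: "('a \<times> 'a) \<times> 'a \<Rightarrow> complex" and b
    assume f: "f \<in> schwartz"
    have "bounded_linear (\<lambda>q::('a \<times> 'a) \<times> 'a. snd q \<bullet> snd (fst b))" "bounded_linear (\<lambda>q::('a \<times> 'a) \<times> 'a. snd b \<bullet> snd (fst q))"
      by (auto simp: linear_conv_bounded_linear[symmetric] linear_iff inner_simps)
    then have "(\<lambda>q. 2 * pi * (of_real (snd q \<bullet> snd (fst b)) * f q) + 2 * pi * (of_real (snd b \<bullet> snd (fst q)) * f q)) \<in> schwartz"
      by (intro schwartz_add schwartz_cmult schwartz_linear_mult f)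
    then show "(\<lambda>q. of_real (2 * pi * (snd q \<bullet> snd (fst b)) + 2 * pi * (snd b \<bullet> snd (fst q))) * f q) \<in> schwartz"
      by (simp add: algebra_simps)
  qed
  then show ?thesis by (simp add: tf_shift_apply mult_ac)
qed

text \<open>The frequency integral inverts the partial Fourier transform and returns
  \<open>f t * cnj (g (t - x))\<close>; with the factor \<open>g (t - x)\<close> of the shift, the
  position integral yields the squared norm of \<open>g\<close>.\<close>

lemma stft_inversion:
  fixes f g :: "'a::euclidean_space \<Rightarrow> complex"
  assumes f: "f \<in> schwartz" and g: "g \<in> schwartz"
  shows "(\<integral>w. stft g f w * tf_shift w g t \<partial>lborel) = of_real (\<integral>s. (cmod (g s))\<^sup>2 \<partial>lborel) * f t"
proof -
  have "(\<lambda>q. stft g f (fst q) * tf_shift (fst q) g (snd q)) \<in> schwartz"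
    by (intro schwartz_tf_shift_family stft_schwartz f g)
  then have "(\<lambda>w. stft g f (fst (w, t)) * tf_shift (fst (w, t)) g (snd (w, t))) \<in> schwartz"
    using schwartz_affine_comp[where l = "\<lambda>w. (w, 0)" and C = 1 and c = "(0, t)"]
    by (fastforce simp: linear_iff norm_Pair)
  then have int: "integrable lborel (\<lambda>w. stft g f w * tf_shift w g t)"
    by (simp add: schwartz_integrable)
  have [measurable]: "g \<in> borel_measurable borel" by (rule schwartz_measurable[OF g])
  have "(\<integral>w. stft g f w * tf_shift w g t \<partial>lborel)
      = (\<integral>x. (\<integral>\<xi>. stft g f (x, \<xi>) * tf_shift (x, \<xi>) g t \<partial>lborel) \<partial>lborel)"
    by (rule lborel_integral_Pair(1)[OF int])
  also have "\<dots> = (\<integral>x. (\<integral>\<xi>. stft g f (x, \<xi>) * cis (2 * pi * (\<xi> \<bullet> t)) \<partial>lborel) * g (t - x) \<partial>lborel)"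
    by (simp add: tf_shift_apply inner_commute flip: mult.assoc)
  also have "\<dots> = (\<integral>x. f t * of_real ((cmod (g (t - x)))\<^sup>2) \<partial>lborel)"
    unfolding stft_def partial_fourier_inversion[OF schwartz_stft_kernel[OF f g]]
    by (simp add: mult.assoc complex_norm_square del: of_real_power) (simp add: mult.commute)
  also have "\<dots> = f t * of_real (\<integral>x. (cmod (g (t + (-1) *\<^sub>R x)))\<^sup>2 \<partial>lborel)"
    by (simp del: of_real_power)
  also have "(\<integral>x. (cmod (g (t + (-1) *\<^sub>R x)))\<^sup>2 \<partial>lborel) = (\<integral>s. (cmod (g s))\<^sup>2 \<partial>lborel)"
    using lborel_integral_affine[of "\<lambda>s. (cmod (g s))\<^sup>2" "-1" t] by simp
  finally show ?thesis by (simp add: mult.commute)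
qed

subsection \<open>Tempered distributions and Schwartz-valued integrals\<close>

lemma iterated_partial_sum:
  fixes f :: "'i \<Rightarrow> 'a::euclidean_space \<Rightarrow> complex"
  assumes f: "\<And>i. i \<in> I \<Longrightarrow> f i \<in> schwartz" and bs: "set bs \<subseteq> Basis"
  shows "iterated_partial bs (\<lambda>x. \<Sum>i\<in>I. c i * f i x) = (\<lambda>x. \<Sum>i\<in>I. c i * iterated_partial bs (f i) x)"
  using bs
proof (induction bs)
  case (Cons b bs)
  then have "((\<lambda>x. \<Sum>i\<in>I. c i * iterated_partial bs (f i) x) has_derivative
      (\<lambda>h. \<Sum>i\<in>I. c i * dirder h (iterated_partial bs (f i)) x)) (at x)" for x
    by (intro has_derivative_sum has_derivative_mult_right schwartz_has_derivative schwartz_iterated_partial f) auto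
  from dirder_eqI[OF this] Cons show ?case by simp
qed simp

lemma iterated_partial_diff:
  fixes f :: "'a::euclidean_space \<Rightarrow> complex"
  assumes f: "f \<in> schwartz" and g: "g \<in> schwartz" and bs: "set bs \<subseteq> Basis"
  shows "iterated_partial bs (\<lambda>x. f x - g x) = (\<lambda>x. iterated_partial bs f x - iterated_partial bs g x)"
  using bs
proof (induction bs)
  case (Cons b bs)
  then have "((\<lambda>x. iterated_partial bs f x - iterated_partial bs g x) has_derivative
      (\<lambda>h. dirder h (iterated_partial bs f) x - dirder h (iterated_partial bs g) x)) (at x)" for x
    by (intro has_derivative_diff schwartz_has_derivative schwartz_iterated_partial f g) auto
  from dirder_eqI[OF this] Cons show ?case by simp
qed simp

abbreviation inject_snd :: "'b list \<Rightarrow> ('a::zero \<times> 'b) list" where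
  "inject_snd bs \<equiv> map (\<lambda>b. (0, b)) bs"

lemma set_inject_snd: "set bs \<subseteq> Basis \<Longrightarrow> set (inject_snd bs) \<subseteq> (Basis :: ('a::euclidean_space \<times> 'b::euclidean_space) set)"
  by (auto simp: Basis_prod_def)

lemma dirder_section:
  fixes \<Gamma> :: "'p::euclidean_space \<times> 'a::euclidean_space \<Rightarrow> complex"
  assumes "\<Gamma> \<in> schwartz"
  shows "dirder b (\<lambda>x. \<Gamma> (y, x)) = (\<lambda>x. dirder (0, b) \<Gamma> (y, x))"
proof (rule dirder_eqI)
  fix x :: 'a
  have "((\<lambda>x. (y, x)) has_derivative (\<lambda>h. (0, h))) (at x)"
    by (auto intro!: derivative_eq_intros)
  then show "((\<lambda>x. \<Gamma> (y, x)) has_derivative (\<lambda>h. dirder (0, h) \<Gamma> (y, x))) (at x)"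
    by (rule has_derivative_compose) (rule schwartz_has_derivative[OF assms])
qed

lemma iterated_partial_section:
  fixes \<Gamma> :: "'p::euclidean_space \<times> 'a::euclidean_space \<Rightarrow> complex"
  assumes \<Gamma>: "\<Gamma> \<in> schwartz" and bs: "set bs \<subseteq> Basis"
  shows "iterated_partial bs (\<lambda>x. \<Gamma> (y, x)) = (\<lambda>x. iterated_partial (inject_snd bs) \<Gamma> (y, x))"
  using bs
proof (induction bs)
  case (Cons b bs)
  then have "iterated_partial (inject_snd bs) \<Gamma> \<in> schwartz"
    using set_inject_snd[of bs, where 'a = 'p] by (intro schwartz_iterated_partial \<Gamma>) auto
  from dirder_section[OF this] Cons show ?case by simp
qed simp

lemma schwartz_swap:
  fixes \<Gamma> :: "'p::euclidean_space \<times> 'a::euclidean_space \<Rightarrow> complex"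
  assumes "\<Gamma> \<in> schwartz"
  shows "(\<lambda>z. \<Gamma> (snd z, fst z)) \<in> schwartz"
  using schwartz_affine_comp[OF assms, where l = "\<lambda>z. (snd z, fst z)" and C = 1 and c = 0]
  by (simp add: linear_iff norm_prod_def add.commute)

lemma schwartz_section_fst:
  fixes \<Gamma> :: "'p::euclidean_space \<times> 'a::euclidean_space \<Rightarrow> complex"
  assumes "\<Gamma> \<in> schwartz"
  shows "(\<lambda>y. \<Gamma> (y, x)) \<in> schwartz"
  using schwartz_section[OF schwartz_swap[OF assms], of x] by simp

text \<open>The integral over the parameter is the partial Fourier transform of the swapped kernel
  at frequency 0, from which both claims are inherited.\<close>

lemma
  fixes \<Gamma> :: "'p::euclidean_space \<times> 'a::euclidean_space \<Rightarrow> complex"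
  assumes \<Gamma>: "\<Gamma> \<in> schwartz"
  shows schwartz_integral: "(\<lambda>x. \<integral>y. \<Gamma> (y, x) \<partial>lborel) \<in> schwartz"
    and dirder_integral: "dirder b (\<lambda>x. \<integral>y. \<Gamma> (y, x) \<partial>lborel) = (\<lambda>x. \<integral>y. dirder (0, b) \<Gamma> (y, x) \<partial>lborel)"
proof -
  let ?k = "\<lambda>z. \<Gamma> (snd z, fst z)"
  have k: "?k \<in> schwartz" by (rule schwartz_swap[OF \<Gamma>])
  have eq: "(\<lambda>x. \<integral>y. \<Gamma> (y, x) \<partial>lborel) = (\<lambda>x. partial_fourier ?k (x, 0))"
    by (simp add: partial_fourier_def)
  show "(\<lambda>x. \<integral>y. \<Gamma> (y, x) \<partial>lborel) \<in> schwartz"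
    unfolding eq by (rule schwartz_section_fst[OF partial_fourier_schwartz[OF k]])
  have "((\<lambda>z. (snd z, fst z)) has_derivative (\<lambda>h. (snd h, fst h))) (at z)" for z :: "'a \<times> 'p"
    by (auto intro!: derivative_eq_intros)
  then have "(?k has_derivative (\<lambda>h. dirder (snd h, fst h) \<Gamma> (snd z, fst z))) (at z)" for z
    by (rule has_derivative_compose) (rule schwartz_has_derivative[OF \<Gamma>])
  from dirder_eqI[OF this] have dk: "dirder (h, 0) ?k = (\<lambda>z. dirder (0, h) \<Gamma> (snd z, fst z))" for h
    by simp
  show "dirder b (\<lambda>x. \<integral>y. \<Gamma> (y, x) \<partial>lborel) = (\<lambda>x. \<integral>y. dirder (0, b) \<Gamma> (y, x) \<partial>lborel)"
    unfolding eq
  proof (rule trans[OF dirder_eqI])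
    fix x :: 'a
    have "((\<lambda>x. (x, 0 :: 'p)) has_derivative (\<lambda>h. (h, 0))) (at x)"
      by (auto intro!: derivative_eq_intros)
    from has_derivative_compose[OF this partial_fourier_has_derivative[OF k]]
    show "((\<lambda>x. partial_fourier ?k (x, 0)) has_derivative (\<lambda>h. partial_fourier (dirder (h, 0) ?k) (x, 0))) (at x)"
      by (rule has_derivative_eq_rhs) simp
  qed (simp add: dk partial_fourier_def)
qed

lemma iterated_partial_integral:
  fixes \<Gamma> :: "'p::euclidean_space \<times> 'a::euclidean_space \<Rightarrow> complex"
  assumes \<Gamma>: "\<Gamma> \<in> schwartz" and bs: "set bs \<subseteq> Basis"
  shows "iterated_partial bs (\<lambda>x. \<integral>y. \<Gamma> (y, x) \<partial>lborel)
    = (\<lambda>x. \<integral>y. iterated_partial (inject_snd bs) \<Gamma> (y, x) \<partial>lborel)"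
  using bs
proof (induction bs)
  case (Cons b bs)
  then have "iterated_partial (inject_snd bs) \<Gamma> \<in> schwartz"
    using set_inject_snd[of bs, where 'a = 'p] by (intro schwartz_iterated_partial \<Gamma>) auto
  from dirder_integral[OF this] Cons show ?case by simp
qed simp

text \<open>The two estimates needed to pass from Riemann sums to integrals in a weighted sup norm:
  Lipschitz dependence on the parameter controls a fine sum on a box, decay in the parameter
  controls what lies outside the box.\<close>

lemma schwartz_parameter_bounds:
  fixes H :: "'p::euclidean_space \<times> 'a::euclidean_space \<Rightarrow> complex"
  assumes H: "H \<in> schwartz" and r: "0 \<le> r"
  obtains L where "0 \<le> L" "\<And>x y z. \<langle>x\<rangle> ^ k * cmod (H (y, x) - H (z, x)) \<le> L * norm (y - z)"
    "\<And>x y. \<langle>x\<rangle> ^ k * cmod (H (y, x)) \<le> L * \<langle>y\<rangle> powr (-r)"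
proof -
  obtain C where C: "0 \<le> C" "\<And>x h. cmod (dirder h H x) \<le> C * \<langle>x\<rangle> powr (- real k) * norm h"
    using schwartz_dirder_bound[OF H] by blast
  obtain D where D: "0 \<le> D" "\<And>x. cmod (H x) \<le> D * \<langle>x\<rangle> powr (- (real k + r))"
    using schwartz_decay[OF H] by blast
  have cancel: "\<langle>x\<rangle> ^ k * \<langle>x\<rangle> powr (- real k) = 1" for x :: 'a
    using jb_pos[of x] by (simp add: powr_minus powr_realpow)
  have lip: "\<langle>x\<rangle> ^ k * cmod (H (y, x) - H (z, x)) \<le> C * norm (y - z)" for x y z
  proof -
    have "cmod (H (y, x) - H (z, x)) \<le> (C * \<langle>x\<rangle> powr (- real k)) * norm (y - z)"
    proof (rule differentiable_bound[where S = UNIV])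
      fix y :: 'p
      have "((\<lambda>y. (y, x)) has_derivative (\<lambda>h. (h, 0))) (at y)"
        by (auto intro!: derivative_eq_intros)
      then show "((\<lambda>y. H (y, x)) has_derivative (\<lambda>h. dirder (h, 0) H (y, x))) (at y within UNIV)"
        by (rule has_derivative_compose) (rule schwartz_has_derivative[OF H])
      show "onorm (\<lambda>h. dirder (h, 0) H (y, x)) \<le> C * \<langle>x\<rangle> powr (- real k)"
      proof (rule onorm_le)
        fix h
        show "cmod (dirder (h, 0) H (y, x)) \<le> C * \<langle>x\<rangle> powr (- real k) * norm h"
          by (rule order_trans[OF C(2)])
            (use C(1) in \<open>auto simp: norm_Pair intro!: mult_right_mono mult_left_mono jb_powr_snd_le\<close>)
      qed
    qed auto
    then have "\<langle>x\<rangle> ^ k * cmod (H (y, x) - H (z, x)) \<le> \<langle>x\<rangle> ^ k * ((C * \<langle>x\<rangle> powr (- real k)) * norm (y - z))"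
      by (intro mult_left_mono) (auto simp: jb_nonneg)
    also have "\<dots> = C * norm (y - z) * (\<langle>x\<rangle> ^ k * \<langle>x\<rangle> powr (- real k))" by (simp only: mult_ac)
    finally show ?thesis by (simp add: cancel)
  qed
  have dec: "\<langle>x\<rangle> ^ k * cmod (H (y, x)) \<le> D * \<langle>y\<rangle> powr (-r)" for x y
  proof -
    have "\<langle>(y, x)\<rangle> powr (- (real k + r)) = \<langle>(y, x)\<rangle> powr (- real k) * \<langle>(y, x)\<rangle> powr (- r)"
      by (simp add: powr_add[symmetric])
    also have "\<dots> \<le> \<langle>x\<rangle> powr (- real k) * \<langle>y\<rangle> powr (- r)"
      using jb_fst_le[of "(y, x)"] r by (intro mult_mono jb_powr_snd_le powr_mono2') (auto simp: jb_pos)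
    finally have "cmod (H (y, x)) \<le> D * (\<langle>x\<rangle> powr (- real k) * \<langle>y\<rangle> powr (- r))"
      by (rule order_trans[OF D(2) mult_left_mono[OF _ D(1)]])
    then have "\<langle>x\<rangle> ^ k * cmod (H (y, x)) \<le> \<langle>x\<rangle> ^ k * (D * (\<langle>x\<rangle> powr (- real k) * \<langle>y\<rangle> powr (- r)))"
      by (intro mult_left_mono) (auto simp: jb_nonneg)
    also have "\<dots> = D * \<langle>y\<rangle> powr (- r) * (\<langle>x\<rangle> ^ k * \<langle>x\<rangle> powr (- real k))" by (simp only: mult_ac)
    finally show ?thesis by (simp add: cancel)
  qed
  show ?thesis
  proof (rule that[of "C + D"])
    show "\<langle>x\<rangle> ^ k * cmod (H (y, x) - H (z, x)) \<le> (C + D) * norm (y - z)" for x y z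
      by (rule order_trans[OF lip]) (use D(1) in \<open>auto intro: mult_right_mono\<close>)
    show "\<langle>x\<rangle> ^ k * cmod (H (y, x)) \<le> (C + D) * \<langle>y\<rangle> powr (-r)" for x y
      by (rule order_trans[OF dec]) (use C(1) in \<open>auto intro: mult_right_mono\<close>)
  qed (use C D in auto)
qed

section \<open>Tempered distributions: linearity, a usable form of continuity, and exchange with
  integrals\<close>

lemma tempered_add: "u \<in> tempered_distributions \<Longrightarrow> f \<in> schwartz \<Longrightarrow> g \<in> schwartz \<Longrightarrow> u (\<lambda>x. f x + g x) = u f + u g"
  by (simp add: tempered_distributions_def)

lemma tempered_cmult: "u \<in> tempered_distributions \<Longrightarrow> f \<in> schwartz \<Longrightarrow> u (\<lambda>x. c * f x) = c * u f"
  by (simp add: tempered_distributions_def)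

lemma tempered_zero: "u \<in> tempered_distributions \<Longrightarrow> u (\<lambda>x. 0) = 0"
  using tempered_cmult[OF _ schwartz_zero, of u 0] by simp

lemma tempered_diff:
  "u \<in> tempered_distributions \<Longrightarrow> f \<in> schwartz \<Longrightarrow> g \<in> schwartz \<Longrightarrow> u (\<lambda>x. f x - g x) = u f - u g"
  using tempered_add[of u f "\<lambda>x. -1 * g x"] tempered_cmult[of u g "-1"] schwartz_cmult[of g "-1"] by simp

lemma tempered_sum:
  assumes "u \<in> tempered_distributions" "\<And>i. i \<in> I \<Longrightarrow> f i \<in> schwartz"
  shows "u (\<lambda>x. \<Sum>i\<in>I. c i * f i x) = (\<Sum>i\<in>I. c i * u (f i))"
  using assms(2)
proof (induction I rule: infinite_finite_induct)
  case (insert i I)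
  have "u (\<lambda>x. c i * f i x + (\<Sum>i\<in>I. c i * f i x)) = u (\<lambda>x. c i * f i x) + u (\<lambda>x. \<Sum>i\<in>I. c i * f i x)"
    using insert.prems by (intro tempered_add assms(1) schwartz_cmult schwartz_sum) auto
  with insert show ?case by (simp add: tempered_cmult[OF assms(1)])
qed (simp_all add: tempered_zero[OF assms(1)])

lemma finite_multiindices: "finite {bs. set bs \<subseteq> (Basis :: 'a::euclidean_space set) \<and> length bs \<le> k}"
  by (rule finite_lists_length_le) simp

text \<open>Continuity in applicable form: one bound \<open>M\<close> for finitely many weighted
  derivatives. The absolute value of \<open>C\<close> is taken because the definition does not fix
  its sign.\<close>

lemma tempered_bound:
  fixes u :: "('a::euclidean_space \<Rightarrow> complex) \<Rightarrow> complex"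
  assumes "u \<in> tempered_distributions"
  obtains K k where "0 \<le> K"
    "\<And>f M. f \<in> schwartz \<Longrightarrow> (\<And>bs x. set bs \<subseteq> Basis \<Longrightarrow> length bs \<le> k \<Longrightarrow> \<langle>x\<rangle> ^ k * cmod (iterated_partial bs f x) \<le> M)
      \<Longrightarrow> cmod (u f) \<le> K * M"
proof -
  obtain C k where C: "\<And>f. f \<in> schwartz \<Longrightarrow> cmod (u f) \<le> C * (\<Sum>bs\<in>{bs. set bs \<subseteq> Basis \<and> length bs \<le> k}. schwartz_seminorm k bs f)"
    using assms unfolding tempered_distributions_def by blast
  let ?B = "{bs. set bs \<subseteq> (Basis :: 'a set) \<and> length bs \<le> k}"
  have "cmod (u f) \<le> (\<bar>C\<bar> * real (card ?B)) * M"
    if f: "f \<in> schwartz" and M: "\<And>bs x. set bs \<subseteq> Basis \<Longrightarrow> length bs \<le> k \<Longrightarrow> \<langle>x\<rangle> ^ k * cmod (iterated_partial bs f x) \<le> M" for f M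
  proof -
    have bdd: "bdd_above (range (\<lambda>x. \<langle>x\<rangle> ^ k * cmod (iterated_partial bs f x)))" if "bs \<in> ?B" for bs
      by (rule bdd_aboveI2[where M = M]) (use M that in auto)
    have 0: "0 \<le> schwartz_seminorm k bs f" if "bs \<in> ?B" for bs
      unfolding schwartz_seminorm_def by (rule cSUP_upper2[OF bdd[OF that], of 0]) (auto simp: jb_nonneg)
    have le: "schwartz_seminorm k bs f \<le> M" if "bs \<in> ?B" for bs
      unfolding schwartz_seminorm_def by (rule cSUP_least) (use M that in auto)
    have "cmod (u f) \<le> C * (\<Sum>bs\<in>?B. schwartz_seminorm k bs f)" by (rule C[OF f])
    also have "\<dots> \<le> \<bar>C\<bar> * (\<Sum>bs\<in>?B. schwartz_seminorm k bs f)"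
      by (intro mult_right_mono sum_nonneg 0) auto
    also have "\<dots> \<le> \<bar>C\<bar> * (\<Sum>bs\<in>?B. M)"
      by (intro mult_left_mono sum_mono le) auto
    finally show ?thesis by simp
  qed
  then show ?thesis by (intro that[of "\<bar>C\<bar> * real (card ?B)" k]) auto
qed

text \<open>Each point of a tile is within \<eta> of the tag, so the error on the tile is at most
  \<open>L * \<eta>\<close> times its volume, and the volumes add up.\<close>

lemma riemann_sum_error:
  fixes f :: "'p::euclidean_space \<Rightarrow> complex"
  assumes p: "p tagged_division_of cbox a b" and fine: "(\<lambda>y. ball y \<eta>) fine p"
    and lip: "\<And>y z. cmod (f y - f z) \<le> L * norm (y - z)" and L: "0 \<le> L"
    and f: "f integrable_on cbox a b" and \<eta>: "0 \<le> \<eta>"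
  shows "cmod ((\<Sum>(y, Q)\<in>p. of_real (measure lborel Q) * f y) - integral (cbox a b) f) \<le> L * \<eta> * measure lborel (cbox a b)"
proof -
  have each: "cmod (of_real (measure lborel Q) * f y - integral Q f) \<le> L * \<eta> * measure lborel Q" if yQ: "(y, Q) \<in> p" for y Q
  proof -
    obtain c d where Q: "Q = cbox c d" using tagged_division_ofD(4)[OF p yQ] by blast
    have sub: "Q \<subseteq> cbox a b" "Q \<subseteq> ball y \<eta>"
      using tagged_division_ofD(3)[OF p yQ] fineD[OF fine yQ] by auto
    have "((\<lambda>z. f y - f z) has_integral (measure lborel (cbox c d) *\<^sub>R f y - integral (cbox c d) f)) (cbox c d)"
      using integrable_on_subcbox[OF f] sub(1) Q
      by (intro has_integral_diff has_integral_const integrable_integral) auto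
    then have "cmod (measure lborel (cbox c d) *\<^sub>R f y - integral (cbox c d) f) \<le> L * \<eta> * measure lborel (cbox c d)"
    proof (rule has_integral_bound[rotated])
      fix z assume "z \<in> cbox c d"
      then have "norm (y - z) \<le> \<eta>" using sub(2) Q by (auto simp: dist_norm)
      then show "cmod (f y - f z) \<le> L * \<eta>"
        using lip[of y z] L mult_left_mono[of "norm (y - z)" \<eta> L] by linarith
    qed (use L \<eta> in auto)
    then show ?thesis by (simp add: Q scaleR_conv_of_real)
  qed
  have "cmod ((\<Sum>(y, Q)\<in>p. of_real (measure lborel Q) * f y) - integral (cbox a b) f)
      = cmod (\<Sum>(y, Q)\<in>p. of_real (measure lborel Q) * f y - integral Q f)"
    by (simp add: integral_combine_tagged_division_topdown[OF f p] sum_subtractf case_prod_beta)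
  also have "\<dots> \<le> (\<Sum>(y, Q)\<in>p. L * \<eta> * measure lborel Q)"
    by (rule order_trans[OF norm_sum sum_mono]) (use each in auto)
  also have "\<dots> = L * \<eta> * (\<Sum>(y, Q)\<in>p. measure lborel Q)"
    by (simp add: sum_distrib_left case_prod_beta)
  also have "\<dots> = L * \<eta> * measure lborel (cbox a b)"
    by (simp only: additive_content_tagged_division[OF p])
  finally show ?thesis .
qed

text \<open>
  Riemann sums of a Schwartz family converge in every Schwartz seminorm, hence a tempered
  distribution commutes with the integral.
\<close>

lemma
  fixes \<Gamma> :: "'p::euclidean_space \<times> 'a::euclidean_space \<Rightarrow> complex"
  assumes u: "u \<in> tempered_distributions" and \<Gamma>: "\<Gamma> \<in> schwartz"
  shows tempered_family_continuous: "continuous_on UNIV (\<lambda>y. u (\<lambda>x. \<Gamma> (y, x)))"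
    and tempered_family_integrable: "integrable lborel (\<lambda>y. u (\<lambda>x. \<Gamma> (y, x)))"
    and tempered_family_integral: "u (\<lambda>x. \<integral>y. \<Gamma> (y, x) \<partial>lborel) = (\<integral>y. u (\<lambda>x. \<Gamma> (y, x)) \<partial>lborel)"
proof -
  define r where "r = real DIM('p) + 1"
  obtain K k where K: "0 \<le> K"
    "\<And>f M. f \<in> schwartz \<Longrightarrow> (\<And>bs x. set bs \<subseteq> Basis \<Longrightarrow> length bs \<le> k \<Longrightarrow> \<langle>x\<rangle> ^ k * cmod (iterated_partial bs f x) \<le> M)
      \<Longrightarrow> cmod (u f) \<le> K * M"
    using tempered_bound[OF u] by blast
  define H where "H bs = iterated_partial (inject_snd bs) \<Gamma>" for bs
  define B where "B = {bs. set bs \<subseteq> (Basis :: 'a set) \<and> length bs \<le> k}"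
  have H: "H bs \<in> schwartz" if "bs \<in> B" for bs
    unfolding H_def using that set_inject_snd[of bs, where 'a = 'p]
    by (intro schwartz_iterated_partial \<Gamma>) (auto simp: B_def)
  have r0: "0 \<le> r" by (simp add: r_def)
  have "\<forall>bs\<in>B. \<exists>L. 0 \<le> L \<and> (\<forall>x y z. \<langle>x\<rangle> ^ k * cmod (H bs (y, x) - H bs (z, x)) \<le> L * norm (y - z))
      \<and> (\<forall>x y. \<langle>x\<rangle> ^ k * cmod (H bs (y, x)) \<le> L * \<langle>y\<rangle> powr (-r))"
  proof
    fix bs assume bs: "bs \<in> B"
    show "\<exists>L. 0 \<le> L \<and> (\<forall>x y z. \<langle>x\<rangle> ^ k * cmod (H bs (y, x) - H bs (z, x)) \<le> L * norm (y - z))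
      \<and> (\<forall>x y. \<langle>x\<rangle> ^ k * cmod (H bs (y, x)) \<le> L * \<langle>y\<rangle> powr (-r))"
      by (rule schwartz_parameter_bounds[OF H[OF bs] r0, where k = k]) blast
  qed
  from bchoice[OF this] obtain l where *: "\<forall>bs\<in>B. 0 \<le> l bs \<and>
      (\<forall>x y z. \<langle>x\<rangle> ^ k * cmod (H bs (y, x) - H bs (z, x)) \<le> l bs * norm (y - z))
      \<and> (\<forall>x y. \<langle>x\<rangle> ^ k * cmod (H bs (y, x)) \<le> l bs * \<langle>y\<rangle> powr (-r))"
    by blast
  have l: "\<And>bs. bs \<in> B \<Longrightarrow> 0 \<le> l bs"
    "\<And>bs x y z. bs \<in> B \<Longrightarrow> \<langle>x\<rangle> ^ k * cmod (H bs (y, x) - H bs (z, x)) \<le> l bs * norm (y - z)"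
    "\<And>bs x y. bs \<in> B \<Longrightarrow> \<langle>x\<rangle> ^ k * cmod (H bs (y, x)) \<le> l bs * \<langle>y\<rangle> powr (-r)"
    using * by blast+
  define L where "L = (\<Sum>bs\<in>B. l bs)"
  have L0: "0 \<le> L" unfolding L_def by (intro sum_nonneg l)
  have lL: "l bs \<le> L" if "bs \<in> B" for bs
    unfolding L_def using that l(1) finite_multiindices[of k, where 'a = 'a]
    by (intro member_le_sum) (auto simp: B_def)
  have lip: "\<langle>x\<rangle> ^ k * cmod (H bs (y, x) - H bs (z, x)) \<le> L * norm (y - z)" if "bs \<in> B" for bs x y z
    by (rule order_trans[OF l(2)[OF that] mult_right_mono[OF lL[OF that] norm_ge_zero]])
  have dec: "\<langle>x\<rangle> ^ k * cmod (H bs (y, x)) \<le> L * \<langle>y\<rangle> powr (-r)" if "bs \<in> B" for bs x y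
    by (rule order_trans[OF l(3)[OF that] mult_right_mono[OF lL[OF that] powr_ge_zero]])
  define U where "U y = u (\<lambda>x. \<Gamma> (y, x))" for y
  have sec: "(\<lambda>x. \<Gamma> (y, x)) \<in> schwartz" for y by (rule schwartz_section[OF \<Gamma>])
  have U_lip: "cmod (U y - U z) \<le> K * (L * norm (y - z))" for y z
  proof -
    have "cmod (u (\<lambda>x. \<Gamma> (y, x) - \<Gamma> (z, x))) \<le> K * (L * norm (y - z))"
    proof (rule K(2)[OF schwartz_diff[OF sec sec]])
      fix bs :: "'a list" and x assume bs: "set bs \<subseteq> Basis" "length bs \<le> k"
      then show "\<langle>x\<rangle> ^ k * cmod (iterated_partial bs (\<lambda>x. \<Gamma> (y, x) - \<Gamma> (z, x)) x) \<le> L * norm (y - z)"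
        using lip[of bs x y z]
        by (simp add: B_def H_def iterated_partial_diff[OF sec sec] iterated_partial_section[OF \<Gamma>])
    qed
    then show ?thesis by (simp add: U_def tempered_diff[OF u sec sec])
  qed
  have U_dec: "cmod (U y) \<le> K * (L * \<langle>y\<rangle> powr (-r))" for y
    unfolding U_def
  proof (rule K(2)[OF sec])
    fix bs :: "'a list" and x assume bs: "set bs \<subseteq> Basis" "length bs \<le> k"
    then show "\<langle>x\<rangle> ^ k * cmod (iterated_partial bs (\<lambda>x. \<Gamma> (y, x)) x) \<le> L * \<langle>y\<rangle> powr (-r)"
      using dec[of bs x y] by (simp add: B_def H_def iterated_partial_section[OF \<Gamma>])
  qed
  have "(K * L)-lipschitz_on UNIV U"
    using U_lip K(1) L0 by (auto simp: lipschitz_on_def dist_norm mult.assoc)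
  then have U_cont: "continuous_on S U" for S
    using lipschitz_on_continuous_on continuous_on_subset by blast
  then show "continuous_on UNIV (\<lambda>y. u (\<lambda>x. \<Gamma> (y, x)))" by (simp add: U_def[abs_def])
  have U_int: "integrable lborel U"
  proof (rule Bochner_Integration.integrable_bound)
    show "integrable lborel (\<lambda>y::'p. (K * L) * \<langle>y\<rangle> powr (-r))"
      using integrable_jb[of r, where 'a = 'p] by (simp add: r_def)
    show "U \<in> borel_measurable lborel"
      using borel_measurable_continuous_onI[OF U_cont] by simp
  qed (use U_dec K(1) L0 in \<open>auto simp: abs_mult mult.assoc\<close>)
  then show "integrable lborel (\<lambda>y. u (\<lambda>x. \<Gamma> (y, x)))" by (simp add: U_def[abs_def])
  define I where "I x = (\<integral>y. \<Gamma> (y, x) \<partial>lborel)" for x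
  have I: "I \<in> schwartz" unfolding I_def by (rule schwartz_integral[OF \<Gamma>])
  define h where "h y = L * \<langle>y\<rangle> powr (-r)" for y :: 'p
  have h: "integrable lborel h" "\<And>y. 0 \<le> h y"
    using integrable_jb[of r, where 'a = 'p] L0 by (auto simp: h_def[abs_def] r_def)
  \<comment> \<open>Gauge integrals are used because their sums over tagged divisions are values of
    \<open>u\<close> at Schwartz functions. Uniqueness then identifies \<open>u I\<close> with the
    Lebesgue integral of \<open>U\<close>.\<close>
  have "(U has_integral (u I)) UNIV"
    unfolding has_integral_alt'
  proof (intro conjI allI impI)
    show U_box: "(\<lambda>y. if y \<in> UNIV then U y else 0) integrable_on cbox a b" for a b
      using integrable_continuous[OF U_cont] by simp
    fix e :: real assume e: "0 < e"
    define e' where "e' = e / (2 * (K + 1))"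
    have e': "0 < e'" "K * e' \<le> e / 2" using e K(1) by (auto simp: e'_def field_simps)
    have "(h has_integral (\<integral>y. h y \<partial>lborel)) UNIV" by (rule has_integral_integral_lborel[OF h(1)])
    then obtain R where R: "0 < R" "\<And>a b. ball 0 R \<subseteq> cbox a b \<Longrightarrow> norm (integral (cbox a b) h - (\<integral>y. h y \<partial>lborel)) < e'"
      unfolding has_integral_alt' using e'(1) by auto
    have "norm (integral (cbox a b) U - u I) < e" if ab: "ball 0 R \<subseteq> cbox a b" for a b
    proof -
      define V where "V = measure lborel (cbox a b)"
      have V: "0 \<le> V" by (simp add: V_def)
      \<comment> \<open>The mesh is chosen after the box, since the discretisation error grows with
        the volume \<open>V\<close>; the summand 1 keeps the denominator positive.\<close>
      define \<eta> where "\<eta> = e / (4 * (K * L * V + 1))"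
      have "0 \<le> K * L * V" using K(1) L0 V by simp
      then have \<eta>: "0 < \<eta>" "K * (L * \<eta> * V) < e / 4"
        using e by (auto simp: \<eta>_def field_simps add_pos_nonneg)
      have "(U has_integral integral (cbox a b) U) (cbox a b)"
        using U_box[of a b] by (simp add: integrable_integral)
      then obtain \<gamma> where \<gamma>: "gauge \<gamma>" "\<And>p. p tagged_division_of cbox a b \<Longrightarrow> \<gamma> fine p \<Longrightarrow>
          norm ((\<Sum>(y, Q)\<in>p. measure lborel Q *\<^sub>R U y) - integral (cbox a b) U) < e / 4"
        unfolding has_integral using e by (metis zero_less_divide_iff zero_less_numeral)
      have "gauge (\<lambda>y. \<gamma> y \<inter> ball y \<eta>)" using \<gamma>(1) \<eta>(1) by (intro gauge_Int gauge_ball)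
      then obtain p where p: "p tagged_division_of cbox a b" "(\<lambda>y. \<gamma> y \<inter> ball y \<eta>) fine p"
        using fine_division_exists by blast
      then have fine: "\<gamma> fine p" "(\<lambda>y. ball y \<eta>) fine p" by (auto simp: fine_Int)
      define S where "S x = (\<Sum>i\<in>p. of_real (measure lborel (snd i)) * \<Gamma> (fst i, x))" for x
      have S: "S \<in> schwartz" unfolding S_def by (intro schwartz_sum schwartz_cmult sec)
      have uS: "u S = (\<Sum>(y, Q)\<in>p. measure lborel Q *\<^sub>R U y)"
        unfolding S_def by (subst tempered_sum[OF u sec]) (simp add: U_def case_prod_beta scaleR_conv_of_real)
      \<comment> \<open>The first term is the discretisation error on the box, \<open>e'\<close> is
        the tail outside it; both bounds hold for all weighted derivatives at once.\<close>
      have "cmod (u (\<lambda>x. S x - I x)) \<le> K * (L * \<eta> * V + e')"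
      proof (rule K(2)[OF schwartz_diff[OF S I]])
        fix bs :: "'a list" and x assume "set bs \<subseteq> Basis" "length bs \<le> k"
        then have bs: "bs \<in> B" "set bs \<subseteq> Basis" by (auto simp: B_def)
        define g where "g y = of_real (\<langle>x\<rangle> ^ k) * H bs (y, x)" for y
        have g_schwartz: "g \<in> schwartz"
          unfolding g_def by (intro schwartz_cmult schwartz_section_fst H bs)
        have g_lip: "cmod (g y - g z) \<le> L * norm (y - z)" for y z
          using lip[OF bs(1), of x y z] by (simp add: g_def norm_mult norm_power jb_nonneg flip: right_diff_distrib)
        have g_le: "cmod (g y) \<le> h y" for y
          using dec[OF bs(1), of x y] by (simp add: g_def h_def norm_mult norm_power jb_nonneg)
        have g_int: "integrable lborel g" by (rule schwartz_integrable[OF g_schwartz])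
        have set_g: "set_integrable lborel (cbox a b) g" and set_h: "set_integrable lborel (cbox a b) h"
          unfolding set_integrable_def
          by (rule integrable_mult_indicator[OF _ g_int], simp) (rule integrable_mult_indicator[OF _ h(1)], simp)
        have ind_g: "integrable lborel (\<lambda>y. indicat_real (cbox a b) y *\<^sub>R g y)"
          and ind_h: "integrable lborel (\<lambda>y. indicat_real (cbox a b) y *\<^sub>R h y)"
          using set_g set_h unfolding set_integrable_def by blast+
        have g_box: "g integrable_on cbox a b"
          by (rule set_borel_integral_eq_integral[OF set_g])
        have tail: "cmod (integral (cbox a b) g - (\<integral>y. g y \<partial>lborel)) \<le> e'"
        proof -
          have "integral (cbox a b) g - (\<integral>y. g y \<partial>lborel) = (\<integral>y. indicat_real (cbox a b) y *\<^sub>R g y - g y \<partial>lborel)"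
            using set_borel_integral_eq_integral(2)[OF set_g] g_int ind_g
            by (simp add: set_lebesgue_integral_def)
          also have "cmod \<dots> \<le> (\<integral>y. h y - indicat_real (cbox a b) y *\<^sub>R h y \<partial>lborel)"
          proof (rule order_trans[OF integral_norm_bound integral_mono])
            show "cmod (indicat_real (cbox a b) y *\<^sub>R g y - g y) \<le> h y - indicat_real (cbox a b) y *\<^sub>R h y" for y
              using g_le[of y] by (auto simp: indicator_def)
          qed (use g_int h(1) ind_g ind_h in auto)
          also have "\<dots> = (\<integral>y. h y \<partial>lborel) - integral (cbox a b) h"
            using set_borel_integral_eq_integral(2)[OF set_h] h(1) ind_h
            by (simp add: set_lebesgue_integral_def)
          also have "\<dots> \<le> e'" using R(2)[OF ab] by simp
          finally show ?thesis .
        qed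
        have "iterated_partial bs (\<lambda>x. S x - I x) x = (\<Sum>(y, Q)\<in>p. of_real (measure lborel Q) * H bs (y, x)) - (\<integral>y. H bs (y, x) \<partial>lborel)"
        proof -
          have "iterated_partial bs S x = (\<Sum>(y, Q)\<in>p. of_real (measure lborel Q) * H bs (y, x))"
            unfolding S_def iterated_partial_sum[of p "\<lambda>i x. \<Gamma> (fst i, x)", OF sec bs(2)]
              iterated_partial_section[OF \<Gamma> bs(2)] H_def by (simp add: case_prod_beta)
          moreover have "iterated_partial bs I x = (\<integral>y. H bs (y, x) \<partial>lborel)"
            unfolding I_def iterated_partial_integral[OF \<Gamma> bs(2)] H_def ..
          ultimately show ?thesis by (simp add: iterated_partial_diff[OF S I bs(2)])
        qed
        then have "of_real (\<langle>x\<rangle> ^ k) * iterated_partial bs (\<lambda>x. S x - I x) x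
            = (\<Sum>(y, Q)\<in>p. of_real (measure lborel Q) * g y) - (\<integral>y. g y \<partial>lborel)"
          by (simp add: g_def right_diff_distrib sum_distrib_left case_prod_beta mult_ac)
        also have "\<dots> = ((\<Sum>(y, Q)\<in>p. of_real (measure lborel Q) * g y) - integral (cbox a b) g)
            + (integral (cbox a b) g - (\<integral>y. g y \<partial>lborel))" by simp
        also have "cmod \<dots> \<le> L * \<eta> * V + e'"
          unfolding V_def using \<eta>(1)
          by (intro norm_triangle_mono tail riemann_sum_error[OF p(1) fine(2) g_lip L0 g_box]) simp
        finally show "\<langle>x\<rangle> ^ k * cmod (iterated_partial bs (\<lambda>x. S x - I x) x) \<le> L * \<eta> * V + e'"
          by (simp add: norm_mult norm_power jb_nonneg)
      qed
      then have "cmod (u S - u I) < 3 * e / 4"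
        using \<eta>(2) e'(2) by (simp add: tempered_diff[OF u S I] distrib_left)
      moreover have "cmod (u S - integral (cbox a b) U) < e / 4"
        unfolding uS by (rule \<gamma>(2)[OF p(1) fine(1)])
      ultimately show ?thesis
        using norm_triangle_ineq[of "integral (cbox a b) U - u S" "u S - u I"] by (simp add: norm_minus_commute)
    qed
    with R(1) show "\<exists>R>0. \<forall>a b. ball 0 R \<subseteq> cbox a b \<longrightarrow>
        norm (integral (cbox a b) (\<lambda>y. if y \<in> UNIV then U y else 0) - u I) < e" by auto
  qed
  with has_integral_integral_lborel[OF U_int] have "u I = (\<integral>y. U y \<partial>lborel)"
    by (rule has_integral_unique[rotated])
  then show "u (\<lambda>x. \<integral>y. \<Gamma> (y, x) \<partial>lborel) = (\<integral>y. u (\<lambda>x. \<Gamma> (y, x)) \<partial>lborel)"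
    by (simp add: I_def[abs_def] U_def[abs_def])
qed

text \<open>Apply \<open>u\<close> to the inversion formula for \<open>f\<close>: a tempered
  distribution is recovered from its values on the time-frequency shifts of one nonzero
  window.\<close>

lemma
  fixes f g :: "'a::euclidean_space \<Rightarrow> complex"
  assumes u: "u \<in> tempered_distributions" and f: "f \<in> schwartz" and g: "g \<in> schwartz"
  shows tempered_stft_integrable: "integrable lborel (\<lambda>w. stft g f w * u (tf_shift w g))"
    and tempered_stft_inversion: "(\<integral>w. stft g f w * u (tf_shift w g) \<partial>lborel) = of_real (\<integral>s. (cmod (g s))\<^sup>2 \<partial>lborel) * u f"
proof -
  have \<Gamma>: "(\<lambda>q. stft g f (fst q) * tf_shift (fst q) g (snd q)) \<in> schwartz"
    by (intro schwartz_tf_shift_family stft_schwartz f g)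
  have eq: "u (\<lambda>x. stft g f w * tf_shift w g x) = stft g f w * u (tf_shift w g)" for w
    by (intro tempered_cmult u tf_shift_schwartz g)
  show "integrable lborel (\<lambda>w. stft g f w * u (tf_shift w g))"
    using tempered_family_integrable[OF u \<Gamma>] by (simp add: eq)
  show "(\<integral>w. stft g f w * u (tf_shift w g) \<partial>lborel) = of_real (\<integral>s. (cmod (g s))\<^sup>2 \<partial>lborel) * u f"
    using tempered_family_integral[OF u \<Gamma>] by (simp add: eq stft_inversion[OF f g] tempered_cmult[OF u f])
qed

text \<open>The shifts of \<open>g\<close> are no Schwartz family in \<open>w\<close>, so the result
  for families is applied after multiplication by a function \<open>A\<close> that does not vanish
  at \<open>v\<close>, and \<open>A\<close> is divided out afterwards.\<close>

lemma tempered_tf_shift_continuous: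
  fixes g :: "'a::euclidean_space \<Rightarrow> complex"
  assumes u: "u \<in> tempered_distributions" and g: "g \<in> schwartz"
  shows "continuous_on UNIV (\<lambda>w. u (tf_shift w g))"
proof (cases "g = (\<lambda>_. 0)")
  case True
  then show ?thesis by (simp add: tf_shift_apply[abs_def] tempered_zero[OF u])
next
  case False
  then obtain t where t: "g t \<noteq> 0" by auto
  have "isCont (\<lambda>w. u (tf_shift w g)) v" for v
  proof -
    \<comment> \<open>Built from \<open>g\<close> itself so that \<open>A v = g t * g t\<close>,
      with \<open>g t\<close> nonzero.\<close>
    define A where "A w = g (fst w - (fst v - t)) * g (snd w - (snd v - t))" for w
    have A: "A \<in> schwartz"
      unfolding A_def
      by (rule schwartz_linear_tensor[where l = fst and m = snd and C = 1])
        (auto simp: linear_fst linear_snd intro!: schwartz_translate g, metis norm_Pair_le prod.collapse)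
    have "continuous_on UNIV (\<lambda>w. u (\<lambda>x. A w * tf_shift w g x))"
      using tempered_family_continuous[OF u schwartz_tf_shift_family[OF A g]] by simp
    then have "isCont (\<lambda>w. A w * u (tf_shift w g)) v"
      unfolding tempered_cmult[OF u tf_shift_schwartz[OF g]] continuous_on_eq_continuous_at[OF open_UNIV] by blast
    moreover have Av: "isCont A v" "A v \<noteq> 0"
      using schwartz_continuous[OF A, of UNIV] unfolding continuous_on_eq_continuous_at[OF open_UNIV]
      by (blast, simp add: A_def t)
    ultimately have "isCont (\<lambda>w. (A w * u (tf_shift w g)) / A w) v"
      by (rule isCont_divide)
    moreover have "\<forall>\<^sub>F w in nhds v. A w \<noteq> 0"
      using eventually_nhds_in_open[OF open_Collect_neq[OF schwartz_continuous[OF A] continuous_on_const]] Av(2)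
      by (auto elim: eventually_mono)
    then have "\<forall>\<^sub>F w in nhds v. (A w * u (tf_shift w g)) / A w = u (tf_shift w g)"
      by eventually_elim simp
    ultimately show ?thesis by (rule isCont_cong[THEN iffD1, rotated])
  qed
  then show ?thesis by (simp add: continuous_at_imp_continuous_on)
qed

subsection \<open>The Wigner distribution and the Gabor matrix of a pseudodifferential operator\<close>

lemma borel_measurable_cis [measurable]:
  "f \<in> borel_measurable M \<Longrightarrow> (\<lambda>x. cis (f x)) \<in> borel_measurable M"
  unfolding cis_conv_exp by measurable

lemma borel_measurable_cnj [measurable]:
  "f \<in> borel_measurable M \<Longrightarrow> (\<lambda>x. cnj (f x)) \<in> borel_measurable M"
  by (rule measurable_compose[OF _ borel_measurable_continuous_onI[OF continuous_on_cnj[OF continuous_on_id]]])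

lemma norm_le_fst_snd: "norm p \<le> norm (fst p) + norm (snd p)"
  by (metis norm_Pair_le prod.collapse)

text \<open>Inverts the substitution in the Wigner kernel: with \<open>a\<close>, \<open>b\<close>
  the two arguments, the second component is \<open>a - b\<close> and the first is
  \<open>(1 - \<tau>) *\<^sub>R a + \<tau> *\<^sub>R b\<close>. It is the injectivity bound for
  \<open>schwartz_linear_tensor\<close>.\<close>

lemma wigner_coordinates:
  fixes p :: "'a::real_normed_vector \<times> 'a"
  shows "norm p \<le> (2 + \<bar>\<tau>\<bar>) * (norm (fst p + \<tau> *\<^sub>R snd p) + norm (fst p - (1 - \<tau>) *\<^sub>R snd p))"
proof -
  define a b where "a = fst p + \<tau> *\<^sub>R snd p" and "b = fst p - (1 - \<tau>) *\<^sub>R snd p"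
  have "snd p = a - b" "fst p = (1 - \<tau>) *\<^sub>R a + \<tau> *\<^sub>R b"
    by (simp_all add: a_def b_def algebra_simps)
  then have "norm (snd p) \<le> norm a + norm b" "norm (fst p) \<le> \<bar>1 - \<tau>\<bar> * norm a + \<bar>\<tau>\<bar> * norm b"
    using norm_triangle_ineq4[of a b] norm_triangle_ineq[of "(1 - \<tau>) *\<^sub>R a" "\<tau> *\<^sub>R b"] by simp_all
  moreover have "\<bar>1 - \<tau>\<bar> * norm a \<le> (1 + \<bar>\<tau>\<bar>) * norm a" "\<bar>\<tau>\<bar> * norm b \<le> (1 + \<bar>\<tau>\<bar>) * norm b"
    by (auto intro!: mult_right_mono)
  ultimately have "norm (fst p) + norm (snd p) \<le> ((1 + \<bar>\<tau>\<bar>) * norm a + (1 + \<bar>\<tau>\<bar>) * norm b) + (norm a + norm b)"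
    by linarith
  also have "\<dots> = (2 + \<bar>\<tau>\<bar>) * (norm a + norm b)" by (simp add: algebra_simps)
  finally have "norm p \<le> (2 + \<bar>\<tau>\<bar>) * (norm a + norm b)"
    by (rule order_trans[OF norm_le_fst_snd])
  then show ?thesis by (simp add: a_def b_def)
qed

lemma Wigner_eq_partial_fourier:
  "Wigner \<tau> g f = partial_fourier (\<lambda>p. g (fst p + \<tau> *\<^sub>R snd p) * cnj (f (fst p - (1 - \<tau>) *\<^sub>R snd p)))"
  by (auto simp: Wigner_def partial_fourier_def)

lemma Wigner_schwartz:
  fixes f g :: "'a::euclidean_space \<Rightarrow> complex"
  assumes "f \<in> schwartz" "g \<in> schwartz"
  shows "Wigner \<tau> g f \<in> schwartz"
  unfolding Wigner_eq_partial_fourier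
  by (intro partial_fourier_schwartz schwartz_linear_tensor[where C = "2 + \<bar>\<tau>\<bar>" and f = g and g = "\<lambda>x. cnj (f x)"
        and l = "\<lambda>p. fst p + \<tau> *\<^sub>R snd p" and m = "\<lambda>p. fst p - (1 - \<tau>) *\<^sub>R snd p"] wigner_coordinates)
    (use assms in \<open>auto simp: linear_iff algebra_simps intro: schwartz_cnj\<close>)

text \<open>Allows the inversion formula to be inserted inside the Wigner distribution under
  \<open>u\<close>. The point is that the conjugated Wigner distributions form a Schwartz family
  jointly in the parameter and the phase-space variable.\<close>

lemma tempered_Wigner_integral:
  fixes \<Gamma> :: "'p::euclidean_space \<times> 'a::euclidean_space \<Rightarrow> complex" and g :: "'a \<Rightarrow> complex"
  assumes u: "u \<in> tempered_distributions" and \<Gamma>: "\<Gamma> \<in> schwartz" and g: "g \<in> schwartz"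
  shows "u (\<lambda>Z. cnj (Wigner \<tau> g (\<lambda>x. \<integral>y. \<Gamma> (y, x) \<partial>lborel) Z))
    = (\<integral>y. u (\<lambda>Z. cnj (Wigner \<tau> g (\<lambda>x. \<Gamma> (y, x)) Z)) \<partial>lborel)"
proof -
  define k where "k q = cnj (g (snd (fst q) + \<tau> *\<^sub>R snd q)) * \<Gamma> (fst (fst q), snd (fst q) - (1 - \<tau>) *\<^sub>R snd q)"
    for q :: "('p \<times> 'a) \<times> 'a"
  have k: "k \<in> schwartz"
    unfolding k_def
  proof (rule schwartz_linear_tensor[where f = "\<lambda>x. cnj (g x)" and g = \<Gamma> and C = "3 + \<bar>\<tau>\<bar>"
        and l = "\<lambda>q. snd (fst q) + \<tau> *\<^sub>R snd q" and m = "\<lambda>q. (fst (fst q), snd (fst q) - (1 - \<tau>) *\<^sub>R snd q)"])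
    fix q :: "('p \<times> 'a) \<times> 'a"
    let ?a = "snd (fst q) + \<tau> *\<^sub>R snd q" and ?b = "snd (fst q) - (1 - \<tau>) *\<^sub>R snd q"
    have "norm q \<le> norm (fst (fst q)) + norm (snd (fst q), snd q)"
      using norm_le_fst_snd[of "(fst (fst q), (snd (fst q), snd q))"]
      by (simp add: norm_prod_def add.assoc)
    also have "\<dots> \<le> norm (fst (fst q)) + (2 + \<bar>\<tau>\<bar>) * (norm ?a + norm ?b)"
      using wigner_coordinates[of "(snd (fst q), snd q)" \<tau>] by simp
    also have "\<dots> \<le> norm (fst (fst q), ?b) + (2 + \<bar>\<tau>\<bar>) * (norm ?a + norm (fst (fst q), ?b))"
      using norm_fst_le[of "fst (fst q)" ?b] norm_snd_le[of ?b "fst (fst q)"]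
      by (intro add_mono mult_left_mono) auto
    also have "\<dots> \<le> (3 + \<bar>\<tau>\<bar>) * (norm ?a + norm (fst (fst q), ?b))"
      by (simp add: algebra_simps)
    finally show "norm q \<le> (3 + \<bar>\<tau>\<bar>) * (norm ?a + norm (fst (fst q), ?b))" .
  qed (use \<Gamma> g in \<open>auto simp: linear_iff algebra_simps intro: schwartz_cnj\<close>)
  \<comment> \<open>Conjugating the Wigner integral reverses its frequency, hence the minus
    sign.\<close>
  define \<Gamma>' where "\<Gamma>' q = partial_fourier k ((fst q, fst (snd q)), - snd (snd q))" for q
  have \<Gamma>': "\<Gamma>' \<in> schwartz"
    using schwartz_affine_comp[OF partial_fourier_schwartz[OF k], where l = "\<lambda>q. ((fst q, fst (snd q)), - snd (snd q))" and C = 1 and c = 0]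
    unfolding \<Gamma>'_def by (simp add: linear_iff norm_prod_def add.assoc)
  have 1: "(\<lambda>Z. cnj (Wigner \<tau> g (\<lambda>x. \<Gamma> (y, x)) Z)) = (\<lambda>Z. \<Gamma>' (y, Z))" for y
    unfolding \<Gamma>'_def k_def partial_fourier_def Wigner_def
    by (rule ext, simp only: case_prod_beta, rule trans[OF Bochner_Integration.integral_cnj[symmetric]],
        rule Bochner_Integration.integral_cong[OF refl]) (simp add: cis_cnj)
  have 2: "(\<lambda>Z. cnj (Wigner \<tau> g (\<lambda>x. \<integral>y. \<Gamma> (y, x) \<partial>lborel) Z)) = (\<lambda>Z. \<integral>y. \<Gamma>' (y, Z) \<partial>lborel)"
  proof (rule ext)
    fix Z :: "'a \<times> 'a"
    define G where "G q = k ((fst q, fst Z), snd q) * cis (2 * pi * (snd Z \<bullet> snd q))" for q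
    have "(\<lambda>q. k ((fst q, fst Z), snd q)) \<in> schwartz"
      using schwartz_affine_comp[OF k, where l = "\<lambda>q. ((fst q, 0), snd q)" and C = 1 and c = "((0, fst Z), 0)"]
      by (simp add: linear_iff norm_prod_def)
    from schwartz_integrable[OF schwartz_modulate[OF this, of "2 * pi" "(0, snd Z)"]]
    have "integrable lborel G"
      by (simp add: G_def[abs_def] inner_prod_def mult.commute)
    note G = lborel_integral_Pair[OF this]
    have "cnj (Wigner \<tau> g (\<lambda>x. \<integral>y. \<Gamma> (y, x) \<partial>lborel) Z) = (\<integral>t. (\<integral>y. G (y, t) \<partial>lborel) \<partial>lborel)"
      by (simp add: G_def k_def Wigner_def case_prod_beta cis_cnj flip: Bochner_Integration.integral_cnj)
    also have "\<dots> = (\<integral>y. \<Gamma>' (y, Z) \<partial>lborel)"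
      unfolding G(2)[symmetric] G(1) by (simp add: G_def \<Gamma>'_def partial_fourier_def)
    finally show "cnj (Wigner \<tau> g (\<lambda>x. \<integral>y. \<Gamma> (y, x) \<partial>lborel) Z) = (\<integral>y. \<Gamma>' (y, Z) \<partial>lborel)" .
  qed
  show ?thesis unfolding 1 2 by (rule tempered_family_integral[OF u \<Gamma>'])
qed

lemma Wigner_cmult: "Wigner \<tau> g (\<lambda>x. c * f x) Z = cnj c * Wigner \<tau> g f Z"
  by (simp add: Wigner_def case_prod_beta mult_ac)

text \<open>The centre of the cross-Wigner distribution of two shifts. Position and frequency are
  averaged with interchanged weights; for \<open>\<tau> = 1/2\<close> it is the midpoint.\<close>

definition wigner_mid :: "real \<Rightarrow> 'a::real_vector \<times> 'a \<Rightarrow> 'a \<times> 'a \<Rightarrow> 'a \<times> 'a" where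
  "wigner_mid \<tau> w v = ((1 - \<tau>) *\<^sub>R fst w + \<tau> *\<^sub>R fst v, \<tau> *\<^sub>R snd w + (1 - \<tau>) *\<^sub>R snd v)"

text \<open>The difference \<open>w - v\<close> multiplied by the standard symplectic
  matrix.\<close>

definition wigner_freq :: "'a::real_vector \<times> 'a \<Rightarrow> 'a \<times> 'a \<Rightarrow> 'a \<times> 'a" where
  "wigner_freq w v = (snd w - snd v, fst v - fst w)"

definition wigner_phase :: "real \<Rightarrow> 'a::real_inner \<times> 'a \<Rightarrow> 'a \<times> 'a \<Rightarrow> complex" where
  "wigner_phase \<tau> w v = cis (2 * pi * (snd (wigner_mid \<tau> w v) \<bullet> (fst w - fst v)))"

text \<open>Covariance: two shifts of the arguments become one shift on phase space up to a
  unimodular factor. This turns the entries of the operator's matrix into values of the STFT of the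
  symbol.\<close>

lemma Wigner_tf_shift:
  fixes f g :: "'a::euclidean_space \<Rightarrow> complex"
  assumes f: "f \<in> schwartz" and g: "g \<in> schwartz"
  shows "Wigner \<tau> (tf_shift w g) (tf_shift v f) Z
    = wigner_phase \<tau> w v * tf_shift (wigner_mid \<tau> w v, wigner_freq w v) (Wigner \<tau> g f) Z"
proof -
  obtain x \<xi> where w: "w = (x, \<xi>)" by (cases w)
  obtain y \<eta> where v: "v = (y, \<eta>)" by (cases v)
  obtain X \<Xi> where Z: "Z = (X, \<Xi>)" by (cases Z)
  define a m where "a = (1 - \<tau>) *\<^sub>R x + \<tau> *\<^sub>R y" and "m = \<tau> *\<^sub>R \<xi> + (1 - \<tau>) *\<^sub>R \<eta>"
  define F where "F t = tf_shift w g (X + \<tau> *\<^sub>R t) * cnj (tf_shift v f (X - (1 - \<tau>) *\<^sub>R t)) * cis (- 2 * pi * (\<Xi> \<bullet> t))" for t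
  define c where "c = cis (2 * pi * (m \<bullet> (x - y))) * cis (2 * pi * ((X, \<Xi>) \<bullet> (\<xi> - \<eta>, y - x)))"
  have [measurable]: "tf_shift w g \<in> borel_measurable borel" "tf_shift v f \<in> borel_measurable borel"
    using f g by (auto intro!: schwartz_measurable tf_shift_schwartz)
  have [measurable]: "F \<in> borel_measurable borel"
    unfolding F_def by measurable
  have "Wigner \<tau> (tf_shift w g) (tf_shift v f) Z = (\<integral>t. F t \<partial>lborel)"
    by (simp add: Wigner_def Z F_def)
  \<comment> \<open>After this substitution the two arguments are
    \<open>(X - a) + \<tau> *\<^sub>R s\<close> and
    \<open>(X - a) - (1 - \<tau>) *\<^sub>R s\<close>, with a common centre.\<close>
  also have "\<dots> = (\<integral>s. F (s + (x - y)) \<partial>lborel)"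
    by (rule lborel_integral_translate[symmetric]) measurable
  also have "\<dots> = (\<integral>s. c * (g ((X - a) + \<tau> *\<^sub>R s) * cnj (f ((X - a) - (1 - \<tau>) *\<^sub>R s)) * cis (- 2 * pi * ((\<Xi> - m) \<bullet> s))) \<partial>lborel)"
  proof (rule Bochner_Integration.integral_cong[OF refl])
    fix s
    have 1: "X + \<tau> *\<^sub>R (s + (x - y)) - x = (X - a) + \<tau> *\<^sub>R s" "X - (1 - \<tau>) *\<^sub>R (s + (x - y)) - y = (X - a) - (1 - \<tau>) *\<^sub>R s"
      by (simp_all add: a_def algebra_simps)
    have "cis (2 * pi * ((X + \<tau> *\<^sub>R (s + (x - y))) \<bullet> \<xi>)) * cis (- (2 * pi * ((X - (1 - \<tau>) *\<^sub>R (s + (x - y))) \<bullet> \<eta>)))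
        * cis (- 2 * pi * (\<Xi> \<bullet> (s + (x - y)))) = c * cis (- 2 * pi * ((\<Xi> - m) \<bullet> s))"
      unfolding c_def cis_mult
      by (rule arg_cong[where f = cis]) (simp add: m_def inner_simps inner_commute algebra_simps)
    then show "F (s + (x - y)) = c * (g ((X - a) + \<tau> *\<^sub>R s) * cnj (f ((X - a) - (1 - \<tau>) *\<^sub>R s)) * cis (- 2 * pi * ((\<Xi> - m) \<bullet> s)))"
      unfolding F_def tf_shift_apply w v fst_conv snd_conv 1 complex_cnj_mult cis_cnj
      by (simp only: mult_ac)
  qed
  also have "\<dots> = c * Wigner \<tau> g f (X - a, \<Xi> - m)"
    by (simp add: Wigner_def)
  also have "\<dots> = wigner_phase \<tau> w v * tf_shift (wigner_mid \<tau> w v, wigner_freq w v) (Wigner \<tau> g f) Z"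
    by (simp add: wigner_phase_def wigner_mid_def wigner_freq_def tf_shift_apply w v Z c_def a_def m_def)
  finally show ?thesis .
qed

lemma STFT_eq: "STFT \<phi> u x \<xi> = u (\<lambda>t. cnj (tf_shift (x, \<xi>) \<phi> t))"
  by (simp add: STFT_def pairing_def tf_shift_def)

lemma cnj_tf_shift: "cnj (tf_shift (x, \<xi>) \<phi> t) = tf_shift (x, - \<xi>) (\<lambda>t. cnj (\<phi> t)) t"
  by (simp add: tf_shift_apply cis_cnj)

lemma STFT_continuous:
  fixes \<phi> :: "'a::euclidean_space \<Rightarrow> complex"
  assumes u: "u \<in> tempered_distributions" and \<phi>: "\<phi> \<in> schwartz"
  shows "continuous_on UNIV (\<lambda>w. STFT \<phi> u (fst w) (snd w))"
proof -
  have "continuous_on UNIV ((\<lambda>w. u (tf_shift w (\<lambda>t. cnj (\<phi> t)))) \<circ> (\<lambda>w. (fst w, - snd w)))"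
    by (rule continuous_on_compose[OF _ continuous_on_subset[OF tempered_tf_shift_continuous[OF u schwartz_cnj[OF \<phi>]]]])
      (auto intro!: continuous_intros)
  then show ?thesis by (simp add: STFT_eq cnj_tf_shift comp_def del: prod.collapse)
qed

text \<open>Insert the inversion formula for \<open>f\<close>, take the integral out of \<sigma>,
  and use covariance. The kernel acting on \<open>stft \<phi> f\<close> has the modulus of one value
  of the STFT of \<sigma> with window \<open>Wigner \<tau> \<phi> \<phi>\<close>.\<close>

lemma STFT_OP_inversion:
  fixes f \<phi> :: "'a::euclidean_space \<Rightarrow> complex"
  assumes \<sigma>: "\<sigma> \<in> tempered_distributions" and f: "f \<in> schwartz" and \<phi>: "\<phi> \<in> schwartz"
  shows "of_real (\<integral>s. (cmod (\<phi> s))\<^sup>2 \<partial>lborel) * STFT \<phi> (OP \<tau> \<sigma> f) x \<xi>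
    = (\<integral>v. stft \<phi> f v * (cnj (wigner_phase \<tau> (x, \<xi>) v)
        * STFT (Wigner \<tau> \<phi> \<phi>) \<sigma> (wigner_mid \<tau> (x, \<xi>) v) (wigner_freq (x, \<xi>) v)) \<partial>lborel)"
proof -
  let ?g = "tf_shift (x, \<xi>) \<phi>" and ?c = "complex_of_real (\<integral>s. (cmod (\<phi> s))\<^sup>2 \<partial>lborel)"
  have g: "?g \<in> schwartz" by (rule tf_shift_schwartz[OF \<phi>])
  have W: "(\<lambda>Z. cnj (Wigner \<tau> ?g h Z)) \<in> schwartz" if "h \<in> schwartz" for h
    by (intro schwartz_cnj Wigner_schwartz g that)
  have \<Gamma>: "(\<lambda>q. stft \<phi> f (fst q) * tf_shift (fst q) \<phi> (snd q)) \<in> schwartz"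
    by (intro schwartz_tf_shift_family stft_schwartz f \<phi>)
  have "?c * STFT \<phi> (OP \<tau> \<sigma> f) x \<xi> = \<sigma> (\<lambda>Z. ?c * cnj (Wigner \<tau> ?g f Z))"
    by (simp add: tempered_cmult[OF \<sigma> W[OF f]] STFT_eq OP_def pairing_def)
  also have "\<dots> = \<sigma> (\<lambda>Z. cnj (Wigner \<tau> ?g (\<lambda>t. \<integral>v. stft \<phi> f v * tf_shift v \<phi> t \<partial>lborel) Z))"
    by (simp add: stft_inversion[OF f \<phi>] Wigner_cmult)
  also have "\<dots> = (\<integral>v. \<sigma> (\<lambda>Z. cnj (Wigner \<tau> ?g (\<lambda>t. stft \<phi> f v * tf_shift v \<phi> t) Z)) \<partial>lborel)"
    using tempered_Wigner_integral[OF \<sigma> \<Gamma> g, of \<tau>] by simp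
  also have "\<dots> = (\<integral>v. stft \<phi> f v * (cnj (wigner_phase \<tau> (x, \<xi>) v)
        * STFT (Wigner \<tau> \<phi> \<phi>) \<sigma> (wigner_mid \<tau> (x, \<xi>) v) (wigner_freq (x, \<xi>) v)) \<partial>lborel)"
  proof (rule Bochner_Integration.integral_cong[OF refl])
    fix v
    let ?S = "\<lambda>Z. cnj (tf_shift (wigner_mid \<tau> (x, \<xi>) v, wigner_freq (x, \<xi>) v) (Wigner \<tau> \<phi> \<phi>) Z)"
    have S: "?S \<in> schwartz" by (intro schwartz_cnj tf_shift_schwartz Wigner_schwartz \<phi>)
    have "\<sigma> (\<lambda>Z. cnj (Wigner \<tau> ?g (\<lambda>t. stft \<phi> f v * tf_shift v \<phi> t) Z))
        = \<sigma> (\<lambda>Z. (stft \<phi> f v * cnj (wigner_phase \<tau> (x, \<xi>) v)) * ?S Z)"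
      by (simp add: Wigner_cmult Wigner_tf_shift[OF \<phi> \<phi>] mult.assoc)
    also have "\<dots> = (stft \<phi> f v * cnj (wigner_phase \<tau> (x, \<xi>) v)) * \<sigma> ?S"
      by (rule tempered_cmult[OF \<sigma> S])
    finally show "\<sigma> (\<lambda>Z. cnj (Wigner \<tau> ?g (\<lambda>t. stft \<phi> f v * tf_shift v \<phi> t) Z))
        = stft \<phi> f v * (cnj (wigner_phase \<tau> (x, \<xi>) v)
        * STFT (Wigner \<tau> \<phi> \<phi>) \<sigma> (wigner_mid \<tau> (x, \<xi>) v) (wigner_freq (x, \<xi>) v))"
      by (simp add: STFT_eq mult.assoc)
  qed
  finally show ?thesis .
qed

text \<open>A vanishing integral would make \<open>g\<close> zero almost everywhere; the zero set of
  a continuous function is closed, hence it would be the whole space.\<close>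

lemma schwartz_norm2_pos:
  fixes g :: "'a::euclidean_space \<Rightarrow> complex"
  assumes g: "g \<in> schwartz" and "g \<noteq> (\<lambda>_. 0)"
  shows "0 < (\<integral>s. (cmod (g s))\<^sup>2 \<partial>lborel)"
proof -
  obtain t where t: "g t \<noteq> 0" using assms(2) by auto
  obtain C where C: "0 \<le> C" "\<And>x. \<langle>x\<rangle> ^ 0 * cmod (g x) \<le> C" using schwartz_bound_nonneg[OF g] by blast
  have int: "integrable lborel (\<lambda>s. (cmod (g s))\<^sup>2)"
  proof (rule Bochner_Integration.integrable_bound)
    show "integrable lborel (\<lambda>s. C *\<^sub>R g s)" using schwartz_integrable[OF g] by simp
    show "AE s in lborel. norm ((cmod (g s))\<^sup>2) \<le> norm (C *\<^sub>R g s)"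
      using C by (auto simp: power2_eq_square intro!: mult_right_mono)
  qed (use schwartz_measurable[OF g] in simp)
  have "(\<integral>s. (cmod (g s))\<^sup>2 \<partial>lborel) \<noteq> 0"
  proof
    assume "(\<integral>s. (cmod (g s))\<^sup>2 \<partial>lborel) = 0"
    then have "AE s in lborel. g s = 0"
      using integral_nonneg_eq_0_iff_AE[OF int] by auto
    then have "AE s in lebesgue. s \<in> {s. g s = 0}" by (auto intro: AE_completion)
    moreover have "closed {s. g s = 0}"
      by (intro closed_Collect_eq schwartz_continuous g continuous_on_const)
    ultimately have "g t = 0" using mem_closed_if_AE_lebesgue by blast
    with t show False by simp
  qed
  moreover have "0 \<le> (\<integral>s. (cmod (g s))\<^sup>2 \<partial>lborel)" by simp
  ultimately show ?thesis by linarith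
qed

section \<open>Measurability of STFTs and of essential suprema; bounds for the operator\<close>

lemma borel_measurable_fst_snd [measurable]:
  fixes f :: "'c \<Rightarrow> 'a::euclidean_space \<times> 'b::euclidean_space"
  assumes "f \<in> borel_measurable M"
  shows "(\<lambda>x. fst (f x)) \<in> borel_measurable M" "(\<lambda>x. snd (f x)) \<in> borel_measurable M"
  by (rule measurable_compose[OF assms borel_measurable_continuous_onI];
      intro continuous_on_fst continuous_on_snd continuous_on_id)+

lemma lborel_nn_integral_Pair:
  fixes f :: "'a::euclidean_space \<times> 'b::euclidean_space \<Rightarrow> ennreal"
  assumes "f \<in> borel_measurable borel"
  shows "(\<integral>\<^sup>+z. f z \<partial>lborel) = (\<integral>\<^sup>+x. (\<integral>\<^sup>+y. f (x, y) \<partial>lborel) \<partial>lborel)"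
    and "(\<integral>\<^sup>+z. f z \<partial>lborel) = (\<integral>\<^sup>+y. (\<integral>\<^sup>+x. f (x, y) \<partial>lborel) \<partial>lborel)"
proof -
  have f: "f \<in> borel_measurable (lborel \<Otimes>\<^sub>M lborel)"
    using assms by (simp add: lborel_prod)
  show "(\<integral>\<^sup>+z. f z \<partial>lborel) = (\<integral>\<^sup>+x. (\<integral>\<^sup>+y. f (x, y) \<partial>lborel) \<partial>lborel)"
    using lborel.nn_integral_fst[OF f] by (simp add: lborel_prod)
  show "(\<integral>\<^sup>+z. f z \<partial>lborel) = (\<integral>\<^sup>+y. (\<integral>\<^sup>+x. f (x, y) \<partial>lborel) \<partial>lborel)"
    using lborel_pair.nn_integral_snd[OF f] by (simp add: lborel_prod)
qed

text \<open>The essential supremum exceeds \<open>c\<close> exactly when the section of the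
  superlevel set has positive measure, and the measure of a section depends measurably on the
  parameter.\<close>

lemma borel_measurable_esssup:
  fixes f :: "'a \<Rightarrow> 'b \<Rightarrow> ennreal"
  assumes N: "sigma_finite_measure N" and f: "(\<lambda>(x, y). f x y) \<in> borel_measurable (M \<Otimes>\<^sub>M N)"
  shows "(\<lambda>x. esssup N (f x)) \<in> borel_measurable M"
proof (rule borel_measurableI_greater)
  fix c
  interpret N: sigma_finite_measure N by (rule N)
  define Q where "Q = {z \<in> space (M \<Otimes>\<^sub>M N). c < (\<lambda>(x, y). f x y) z}"
  have Q[measurable]: "Q \<in> sets (M \<Otimes>\<^sub>M N)" unfolding Q_def using f by measurable
  have "c < esssup N (f x) \<longleftrightarrow> emeasure N (Pair x -` Q) \<noteq> 0" if x: "x \<in> space M" for x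
  proof -
    have m: "f x \<in> borel_measurable N" using measurable_Pair2[OF f x] by simp
    have Px: "Pair x -` Q = {y \<in> space N. c < f x y}"
      using x by (auto simp: Q_def space_pair_measure)
    have "esssup N (f x) \<le> c \<longleftrightarrow> (AE y in N. f x y \<le> c)"
    proof
      assume c: "esssup N (f x) \<le> c"
      show "AE y in N. f x y \<le> c"
        using esssup_AE[of "f x" N] by eventually_elim (rule order_trans[OF _ c])
    qed (rule esssup_I[OF m])
    also have "\<dots> \<longleftrightarrow> emeasure N {y \<in> space N. c < f x y} = 0"
      using m by (subst AE_iff_measurable[OF _ refl]) (auto simp: not_le)
    finally show ?thesis unfolding Px by (auto simp: not_le[symmetric])
  qed
  then have "{x \<in> space M. c < esssup N (f x)} = {x \<in> space M. emeasure N (Pair x -` Q) \<noteq> 0}"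
    by auto
  moreover have "(\<lambda>x. emeasure N (Pair x -` Q)) \<in> borel_measurable M"
    by (rule N.measurable_emeasure_Pair[OF Q])
  ultimately show "{x \<in> space M. c < esssup N (f x)} \<in> sets M" by simp
qed

lemma STFT_measurable:
  fixes \<Phi> :: "'a::euclidean_space \<Rightarrow> complex"
  assumes "\<sigma> \<in> tempered_distributions" "\<Phi> \<in> schwartz"
  shows "(\<lambda>w. STFT \<Phi> \<sigma> (fst w) (snd w)) \<in> borel_measurable borel"
  by (rule borel_measurable_continuous_onI[OF STFT_continuous[OF assms]])

text \<open>The inner norm of Sjostrand's class. Its integral over \<zeta> is the norm of \<sigma>,
  and it is the only size information about the symbol that enters the sufficiency proof.\<close>

definition sup_STFT :: "('a::euclidean_space \<Rightarrow> complex) \<Rightarrow> (('a \<Rightarrow> complex) \<Rightarrow> complex) \<Rightarrow> 'a \<Rightarrow> ennreal" where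
  "sup_STFT \<Phi> \<sigma> \<zeta> = esssup lborel (\<lambda>z. ennreal (cmod (STFT \<Phi> \<sigma> z \<zeta>)))"

lemma sup_STFT_measurable [measurable]:
  fixes \<Phi> :: "'a::euclidean_space \<Rightarrow> complex"
  assumes "\<sigma> \<in> tempered_distributions" "\<Phi> \<in> schwartz"
  shows "sup_STFT \<Phi> \<sigma> \<in> borel_measurable borel"
proof -
  have "(\<lambda>w::'a \<times> 'a. (snd w, fst w)) \<in> borel_measurable borel"
    by (intro borel_measurable_continuous_onI continuous_intros)
  from measurable_compose[OF this STFT_measurable[OF assms]]
  have "(\<lambda>w. ennreal (cmod (STFT \<Phi> \<sigma> (snd w) (fst w)))) \<in> borel_measurable borel"
    by simp
  then have "(\<lambda>(\<zeta>, z). ennreal (cmod (STFT \<Phi> \<sigma> z \<zeta>))) \<in> borel_measurable (borel \<Otimes>\<^sub>M lborel)"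
    unfolding borel_prod[symmetric] by (simp add: case_prod_beta' cong: measurable_cong_sets)
  from borel_measurable_esssup[OF sigma_finite_lborel this]
  show ?thesis by (simp add: sup_STFT_def[abs_def])
qed

text \<open>Each component is bounded by the pair, so decay on phase space can be divided between
  the two components.\<close>

lemma jb_powr_Pair_le:
  assumes "0 \<le> a" "0 \<le> b"
  shows "\<langle>(x, y)\<rangle> powr (- (a + b)) \<le> \<langle>x\<rangle> powr (- a) * \<langle>y\<rangle> powr (- b)"
proof -
  have "\<langle>(x, y)\<rangle> powr (- (a + b)) = \<langle>(x, y)\<rangle> powr (- a) * \<langle>(x, y)\<rangle> powr (- b)"
    by (simp add: powr_add[symmetric])
  also have "\<dots> \<le> \<langle>x\<rangle> powr (- a) * \<langle>y\<rangle> powr (- b)"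
    using jb_fst_le[of "(x, y)"] assms by (intro mult_mono jb_powr_snd_le powr_mono2') (auto simp: jb_pos)
  finally show ?thesis .
qed

text \<open>The conjugates stem from applying a linear functional where the STFT is sesquilinear.
  The identity reduces a shifted window to the fixed Schwartz function
  \<open>stft \<Phi> \<Psi>\<close> at a displaced point.\<close>

lemma norm_stft_cnj_tf_shift:
  fixes \<Phi> \<Psi> :: "'a::euclidean_space \<Rightarrow> complex"
  assumes \<Phi>: "\<Phi> \<in> schwartz" and \<Psi>: "\<Psi> \<in> schwartz"
  shows "cmod (stft (\<lambda>t. cnj (\<Phi> t)) (\<lambda>t. cnj (tf_shift (z, \<zeta>) \<Psi> t)) w) = cmod (stft \<Phi> \<Psi> (fst w - z, - (\<zeta> + snd w)))"
proof -
  have swap: "a * p * (b * r) = c * (p * (d * r))" if "a * b = c * d" for a b c d p r :: complex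
  proof -
    have "a * p * (b * r) = (a * b) * (p * r)" by (simp only: mult_ac)
    also have "\<dots> = c * (p * (d * r))" unfolding that by (simp only: mult_ac)
    finally show ?thesis .
  qed
  define F where "F t = tf_shift (z, \<zeta>) \<Psi> t * tf_shift w (\<lambda>t. cnj (\<Phi> t)) t" for t
  have [measurable]: "F \<in> borel_measurable borel"
    unfolding F_def using \<Phi> \<Psi>
    by (intro borel_measurable_times schwartz_measurable tf_shift_schwartz schwartz_cnj)
  have "stft (\<lambda>t. cnj (\<Phi> t)) (\<lambda>t. cnj (tf_shift (z, \<zeta>) \<Psi> t)) w = (\<integral>t. cnj (F t) \<partial>lborel)"
    by (simp add: stft_eq_integral F_def)
  also have "\<dots> = cnj (\<integral>t. F t \<partial>lborel)" by (rule Bochner_Integration.integral_cnj)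
  also have "(\<integral>t. F t \<partial>lborel) = (\<integral>t. F (t + z) \<partial>lborel)"
    by (rule lborel_integral_translate[symmetric]) measurable
  also have "\<dots> = (\<integral>t. cis (2 * pi * (z \<bullet> (\<zeta> + snd w))) * (\<Psi> t * cnj (tf_shift (fst w - z, - (\<zeta> + snd w)) \<Phi> t)) \<partial>lborel)"
  proof (rule Bochner_Integration.integral_cong[OF refl])
    fix t
    have "cis (2 * pi * ((t + z) \<bullet> \<zeta>)) * cis (2 * pi * ((t + z) \<bullet> snd w))
        = cis (2 * pi * (z \<bullet> (\<zeta> + snd w))) * cis (- (2 * pi * (t \<bullet> - (\<zeta> + snd w))))"
      unfolding cis_mult by (rule arg_cong[where f = cis]) (simp add: inner_simps algebra_simps)
    then have "cis (2 * pi * ((t + z) \<bullet> \<zeta>)) * \<Psi> t * (cis (2 * pi * ((t + z) \<bullet> snd w)) * cnj (\<Phi> (t + z - fst w)))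
        = cis (2 * pi * (z \<bullet> (\<zeta> + snd w))) * (\<Psi> t * (cis (- (2 * pi * (t \<bullet> - (\<zeta> + snd w)))) * cnj (\<Phi> (t + z - fst w))))"
      by (rule swap)
    then show "F (t + z) = cis (2 * pi * (z \<bullet> (\<zeta> + snd w))) * (\<Psi> t * cnj (tf_shift (fst w - z, - (\<zeta> + snd w)) \<Phi> t))"
      by (simp add: F_def tf_shift_apply cis_cnj diff_diff_eq2)
  qed
  also have "\<dots> = cis (2 * pi * (z \<bullet> (\<zeta> + snd w))) * stft \<Phi> \<Psi> (fst w - z, - (\<zeta> + snd w))"
    by (simp add: stft_eq_integral)
  finally show ?thesis by (simp add: norm_mult)
qed

text \<open>Changing the window convolves the STFT with the rapidly decaying STFT of one window against the other.\<close>

lemma STFT_window_change: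
  fixes \<Phi> \<Psi> :: "'a::euclidean_space \<Rightarrow> complex"
  assumes \<sigma>: "\<sigma> \<in> tempered_distributions" and \<Phi>: "\<Phi> \<in> schwartz" "\<Phi> \<noteq> (\<lambda>_. 0)" and \<Psi>: "\<Psi> \<in> schwartz" and N: "0 \<le> N"
  obtains C where "0 \<le> C" "\<And>z \<zeta>. ennreal (cmod (STFT \<Psi> \<sigma> z \<zeta>))
    \<le> ennreal C * (\<integral>\<^sup>+\<zeta>'. sup_STFT \<Phi> \<sigma> \<zeta>' * ennreal (\<langle>\<zeta> - \<zeta>'\<rangle> powr (-N)) \<partial>lborel)"
proof -
  define n where "n = (\<integral>s. (cmod (\<Phi> s))\<^sup>2 \<partial>lborel)"
  have n: "0 < n" unfolding n_def by (rule schwartz_norm2_pos[OF \<Phi>])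
  define M where "M = real DIM('a) + 1"
  define A where "A = (\<integral>\<^sup>+x. ennreal (\<langle>x::'a\<rangle> powr (-M)) \<partial>lborel)"
  have A: "A < \<infinity>" unfolding A_def by (rule nn_integral_jb_finite) (simp add: M_def)
  \<comment> \<open>The exponent is split below: \<open>M\<close> exceeds the dimension and makes
    the position integral finite, \<open>N\<close> remains as decay in frequency.\<close>
  obtain D where D: "0 \<le> D" "\<And>q. cmod (stft \<Phi> \<Psi> q) \<le> D * \<langle>q\<rangle> powr (- (M + N))"
    using schwartz_decay[OF stft_schwartz[OF \<Psi> \<Phi>(1)]] by blast
  have D': "cmod (stft \<Phi> \<Psi> (a, b)) \<le> D * (\<langle>a\<rangle> powr (-M) * \<langle>b\<rangle> powr (-N))" for a b
    by (rule order_trans[OF D(2) mult_left_mono[OF jb_powr_Pair_le D(1)]]) (use N in \<open>auto simp: M_def\<close>)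
  let ?H = "sup_STFT \<Phi> \<sigma>"
  have [measurable]: "?H \<in> borel_measurable borel" using \<sigma> \<Phi>(1) by (rule sup_STFT_measurable)
  have "ennreal (cmod (STFT \<Psi> \<sigma> z \<zeta>)) \<le> ennreal (D * enn2real A / n) * (\<integral>\<^sup>+\<zeta>'. ?H \<zeta>' * ennreal (\<langle>\<zeta> - \<zeta>'\<rangle> powr (-N)) \<partial>lborel)" for z \<zeta>
  proof -
    let ?h = "\<lambda>t. cnj (tf_shift (z, \<zeta>) \<Psi> t)" and ?g = "\<lambda>t. cnj (\<Phi> t)"
    have h: "?h \<in> schwartz" and g: "?g \<in> schwartz" by (intro schwartz_cnj tf_shift_schwartz \<Psi> \<Phi>)+
    have eq: "\<sigma> (tf_shift w ?g) = STFT \<Phi> \<sigma> (fst w) (- snd w)" for w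
      by (simp add: STFT_eq cnj_tf_shift)
    define V where "V w = ennreal (cmod (STFT \<Phi> \<sigma> (fst w) (- snd w)))" for w
    have "(\<lambda>w. STFT \<Phi> \<sigma> (fst w) (- snd w)) \<in> borel_measurable borel"
      unfolding eq[symmetric] by (rule borel_measurable_continuous_onI[OF tempered_tf_shift_continuous[OF \<sigma> g]])
    then have V[measurable]: "V \<in> borel_measurable borel" unfolding V_def by measurable
    have "ennreal n * ennreal (cmod (STFT \<Psi> \<sigma> z \<zeta>)) = ennreal (cmod (of_real n * \<sigma> ?h))"
      using n by (simp add: STFT_eq norm_mult ennreal_mult)
    also have "of_real n * \<sigma> ?h = (\<integral>w. stft ?g ?h w * \<sigma> (tf_shift w ?g) \<partial>lborel)"
      using tempered_stft_inversion[OF \<sigma> h g] by (simp add: n_def)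
    also have "ennreal (cmod \<dots>) \<le> (\<integral>\<^sup>+w. ennreal (cmod (stft ?g ?h w * \<sigma> (tf_shift w ?g))) \<partial>lborel)"
      by (rule integral_norm_bound_ennreal[OF tempered_stft_integrable[OF \<sigma> h g]])
    also have "\<dots> \<le> (\<integral>\<^sup>+w. ennreal (D * (\<langle>fst w - z\<rangle> powr (-M) * \<langle>\<zeta> + snd w\<rangle> powr (-N))) * V w \<partial>lborel)"
    proof (rule nn_integral_mono)
      fix w
      have "cmod (stft ?g ?h w) \<le> D * (\<langle>fst w - z\<rangle> powr (-M) * \<langle>\<zeta> + snd w\<rangle> powr (-N))"
        using D'[of "fst w - z" "- (\<zeta> + snd w)"] unfolding norm_stft_cnj_tf_shift[OF \<Phi>(1) \<Psi>] by (simp only: jb_minus)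
      then show "ennreal (cmod (stft ?g ?h w * \<sigma> (tf_shift w ?g))) \<le> ennreal (D * (\<langle>fst w - z\<rangle> powr (-M) * \<langle>\<zeta> + snd w\<rangle> powr (-N))) * V w"
        unfolding norm_mult eq V_def using D(1) by (subst ennreal_mult'') (auto intro: mult_right_mono ennreal_leI)
    qed
    also have "\<dots> = (\<integral>\<^sup>+\<omega>. (\<integral>\<^sup>+x. ennreal (D * (\<langle>x - z\<rangle> powr (-M) * \<langle>\<zeta> + \<omega>\<rangle> powr (-N))) * V (x, \<omega>) \<partial>lborel) \<partial>lborel)"
      by (subst lborel_nn_integral_Pair(2)) auto
    \<comment> \<open>Replacing the STFT of \<sigma> by its supremum over positions lets the
      position integral factor out as the constant \<open>A\<close>, and the bound becomes
      independent of \<open>z\<close>.\<close>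
    also have "\<dots> \<le> (\<integral>\<^sup>+\<omega>. (\<integral>\<^sup>+x. ennreal D * ennreal (\<langle>\<zeta> + \<omega>\<rangle> powr (-N)) * ?H (- \<omega>) * ennreal (\<langle>x - z\<rangle> powr (-M)) \<partial>lborel) \<partial>lborel)"
    proof (rule nn_integral_mono, rule nn_integral_mono_AE)
      fix \<omega>
      have "AE x in lborel. V (x, \<omega>) \<le> ?H (- \<omega>)"
        using esssup_AE[of "\<lambda>x. ennreal (cmod (STFT \<Phi> \<sigma> x (- \<omega>)))" lborel] by (simp add: V_def sup_STFT_def)
      then show "AE x in lborel. ennreal (D * (\<langle>x - z\<rangle> powr (-M) * \<langle>\<zeta> + \<omega>\<rangle> powr (-N))) * V (x, \<omega>)
          \<le> ennreal D * ennreal (\<langle>\<zeta> + \<omega>\<rangle> powr (-N)) * ?H (- \<omega>) * ennreal (\<langle>x - z\<rangle> powr (-M))"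
      proof eventually_elim
        case (elim x)
        have "ennreal (D * (\<langle>x - z\<rangle> powr (-M) * \<langle>\<zeta> + \<omega>\<rangle> powr (-N))) * V (x, \<omega>)
            \<le> ennreal (D * (\<langle>x - z\<rangle> powr (-M) * \<langle>\<zeta> + \<omega>\<rangle> powr (-N))) * ?H (- \<omega>)"
          by (rule mult_left_mono[OF elim]) simp
        then show ?case using D(1) by (simp add: ennreal_mult mult_ac)
      qed
    qed
    also have "\<dots> = (\<integral>\<^sup>+\<omega>. ennreal D * ennreal (\<langle>\<zeta> + \<omega>\<rangle> powr (-N)) * ?H (- \<omega>) * A \<partial>lborel)"
    proof (rule nn_integral_cong)
      fix \<omega>
      have "(\<integral>\<^sup>+x. ennreal (\<langle>x - z\<rangle> powr (-M)) \<partial>lborel) = A"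
        unfolding A_def using lborel_nn_integral_affine[of "\<lambda>x. ennreal (\<langle>x\<rangle> powr (-M))" 1 "- z"]
        by simp
      then show "(\<integral>\<^sup>+x. ennreal D * ennreal (\<langle>\<zeta> + \<omega>\<rangle> powr (-N)) * ?H (- \<omega>) * ennreal (\<langle>x - z\<rangle> powr (-M)) \<partial>lborel)
          = ennreal D * ennreal (\<langle>\<zeta> + \<omega>\<rangle> powr (-N)) * ?H (- \<omega>) * A"
        by (simp add: nn_integral_cmult)
    qed
    also have "\<dots> = (\<integral>\<^sup>+\<omega>. (ennreal D * A) * (?H (- \<omega>) * ennreal (\<langle>\<zeta> - (- \<omega>)\<rangle> powr (-N))) \<partial>lborel)"
      by (simp add: mult_ac)
    also have "\<dots> = (ennreal D * A) * (\<integral>\<^sup>+\<omega>. ?H (- \<omega>) * ennreal (\<langle>\<zeta> - (- \<omega>)\<rangle> powr (-N)) \<partial>lborel)"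
      by (rule nn_integral_cmult) measurable
    also have "(\<integral>\<^sup>+\<omega>. ?H (- \<omega>) * ennreal (\<langle>\<zeta> - (- \<omega>)\<rangle> powr (-N)) \<partial>lborel) = (\<integral>\<^sup>+\<zeta>'. ?H \<zeta>' * ennreal (\<langle>\<zeta> - \<zeta>'\<rangle> powr (-N)) \<partial>lborel)"
      using lborel_nn_integral_affine[of "\<lambda>\<zeta>'. ?H \<zeta>' * ennreal (\<langle>\<zeta> - \<zeta>'\<rangle> powr (-N))" "-1" 0] by simp
    finally have le: "ennreal n * ennreal (cmod (STFT \<Psi> \<sigma> z \<zeta>))
        \<le> ennreal D * A * (\<integral>\<^sup>+\<zeta>'. ?H \<zeta>' * ennreal (\<langle>\<zeta> - \<zeta>'\<rangle> powr (-N)) \<partial>lborel)" .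
    have "ennreal (cmod (STFT \<Psi> \<sigma> z \<zeta>)) = ennreal (1 / n) * (ennreal n * ennreal (cmod (STFT \<Psi> \<sigma> z \<zeta>)))"
      using n by (simp add: mult.assoc[symmetric] ennreal_mult[symmetric])
    also have "\<dots> \<le> ennreal (1 / n) * (ennreal D * A * (\<integral>\<^sup>+\<zeta>'. ?H \<zeta>' * ennreal (\<langle>\<zeta> - \<zeta>'\<rangle> powr (-N)) \<partial>lborel))"
      by (rule mult_left_mono[OF le]) simp
    also have "A = ennreal (enn2real A)" using A by simp
    also have "ennreal (1 / n) * (ennreal D * ennreal (enn2real A) * (\<integral>\<^sup>+\<zeta>'. ?H \<zeta>' * ennreal (\<langle>\<zeta> - \<zeta>'\<rangle> powr (-N)) \<partial>lborel))
        = ennreal (D * enn2real A / n) * (\<integral>\<^sup>+\<zeta>'. ?H \<zeta>' * ennreal (\<langle>\<zeta> - \<zeta>'\<rangle> powr (-N)) \<partial>lborel)"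
      using n D(1) by (simp add: mult.assoc[symmetric] ennreal_mult[symmetric] mult.commute)
    finally show ?thesis .
  qed
  then show ?thesis using D(1) n by (intro that[of "D * enn2real A / n"]) auto
qed

text \<open>Read off the integral formula, whose integrand is jointly continuous:
  \<open>STFT_measurable\<close> applies to tempered distributions, and
  \<open>OP \<tau> \<sigma> f\<close> is not shown to be one.\<close>

lemma STFT_OP_measurable:
  fixes f \<phi> :: "'a::euclidean_space \<Rightarrow> complex"
  assumes \<sigma>: "\<sigma> \<in> tempered_distributions" and f: "f \<in> schwartz" and \<phi>: "\<phi> \<in> schwartz" and "\<phi> \<noteq> (\<lambda>_. 0)"
  shows "(\<lambda>w. STFT \<phi> (OP \<tau> \<sigma> f) (fst w) (snd w)) \<in> borel_measurable borel"
proof -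
  let ?G = "\<lambda>(w, v). stft \<phi> f v * (cnj (wigner_phase \<tau> w v)
        * STFT (Wigner \<tau> \<phi> \<phi>) \<sigma> (wigner_mid \<tau> w v) (wigner_freq w v))"
  have 1: "continuous_on UNIV (\<lambda>q::('a \<times> 'a) \<times> ('a \<times> 'a). stft \<phi> f (snd q))"
    by (rule continuous_on_compose2[OF schwartz_continuous[OF stft_schwartz[OF f \<phi>]]]) (auto intro!: continuous_intros)
  have 2: "continuous_on UNIV (\<lambda>q. STFT (Wigner \<tau> \<phi> \<phi>) \<sigma> (wigner_mid \<tau> (fst q) (snd q)) (wigner_freq (fst q) (snd q)))"
    using continuous_on_compose2[OF STFT_continuous[OF \<sigma> Wigner_schwartz[OF \<phi> \<phi>, of \<tau>]],
        where s = UNIV and f = "\<lambda>q. (wigner_mid \<tau> (fst q) (snd q), wigner_freq (fst q) (snd q))"]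
    by (simp add: wigner_mid_def wigner_freq_def continuous_intros)
  have 3: "continuous_on UNIV (\<lambda>q. cnj (wigner_phase \<tau> (fst q) (snd q :: 'a \<times> 'a)))"
    unfolding wigner_phase_def wigner_mid_def cis_conv_exp by (auto intro!: continuous_intros)
  have "continuous_on UNIV ?G"
    unfolding case_prod_beta by (intro continuous_on_mult 1 2 3)
  then have "?G \<in> borel_measurable borel" by (rule borel_measurable_continuous_onI)
  then have G: "?G \<in> borel_measurable (borel \<Otimes>\<^sub>M borel)" by (simp add: borel_prod)
  have n: "0 < (\<integral>s. (cmod (\<phi> s))\<^sup>2 \<partial>lborel)" (is "0 < ?n") using assms(3,4) by (rule schwartz_norm2_pos)
  have "STFT \<phi> (OP \<tau> \<sigma> f) (fst w) (snd w) = (\<integral>v. ?G (w, v) \<partial>lborel) / of_real ?n" for w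
    using STFT_OP_inversion[OF \<sigma> f \<phi>, of \<tau> "fst w" "snd w"] n by (simp add: field_simps)
  moreover have "(\<lambda>w. (\<integral>v. ?G (w, v) \<partial>lborel)) \<in> borel_measurable borel"
    by (rule lborel.borel_measurable_lebesgue_integral) (use G in \<open>simp add: case_prod_beta cong: measurable_cong_sets\<close>)
  ultimately show "(\<lambda>w. STFT \<phi> (OP \<tau> \<sigma> f) (fst w) (snd w)) \<in> borel_measurable borel" by simp
qed

text \<open>Matrix formula, window change from \<Phi> to \<open>Wigner \<tau> \<phi> \<phi>\<close>,
  then Tonelli. For fixed \<zeta> the inner integral is a convolution of
  \<open>cmod (stft \<phi> f v)\<close> with a product kernel, displaced by the shift that \<zeta>
  encodes.\<close>

lemma STFT_OP_bound:
  fixes \<phi> :: "'a::euclidean_space \<Rightarrow> complex"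
  assumes \<sigma>: "\<sigma> \<in> tempered_distributions" and \<phi>: "\<phi> \<in> schwartz" "\<phi> \<noteq> (\<lambda>_. 0)"
    and \<Phi>: "\<Phi> \<in> schwartz" "\<Phi> \<noteq> (\<lambda>_. 0)" and N: "0 \<le> N"
  obtains C where "0 \<le> C" "\<And>f x \<xi>. f \<in> schwartz \<Longrightarrow> ennreal (cmod (STFT \<phi> (OP \<tau> \<sigma> f) x \<xi>))
    \<le> ennreal C * (\<integral>\<^sup>+\<zeta>. sup_STFT \<Phi> \<sigma> \<zeta> * (\<integral>\<^sup>+v. ennreal (cmod (stft \<phi> f v))
      * (ennreal (\<langle>x - fst v + snd \<zeta>\<rangle> powr (-N)) * ennreal (\<langle>\<xi> - snd v - fst \<zeta>\<rangle> powr (-N))) \<partial>lborel) \<partial>lborel)"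
proof -
  define n where "n = (\<integral>s. (cmod (\<phi> s))\<^sup>2 \<partial>lborel)"
  have n: "0 < n" unfolding n_def by (rule schwartz_norm2_pos[OF \<phi>])
  let ?H = "sup_STFT \<Phi> \<sigma>"
  have [measurable]: "?H \<in> borel_measurable borel" using \<sigma> \<Phi>(1) by (rule sup_STFT_measurable)
  \<comment> \<open>Twice the decay is requested so that it can be divided between position and
    frequency.\<close>
  have N2: "0 \<le> N + N" using N by simp
  obtain C where C: "0 \<le> C" "\<And>z \<zeta>. ennreal (cmod (STFT (Wigner \<tau> \<phi> \<phi>) \<sigma> z \<zeta>))
    \<le> ennreal C * (\<integral>\<^sup>+\<zeta>'. ?H \<zeta>' * ennreal (\<langle>\<zeta> - \<zeta>'\<rangle> powr (-(N + N))) \<partial>lborel)"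
    using STFT_window_change[OF \<sigma> \<Phi> Wigner_schwartz[OF \<phi>(1) \<phi>(1)] N2] by blast
  have "ennreal (cmod (STFT \<phi> (OP \<tau> \<sigma> f) x \<xi>))
    \<le> ennreal (C / n) * (\<integral>\<^sup>+\<zeta>. ?H \<zeta> * (\<integral>\<^sup>+v. ennreal (cmod (stft \<phi> f v))
      * (ennreal (\<langle>x - fst v + snd \<zeta>\<rangle> powr (-N)) * ennreal (\<langle>\<xi> - snd v - fst \<zeta>\<rangle> powr (-N))) \<partial>lborel) \<partial>lborel)"
    if f: "f \<in> schwartz" for f x \<xi>
  proof -
    let ?E = "\<lambda>v \<zeta>. ennreal (\<langle>x - fst v + snd \<zeta>\<rangle> powr (-N)) * ennreal (\<langle>\<xi> - snd v - fst \<zeta>\<rangle> powr (-N))"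
    let ?F = "\<lambda>v. ennreal (cmod (stft \<phi> f v))"
    have [measurable]: "stft \<phi> f \<in> borel_measurable borel"
      by (rule schwartz_measurable[OF stft_schwartz[OF f \<phi>(1)]])
    have "ennreal n * ennreal (cmod (STFT \<phi> (OP \<tau> \<sigma> f) x \<xi>)) = ennreal (cmod (of_real n * STFT \<phi> (OP \<tau> \<sigma> f) x \<xi>))"
      using n by (simp add: norm_mult ennreal_mult)
    also have "\<dots> \<le> (\<integral>\<^sup>+v. ennreal (cmod (stft \<phi> f v * (cnj (wigner_phase \<tau> (x, \<xi>) v)
        * STFT (Wigner \<tau> \<phi> \<phi>) \<sigma> (wigner_mid \<tau> (x, \<xi>) v) (wigner_freq (x, \<xi>) v)))) \<partial>lborel)"
      unfolding n_def STFT_OP_inversion[OF \<sigma> f \<phi>(1)]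
    \<comment> \<open>If the integrand is not integrable, the Bochner integral is 0 by default and
      the bound is trivial.\<close>
    proof (cases "integrable lborel (\<lambda>v. stft \<phi> f v * (cnj (wigner_phase \<tau> (x, \<xi>) v)
        * STFT (Wigner \<tau> \<phi> \<phi>) \<sigma> (wigner_mid \<tau> (x, \<xi>) v) (wigner_freq (x, \<xi>) v)))")
      case True
      then show "ennreal (cmod (\<integral>v. stft \<phi> f v * (cnj (wigner_phase \<tau> (x, \<xi>) v)
        * STFT (Wigner \<tau> \<phi> \<phi>) \<sigma> (wigner_mid \<tau> (x, \<xi>) v) (wigner_freq (x, \<xi>) v)) \<partial>lborel)) \<le> (\<integral>\<^sup>+v. ennreal (cmod (stft \<phi> f v * (cnj (wigner_phase \<tau> (x, \<xi>) v)
        * STFT (Wigner \<tau> \<phi> \<phi>) \<sigma> (wigner_mid \<tau> (x, \<xi>) v) (wigner_freq (x, \<xi>) v)))) \<partial>lborel)"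
        by (rule integral_norm_bound_ennreal)
    qed (simp add: not_integrable_integral_eq)
    also have "\<dots> \<le> (\<integral>\<^sup>+v. ?F v * (ennreal C * (\<integral>\<^sup>+\<zeta>. ?H \<zeta> * ?E v \<zeta> \<partial>lborel)) \<partial>lborel)"
    proof (rule nn_integral_mono)
      fix v
      have "cmod (stft \<phi> f v * (cnj (wigner_phase \<tau> (x, \<xi>) v)
        * STFT (Wigner \<tau> \<phi> \<phi>) \<sigma> (wigner_mid \<tau> (x, \<xi>) v) (wigner_freq (x, \<xi>) v)))
        = cmod (stft \<phi> f v) * cmod (STFT (Wigner \<tau> \<phi> \<phi>) \<sigma> (wigner_mid \<tau> (x, \<xi>) v) (wigner_freq (x, \<xi>) v))"
        by (simp add: norm_mult wigner_phase_def)
      also have "ennreal \<dots> \<le> ?F v * (ennreal C * (\<integral>\<^sup>+\<zeta>. ?H \<zeta> * ennreal (\<langle>wigner_freq (x, \<xi>) v - \<zeta>\<rangle> powr (-(N + N))) \<partial>lborel))"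
        unfolding ennreal_mult[OF norm_ge_zero norm_ge_zero] by (rule mult_left_mono[OF C(2) zero_le])
      also have "\<dots> \<le> ?F v * (ennreal C * (\<integral>\<^sup>+\<zeta>. ?H \<zeta> * ?E v \<zeta> \<partial>lborel))"
      proof (intro mult_left_mono nn_integral_mono)
        fix \<zeta> :: "'a \<times> 'a"
        have eq: "wigner_freq (x, \<xi>) v - \<zeta> = (\<xi> - snd v - fst \<zeta>, - (x - fst v + snd \<zeta>))"
          by (simp add: wigner_freq_def prod_eq_iff)
        have "\<langle>wigner_freq (x, \<xi>) v - \<zeta>\<rangle> powr (-(N + N)) \<le> \<langle>x - fst v + snd \<zeta>\<rangle> powr (-N) * \<langle>\<xi> - snd v - fst \<zeta>\<rangle> powr (-N)"
          using jb_powr_Pair_le[OF N N, of "\<xi> - snd v - fst \<zeta>" "- (x - fst v + snd \<zeta>)"]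
          unfolding eq jb_minus by (simp add: mult.commute)
        then show "ennreal (\<langle>wigner_freq (x, \<xi>) v - \<zeta>\<rangle> powr (-(N + N))) \<le> ?E v \<zeta>"
          by (subst ennreal_mult[symmetric]) (auto intro: ennreal_leI)
      qed auto
      finally show "ennreal (cmod (stft \<phi> f v * (cnj (wigner_phase \<tau> (x, \<xi>) v)
        * STFT (Wigner \<tau> \<phi> \<phi>) \<sigma> (wigner_mid \<tau> (x, \<xi>) v) (wigner_freq (x, \<xi>) v))))
        \<le> ?F v * (ennreal C * (\<integral>\<^sup>+\<zeta>. ?H \<zeta> * ?E v \<zeta> \<partial>lborel))" .
    qed
    also have "\<dots> = (\<integral>\<^sup>+v. (\<integral>\<^sup>+\<zeta>. ennreal C * (?H \<zeta> * (?F v * ?E v \<zeta>)) \<partial>lborel) \<partial>lborel)"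
      by (subst nn_integral_cmult[symmetric], measurable)+ (simp add: mult_ac)
    also have "\<dots> = (\<integral>\<^sup>+\<zeta>. (\<integral>\<^sup>+v. ennreal C * (?H \<zeta> * (?F v * ?E v \<zeta>)) \<partial>lborel) \<partial>lborel)"
      by (rule lborel_pair.Fubini') measurable
    also have "\<dots> = (\<integral>\<^sup>+\<zeta>. ennreal C * (?H \<zeta> * (\<integral>\<^sup>+v. ?F v * ?E v \<zeta> \<partial>lborel)) \<partial>lborel)"
      by (simp add: nn_integral_cmult)
    also have "\<dots> = ennreal C * (\<integral>\<^sup>+\<zeta>. ?H \<zeta> * (\<integral>\<^sup>+v. ?F v * ?E v \<zeta> \<partial>lborel) \<partial>lborel)"
      by (rule nn_integral_cmult) measurable
    finally have le: "ennreal n * ennreal (cmod (STFT \<phi> (OP \<tau> \<sigma> f) x \<xi>)) \<le> \<dots>" .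
    have "ennreal (cmod (STFT \<phi> (OP \<tau> \<sigma> f) x \<xi>)) = ennreal (1 / n) * (ennreal n * ennreal (cmod (STFT \<phi> (OP \<tau> \<sigma> f) x \<xi>)))"
      using n by (simp add: mult.assoc[symmetric] ennreal_mult[symmetric])
    also have "\<dots> \<le> ennreal (1 / n) * (ennreal C * (\<integral>\<^sup>+\<zeta>. ?H \<zeta> * (\<integral>\<^sup>+v. ?F v * ?E v \<zeta> \<partial>lborel) \<partial>lborel))"
      by (rule mult_left_mono[OF le]) simp
    also have "\<dots> = ennreal (C / n) * (\<integral>\<^sup>+\<zeta>. ?H \<zeta> * (\<integral>\<^sup>+v. ?F v * ?E v \<zeta> \<partial>lborel) \<partial>lborel)"
      using n C(1) by (simp add: mult.assoc[symmetric] ennreal_mult[symmetric])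
    finally show ?thesis .
  qed
  then show ?thesis using C(1) n by (intro that[of "C / n"]) auto
qed

subsection \<open>Lebesgue norms of extended nonnegative functions\<close>

lemma epowr_top [simp]: "ennreal_powr top r = top"
  by (simp add: ennreal_powr_def)

lemma epowr_ennreal: "0 \<le> x \<Longrightarrow> ennreal_powr (ennreal x) r = ennreal (x powr r)"
  by (simp add: ennreal_powr_def)

lemma epowr_0 [simp]: "ennreal_powr 0 r = 0"
  by (simp add: ennreal_powr_def)

lemma ennreal_cases_real:
  obtains (real) a where "0 \<le> a" "x = ennreal a" | (top) "x = \<infinity>"
  by (cases x) auto

lemma epowr_mono: "x \<le> y \<Longrightarrow> 0 \<le> r \<Longrightarrow> ennreal_powr x r \<le> ennreal_powr y r"
  by (cases x rule: ennreal_cases_real; cases y rule: ennreal_cases_real)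
    (auto simp: epowr_ennreal powr_mono2 top_unique intro!: ennreal_leI)

lemma epowr_mult: "0 < r \<Longrightarrow> ennreal_powr (x * y) r = ennreal_powr x r * ennreal_powr y r"
proof -
  have top: "ennreal_powr (\<infinity> * z) r = \<infinity> * ennreal_powr z r" if "0 < r" for z
    using that by (cases z rule: ennreal_cases_real)
      (auto simp: epowr_ennreal ennreal_top_mult)
  show "0 < r \<Longrightarrow> ennreal_powr (x * y) r = ennreal_powr x r * ennreal_powr y r"
    using top[of x] top[of y]
    by (cases x rule: ennreal_cases_real; cases y rule: ennreal_cases_real)
      (auto simp: epowr_ennreal powr_mult mult.commute simp flip: ennreal_mult)
qed

lemma epowr_epowr: "ennreal_powr (ennreal_powr x a) b = ennreal_powr x (a * b)"
  by (cases x rule: ennreal_cases_real) (auto simp: epowr_ennreal powr_powr)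

lemma epowr_one [simp]: "ennreal_powr x 1 = x"
  by (cases x rule: ennreal_cases_real) (auto simp: epowr_ennreal)

lemma epowr_add: "0 < a \<Longrightarrow> 0 < b \<Longrightarrow> ennreal_powr x (a + b) = ennreal_powr x a * ennreal_powr x b"
  by (cases x rule: ennreal_cases_real) (auto simp: epowr_ennreal powr_add ennreal_mult)

lemma epowr_eq_0_iff: "ennreal_powr x r = 0 \<longleftrightarrow> x = 0"
  by (cases x rule: ennreal_cases_real) (auto simp: epowr_ennreal ennreal_eq_0_iff powr_eq_0_iff order.antisym)

lemma epowr_less_top: "ennreal_powr x r < \<infinity> \<longleftrightarrow> x < \<infinity>"
  by (cases x rule: ennreal_cases_real) (auto simp: epowr_ennreal)

lemma epowr_measurable [measurable]:
  assumes [measurable]: "f \<in> borel_measurable M"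
  shows "(\<lambda>x. ennreal_powr (f x) r) \<in> borel_measurable M"
  unfolding ennreal_powr_def by measurable

lemma real_exponent:
  fixes p :: ennreal
  assumes "1 \<le> p" "p \<noteq> \<infinity>"
  shows "1 \<le> enn2real p" "p = ennreal (enn2real p)" "recip p = 1 / enn2real p"
proof -
  show p: "p = ennreal (enn2real p)" using assms(2) by (simp add: less_top)
  then show 1: "1 \<le> enn2real p" using assms(1) by (metis enn2real_nonneg ennreal_le_iff ennreal_1)
  have "1 / p = ennreal 1 / ennreal (enn2real p)" using p by simp
  also have "\<dots> = ennreal (1 / enn2real p)" using 1 by (intro divide_ennreal) auto
  finally show "recip p = 1 / enn2real p" unfolding recip_def using 1 by simp
qed

lemma recip_top [simp]: "recip top = 0"
  by (simp add: recip_def)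

lemma Lp_norm_top: "Lp_norm top F = esssup lborel F"
  by (simp add: Lp_norm_def)

lemma Lp_norm_real: "p \<noteq> \<infinity> \<Longrightarrow> Lp_norm p F = ennreal_powr (\<integral>\<^sup>+x. ennreal_powr (F x) (enn2real p) \<partial>lborel) (1 / enn2real p)"
  by (simp add: Lp_norm_def)

lemma Lp_norm_powr:
  assumes "1 \<le> p" "p \<noteq> \<infinity>"
  shows "ennreal_powr (Lp_norm p F) (enn2real p) = (\<integral>\<^sup>+x. ennreal_powr (F x) (enn2real p) \<partial>lborel)"
  using real_exponent[OF assms] assms(2) by (simp add: Lp_norm_real epowr_epowr)

lemma Lp_norm_leI:
  assumes p: "1 \<le> p" "p \<noteq> \<infinity>" and "(\<integral>\<^sup>+x. ennreal_powr (F x) (enn2real p) \<partial>lborel) \<le> ennreal_powr B (enn2real p)"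
  shows "Lp_norm p F \<le> B"
proof -
  have "Lp_norm p F \<le> ennreal_powr (ennreal_powr B (enn2real p)) (1 / enn2real p)"
    unfolding Lp_norm_real[OF p(2)] by (rule epowr_mono[OF assms(3)]) simp
  then show ?thesis using real_exponent[OF p] by (simp add: epowr_epowr)
qed

lemma Lp_norm_AE_mono:
  assumes "F \<in> borel_measurable borel" "AE x in lborel. F x \<le> G x"
  shows "Lp_norm p F \<le> Lp_norm p G"
proof (cases "p = \<infinity>")
  case True
  then show ?thesis unfolding True infinity_ennreal_def Lp_norm_top using assms by (intro esssup_AE_mono) auto
next
  case False
  have "AE x in lborel. ennreal_powr (F x) (enn2real p) \<le> ennreal_powr (G x) (enn2real p)"
    using assms(2) by eventually_elim (rule epowr_mono, auto)
  then show ?thesis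
    unfolding Lp_norm_real[OF False] by (intro epowr_mono nn_integral_mono_AE) auto
qed

lemma Lp_norm_mono:
  "F \<in> borel_measurable borel \<Longrightarrow> (\<And>x. F x \<le> G x) \<Longrightarrow> Lp_norm p F \<le> Lp_norm p G"
  by (rule Lp_norm_AE_mono) auto

lemma Lp_norm_cmult_le:
  assumes p: "1 \<le> p" and F[measurable]: "F \<in> borel_measurable borel"
  shows "Lp_norm p (\<lambda>x. c * F x) \<le> c * Lp_norm p F"
proof (cases "p = \<infinity>")
  case True
  have "AE x in lborel. c * F x \<le> c * esssup lborel F"
    using esssup_AE[of F lborel] by eventually_elim (rule mult_left_mono, auto)
  then show ?thesis unfolding True infinity_ennreal_def Lp_norm_top by (intro esssup_I) auto
next
  case False
  note P = real_exponent[OF p False]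
  show ?thesis
  proof (rule Lp_norm_leI[OF p False])
    show "(\<integral>\<^sup>+x. ennreal_powr (c * F x) (enn2real p) \<partial>lborel) \<le> ennreal_powr (c * Lp_norm p F) (enn2real p)"
      using P(1) by (simp add: epowr_mult nn_integral_cmult Lp_norm_powr[OF p False])
  qed
qed

lemma Lp_norm_cmult_ge:
  assumes p: "1 \<le> p" and F[measurable]: "F \<in> borel_measurable borel" and c: "0 < c"
  shows "ennreal c * Lp_norm p F \<le> Lp_norm p (\<lambda>x. ennreal c * F x)"
proof -
  have "Lp_norm p F = Lp_norm p (\<lambda>x. ennreal (1 / c) * (ennreal c * F x))"
    using c by (simp add: mult.assoc[symmetric] ennreal_mult[symmetric])
  also have "\<dots> \<le> ennreal (1 / c) * Lp_norm p (\<lambda>x. ennreal c * F x)"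
    by (rule Lp_norm_cmult_le[OF p]) measurable
  finally have "ennreal c * Lp_norm p F \<le> ennreal c * (ennreal (1 / c) * Lp_norm p (\<lambda>x. ennreal c * F x))"
    by (rule mult_left_mono) simp
  then show ?thesis using c by (simp add: mult.assoc[symmetric] ennreal_mult[symmetric])
qed

lemma Lp_norm_measurable:
  assumes f[measurable]: "(\<lambda>(x, y). f x y) \<in> borel_measurable (M \<Otimes>\<^sub>M borel)"
  shows "(\<lambda>x. Lp_norm p (f x)) \<in> borel_measurable M"
proof (cases "p = \<infinity>")
  case True
  have "(\<lambda>(x, y). f x y) \<in> borel_measurable (M \<Otimes>\<^sub>M lborel)"
    using f by (simp cong: measurable_cong_sets)
  from borel_measurable_esssup[OF sigma_finite_lborel this] True show ?thesis by (simp add: Lp_norm_top)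
next
  case False
  then show ?thesis by (simp add: Lp_norm_real) measurable
qed

lemma Lp_norm_translate:
  assumes [measurable]: "F \<in> borel_measurable borel"
  shows "Lp_norm p (\<lambda>x. F (x + c)) \<le> Lp_norm p F"
proof (cases "p = \<infinity>")
  case True
  have "AE x in distr lborel borel ((+) c). F x \<le> esssup lborel F"
    unfolding lborel_distr_plus by (rule esssup_AE)
  then have "AE x in lborel. F (x + c) \<le> esssup lborel F"
    by (subst (asm) AE_distr_iff) (auto simp: add.commute)
  then show ?thesis unfolding True infinity_ennreal_def Lp_norm_top by (intro esssup_I) auto
next
  case False
  then show ?thesis
    using lborel_nn_integral_affine[of "\<lambda>x. ennreal_powr (F x) (enn2real p)" 1 c]
    by (simp add: Lp_norm_real add.commute)
qed

text \<open>Jensen's inequality for a measure of mass at most \<open>A\<close>, not normalised. It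
  comes from the tangent inequality \<open>t \<le> k * t powr P + l\<close> integrated against the
  density \<open>a\<close>, and is the source of the Minkowski, Hoelder and sup bounds
  below.\<close>

lemma nn_integral_jensen:
  fixes g a :: "'a \<Rightarrow> ennreal"
  assumes [measurable]: "g \<in> borel_measurable M" "a \<in> borel_measurable M"
    and P: "1 \<le> P" and A: "0 < A" "(\<integral>\<^sup>+x. a x \<partial>M) \<le> ennreal A"
  shows "ennreal_powr (\<integral>\<^sup>+x. g x * a x \<partial>M) P \<le> ennreal (A powr (P - 1)) * (\<integral>\<^sup>+x. ennreal_powr (g x) P * a x \<partial>M)"
proof (cases "\<integral>\<^sup>+x. ennreal_powr (g x) P * a x \<partial>M" rule: ennreal_cases_real)
  case top
  then show ?thesis using A(1) by (simp add: ennreal_mult_top)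
next
  case (real B)
  show ?thesis
  proof (cases "B = 0")
    case True
    then have "(\<integral>\<^sup>+x. ennreal_powr (g x) P * a x \<partial>M) = 0" using real by simp
    then have "AE x in M. ennreal_powr (g x) P * a x = 0"
      by (subst (asm) nn_integral_0_iff_AE) auto
    then have "AE x in M. g x * a x = 0" by eventually_elim (auto simp: epowr_eq_0_iff)
    then have "(\<integral>\<^sup>+x. g x * a x \<partial>M) = 0" by (subst nn_integral_0_iff_AE) auto
    then show ?thesis by simp
  next
    case False
    with real have B: "0 < B" by simp
    \<comment> \<open>The tangent inequality is an equality at \<open>t = c\<close>; this choice
      turns the integrated bound into \<open>c * A\<close>, whose P-th power is
      \<open>A powr (P - 1) * B\<close>.\<close>
    define c where "c = (B / A) powr (1 / P)"
    have c: "0 < c" using A B by (simp add: c_def)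
    have cP: "c powr P = B / A" using A B P by (simp add: c_def powr_powr)
    define k where "k = 1 / P * c powr (1 - P)"
    define l where "l = (1 - 1 / P) * c"
    have kl: "0 \<le> k" "0 \<le> l" using P c by (simp_all add: k_def l_def)
    have young: "t \<le> ennreal k * ennreal_powr t P + ennreal l" for t
    proof (cases t rule: ennreal_cases_real)
      case top
      have "0 < k" using P c by (simp add: k_def)
      then show ?thesis using top by (simp add: ennreal_mult_top)
    next
      case (real s)
      have "s \<le> k * s powr P + l"
      proof (cases "s = 0")
        case False
        with real have s: "0 < s" by simp
        have "(s powr P * c powr (1 - P)) powr (1 / P) * c powr (1 - 1 / P) \<le> 1 / P * (s powr P * c powr (1 - P)) + (1 - 1 / P) * c"
          using P c s by (intro Youngs_inequality_0) auto
        moreover have "(s powr P * c powr (1 - P)) powr (1 / P) * c powr (1 - 1 / P) = s"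
        proof -
          have "(s powr P * c powr (1 - P)) powr (1 / P) = s * c powr ((1 - P) / P)"
            using P s by (simp add: powr_mult powr_powr)
          moreover have "c powr ((1 - P) / P) * c powr (1 - 1 / P) = 1"
            using P c by (simp add: powr_add[symmetric] diff_divide_distrib)
          ultimately show ?thesis by simp
        qed
        ultimately show ?thesis by (simp add: k_def l_def mult_ac)
      qed (use kl in simp)
      then have "ennreal s \<le> ennreal (k * s powr P + l)" by (rule ennreal_leI)
      then show ?thesis using real kl by (simp add: epowr_ennreal ennreal_mult)
    qed
    have "(\<integral>\<^sup>+x. g x * a x \<partial>M) \<le> (\<integral>\<^sup>+x. ennreal k * (ennreal_powr (g x) P * a x) + ennreal l * a x \<partial>M)"
    proof (rule nn_integral_mono)
      fix x
      show "g x * a x \<le> ennreal k * (ennreal_powr (g x) P * a x) + ennreal l * a x"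
        using mult_right_mono[OF young[of "g x"], of "a x"] by (simp add: distrib_right mult.assoc)
    qed
    also have "\<dots> = ennreal k * ennreal B + ennreal l * (\<integral>\<^sup>+x. a x \<partial>M)"
      by (subst nn_integral_add) (auto simp: nn_integral_cmult real)
    also have "\<dots> \<le> ennreal k * ennreal B + ennreal l * ennreal A"
      by (intro add_mono mult_left_mono A) auto
    also have "\<dots> = ennreal (k * B + l * A)"
      using kl B A by (simp add: ennreal_mult)
    also have "k * B + l * A = c * A"
    proof -
      have "B = c powr P * A" using cP A by simp
      then have "k * B = 1 / P * (c powr (1 - P) * c powr P) * A" by (simp add: k_def)
      also have "c powr (1 - P) * c powr P = c" using c by (simp add: powr_add[symmetric])
      finally show ?thesis by (simp add: l_def algebra_simps)
    qed
    finally have "ennreal_powr (\<integral>\<^sup>+x. g x * a x \<partial>M) P \<le> ennreal_powr (ennreal (c * A)) P"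
      using P by (intro epowr_mono) auto
    also have "\<dots> = ennreal (A powr (P - 1) * B)"
      using c A B by (simp add: epowr_ennreal powr_mult cP powr_diff)
    also have "\<dots> = ennreal (A powr (P - 1)) * (\<integral>\<^sup>+x. ennreal_powr (g x) P * a x \<partial>M)"
      using real by (simp add: ennreal_mult)
    finally show ?thesis .
  qed
qed

lemma Lp_norm_0_AE:
  assumes p: "1 \<le> p" "p \<noteq> \<infinity>" and [measurable]: "F \<in> borel_measurable borel" and "Lp_norm p F = 0"
  shows "AE x in lborel. F x = 0"
proof -
  have "(\<integral>\<^sup>+x. ennreal_powr (F x) (enn2real p) \<partial>lborel) = 0"
    using Lp_norm_powr[OF p, of F] assms(4) by simp
  then have "AE x in lborel. ennreal_powr (F x) (enn2real p) = 0"
    by (subst (asm) nn_integral_0_iff_AE) auto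
  then show ?thesis by (simp add: epowr_eq_0_iff)
qed

text \<open>At \<open>t = 0\<close> and \<open>t = \<infinity>\<close> the product is 0, hence an
  inequality.\<close>

lemma mult_inverse_le_1: "t * inverse t \<le> (1::ennreal)"
proof (cases t rule: ennreal_cases_real)
  case (real a)
  then show ?thesis
    by (cases "a = 0") (auto simp: inverse_ennreal ennreal_mult[symmetric])
qed simp

text \<open>
  Jensen's inequality for the measure with density \<open>y \<mapsto> Lp_norm p (F (_, y))\<close>, applied to the
  normalised functions, avoids the usual detour through duality.
\<close>

lemma Lp_norm_nn_integral:
  fixes F :: "'a::euclidean_space \<Rightarrow> 'b \<Rightarrow> ennreal"
  assumes M: "sigma_finite_measure M" and p: "1 \<le> p"
    and F: "(\<lambda>(x, y). F x y) \<in> borel_measurable (borel \<Otimes>\<^sub>M M)"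
  shows "Lp_norm p (\<lambda>x. \<integral>\<^sup>+y. F x y \<partial>M) \<le> (\<integral>\<^sup>+y. Lp_norm p (\<lambda>x. F x y) \<partial>M)"
proof -
  interpret M: sigma_finite_measure M by (rule M)
  interpret pair_sigma_finite lborel M ..
  interpret P2: pair_sigma_finite M lborel ..
  have F_l[measurable]: "(\<lambda>(x, y). F x y) \<in> borel_measurable (lborel \<Otimes>\<^sub>M M)"
    using F by (simp cong: measurable_cong_sets)
  have F_sw: "(\<lambda>(y, x). F x y) \<in> borel_measurable (M \<Otimes>\<^sub>M borel)"
    using measurable_compose[OF measurable_pair_swap' F] by (simp add: case_prod_beta')
  define n where "n y = Lp_norm p (\<lambda>x. F x y)" for y
  have n[measurable]: "n \<in> borel_measurable M"
    unfolding n_def by (rule Lp_norm_measurable[OF F_sw])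
  have sec_x[measurable]: "(\<lambda>x. F x y) \<in> borel_measurable borel" if "y \<in> space M" for y
    using measurable_Pair1[OF F that] by simp
  have sec_y[measurable]: "(\<lambda>y. F x y) \<in> borel_measurable M" for x
    using measurable_Pair2[OF F, of x] by simp
  have int[measurable]: "(\<lambda>x. \<integral>\<^sup>+y. F x y \<partial>M) \<in> borel_measurable borel"
    using M.borel_measurable_nn_integral_fst[OF F] by simp
  show ?thesis
  proof (cases "p = \<infinity>")
    case True
    have "AE y in M. AE x in lborel. F x y \<le> n y"
      unfolding n_def True infinity_ennreal_def Lp_norm_top by (rule AE_I2) (rule esssup_AE)
    then have "AE x in lborel. AE y in M. F x y \<le> n y"
      by (subst AE_commute) (use F_l n in measurable)
    then have "AE x in lborel. (\<integral>\<^sup>+y. F x y \<partial>M) \<le> (\<integral>\<^sup>+y. n y \<partial>M)"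
      by eventually_elim (rule nn_integral_mono_AE)
    then show ?thesis
      unfolding True infinity_ennreal_def Lp_norm_top n_def[symmetric, unfolded True infinity_ennreal_def Lp_norm_top] using int by (intro esssup_I) auto
  next
    case False
    define P where "P = enn2real p"
    have P: "1 \<le> P" using real_exponent[OF p False] by (simp add: P_def)
    show ?thesis
    proof (cases "\<integral>\<^sup>+y. n y \<partial>M" rule: ennreal_cases_real)
      case top
      then show ?thesis by (simp add: n_def)
    next
      case (real N)
      have "AE y in M. n y \<noteq> \<infinity>"
        using real by (intro nn_integral_PInf_AE) auto
      \<comment> \<open>Normalising loses nothing: \<open>n y\<close> is finite for almost every
        \<open>y\<close>, and where it is 0 the function \<open>F x y\<close> vanishes for almost
        every \<open>x\<close>.\<close>
      then have "AE y in M. AE x in lborel. F x y = F x y / n y * n y"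
      proof (rule AE_mp[OF _ AE_I2], safe)
        fix y assume y: "y \<in> space M" and fin: "n y \<noteq> \<infinity>"
        show "AE x in lborel. F x y = F x y / n y * n y"
        proof (cases "n y = 0")
          case True
          then have "AE x in lborel. F x y = 0"
            unfolding n_def by (intro Lp_norm_0_AE[OF p False]) (use y in measurable)
          then show ?thesis by eventually_elim simp
        next
          case False
          with fin obtain r where "0 < r" "n y = ennreal r"
            by (cases "n y" rule: ennreal_cases_real) (auto simp: less_le)
          then show ?thesis
            by (intro AE_I2) (simp add: divide_ennreal_def mult.assoc inverse_ennreal ennreal_mult[symmetric])
        qed
      qed
      then have "AE x in lborel. AE y in M. F x y = F x y / n y * n y"
        by (subst AE_commute) (use F_l n in measurable)
      then have AE: "AE x in lborel. (\<integral>\<^sup>+y. F x y \<partial>M) = (\<integral>\<^sup>+y. F x y / n y * n y \<partial>M)"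
        by eventually_elim (rule nn_integral_cong_AE)
      \<comment> \<open>\<open>A\<close> is kept apart from the mass \<open>N\<close> because
        Jensen's inequality asks for a positive bound and \<open>N\<close> may be 0.\<close>
      have le: "(\<integral>\<^sup>+x. ennreal_powr (\<integral>\<^sup>+y. F x y \<partial>M) P \<partial>lborel) \<le> ennreal (A powr (P - 1)) * ennreal N" if A: "0 < A" "N \<le> A" for A
      proof -
        have "(\<integral>\<^sup>+x. ennreal_powr (\<integral>\<^sup>+y. F x y \<partial>M) P \<partial>lborel) = (\<integral>\<^sup>+x. ennreal_powr (\<integral>\<^sup>+y. F x y / n y * n y \<partial>M) P \<partial>lborel)"
          using AE by (intro nn_integral_cong_AE) (auto elim: eventually_mono)
        also have "\<dots> \<le> (\<integral>\<^sup>+x. ennreal (A powr (P - 1)) * (\<integral>\<^sup>+y. ennreal_powr (F x y / n y) P * n y \<partial>M) \<partial>lborel)"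
          using A real P by (intro nn_integral_mono nn_integral_jensen) (auto intro: ennreal_leI)
        also have "\<dots> = ennreal (A powr (P - 1)) * (\<integral>\<^sup>+x. (\<integral>\<^sup>+y. ennreal_powr (F x y / n y) P * n y \<partial>M) \<partial>lborel)"
          by (rule nn_integral_cmult) measurable
        also have "(\<integral>\<^sup>+x. (\<integral>\<^sup>+y. ennreal_powr (F x y / n y) P * n y \<partial>M) \<partial>lborel)
            = (\<integral>\<^sup>+y. (\<integral>\<^sup>+x. ennreal_powr (F x y / n y) P * n y \<partial>lborel) \<partial>M)"
          by (rule Fubini'[symmetric]) measurable
        also have "\<dots> \<le> (\<integral>\<^sup>+y. n y \<partial>M)"
        proof (rule nn_integral_mono)
          fix y assume y: "y \<in> space M"
          have [measurable]: "(\<lambda>x. F x y) \<in> borel_measurable lborel" using sec_x[OF y] by simp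
          have "(\<integral>\<^sup>+x. ennreal_powr (F x y / n y) P * n y \<partial>lborel)
              = (\<integral>\<^sup>+x. ennreal_powr (F x y) P \<partial>lborel) * ennreal_powr (inverse (n y)) P * n y"
            using P by (simp add: divide_ennreal_def epowr_mult nn_integral_multc)
          also have "\<dots> = ennreal_powr (n y * inverse (n y)) P * n y"
            using P Lp_norm_powr[OF p False, of "\<lambda>x. F x y"] by (simp add: P_def n_def epowr_mult)
          also have "\<dots> \<le> ennreal_powr 1 P * n y"
            using P by (intro mult_right_mono epowr_mono mult_inverse_le_1) auto
          also have "\<dots> = n y" using epowr_ennreal[of 1 P] by simp
          finally show "(\<integral>\<^sup>+x. ennreal_powr (F x y / n y) P * n y \<partial>lborel) \<le> n y" .
        qed
        also have "(\<integral>\<^sup>+y. n y \<partial>M) = ennreal N" by (rule real)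
        finally show ?thesis by (simp add: mult_left_mono)
      qed
      have "(\<integral>\<^sup>+x. ennreal_powr (\<integral>\<^sup>+y. F x y \<partial>M) P \<partial>lborel) \<le> ennreal_powr (ennreal N) P"
      proof (cases "N = 0")
        case True
        then show ?thesis using le[of 1] by simp
      next
        case False
        then have "N powr (P - 1) * N = N powr P" using real P by (simp add: powr_diff)
        then show ?thesis using le[of N] real False by (simp add: epowr_ennreal ennreal_mult[symmetric])
      qed
      then show ?thesis unfolding n_def[symmetric] real P_def by (intro Lp_norm_leI[OF p False])
    qed
  qed
qed

text \<open>After the substitution \<open>z = x - y\<close>, Minkowski's inequality in
  \<open>z\<close> reduces the claim to translates of \<open>F\<close>.\<close>

lemma Lp_norm_convolution:
  fixes F :: "'a::euclidean_space \<Rightarrow> ennreal"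
  assumes p: "1 \<le> p" and F[measurable]: "F \<in> borel_measurable borel"
  shows "Lp_norm p (\<lambda>x. \<integral>\<^sup>+y. F y * ennreal (\<langle>x - y\<rangle> powr (-r)) \<partial>lborel)
    \<le> (\<integral>\<^sup>+x. ennreal (\<langle>x::'a\<rangle> powr (-r)) \<partial>lborel) * Lp_norm p F"
proof -
  have "(\<integral>\<^sup>+y. F y * ennreal (\<langle>x - y\<rangle> powr (-r)) \<partial>lborel) = (\<integral>\<^sup>+z. F (x - z) * ennreal (\<langle>z\<rangle> powr (-r)) \<partial>lborel)" for x
    using lborel_nn_integral_affine[of "\<lambda>y. F y * ennreal (\<langle>x - y\<rangle> powr (-r))" "-1" x] by simp
  then have "Lp_norm p (\<lambda>x. \<integral>\<^sup>+y. F y * ennreal (\<langle>x - y\<rangle> powr (-r)) \<partial>lborel)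
      = Lp_norm p (\<lambda>x. \<integral>\<^sup>+z. F (x - z) * ennreal (\<langle>z\<rangle> powr (-r)) \<partial>lborel)" by simp
  also have "\<dots> \<le> (\<integral>\<^sup>+z. Lp_norm p (\<lambda>x. F (x - z) * ennreal (\<langle>z\<rangle> powr (-r))) \<partial>lborel)"
    by (rule Lp_norm_nn_integral[OF sigma_finite_lborel p]) measurable
  also have "\<dots> \<le> (\<integral>\<^sup>+z. ennreal (\<langle>z::'a\<rangle> powr (-r)) * Lp_norm p F \<partial>lborel)"
  proof (rule nn_integral_mono)
    fix z
    have "Lp_norm p (\<lambda>x. F (x - z) * ennreal (\<langle>z\<rangle> powr (-r))) = Lp_norm p (\<lambda>x. ennreal (\<langle>z\<rangle> powr (-r)) * F (x + (- z)))"
      by (simp add: mult.commute)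
    also have "\<dots> \<le> ennreal (\<langle>z\<rangle> powr (-r)) * Lp_norm p (\<lambda>x. F (x + (- z)))"
      by (rule Lp_norm_cmult_le[OF p]) measurable
    also have "\<dots> \<le> ennreal (\<langle>z\<rangle> powr (-r)) * Lp_norm p F"
      by (intro mult_left_mono Lp_norm_translate F) simp
    finally show "Lp_norm p (\<lambda>x. F (x - z) * ennreal (\<langle>z\<rangle> powr (-r))) \<le> ennreal (\<langle>z\<rangle> powr (-r)) * Lp_norm p F" .
  qed
  also have "\<dots> = (\<integral>\<^sup>+x. ennreal (\<langle>x::'a\<rangle> powr (-r)) \<partial>lborel) * Lp_norm p F"
    by (rule nn_integral_multc) measurable
  finally show ?thesis .
qed

lemma jb_integral_real:
  assumes "real DIM('a) < r"
  obtains A where "0 < A" "(\<integral>\<^sup>+x. ennreal (\<langle>x::'a::euclidean_space\<rangle> powr (-r)) \<partial>lborel) \<le> ennreal A"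
proof -
  obtain B where B: "0 \<le> B" "(\<integral>\<^sup>+x. ennreal (\<langle>x::'a\<rangle> powr (-r)) \<partial>lborel) = ennreal B"
    using nn_integral_jb_finite[OF assms] by (cases rule: ennreal_cases_real) auto
  then show ?thesis by (intro that[of "B + 1"]) (auto intro: ennreal_leI)
qed

section \<open>Reciprocal exponents, the index condition, and weighted convolution estimates\<close>

lemma recip_bounds:
  assumes "1 \<le> p"
  shows "0 \<le> recip p" "recip p \<le> 1" "recip p = 1 \<Longrightarrow> p = 1" "recip p = 0 \<Longrightarrow> p = \<infinity>"
proof -
  show "0 \<le> recip p" by (simp add: recip_def)
  show "recip p \<le> 1" "recip p = 1 \<Longrightarrow> p = 1" "recip p = 0 \<Longrightarrow> p = \<infinity>"
  proof -
    have "recip p \<le> 1 \<and> (recip p = 1 \<longrightarrow> p = 1) \<and> (recip p = 0 \<longrightarrow> p = \<infinity>)"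
    proof (cases "p = \<infinity>")
      case False
      define P where "P = enn2real p"
      have P: "1 \<le> P" "p = ennreal P" "recip p = 1 / P"
        unfolding P_def using real_exponent[OF assms False] by blast+
      then have "recip p = 1 \<Longrightarrow> P = 1" by (simp add: field_simps)
      with P show ?thesis by auto
    qed simp
    then show "recip p \<le> 1" "recip p = 1 \<Longrightarrow> p = 1" "recip p = 0 \<Longrightarrow> p = \<infinity>" by blast+
  qed
qed

lemma recip_le_iff:
  assumes "1 \<le> p" "1 \<le> q"
  shows "recip q \<le> recip p \<longleftrightarrow> p \<le> q"
proof (cases "p = \<infinity> \<or> q = \<infinity>")
  case True
  then show ?thesis
    using recip_bounds[OF assms(1)] recip_bounds[OF assms(2)] by (auto simp: top_unique)
next
  case False
  define P Q where "P = enn2real p" and "Q = enn2real q"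
  have PQ: "p = ennreal P" "1 \<le> P" "q = ennreal Q" "1 \<le> Q" "recip p = 1 / P" "recip q = 1 / Q"
    unfolding P_def Q_def using False real_exponent[OF assms(1)] real_exponent[OF assms(2)] by blast+
  have "p \<le> q \<longleftrightarrow> P \<le> Q" using PQ(2,4) by (subst PQ(1), subst PQ(3)) simp
  moreover have "recip q \<le> recip p \<longleftrightarrow> P \<le> Q"
    unfolding PQ(5,6) using PQ(2,4) by (simp add: field_simps)
  ultimately show ?thesis by simp
qed

text \<open>Given the signs, \<open>recip p1 + s1 / real d = 0\<close> makes both summands 0, and
  \<open>recip p2 + s2 / real d = 1\<close> forces \<open>recip p2 = 1\<close> and
  \<open>s2 = 0\<close>. If \<open>p1 \<le> p2\<close> but the strict inequality fails, all
  comparisons are equalities, which is the first alternative. Both directions of the theorem are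
  proved in this form.\<close>

lemma index_condition_iff:
  assumes "1 \<le> p1" "1 \<le> p2" and d: "0 < d"
  shows "index_condition d p1 s1 p2 s2 \<longleftrightarrow>
    s2 \<le> 0 \<and> 0 \<le> s1 \<and> (p1 \<le> p2 \<or> recip p2 + s2 / real d < recip p1 + s1 / real d)"
proof
  assume "index_condition d p1 s1 p2 s2"
  then show "s2 \<le> 0 \<and> 0 \<le> s1 \<and> (p1 \<le> p2 \<or> recip p2 + s2 / real d < recip p1 + s1 / real d)"
    by (auto simp: index_condition_def)
next
  note b = recip_bounds[OF assms(1)] recip_bounds[OF assms(2)]
  assume *: "s2 \<le> 0 \<and> 0 \<le> s1 \<and> (p1 \<le> p2 \<or> recip p2 + s2 / real d < recip p1 + s1 / real d)"
  then have sd: "s2 / real d \<le> 0" "0 \<le> s1 / real d" using d by (auto simp: divide_le_0_iff)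
  have 1: "(p1, s1) = (\<infinity>, 0)" if "recip p1 + s1 / real d = 0"
    using that b sd d by (auto simp: add_nonneg_eq_0_iff)
  have 2: "(p2, s2) = (1, 0)" if "recip p2 + s2 / real d = 1"
  proof -
    have "recip p2 = 1" "s2 / real d = 0" using that b sd by linarith+
    then show ?thesis using b d by auto
  qed
  show "index_condition d p1 s1 p2 s2"
  proof (cases "recip p2 + s2 / real d < recip p1 + s1 / real d")
    case True
    then show ?thesis using * 1 2 by (auto simp: index_condition_def)
  next
    case False
    then have "p1 \<le> p2" using * by blast
    then have "recip p2 \<le> recip p1" using recip_le_iff assms by blast
    then have "recip p1 = recip p2" "s2 / real d = 0" "s1 / real d = 0" using False sd by linarith+
    moreover have "p2 \<le> p1" using \<open>recip p1 = recip p2\<close> recip_le_iff[OF assms(2,1)] by simp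
    ultimately show ?thesis using d \<open>p1 \<le> p2\<close> by (auto simp: index_condition_def)
  qed
qed

text \<open>Interpolation by hand: the convolution \<open>T\<close> is bounded in the
  \<open>p1\<close>-norm by Young's inequality and uniformly by Jensen's, the kernel being at most
  1. The power \<open>Q\<close> of \<open>T\<close> is then the power \<open>Q - P\<close>, bounded
  uniformly, times the power \<open>P\<close>.\<close>

lemma Lp_norm_convolution_exponents:
  assumes p: "1 \<le> p1" "p1 \<le> p2" and r: "real DIM('a) < r"
  obtains C where "0 \<le> C" "\<And>F :: 'a::euclidean_space \<Rightarrow> ennreal. F \<in> borel_measurable borel \<Longrightarrow>
    Lp_norm p2 (\<lambda>x. \<integral>\<^sup>+y. F y * ennreal (\<langle>x - y\<rangle> powr (-r)) \<partial>lborel) \<le> ennreal C * Lp_norm p1 F"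
proof -
  have p2: "1 \<le> p2" using p by simp
  obtain A where A: "0 < A" "(\<integral>\<^sup>+x. ennreal (\<langle>x::'a\<rangle> powr (-r)) \<partial>lborel) \<le> ennreal A"
    using jb_integral_real[OF r] by blast
  have young: "Lp_norm p1 (\<lambda>x. \<integral>\<^sup>+y. F y * ennreal (\<langle>x - y\<rangle> powr (-r)) \<partial>lborel) \<le> ennreal A * Lp_norm p1 F"
    if "F \<in> borel_measurable borel" for F :: "'a \<Rightarrow> ennreal"
    using order_trans[OF Lp_norm_convolution[OF p(1) that] mult_right_mono[OF A(2)]] by simp
  show ?thesis
  proof (cases "p1 = p2")
    case True
    then show ?thesis using young A(1) by (intro that[of A]) auto
  next
    case False
    then have fin: "p1 \<noteq> \<infinity>" using p by (auto simp: top_unique)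
    define P where "P = enn2real p1"
    have P: "1 \<le> P" "p1 = ennreal P" unfolding P_def using real_exponent[OF p(1) fin] by blast+
    \<comment> \<open>The larger of the constants of the two bounds, so that the same
      \<open>?S\<close> serves in both.\<close>
    define K where "K = max A (A powr ((P - 1) / P))"
    have K: "0 < K" "A \<le> K" "A powr ((P - 1) / P) \<le> K" using A(1) by (auto simp: K_def)
    have "Lp_norm p2 (\<lambda>x. \<integral>\<^sup>+y. F y * ennreal (\<langle>x - y\<rangle> powr (-r)) \<partial>lborel) \<le> ennreal K * Lp_norm p1 F"
      if F[measurable]: "F \<in> borel_measurable borel" for F :: "'a \<Rightarrow> ennreal"
    proof -
      define T where "T x = (\<integral>\<^sup>+y. F y * ennreal (\<langle>x - y\<rangle> powr (-r)) \<partial>lborel)" for x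
      have T[measurable]: "T \<in> borel_measurable borel" unfolding T_def by measurable
      let ?S = "ennreal K * Lp_norm p1 F"
      have sup: "T x \<le> ?S" for x
      proof -
        have Ax: "(\<integral>\<^sup>+y. ennreal (\<langle>x - y\<rangle> powr (-r)) \<partial>lborel) \<le> ennreal A"
          using A(2) lborel_nn_integral_affine[of "\<lambda>y. ennreal (\<langle>y\<rangle> powr (-r))" "-1" x] by simp
        have "ennreal_powr (T x) P \<le> ennreal (A powr (P - 1)) * (\<integral>\<^sup>+y. ennreal_powr (F y) P * ennreal (\<langle>x - y\<rangle> powr (-r)) \<partial>lborel)"
          unfolding T_def by (rule nn_integral_jensen[OF _ _ P(1) A(1) Ax]) measurable
        also have "\<dots> \<le> ennreal (A powr (P - 1)) * (\<integral>\<^sup>+y. ennreal_powr (F y) P * 1 \<partial>lborel)"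
        proof (intro mult_left_mono nn_integral_mono)
          show "ennreal (\<langle>x - y\<rangle> powr (-r)) \<le> 1" for y
            using r jb_ge_1[of "x - y"] powr_mono[of "-r" 0 "\<langle>x - y\<rangle>"] by (simp add: ennreal_le_1)
        qed auto
        also have "\<dots> = ennreal (A powr (P - 1)) * ennreal_powr (Lp_norm p1 F) P"
          by (simp add: P_def Lp_norm_powr[OF p(1) fin])
        finally have "ennreal_powr (ennreal_powr (T x) P) (1 / P) \<le> ennreal_powr (ennreal (A powr (P - 1)) * ennreal_powr (Lp_norm p1 F) P) (1 / P)"
          using P by (intro epowr_mono) auto
        then have "T x \<le> ennreal (A powr ((P - 1) / P)) * Lp_norm p1 F"
          using P by (simp add: epowr_mult epowr_epowr epowr_ennreal powr_powr)
        also have "\<dots> \<le> ?S" by (intro mult_right_mono ennreal_leI K) simp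
        finally show ?thesis .
      qed
      show ?thesis
      proof (cases "p2 = \<infinity>")
        case True
        then show ?thesis
          unfolding True infinity_ennreal_def Lp_norm_top T_def[symmetric] using sup by (intro esssup_I) auto
      next
        case p2_fin: False
        define Q where "Q = enn2real p2"
        have Q: "p2 = ennreal Q" "1 \<le> Q" unfolding Q_def using real_exponent[OF p2 p2_fin] by blast+
        have PQ: "P < Q" using p False P Q by (simp add: less_le)
        have "(\<integral>\<^sup>+x. ennreal_powr (T x) Q \<partial>lborel) = (\<integral>\<^sup>+x. ennreal_powr (T x) (Q - P) * ennreal_powr (T x) P \<partial>lborel)"
          using PQ P by (simp flip: epowr_add)
        also have "\<dots> \<le> (\<integral>\<^sup>+x. ennreal_powr ?S (Q - P) * ennreal_powr (T x) P \<partial>lborel)"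
          using PQ by (intro nn_integral_mono mult_right_mono epowr_mono sup) auto
        also have "\<dots> = ennreal_powr ?S (Q - P) * ennreal_powr (Lp_norm p1 T) P"
          by (simp add: nn_integral_cmult P_def Lp_norm_powr[OF p(1) fin])
        also have "\<dots> \<le> ennreal_powr ?S (Q - P) * ennreal_powr ?S P"
        proof (intro mult_left_mono epowr_mono)
          show "Lp_norm p1 T \<le> ?S"
            unfolding T_def by (rule order_trans[OF young[OF F] mult_right_mono]) (auto intro: ennreal_leI K)
        qed (use P in auto)
        also have "\<dots> = ennreal_powr ?S Q" using PQ P by (simp flip: epowr_add)
        finally show ?thesis unfolding T_def[symmetric] Q_def by (intro Lp_norm_leI[OF p2 p2_fin])
      qed
    qed
    then show ?thesis using K(1) by (intro that[of K]) auto
  qed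
qed

text \<open>Hoelder's inequality with \<open>1/p2 = 1/p1 + 1/R\<close>. The constant depends on the
  multiplier \<open>K\<close> only through the bound \<open>A\<close> for the integral of
  \<open>K powr R\<close>; this uniformity is needed for translated weights.\<close>

lemma Lp_norm_holder:
  fixes p1 p2 :: ennreal
  assumes p: "1 \<le> p2" "p2 < p1" and R: "R = 1 / (recip p2 - recip p1)" and A: "0 < A"
  obtains C where "0 \<le> C" "\<And>(F :: 'a::euclidean_space \<Rightarrow> ennreal) K. F \<in> borel_measurable borel \<Longrightarrow> K \<in> borel_measurable borel \<Longrightarrow>
    (\<And>x. 0 < K x) \<Longrightarrow> (\<integral>\<^sup>+x. ennreal (K x powr R) \<partial>lborel) \<le> ennreal A \<Longrightarrow>
    Lp_norm p2 (\<lambda>x. F x * ennreal (K x)) \<le> ennreal C * Lp_norm p1 F"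
proof -
  have p1: "1 \<le> p1" using p by (meson less_imp_le order_trans)
  have fin: "p2 \<noteq> \<infinity>" using p by auto
  define Q where "Q = enn2real p2"
  have Q: "1 \<le> Q" "p2 = ennreal Q" "recip p2 = 1 / Q" unfolding Q_def using real_exponent[OF p(1) fin] by blast+
  show ?thesis
  proof (cases "p1 = \<infinity>")
    case True
    then have RQ: "R = Q" using R Q by simp
    have "Lp_norm p2 (\<lambda>x. F x * ennreal (K x)) \<le> ennreal (A powr (1 / Q)) * Lp_norm p1 F"
      if [measurable]: "F \<in> borel_measurable borel" "K \<in> borel_measurable borel" and K: "\<And>x. 0 < K x"
        "(\<integral>\<^sup>+x. ennreal (K x powr R) \<partial>lborel) \<le> ennreal A" for F :: "'a \<Rightarrow> ennreal" and K
    proof (rule Lp_norm_leI[OF p(1) fin], unfold Q_def[symmetric])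
      let ?L = "Lp_norm p1 F"
      have "AE x in lborel. F x \<le> ?L"
        unfolding True infinity_ennreal_def Lp_norm_top by (rule esssup_AE)
      then have "AE x in lborel. ennreal_powr (F x * ennreal (K x)) Q \<le> ennreal_powr ?L Q * ennreal (K x powr R)"
      proof eventually_elim
        case (elim x)
        have "ennreal_powr (F x * ennreal (K x)) Q \<le> ennreal_powr (?L * ennreal (K x)) Q"
          using elim Q by (intro epowr_mono mult_right_mono) auto
        then show ?case using Q K(1)[of x] by (simp add: epowr_mult epowr_ennreal RQ)
      qed
      then have "(\<integral>\<^sup>+x. ennreal_powr (F x * ennreal (K x)) Q \<partial>lborel) \<le> (\<integral>\<^sup>+x. ennreal_powr ?L Q * ennreal (K x powr R) \<partial>lborel)"
        by (rule nn_integral_mono_AE)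
      also have "\<dots> = ennreal_powr ?L Q * (\<integral>\<^sup>+x. ennreal (K x powr R) \<partial>lborel)"
        by (rule nn_integral_cmult) measurable
      also have "\<dots> \<le> ennreal_powr ?L Q * ennreal A" by (intro mult_left_mono K) simp
      also have "\<dots> = ennreal_powr (ennreal (A powr (1 / Q)) * ?L) Q"
        using A Q by (simp add: epowr_mult epowr_ennreal powr_powr mult.commute)
      finally show "(\<integral>\<^sup>+x. ennreal_powr (F x * ennreal (K x)) Q \<partial>lborel) \<le> ennreal_powr (ennreal (A powr (1 / Q)) * ?L) Q" .
    qed
    then show ?thesis by (intro that[of "A powr (1 / Q)"]) auto
  next
    case False
    define P where "P = enn2real p1"
    have P: "1 \<le> P" "p1 = ennreal P" "recip p1 = 1 / P" unfolding P_def using real_exponent[OF p1 False] by blast+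
    have PQ: "Q < P" using p(2) P Q by (simp add: ennreal_less_iff)
    define T where "T = P / Q"
    have T: "1 < T" using PQ Q by (simp add: T_def)
    have Rpos: "0 < R" using PQ P Q R by (simp add: frac_less2)
    \<comment> \<open>With these exponents all powers of \<open>K\<close> cancel in
      \<open>g powr T * K powr R\<close>, and only \<open>F powr P\<close> is left.\<close>
    have ex: "(Q - R) * T + R = 0"
    proof -
      have "1 / Q - 1 / P = (P - Q) / (P * Q)" using P(1) Q(1) by (simp add: field_simps)
      then have "R = P * Q / (P - Q)" unfolding R P(3) Q(3) by simp
      then have "R * (P - Q) = P * Q" using PQ by simp
      then have "((Q - R) * T + R) * Q = 0" using Q by (simp add: T_def algebra_simps)
      then show ?thesis using Q by simp
    qed
    define C where "C = A powr ((T - 1) / T / Q)"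
    have "Lp_norm p2 (\<lambda>x. F x * ennreal (K x)) \<le> ennreal C * Lp_norm p1 F"
      if [measurable]: "F \<in> borel_measurable borel" "K \<in> borel_measurable borel" and K: "\<And>x. 0 < K x"
        "(\<integral>\<^sup>+x. ennreal (K x powr R) \<partial>lborel) \<le> ennreal A" for F :: "'a \<Rightarrow> ennreal" and K
    proof (rule Lp_norm_leI[OF p(1) fin], unfold Q_def[symmetric])
      \<comment> \<open>Jensen's inequality is used for the density \<open>K powr R\<close>;
        dividing it out of the integrand leaves the power \<open>Q - R\<close> of
        \<open>K\<close>.\<close>
      define g where "g x = ennreal_powr (F x) Q * ennreal (K x powr (Q - R))" for x
      have [measurable]: "g \<in> borel_measurable borel" unfolding g_def by measurable
      have ga: "g x * ennreal (K x powr R) = ennreal_powr (F x * ennreal (K x)) Q" for x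
        using Q K(1)[of x] by (simp add: g_def epowr_mult epowr_ennreal mult.assoc ennreal_mult[symmetric] powr_add[symmetric])
      have gT: "ennreal_powr (g x) T * ennreal (K x powr R) = ennreal_powr (F x) P" for x
      proof -
        have "ennreal_powr (g x) T * ennreal (K x powr R) = ennreal_powr (F x) (Q * T) * (ennreal (K x powr ((Q - R) * T)) * ennreal (K x powr R))"
          using T by (simp add: g_def epowr_mult epowr_epowr epowr_ennreal powr_powr mult.assoc)
        also have "ennreal (K x powr ((Q - R) * T)) * ennreal (K x powr R) = 1"
          using K(1)[of x] by (simp add: ennreal_mult[symmetric] powr_add[symmetric] ex)
        finally show ?thesis using Q by (simp add: T_def)
      qed
      have "ennreal_powr (\<integral>\<^sup>+x. g x * ennreal (K x powr R) \<partial>lborel) T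
          \<le> ennreal (A powr (T - 1)) * (\<integral>\<^sup>+x. ennreal_powr (g x) T * ennreal (K x powr R) \<partial>lborel)"
        using T A K by (intro nn_integral_jensen) auto
      then have "ennreal_powr (\<integral>\<^sup>+x. ennreal_powr (F x * ennreal (K x)) Q \<partial>lborel) T \<le> ennreal (A powr (T - 1)) * ennreal_powr (Lp_norm p1 F) P"
        by (simp add: ga gT P_def Lp_norm_powr[OF p1 False])
      then have "ennreal_powr (ennreal_powr (\<integral>\<^sup>+x. ennreal_powr (F x * ennreal (K x)) Q \<partial>lborel) T) (1 / T)
          \<le> ennreal_powr (ennreal (A powr (T - 1)) * ennreal_powr (Lp_norm p1 F) P) (1 / T)"
        using T by (intro epowr_mono) auto
      also have "\<dots> = ennreal_powr (ennreal C * Lp_norm p1 F) Q"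
        using T P Q by (simp add: epowr_mult epowr_epowr epowr_ennreal powr_powr C_def) (simp add: T_def)
      finally show "(\<integral>\<^sup>+x. ennreal_powr (F x * ennreal (K x)) Q \<partial>lborel) \<le> ennreal_powr (ennreal C * Lp_norm p1 F) Q"
        using T by (simp add: epowr_epowr)
    qed
    then show ?thesis by (intro that[of C]) (auto simp: C_def)
  qed
qed

text \<open>
  Translations are bounded from the weighted space with exponent \<open>p1\<close> to that with exponent \<open>p2\<close>,
  uniformly in \<open>c\<close>; the convolution with a rapidly decaying function supplies local regularity.
\<close>

lemma weighted_convolution:
  fixes s1 s2 :: real
  assumes p: "1 \<le> p1" "1 \<le> p2" and s: "s2 \<le> 0" "0 \<le> s1"
    and idx: "p1 \<le> p2 \<or> recip p2 + s2 / real DIM('a) < recip p1 + s1 / real DIM('a)"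
    and N: "real DIM('a) + \<bar>s2\<bar> < N"
  obtains C where "0 \<le> C" "\<And>(F :: 'a::euclidean_space \<Rightarrow> ennreal) c. F \<in> borel_measurable borel \<Longrightarrow>
    Lp_norm p2 (\<lambda>x. (\<integral>\<^sup>+y. F y * ennreal (\<langle>x - c - y\<rangle> powr (-N)) \<partial>lborel) * ennreal (\<langle>x\<rangle> powr s2))
      \<le> ennreal C * Lp_norm p1 (\<lambda>y. F y * ennreal (\<langle>y\<rangle> powr s1))"
proof (cases "p1 \<le> p2")
  case True
  have rN: "real DIM('a) < N" using N by linarith
  obtain C where C: "0 \<le> C" "\<And>F :: 'a \<Rightarrow> ennreal. F \<in> borel_measurable borel \<Longrightarrow>
    Lp_norm p2 (\<lambda>x. \<integral>\<^sup>+y. F y * ennreal (\<langle>x - y\<rangle> powr (-N)) \<partial>lborel) \<le> ennreal C * Lp_norm p1 F"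
    using Lp_norm_convolution_exponents[OF p(1) True rN] by blast
  have "Lp_norm p2 (\<lambda>x. (\<integral>\<^sup>+y. F y * ennreal (\<langle>x - c - y\<rangle> powr (-N)) \<partial>lborel) * ennreal (\<langle>x\<rangle> powr s2))
      \<le> ennreal C * Lp_norm p1 (\<lambda>y. F y * ennreal (\<langle>y\<rangle> powr s1))"
    if F[measurable]: "F \<in> borel_measurable borel" for F :: "'a \<Rightarrow> ennreal" and c
  proof -
    define G where "G y = F y * ennreal (\<langle>y\<rangle> powr s1)" for y
    have G[measurable]: "G \<in> borel_measurable borel" unfolding G_def by measurable
    have w1: "1 \<le> \<langle>y\<rangle> powr s1" for y :: 'a using jb_ge_1[of y] s by (simp add: ge_one_powr_ge_zero)
    have w2: "\<langle>y\<rangle> powr s2 \<le> 1" for y :: 'a using jb_ge_1[of y] s powr_mono[of s2 0 "\<langle>y\<rangle>"] by simp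
    have FG: "F y \<le> G y" for y
      unfolding G_def using mult_left_mono[OF ennreal_leI[OF w1[of y]], of "F y"] by simp
    have "Lp_norm p2 (\<lambda>x. (\<integral>\<^sup>+y. F y * ennreal (\<langle>x - c - y\<rangle> powr (-N)) \<partial>lborel) * ennreal (\<langle>x\<rangle> powr s2))
        \<le> Lp_norm p2 (\<lambda>x. \<integral>\<^sup>+y. G y * ennreal (\<langle>(x + (- c)) - y\<rangle> powr (-N)) \<partial>lborel)"
    proof (rule Lp_norm_mono)
      fix x
      have "(\<integral>\<^sup>+y. F y * ennreal (\<langle>x - c - y\<rangle> powr (-N)) \<partial>lborel) * ennreal (\<langle>x\<rangle> powr s2)
          \<le> (\<integral>\<^sup>+y. G y * ennreal (\<langle>x - c - y\<rangle> powr (-N)) \<partial>lborel) * 1"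
        using w2[of x] by (intro mult_mono nn_integral_mono mult_right_mono FG) (auto simp: ennreal_le_1)
      then show "(\<integral>\<^sup>+y. F y * ennreal (\<langle>x - c - y\<rangle> powr (-N)) \<partial>lborel) * ennreal (\<langle>x\<rangle> powr s2)
          \<le> (\<integral>\<^sup>+y. G y * ennreal (\<langle>(x + (- c)) - y\<rangle> powr (-N)) \<partial>lborel)" by simp
    qed measurable
    also have "\<dots> \<le> Lp_norm p2 (\<lambda>x. \<integral>\<^sup>+y. G y * ennreal (\<langle>x - y\<rangle> powr (-N)) \<partial>lborel)"
      by (rule Lp_norm_translate) measurable
    also have "\<dots> \<le> ennreal C * Lp_norm p1 G" by (rule C(2)[OF G])
    finally show ?thesis by (simp add: G_def[abs_def])
  qed
  with C(1) show ?thesis by (rule that)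
next
  case False
  then have lt: "p2 < p1" by simp
  define R where "R = 1 / (recip p2 - recip p1)"
  have recip_lt: "recip p1 < recip p2" using False recip_le_iff[OF p] by linarith
  then have R: "0 < R" by (simp add: R_def)
  \<comment> \<open>The strict index inequality multiplied out: it says that the exponent
    \<open>(s1 - s2) * R\<close> lies beyond the integrability threshold.\<close>
  have sR: "real DIM('a) < (s1 - s2) * R"
  proof -
    have "recip p2 - recip p1 < (s1 - s2) / real DIM('a)" using idx False by (simp add: diff_divide_distrib)
    then have "(recip p2 - recip p1) * real DIM('a) < s1 - s2" by (simp add: pos_less_divide_eq)
    then show ?thesis using recip_lt by (simp add: R_def pos_less_divide_eq mult.commute)
  qed
  obtain A where A: "0 < A" "(\<integral>\<^sup>+x. ennreal (\<langle>x::'a\<rangle> powr (-((s1 - s2) * R))) \<partial>lborel) \<le> ennreal A"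
    using jb_integral_real[OF sR] by blast
  have r: "real DIM('a) < N - \<bar>s2\<bar>" using N by simp
  obtain B where B: "0 < B" "(\<integral>\<^sup>+x. ennreal (\<langle>x::'a\<rangle> powr (-(N - \<bar>s2\<bar>))) \<partial>lborel) \<le> ennreal B"
    using jb_integral_real[OF r] by blast
  have A2: "0 < 2 * A" using A by simp
  obtain C where C: "0 \<le> C" "\<And>(F :: 'a \<Rightarrow> ennreal) K. F \<in> borel_measurable borel \<Longrightarrow> K \<in> borel_measurable borel \<Longrightarrow>
    (\<And>x. 0 < K x) \<Longrightarrow> (\<integral>\<^sup>+x. ennreal (K x powr R) \<partial>lborel) \<le> ennreal (2 * A) \<Longrightarrow>
    Lp_norm p2 (\<lambda>x. F x * ennreal (K x)) \<le> ennreal C * Lp_norm p1 F"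
    using Lp_norm_holder[OF p(2) lt R_def A2, where 'a = 'a] by blast
  have "Lp_norm p2 (\<lambda>x. (\<integral>\<^sup>+y. F y * ennreal (\<langle>x - c - y\<rangle> powr (-N)) \<partial>lborel) * ennreal (\<langle>x\<rangle> powr s2))
      \<le> ennreal (2 powr \<bar>s2\<bar> * B * C) * Lp_norm p1 (\<lambda>y. F y * ennreal (\<langle>y\<rangle> powr s1))"
    if F[measurable]: "F \<in> borel_measurable borel" for F :: "'a \<Rightarrow> ennreal" and c
  proof -
    define G where "G y = F y * ennreal (\<langle>y\<rangle> powr s1)" for y
    have G[measurable]: "G \<in> borel_measurable borel" unfolding G_def by measurable
    \<comment> \<open>The target weight, displaced by \<open>c\<close>, divided by the source
      weight.\<close>
    define K where "K y = \<langle>y\<rangle> powr (-s1) * \<langle>y + c\<rangle> powr s2" for y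
    have [measurable]: "K \<in> borel_measurable borel" unfolding K_def by measurable
    have K0: "0 < K y" for y unfolding K_def using jb_pos[of y] jb_pos[of "y + c"] by simp
    define E where "E y = F y * ennreal (\<langle>y + c\<rangle> powr s2)" for y
    have E[measurable]: "E \<in> borel_measurable borel" unfolding E_def by measurable
    have EG: "E y = G y * ennreal (K y)" for y
    proof -
      have "\<langle>y\<rangle> powr s1 * K y = \<langle>y + c\<rangle> powr s2"
        using jb_pos[of y] by (simp add: K_def mult.assoc[symmetric] powr_add[symmetric])
      then show ?thesis by (simp add: E_def G_def mult.assoc ennreal_mult[symmetric] K0 less_imp_le)
    qed
    \<comment> \<open>As \<open>s2 \<le> 0 \<le> s1\<close>, neither exponent in \<open>K\<close> is
      positive, so the larger bracket may be replaced by the smaller one. The two terms on the right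
      are translates of each other, and their integrals do not see \<open>c\<close>.\<close>
    have K_le: "K y powr R \<le> \<langle>y\<rangle> powr (-((s1 - s2) * R)) + \<langle>y + c\<rangle> powr (-((s1 - s2) * R))" for y
    proof -
      have "K y \<le> max (\<langle>y\<rangle> powr (-(s1 - s2))) (\<langle>y + c\<rangle> powr (-(s1 - s2)))"
      proof (cases "\<langle>y\<rangle> \<le> \<langle>y + c\<rangle>")
        case True
        then have "\<langle>y + c\<rangle> powr s2 \<le> \<langle>y\<rangle> powr s2" using s jb_pos[of y] by (intro powr_mono2') auto
        then have "K y \<le> \<langle>y\<rangle> powr (-s1) * \<langle>y\<rangle> powr s2" unfolding K_def by (intro mult_left_mono) auto
        then show ?thesis by (simp add: powr_add[symmetric])
      next
        case False
        then have "\<langle>y\<rangle> powr (-s1) \<le> \<langle>y + c\<rangle> powr (-s1)" using s jb_pos[of "y + c"] by (intro powr_mono2') auto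
        then have "K y \<le> \<langle>y + c\<rangle> powr (-s1) * \<langle>y + c\<rangle> powr s2" unfolding K_def by (intro mult_right_mono) auto
        then show ?thesis by (simp add: powr_add[symmetric])
      qed
      then have "K y powr R \<le> max (\<langle>y\<rangle> powr (-(s1 - s2))) (\<langle>y + c\<rangle> powr (-(s1 - s2))) powr R"
        using R K0[of y] by (intro powr_mono2) auto
      also have "\<dots> \<le> (\<langle>y\<rangle> powr (-(s1 - s2))) powr R + (\<langle>y + c\<rangle> powr (-(s1 - s2))) powr R"
        by (simp add: max_def)
      finally show ?thesis by (simp only: powr_powr minus_mult_left)
    qed
    have KA: "(\<integral>\<^sup>+x. ennreal (K x powr R) \<partial>lborel) \<le> ennreal (2 * A)"
    proof -
      have "(\<integral>\<^sup>+x. ennreal (K x powr R) \<partial>lborel)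
          \<le> (\<integral>\<^sup>+y. ennreal (\<langle>y\<rangle> powr (-((s1 - s2) * R))) + ennreal (\<langle>y + c\<rangle> powr (-((s1 - s2) * R))) \<partial>lborel)"
        using K_le by (intro nn_integral_mono) (auto simp flip: ennreal_plus intro!: ennreal_leI)
      also have "\<dots> = (\<integral>\<^sup>+y. ennreal (\<langle>y::'a\<rangle> powr (-((s1 - s2) * R))) \<partial>lborel)
          + (\<integral>\<^sup>+y. ennreal (\<langle>y + c\<rangle> powr (-((s1 - s2) * R))) \<partial>lborel)"
        by (rule nn_integral_add) measurable
      also have "(\<integral>\<^sup>+y. ennreal (\<langle>y + c\<rangle> powr (-((s1 - s2) * R))) \<partial>lborel) = (\<integral>\<^sup>+y. ennreal (\<langle>y::'a\<rangle> powr (-((s1 - s2) * R))) \<partial>lborel)"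
        using lborel_nn_integral_affine[of "\<lambda>y::'a. ennreal (\<langle>y\<rangle> powr (-((s1 - s2) * R)))" 1 c] by (simp add: add.commute)
      also have "(\<integral>\<^sup>+y. ennreal (\<langle>y::'a\<rangle> powr (-((s1 - s2) * R))) \<partial>lborel) + (\<integral>\<^sup>+y. ennreal (\<langle>y::'a\<rangle> powr (-((s1 - s2) * R))) \<partial>lborel)
          \<le> ennreal A + ennreal A"
        by (intro add_mono A)
      also have "\<dots> = ennreal (2 * A)" using A by (simp flip: ennreal_plus)
      finally show ?thesis .
    qed
    \<comment> \<open>Peetre's inequality moves the weight from \<open>x\<close> to
      \<open>y + c\<close> at the price of \<open>\<bar>s2\<bar>\<close> powers of the
      kernel.\<close>
    have pw: "F y * ennreal (\<langle>x - c - y\<rangle> powr (-N)) * ennreal (\<langle>x\<rangle> powr s2)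
        \<le> ennreal (2 powr \<bar>s2\<bar>) * (E y * ennreal (\<langle>(x + (- c)) - y\<rangle> powr (-(N - \<bar>s2\<bar>))))" for x y
    proof -
      have "\<langle>x\<rangle> powr s2 \<le> 2 powr \<bar>s2\<bar> * \<langle>x - c - y\<rangle> powr \<bar>s2\<bar> * \<langle>y + c\<rangle> powr s2"
        using jb_peetre[of x s2 "y + c"] by (simp add: diff_diff_eq add.commute)
      then have "\<langle>x - c - y\<rangle> powr (-N) * \<langle>x\<rangle> powr s2 \<le> \<langle>x - c - y\<rangle> powr (-N) * (2 powr \<bar>s2\<bar> * \<langle>x - c - y\<rangle> powr \<bar>s2\<bar> * \<langle>y + c\<rangle> powr s2)"
        by (rule mult_left_mono) simp
      also have "\<dots> = 2 powr \<bar>s2\<bar> * (\<langle>y + c\<rangle> powr s2 * (\<langle>x - c - y\<rangle> powr (-N) * \<langle>x - c - y\<rangle> powr \<bar>s2\<bar>))"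
        by (simp only: mult_ac)
      also have "\<langle>x - c - y\<rangle> powr (-N) * \<langle>x - c - y\<rangle> powr \<bar>s2\<bar> = \<langle>x - c - y\<rangle> powr (-(N - \<bar>s2\<bar>))"
        by (simp flip: powr_add)
      finally have "ennreal (\<langle>x - c - y\<rangle> powr (-N) * \<langle>x\<rangle> powr s2)
          \<le> ennreal (2 powr \<bar>s2\<bar> * (\<langle>y + c\<rangle> powr s2 * \<langle>x - c - y\<rangle> powr (-(N - \<bar>s2\<bar>))))"
        by (rule ennreal_leI)
      from mult_left_mono[OF this, of "F y"] show ?thesis
        by (simp add: E_def ennreal_mult mult_ac)
    qed
    have "Lp_norm p2 (\<lambda>x. (\<integral>\<^sup>+y. F y * ennreal (\<langle>x - c - y\<rangle> powr (-N)) \<partial>lborel) * ennreal (\<langle>x\<rangle> powr s2))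
        \<le> Lp_norm p2 (\<lambda>x. ennreal (2 powr \<bar>s2\<bar>) * (\<integral>\<^sup>+y. E y * ennreal (\<langle>(x + (- c)) - y\<rangle> powr (-(N - \<bar>s2\<bar>))) \<partial>lborel))"
    proof (rule Lp_norm_mono)
      fix x
      show "(\<integral>\<^sup>+y. F y * ennreal (\<langle>x - c - y\<rangle> powr (-N)) \<partial>lborel) * ennreal (\<langle>x\<rangle> powr s2)
          \<le> ennreal (2 powr \<bar>s2\<bar>) * (\<integral>\<^sup>+y. E y * ennreal (\<langle>(x + (- c)) - y\<rangle> powr (-(N - \<bar>s2\<bar>))) \<partial>lborel)"
        by (subst nn_integral_multc[symmetric], measurable, subst nn_integral_cmult[symmetric], measurable)
          (rule nn_integral_mono[OF pw])
    qed measurable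
    also have "\<dots> \<le> ennreal (2 powr \<bar>s2\<bar>) * Lp_norm p2 (\<lambda>x. \<integral>\<^sup>+y. E y * ennreal (\<langle>(x + (- c)) - y\<rangle> powr (-(N - \<bar>s2\<bar>))) \<partial>lborel)"
      by (rule Lp_norm_cmult_le[OF p(2)]) measurable
    also have "\<dots> \<le> ennreal (2 powr \<bar>s2\<bar>) * Lp_norm p2 (\<lambda>x. \<integral>\<^sup>+y. E y * ennreal (\<langle>x - y\<rangle> powr (-(N - \<bar>s2\<bar>))) \<partial>lborel)"
      by (rule mult_left_mono, rule Lp_norm_translate, measurable)
    also have "\<dots> \<le> ennreal (2 powr \<bar>s2\<bar>) * (ennreal B * Lp_norm p2 E)"
      by (intro mult_left_mono order_trans[OF Lp_norm_convolution[OF p(2) E] mult_right_mono[OF B(2)]]) auto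
    also have "\<dots> \<le> ennreal (2 powr \<bar>s2\<bar>) * (ennreal B * (ennreal C * Lp_norm p1 G))"
      unfolding EG by (intro mult_left_mono C(2) G K0 KA) auto
    also have "\<dots> = ennreal (2 powr \<bar>s2\<bar> * B * C) * Lp_norm p1 (\<lambda>y. F y * ennreal (\<langle>y\<rangle> powr s1))"
      using B C by (simp add: G_def[abs_def] ennreal_mult mult.assoc)
    finally show ?thesis .
  qed
  then show ?thesis using B C by (intro that[of "2 powr \<bar>s2\<bar> * B * C"]) auto
qed

subsection \<open>Sufficiency\<close>

lemma modulation_norm_weight:
  "modulation_norm \<phi> (weight s t) p q u
    = Lp_norm q (\<lambda>\<xi>. Lp_norm p (\<lambda>x. ennreal (cmod (STFT \<phi> u x \<xi>)) * (ennreal (\<langle>x\<rangle> powr s) * ennreal (\<langle>\<xi>\<rangle> powr t))))"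
  by (simp add: modulation_norm_def weight_def ennreal_mult)

lemma sjoestrand_sup_STFT:
  assumes "\<sigma> \<in> modulation_space \<Phi> (\<lambda>_. 1) \<infinity> 1"
  shows "\<sigma> \<in> tempered_distributions" "(\<integral>\<^sup>+\<zeta>. sup_STFT \<Phi> \<sigma> \<zeta> \<partial>lborel) < \<infinity>"
proof -
  have "Lp_norm 1 F = (\<integral>\<^sup>+\<zeta>. F \<zeta> \<partial>lborel)" for F :: "'a \<Rightarrow> ennreal"
    by (simp add: Lp_norm_def)
  then show "\<sigma> \<in> tempered_distributions" "(\<integral>\<^sup>+\<zeta>. sup_STFT \<Phi> \<sigma> \<zeta> \<partial>lborel) < \<infinity>"
    using assms by (simp_all add: modulation_space_def modulation_norm_def sup_STFT_def Lp_norm_top)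
qed

text \<open>Minkowski's inequality takes the integral over \<zeta> outside. For fixed \<zeta> the
  kernel is a product, so the position norm is estimated at each frequency \<eta> and then the
  frequency norm. As \<open>Cs\<close> and \<open>Ct\<close> are independent of \<zeta>, what
  remains is the integral \<open>h\<close> of \<open>sup_STFT\<close>.\<close>

lemma OP_bounded:
  fixes \<phi> :: "'a::euclidean_space \<Rightarrow> complex"
  assumes p: "1 \<le> p1" "1 \<le> p2" and q: "1 \<le> q1" "1 \<le> q2"
    and \<phi>: "\<phi> \<in> schwartz" "\<phi> \<noteq> (\<lambda>_. 0)" and \<Phi>: "\<Phi> \<in> schwartz" "\<Phi> \<noteq> (\<lambda>_. 0)"
    and \<sigma>: "\<sigma> \<in> modulation_space \<Phi> (\<lambda>_. 1) \<infinity> 1"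
    and s: "s2 \<le> 0" "0 \<le> s1" "p1 \<le> p2 \<or> recip p2 + s2 / real DIM('a) < recip p1 + s1 / real DIM('a)"
    and t: "t2 \<le> 0" "0 \<le> t1" "q1 \<le> q2 \<or> recip q2 + t2 / real DIM('a) < recip q1 + t1 / real DIM('a)"
  shows "\<exists>C::real. \<forall>f\<in>schwartz. modulation_norm \<phi> (weight s2 t2) p2 q2 (OP \<tau> \<sigma> f)
    \<le> ennreal C * modulation_norm \<phi> (weight s1 t1) p1 q1 (distribution_of f)"
proof -
  note \<sigma>_t = sjoestrand_sup_STFT(1)[OF \<sigma>]
  let ?H = "sup_STFT \<Phi> \<sigma>"
  have [measurable]: "?H \<in> borel_measurable borel" using \<sigma>_t \<Phi>(1) by (rule sup_STFT_measurable)
  obtain h where h: "0 \<le> h" "(\<integral>\<^sup>+\<zeta>. ?H \<zeta> \<partial>lborel) = ennreal h"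
    using sjoestrand_sup_STFT(2)[OF \<sigma>] by (cases rule: ennreal_cases_real) auto
  define N where "N = real DIM('a) + \<bar>s2\<bar> + \<bar>t2\<bar> + 1"
  have N: "0 \<le> N" "real DIM('a) + \<bar>s2\<bar> < N" "real DIM('a) + \<bar>t2\<bar> < N" by (auto simp: N_def)
  define a where "a x = ennreal (\<langle>x\<rangle> powr (-N))" for x :: 'a
  have [measurable]: "a \<in> borel_measurable borel" unfolding a_def by measurable
  obtain C0 where C0: "0 \<le> C0" "\<And>f x \<xi>. f \<in> schwartz \<Longrightarrow> ennreal (cmod (STFT \<phi> (OP \<tau> \<sigma> f) x \<xi>))
    \<le> ennreal C0 * (\<integral>\<^sup>+\<zeta>. ?H \<zeta> * (\<integral>\<^sup>+v. ennreal (cmod (stft \<phi> f v))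
      * (a (x - fst v + snd \<zeta>) * a (\<xi> - snd v - fst \<zeta>)) \<partial>lborel) \<partial>lborel)"
    unfolding a_def using STFT_OP_bound[OF \<sigma>_t \<phi> \<Phi> N(1)] by blast
  obtain Cs where Cs: "0 \<le> Cs" "\<And>(F :: 'a \<Rightarrow> ennreal) c. F \<in> borel_measurable borel \<Longrightarrow>
    Lp_norm p2 (\<lambda>x. (\<integral>\<^sup>+y. F y * a (x - c - y) \<partial>lborel) * ennreal (\<langle>x\<rangle> powr s2))
      \<le> ennreal Cs * Lp_norm p1 (\<lambda>y. F y * ennreal (\<langle>y\<rangle> powr s1))"
    unfolding a_def using weighted_convolution[OF p s N(2)] by blast
  obtain Ct where Ct: "0 \<le> Ct" "\<And>(F :: 'a \<Rightarrow> ennreal) c. F \<in> borel_measurable borel \<Longrightarrow>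
    Lp_norm q2 (\<lambda>x. (\<integral>\<^sup>+y. F y * a (x - c - y) \<partial>lborel) * ennreal (\<langle>x\<rangle> powr t2))
      \<le> ennreal Ct * Lp_norm q1 (\<lambda>y. F y * ennreal (\<langle>y\<rangle> powr t1))"
    unfolding a_def using weighted_convolution[OF q t N(3)] by blast
  have "modulation_norm \<phi> (weight s2 t2) p2 q2 (OP \<tau> \<sigma> f)
    \<le> ennreal (C0 * Cs * Ct * h) * modulation_norm \<phi> (weight s1 t1) p1 q1 (distribution_of f)"
    if f: "f \<in> schwartz" for f
  proof -
    define V where "V v = ennreal (cmod (stft \<phi> f v))" for v
    have stft_m: "stft \<phi> f \<in> borel_measurable borel"
      by (rule schwartz_measurable[OF stft_schwartz[OF f \<phi>(1)]])
    then have "V \<in> borel_measurable borel" unfolding V_def by measurable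
    then have V: "V \<in> borel_measurable (borel \<Otimes>\<^sub>M borel)" by (simp add: borel_prod)
    have V'[measurable]: "(\<lambda>z. V (f z, g z)) \<in> borel_measurable M"
      if "f \<in> borel_measurable M" "g \<in> borel_measurable M" for f g and M :: "'z measure"
      using measurable_compose[OF measurable_Pair[OF that] V] .
    define w2 where "w2 x = ennreal (\<langle>x\<rangle> powr s2)" for x :: 'a
    define v2 where "v2 x = ennreal (\<langle>x\<rangle> powr t2)" for x :: 'a
    define w1 where "w1 x = ennreal (\<langle>x\<rangle> powr s1)" for x :: 'a
    define v1 where "v1 x = ennreal (\<langle>x\<rangle> powr t1)" for x :: 'a
    have [measurable]: "w1 \<in> borel_measurable borel" "w2 \<in> borel_measurable borel" "v1 \<in> borel_measurable borel" "v2 \<in> borel_measurable borel"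
      unfolding w1_def w2_def v1_def v2_def by measurable
    define D where "D x \<xi> = ennreal (cmod (STFT \<phi> (OP \<tau> \<sigma> f) x \<xi>)) * (w2 x * v2 \<xi>)" for x \<xi>
    have "(\<lambda>w. ennreal (cmod (STFT \<phi> (OP \<tau> \<sigma> f) (fst w) (snd w)))) \<in> borel_measurable (borel \<Otimes>\<^sub>M borel)"
      using STFT_OP_measurable[OF \<sigma>_t f \<phi>(1) \<phi>(2)] by (simp add: borel_prod)
    then have OPm[measurable]: "(\<lambda>(x, \<xi>). ennreal (cmod (STFT \<phi> (OP \<tau> \<sigma> f) x \<xi>))) \<in> borel_measurable (borel \<Otimes>\<^sub>M borel)"
      by (simp add: case_prod_beta')
    have D[measurable]: "(\<lambda>(x, \<xi>). D x \<xi>) \<in> borel_measurable (borel \<Otimes>\<^sub>M borel)"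
      unfolding D_def by measurable
    have D_sec[measurable]: "(\<lambda>x. D x \<xi>) \<in> borel_measurable borel" for \<xi>
      using measurable_Pair1[OF D, of \<xi>] by simp
    have D_sw[measurable]: "(\<lambda>(\<xi>, x). D x \<xi>) \<in> borel_measurable (borel \<Otimes>\<^sub>M borel)"
      using measurable_compose[OF measurable_pair_swap' D] by (simp add: case_prod_beta')
    define n where "n \<eta> = Lp_norm p1 (\<lambda>y. V (y, \<eta>) * w1 y)" for \<eta>
    have n[measurable]: "n \<in> borel_measurable borel"
      unfolding n_def by (rule Lp_norm_measurable) measurable
    \<comment> \<open>The position convolution at frequency \<eta>, displaced by
      \<open>- snd \<zeta>\<close>; \<open>J\<close> below is the frequency convolution, displaced
      by \<open>fst \<zeta>\<close>.\<close>
    define B where "B \<zeta> \<eta> x = (\<integral>\<^sup>+y. V (y, \<eta>) * a (x - (- snd \<zeta>) - y) \<partial>lborel) * w2 x" for \<zeta> :: "'a \<times> 'a" and \<eta> x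
    have "(\<lambda>z. B (fst z) (fst (snd z)) (snd (snd z))) \<in> borel_measurable (borel \<Otimes>\<^sub>M (borel \<Otimes>\<^sub>M borel))"
      unfolding B_def by measurable
    note Bm = this
    have B'[measurable]: "(\<lambda>z. B (f z) (g z) (k z)) \<in> borel_measurable M"
      if "f \<in> borel_measurable M" "g \<in> borel_measurable M" "k \<in> borel_measurable M" for f g k and M :: "'z measure"
      using measurable_compose[OF measurable_Pair[OF that(1) measurable_Pair[OF that(2,3)]] Bm] by simp
    define c where "c \<zeta> \<xi> = ennreal C0 * ?H \<zeta> * v2 \<xi>" for \<zeta> \<xi>
    define J where "J \<zeta> \<xi> = (\<integral>\<^sup>+\<eta>. n \<eta> * a (\<xi> - fst \<zeta> - \<eta>) \<partial>lborel) * v2 \<xi>" for \<zeta> :: "'a \<times> 'a" and \<xi>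
    have D_le: "D x \<xi> \<le> (\<integral>\<^sup>+\<zeta>. c \<zeta> \<xi> * (\<integral>\<^sup>+\<eta>. B \<zeta> \<eta> x * a (\<xi> - fst \<zeta> - \<eta>) \<partial>lborel) \<partial>lborel)" for x \<xi>
    proof -
      have "(\<integral>\<^sup>+v. V v * (a (x - fst v + snd \<zeta>) * a (\<xi> - snd v - fst \<zeta>)) \<partial>lborel) * w2 x
          = (\<integral>\<^sup>+\<eta>. B \<zeta> \<eta> x * a (\<xi> - fst \<zeta> - \<eta>) \<partial>lborel)" for \<zeta>
      proof -
        have "(\<lambda>v. V v * (a (x - fst v + snd \<zeta>) * a (\<xi> - snd v - fst \<zeta>))) \<in> borel_measurable borel"
          using \<open>V \<in> borel_measurable borel\<close> by measurable
        then have "(\<integral>\<^sup>+v. V v * (a (x - fst v + snd \<zeta>) * a (\<xi> - snd v - fst \<zeta>)) \<partial>lborel)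
            = (\<integral>\<^sup>+\<eta>. (\<integral>\<^sup>+y. V (y, \<eta>) * (a (x - y + snd \<zeta>) * a (\<xi> - \<eta> - fst \<zeta>)) \<partial>lborel) \<partial>lborel)"
          by (subst lborel_nn_integral_Pair(2)) simp_all
        also have "\<dots> = (\<integral>\<^sup>+\<eta>. (\<integral>\<^sup>+y. V (y, \<eta>) * a (x - (- snd \<zeta>) - y) * a (\<xi> - fst \<zeta> - \<eta>) \<partial>lborel) \<partial>lborel)"
          by (simp add: algebra_simps)
        finally show ?thesis
          unfolding B_def by (simp add: nn_integral_multc mult_ac flip: nn_integral_cmult)
      qed
      note eq = this
      have "D x \<xi> \<le> (ennreal C0 * (\<integral>\<^sup>+\<zeta>. ?H \<zeta> * (\<integral>\<^sup>+v. V v * (a (x - fst v + snd \<zeta>) * a (\<xi> - snd v - fst \<zeta>)) \<partial>lborel) \<partial>lborel)) * (w2 x * v2 \<xi>)"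
        unfolding D_def V_def by (intro mult_right_mono C0(2) f) simp
      also have "\<dots> = (\<integral>\<^sup>+\<zeta>. c \<zeta> \<xi> * ((\<integral>\<^sup>+v. V v * (a (x - fst v + snd \<zeta>) * a (\<xi> - snd v - fst \<zeta>)) \<partial>lborel) * w2 x) \<partial>lborel)"
      proof -
        have [measurable]: "(\<lambda>\<zeta>. \<integral>\<^sup>+v. V v * (a (x - fst v + snd \<zeta>) * a (\<xi> - snd v - fst \<zeta>)) \<partial>lborel) \<in> borel_measurable lborel"
          using \<open>V \<in> borel_measurable borel\<close> by measurable
        show ?thesis
          unfolding c_def by (subst nn_integral_cmult[symmetric], measurable, subst nn_integral_multc[symmetric], measurable)
            (simp add: mult_ac)
      qed
      finally show ?thesis unfolding eq .
    qed
    have inner: "Lp_norm p2 (\<lambda>x. D x \<xi>) \<le> (\<integral>\<^sup>+\<zeta>. (ennreal C0 * ennreal Cs * ?H \<zeta>) * J \<zeta> \<xi> \<partial>lborel)" for \<xi>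
    proof -
      have "Lp_norm p2 (\<lambda>x. D x \<xi>) \<le> Lp_norm p2 (\<lambda>x. \<integral>\<^sup>+\<zeta>. c \<zeta> \<xi> * (\<integral>\<^sup>+\<eta>. B \<zeta> \<eta> x * a (\<xi> - fst \<zeta> - \<eta>) \<partial>lborel) \<partial>lborel)"
        by (intro Lp_norm_mono D_sec D_le)
      also have "\<dots> \<le> (\<integral>\<^sup>+\<zeta>. Lp_norm p2 (\<lambda>x. c \<zeta> \<xi> * (\<integral>\<^sup>+\<eta>. B \<zeta> \<eta> x * a (\<xi> - fst \<zeta> - \<eta>) \<partial>lborel)) \<partial>lborel)"
        unfolding c_def by (rule Lp_norm_nn_integral[OF sigma_finite_lborel p(2)]) measurable
      also have "\<dots> \<le> (\<integral>\<^sup>+\<zeta>. c \<zeta> \<xi> * (\<integral>\<^sup>+\<eta>. a (\<xi> - fst \<zeta> - \<eta>) * (ennreal Cs * n \<eta>) \<partial>lborel) \<partial>lborel)"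
      proof (rule nn_integral_mono)
        fix \<zeta> :: "'a \<times> 'a"
        have "Lp_norm p2 (\<lambda>x. c \<zeta> \<xi> * (\<integral>\<^sup>+\<eta>. B \<zeta> \<eta> x * a (\<xi> - fst \<zeta> - \<eta>) \<partial>lborel))
            \<le> c \<zeta> \<xi> * Lp_norm p2 (\<lambda>x. \<integral>\<^sup>+\<eta>. B \<zeta> \<eta> x * a (\<xi> - fst \<zeta> - \<eta>) \<partial>lborel)"
          by (rule Lp_norm_cmult_le[OF p(2)]) measurable
        also have "\<dots> \<le> c \<zeta> \<xi> * (\<integral>\<^sup>+\<eta>. Lp_norm p2 (\<lambda>x. B \<zeta> \<eta> x * a (\<xi> - fst \<zeta> - \<eta>)) \<partial>lborel)"
        proof (rule mult_left_mono)
          show "Lp_norm p2 (\<lambda>x. \<integral>\<^sup>+\<eta>. B \<zeta> \<eta> x * a (\<xi> - fst \<zeta> - \<eta>) \<partial>lborel)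
              \<le> (\<integral>\<^sup>+\<eta>. Lp_norm p2 (\<lambda>x. B \<zeta> \<eta> x * a (\<xi> - fst \<zeta> - \<eta>)) \<partial>lborel)"
            by (rule Lp_norm_nn_integral[OF sigma_finite_lborel p(2)]) measurable
        qed simp
        also have "\<dots> \<le> c \<zeta> \<xi> * (\<integral>\<^sup>+\<eta>. a (\<xi> - fst \<zeta> - \<eta>) * (ennreal Cs * n \<eta>) \<partial>lborel)"
        proof (intro mult_left_mono nn_integral_mono)
          fix \<eta>
          have "Lp_norm p2 (\<lambda>x. B \<zeta> \<eta> x * a (\<xi> - fst \<zeta> - \<eta>)) \<le> a (\<xi> - fst \<zeta> - \<eta>) * Lp_norm p2 (\<lambda>x. B \<zeta> \<eta> x)"
            by (subst mult.commute) (rule Lp_norm_cmult_le[OF p(2)], measurable)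
          also have "Lp_norm p2 (\<lambda>x. B \<zeta> \<eta> x) \<le> ennreal Cs * n \<eta>"
            unfolding B_def w2_def n_def w1_def by (rule Cs(2)) measurable
          finally show "Lp_norm p2 (\<lambda>x. B \<zeta> \<eta> x * a (\<xi> - fst \<zeta> - \<eta>)) \<le> a (\<xi> - fst \<zeta> - \<eta>) * (ennreal Cs * n \<eta>)"
            by (simp add: mult_left_mono)
        qed simp
        finally show "Lp_norm p2 (\<lambda>x. c \<zeta> \<xi> * (\<integral>\<^sup>+\<eta>. B \<zeta> \<eta> x * a (\<xi> - fst \<zeta> - \<eta>) \<partial>lborel))
            \<le> c \<zeta> \<xi> * (\<integral>\<^sup>+\<eta>. a (\<xi> - fst \<zeta> - \<eta>) * (ennreal Cs * n \<eta>) \<partial>lborel)" .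
      qed
      also have "\<dots> = (\<integral>\<^sup>+\<zeta>. (ennreal C0 * ennreal Cs * ?H \<zeta>) * J \<zeta> \<xi> \<partial>lborel)"
      proof (rule nn_integral_cong)
        fix \<zeta> :: "'a \<times> 'a"
        have "(\<integral>\<^sup>+\<eta>. a (\<xi> - fst \<zeta> - \<eta>) * (ennreal Cs * n \<eta>) \<partial>lborel) = (\<integral>\<^sup>+\<eta>. ennreal Cs * (n \<eta> * a (\<xi> - fst \<zeta> - \<eta>)) \<partial>lborel)"
          by (simp add: mult_ac)
        also have "\<dots> = ennreal Cs * (\<integral>\<^sup>+\<eta>. n \<eta> * a (\<xi> - fst \<zeta> - \<eta>) \<partial>lborel)"
          by (rule nn_integral_cmult) measurable
        finally show "c \<zeta> \<xi> * (\<integral>\<^sup>+\<eta>. a (\<xi> - fst \<zeta> - \<eta>) * (ennreal Cs * n \<eta>) \<partial>lborel) = (ennreal C0 * ennreal Cs * ?H \<zeta>) * J \<zeta> \<xi>"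
          by (simp add: c_def J_def mult_ac)
      qed
      finally show ?thesis .
    qed
    have "modulation_norm \<phi> (weight s2 t2) p2 q2 (OP \<tau> \<sigma> f) = Lp_norm q2 (\<lambda>\<xi>. Lp_norm p2 (\<lambda>x. D x \<xi>))"
      by (simp add: modulation_norm_weight D_def w2_def v2_def)
    also have "\<dots> \<le> Lp_norm q2 (\<lambda>\<xi>. \<integral>\<^sup>+\<zeta>. (ennreal C0 * ennreal Cs * ?H \<zeta>) * J \<zeta> \<xi> \<partial>lborel)"
      by (intro Lp_norm_mono inner Lp_norm_measurable D_sw)
    also have "\<dots> \<le> (\<integral>\<^sup>+\<zeta>. Lp_norm q2 (\<lambda>\<xi>. (ennreal C0 * ennreal Cs * ?H \<zeta>) * J \<zeta> \<xi>) \<partial>lborel)"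
      unfolding J_def by (rule Lp_norm_nn_integral[OF sigma_finite_lborel q(2)]) measurable
    also have "\<dots> \<le> (\<integral>\<^sup>+\<zeta>. (ennreal C0 * ennreal Cs * ?H \<zeta>) * (ennreal Ct * Lp_norm q1 (\<lambda>\<eta>. n \<eta> * v1 \<eta>)) \<partial>lborel)"
    proof (rule nn_integral_mono)
      fix \<zeta> :: "'a \<times> 'a"
      have "Lp_norm q2 (\<lambda>\<xi>. (ennreal C0 * ennreal Cs * ?H \<zeta>) * J \<zeta> \<xi>) \<le> (ennreal C0 * ennreal Cs * ?H \<zeta>) * Lp_norm q2 (\<lambda>\<xi>. J \<zeta> \<xi>)"
        unfolding J_def by (rule Lp_norm_cmult_le[OF q(2)]) measurable
      also have "\<dots> \<le> (ennreal C0 * ennreal Cs * ?H \<zeta>) * (ennreal Ct * Lp_norm q1 (\<lambda>\<eta>. n \<eta> * v1 \<eta>))"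
        unfolding J_def v2_def v1_def by (intro mult_left_mono Ct(2) n) simp
      finally show "Lp_norm q2 (\<lambda>\<xi>. (ennreal C0 * ennreal Cs * ?H \<zeta>) * J \<zeta> \<xi>)
          \<le> (ennreal C0 * ennreal Cs * ?H \<zeta>) * (ennreal Ct * Lp_norm q1 (\<lambda>\<eta>. n \<eta> * v1 \<eta>))" .
    qed
    also have "\<dots> = (ennreal C0 * ennreal Cs * ennreal Ct * Lp_norm q1 (\<lambda>\<eta>. n \<eta> * v1 \<eta>)) * (\<integral>\<^sup>+\<zeta>. ?H \<zeta> \<partial>lborel)"
      by (subst nn_integral_cmult[symmetric], measurable) (simp add: mult_ac)
    also have "\<dots> = ennreal (C0 * Cs * Ct * h) * Lp_norm q1 (\<lambda>\<eta>. n \<eta> * v1 \<eta>)"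
      unfolding h(2) using C0(1) Cs(1) Ct(1) h(1) by (simp add: ennreal_mult mult_ac)
    \<comment> \<open>The frequency weight goes back under the inner norm; it is a positive real, as
      \<open>Lp_norm_cmult_ge\<close> demands.\<close>
    also have "\<dots> \<le> ennreal (C0 * Cs * Ct * h) * modulation_norm \<phi> (weight s1 t1) p1 q1 (distribution_of f)"
      unfolding modulation_norm_weight STFT_distribution_of
    proof (intro mult_left_mono Lp_norm_mono)
      fix \<eta>
      have "n \<eta> * v1 \<eta> = v1 \<eta> * Lp_norm p1 (\<lambda>y. V (y, \<eta>) * w1 y)" by (simp add: n_def mult.commute)
      also have "\<dots> \<le> Lp_norm p1 (\<lambda>y. v1 \<eta> * (V (y, \<eta>) * w1 y))"
        unfolding v1_def by (rule Lp_norm_cmult_ge[OF p(1)], measurable) (use jb_pos[of \<eta>] in simp)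
      finally show "n \<eta> * v1 \<eta> \<le> Lp_norm p1 (\<lambda>x. ennreal (cmod (stft \<phi> f (x, \<eta>))) * (ennreal (\<langle>x\<rangle> powr s1) * ennreal (\<langle>\<eta>\<rangle> powr t1)))"
        by (simp add: V_def v1_def w1_def mult_ac)
    qed simp_all
    finally show ?thesis .
  qed
  then show ?thesis by blast
qed

subsection \<open>Almost periodic symbols\<close>

text \<open>An almost periodic function. With nonnegative \<open>c\<close>, summability of
  \<open>c\<close> is absolute convergence of the series, uniformly in \<open>z\<close>.\<close>

definition trig_symbol :: "(nat \<Rightarrow> real) \<Rightarrow> (nat \<Rightarrow> 'a::euclidean_space) \<Rightarrow> 'a \<Rightarrow> complex" where
  "trig_symbol c \<zeta> z = (\<Sum>k. of_real (c k) * cis (2 * pi * (\<zeta> k \<bullet> z)))"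

lemma trig_symbol_summable:
  assumes "\<And>k. 0 \<le> c k" "summable c"
  shows "summable (\<lambda>k. cmod (of_real (c k) * cis (2 * pi * (\<zeta> k \<bullet> z))))"
  using assms by (simp add: norm_mult)

lemma trig_symbol_measurable [measurable]:
  assumes "\<And>k. 0 \<le> c k" "summable c"
  shows "trig_symbol c \<zeta> \<in> borel_measurable borel"
proof (rule borel_measurable_LIMSEQ_metric)
  show "(\<lambda>z. \<Sum>k<n. of_real (c k) * cis (2 * pi * (\<zeta> k \<bullet> z))) \<in> borel_measurable borel" for n
    by measurable
  show "(\<lambda>n. \<Sum>k<n. of_real (c k) * cis (2 * pi * (\<zeta> k \<bullet> z))) \<longlonglongrightarrow> trig_symbol c \<zeta> z" for z
    unfolding trig_symbol_def
    by (rule summable_LIMSEQ[OF summable_norm_cancel[OF trig_symbol_summable[OF assms]]])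
qed

lemma trig_symbol_bound:
  assumes "\<And>k. 0 \<le> c k" "summable c"
  shows "cmod (trig_symbol c \<zeta> z) \<le> suminf c"
  using summable_norm[OF trig_symbol_summable[OF assms, of \<zeta> z]] assms(1)
  by (simp add: trig_symbol_def norm_mult)

text \<open>Each summand is dominated by \<open>c k * cmod (h z)\<close>, so summability of
  \<open>c\<close> and integrability of \<open>h\<close> allow the sum and the integral to be
  exchanged.\<close>

lemma
  fixes h :: "'a::euclidean_space \<Rightarrow> complex"
  assumes c: "\<And>k. 0 \<le> c k" "summable c" and h: "integrable lborel h"
  shows trig_symbol_integrable: "integrable lborel (\<lambda>z. trig_symbol c \<zeta> z * h z)"
    and distribution_of_trig_symbol:
      "distribution_of (trig_symbol c \<zeta>) h = (\<Sum>k. of_real (c k) * (\<integral>z. cis (2 * pi * (\<zeta> k \<bullet> z)) * h z \<partial>lborel))"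
proof -
  have [measurable]: "h \<in> borel_measurable borel" "trig_symbol c \<zeta> \<in> borel_measurable borel"
    using borel_measurable_integrable[OF h] trig_symbol_measurable[OF c] by auto
  show "integrable lborel (\<lambda>z. trig_symbol c \<zeta> z * h z)"
  proof (rule Bochner_Integration.integrable_bound[OF integrable_scaleR_right[OF h]])
    show "AE z in lborel. cmod (trig_symbol c \<zeta> z * h z) \<le> cmod (suminf c *\<^sub>R h z)"
      using trig_symbol_bound[OF c, of \<zeta>]
      by (auto simp: norm_mult intro!: mult_right_mono order_trans[OF _ abs_ge_self])
  qed measurable
  let ?f = "\<lambda>k z. of_real (c k) * cis (2 * pi * (\<zeta> k \<bullet> z)) * h z"
  have "distribution_of (trig_symbol c \<zeta>) h = (\<integral>z. (\<Sum>k. ?f k z) \<partial>lborel)"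
    unfolding distribution_of_def trig_symbol_def
    by (subst suminf_mult2[OF summable_norm_cancel[OF trig_symbol_summable[OF c]]]) simp
  also have "\<dots> = (\<Sum>k. \<integral>z. ?f k z \<partial>lborel)"
  proof (rule integral_suminf)
    have nf: "cmod (?f k z) = c k * cmod (h z)" for k z using c by (simp add: norm_mult)
    show "integrable lborel (?f k)" for k
      by (rule Bochner_Integration.integrable_bound[OF integrable_scaleR_right[OF h, of "c k"]])
        (use c in \<open>auto simp: norm_mult\<close>)
    show "AE z in lborel. summable (\<lambda>k. cmod (?f k z))"
      unfolding nf using c by (intro AE_I2 summable_mult2)
    show "summable (\<lambda>k. \<integral>z. cmod (?f k z) \<partial>lborel)"
      unfolding nf using c by (simp add: summable_mult2)
  qed
  also have "\<dots> = (\<Sum>k. of_real (c k) * (\<integral>z. cis (2 * pi * (\<zeta> k \<bullet> z)) * h z \<partial>lborel))"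
    by (simp add: mult.assoc)
  finally show "distribution_of (trig_symbol c \<zeta>) h = (\<Sum>k. of_real (c k) * (\<integral>z. cis (2 * pi * (\<zeta> k \<bullet> z)) * h z \<partial>lborel))" .
qed

text \<open>A supremum of reals has its intended meaning only for a bounded range, which membership
  in the Schwartz space provides.\<close>

lemma schwartz_seminorm_nonneg:
  fixes f :: "'a::euclidean_space \<Rightarrow> complex"
  assumes "f \<in> schwartz" "set bs \<subseteq> Basis"
  shows "0 \<le> schwartz_seminorm k bs f" "\<langle>x\<rangle> ^ k * cmod (iterated_partial bs f x) \<le> schwartz_seminorm k bs f"
proof -
  obtain C where "\<And>x. \<langle>x\<rangle> ^ k * cmod (iterated_partial bs f x) \<le> C"
    using schwartz_bound[OF schwartz_iterated_partial[OF assms]] by blast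
  then have bdd: "bdd_above (range (\<lambda>x. \<langle>x\<rangle> ^ k * cmod (iterated_partial bs f x)))"
    by (intro bdd_aboveI2)
  show le: "\<langle>x\<rangle> ^ k * cmod (iterated_partial bs f x) \<le> schwartz_seminorm k bs f" for x
    unfolding schwartz_seminorm_def by (rule cSUP_upper[OF UNIV_I bdd])
  show "0 \<le> schwartz_seminorm k bs f"
    by (rule order_trans[OF _ le[of 0]]) (simp add: jb_nonneg)
qed

text \<open>A bounded function is controlled by the seminorm of order 0 with a power
  \<open>k\<close> above the dimension; in the sum of seminorms this is the term of the empty
  list.\<close>

lemma trig_symbol_tempered:
  fixes \<zeta> :: "nat \<Rightarrow> 'a::euclidean_space"
  assumes c: "\<And>k. 0 \<le> c k" "summable c"
  shows "distribution_of (trig_symbol c \<zeta>) \<in> tempered_distributions"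
  unfolding tempered_distributions_def mem_Collect_eq
proof (intro conjI ballI allI)
  let ?u = "distribution_of (trig_symbol c \<zeta>)"
  show "?u (\<lambda>x. f x + g x) = ?u f + ?u g" if "f \<in> schwartz" "g \<in> schwartz" for f g
    using trig_symbol_integrable[OF c schwartz_integrable[OF that(1)], of \<zeta>]
      trig_symbol_integrable[OF c schwartz_integrable[OF that(2)], of \<zeta>]
    by (simp add: distribution_of_def distrib_left)
  show "?u (\<lambda>x. a * f x) = a * ?u f" for a f
    by (simp add: distribution_of_def mult.left_commute)
  define k where "k = DIM('a) + 1"
  define I where "I = (\<integral>x. \<langle>x::'a\<rangle> powr (- real k) \<partial>lborel)"
  let ?B = "{bs. set bs \<subseteq> (Basis :: 'a set) \<and> length bs \<le> k}"
  have int: "integrable lborel (\<lambda>x::'a. \<langle>x\<rangle> powr (- real k))"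
    by (rule integrable_jb) (simp add: k_def)
  have I: "0 \<le> I" unfolding I_def by simp
  have S: "0 \<le> suminf c" using c by (intro suminf_nonneg) auto
  have "cmod (?u f) \<le> suminf c * I * (\<Sum>bs\<in>?B. schwartz_seminorm k bs f)" if f: "f \<in> schwartz" for f
  proof -
    have fle: "cmod (f x) \<le> schwartz_seminorm k [] f * \<langle>x\<rangle> powr (- real k)" for x
      using schwartz_seminorm_nonneg(2)[OF f, of "[]" x k] jb_pos[of x]
      by (simp add: powr_minus powr_realpow field_simps)
    have "cmod (?u f) \<le> (\<integral>x. cmod (trig_symbol c \<zeta> x * f x) \<partial>lborel)"
      unfolding distribution_of_def by (rule integral_norm_bound)
    also have "\<dots> \<le> (\<integral>x. suminf c * (schwartz_seminorm k [] f * \<langle>x::'a\<rangle> powr (- real k)) \<partial>lborel)"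
    proof (rule Bochner_Integration.integral_mono)
      show "integrable lborel (\<lambda>x. cmod (trig_symbol c \<zeta> x * f x))"
        by (rule integrable_norm[OF trig_symbol_integrable[OF c schwartz_integrable[OF f]]])
      show "cmod (trig_symbol c \<zeta> x * f x) \<le> suminf c * (schwartz_seminorm k [] f * \<langle>x\<rangle> powr (- real k))" for x
        unfolding norm_mult by (intro mult_mono trig_symbol_bound c fle S) auto
    qed (use int in simp)
    also have "\<dots> = suminf c * I * schwartz_seminorm k [] f" by (simp add: I_def mult_ac)
    also have "\<dots> \<le> suminf c * I * (\<Sum>bs\<in>?B. schwartz_seminorm k bs f)"
    proof (rule mult_left_mono)
      show "schwartz_seminorm k [] f \<le> (\<Sum>bs\<in>?B. schwartz_seminorm k bs f)"
        by (rule member_le_sum) (auto intro: schwartz_seminorm_nonneg(1)[OF f] finite_multiindices)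
    qed (use S I in simp)
    finally show ?thesis .
  qed
  then show "\<exists>C k. \<forall>f\<in>schwartz. cmod (?u f) \<le> C * (\<Sum>bs\<in>{bs. set bs \<subseteq> Basis \<and> length bs \<le> k}. schwartz_seminorm k bs f)"
    by blast
qed

text \<open>A character is an eigenfunction of translations, so the modulus of its STFT does not
  depend on the position \<open>z\<close>. Hence the supremum over positions costs nothing for such
  symbols.\<close>

lemma norm_fourier_shift:
  fixes \<Phi> :: "'a::euclidean_space \<Rightarrow> complex"
  assumes \<Phi>: "\<Phi> \<in> schwartz"
  shows "cmod (\<integral>t. cis (2 * pi * (\<omega> \<bullet> t)) * cnj (tf_shift (z, \<zeta>) \<Phi> t) \<partial>lborel)
    = cmod (\<integral>t. \<Phi> t * cis (- 2 * pi * ((\<omega> - \<zeta>) \<bullet> t)) \<partial>lborel)"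
proof -
  define F where "F t = cis (2 * pi * (\<omega> \<bullet> t)) * cnj (tf_shift (z, \<zeta>) \<Phi> t)" for t
  have [measurable]: "\<Phi> \<in> borel_measurable borel" by (rule schwartz_measurable[OF \<Phi>])
  have [measurable]: "F \<in> borel_measurable borel" unfolding F_def tf_shift_apply by measurable
  have "(\<integral>t. F t \<partial>lborel) = (\<integral>t. F (t + z) \<partial>lborel)"
    by (rule lborel_integral_translate[symmetric]) measurable
  also have "\<dots> = (\<integral>t. cis (2 * pi * ((\<omega> - \<zeta>) \<bullet> z)) * cnj (\<Phi> t * cis (- 2 * pi * ((\<omega> - \<zeta>) \<bullet> t))) \<partial>lborel)"
  proof (rule Bochner_Integration.integral_cong[OF refl])
    fix t
    have "cis (2 * pi * (\<omega> \<bullet> (t + z))) * cis (- (2 * pi * ((t + z) \<bullet> \<zeta>)))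
        = cis (2 * pi * ((\<omega> - \<zeta>) \<bullet> z)) * cis (2 * pi * ((\<omega> - \<zeta>) \<bullet> t))"
      unfolding cis_mult by (rule arg_cong[where f = cis]) (simp add: inner_simps inner_commute algebra_simps)
    moreover have "F (t + z) = (cis (2 * pi * (\<omega> \<bullet> (t + z))) * cis (- (2 * pi * ((t + z) \<bullet> \<zeta>)))) * cnj (\<Phi> t)"
      by (simp add: F_def tf_shift_apply cis_cnj)
    ultimately show "F (t + z) = cis (2 * pi * ((\<omega> - \<zeta>) \<bullet> z)) * cnj (\<Phi> t * cis (- 2 * pi * ((\<omega> - \<zeta>) \<bullet> t)))"
      by (simp add: cis_cnj)
  qed
  also have "\<dots> = cis (2 * pi * ((\<omega> - \<zeta>) \<bullet> z)) * cnj (\<integral>t. \<Phi> t * cis (- 2 * pi * ((\<omega> - \<zeta>) \<bullet> t)) \<partial>lborel)"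
    by (subst Bochner_Integration.integral_mult_right_zero) (simp only: Bochner_Integration.integral_cnj)
  finally show ?thesis by (simp add: F_def norm_mult)
qed

text \<open>The full Fourier transform is obtained from \<open>partial_fourier\<close> by adding a
  dummy parameter: the tensor of \<Phi> with itself, restricted to a parameter \<open>x\<close> at
  which \<Phi> does not vanish.\<close>

lemma fourier_decay:
  fixes \<Phi> :: "'a::euclidean_space \<Rightarrow> complex"
  assumes \<Phi>: "\<Phi> \<in> schwartz"
  obtains D where "0 \<le> D" "\<And>\<xi>. cmod (\<integral>t. \<Phi> t * cis (- 2 * pi * (\<xi> \<bullet> t)) \<partial>lborel) \<le> D * \<langle>\<xi>\<rangle> powr (-r)"
proof (cases "\<Phi> = (\<lambda>_. 0)")
  case True
  then show ?thesis by (intro that[of 0]) auto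
next
  case False
  then obtain x where x: "\<Phi> x \<noteq> 0" by auto
  have k: "(\<lambda>p::'a \<times> 'a. \<Phi> (fst p) * \<Phi> (snd p)) \<in> schwartz"
    by (rule schwartz_linear_tensor[OF \<Phi> \<Phi> linear_fst linear_snd, where C = 1]) (use norm_le_fst_snd in auto)
  obtain D where D: "0 \<le> D" "\<And>\<xi>. cmod (partial_fourier (\<lambda>p::'a \<times> 'a. \<Phi> (fst p) * \<Phi> (snd p)) (x, \<xi>)) \<le> D * \<langle>\<xi>\<rangle> powr (-r)"
    using schwartz_decay[OF schwartz_section[OF partial_fourier_schwartz[OF k]]] by blast
  have "partial_fourier (\<lambda>p::'a \<times> 'a. \<Phi> (fst p) * \<Phi> (snd p)) (x, \<xi>) = \<Phi> x * (\<integral>t. \<Phi> t * cis (- 2 * pi * (\<xi> \<bullet> t)) \<partial>lborel)" for \<xi>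
    by (simp add: partial_fourier_def mult.assoc)
  then have "cmod (\<integral>t. \<Phi> t * cis (- 2 * pi * (\<xi> \<bullet> t)) \<partial>lborel) \<le> D / cmod (\<Phi> x) * \<langle>\<xi>\<rangle> powr (-r)" for \<xi>
    using D(2)[of \<xi>] x by (simp add: norm_mult field_simps)
  then show ?thesis using D(1) by (intro that[of "D / cmod (\<Phi> x)"]) auto
qed

text \<open>The supremum over positions is at most a sum of translates of one integrable bump with
  coefficients \<open>c k\<close>, so its integral is bounded by a multiple of the sum of
  \<open>c\<close>.\<close>

lemma trig_symbol_sjoestrand:
  fixes \<Phi> :: "'a::euclidean_space \<Rightarrow> complex"
  assumes c: "\<And>k. 0 \<le> c k" "summable c" and \<Phi>: "\<Phi> \<in> schwartz"
  shows "distribution_of (trig_symbol c \<zeta>) \<in> modulation_space \<Phi> (\<lambda>_. 1) \<infinity> 1"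
proof -
  let ?u = "distribution_of (trig_symbol c \<zeta>)"
  have u: "?u \<in> tempered_distributions" by (rule trig_symbol_tempered[OF c])
  define r where "r = real DIM('a) + 1"
  obtain A where A: "0 < A" "(\<integral>\<^sup>+x. ennreal (\<langle>x::'a\<rangle> powr (-r)) \<partial>lborel) \<le> ennreal A"
    using jb_integral_real[of r, where 'a = 'a] by (auto simp: r_def)
  obtain D where D: "0 \<le> D" "\<And>\<xi>. cmod (\<integral>t. \<Phi> t * cis (- 2 * pi * (\<xi> \<bullet> t)) \<partial>lborel) \<le> D * \<langle>\<xi>\<rangle> powr (-r)"
    using fourier_decay[OF \<Phi>] by blast
  have pt: "ennreal (cmod (STFT \<Phi> ?u z \<xi>)) \<le> (\<Sum>k. ennreal (c k * D) * ennreal (\<langle>\<xi> - \<zeta> k\<rangle> powr (-r)))" for z \<xi>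
  proof -
    let ?h = "\<lambda>t. cnj (tf_shift (z, \<xi>) \<Phi> t)"
    have h: "integrable lborel ?h" by (intro schwartz_integrable schwartz_cnj tf_shift_schwartz \<Phi>)
    let ?g = "\<lambda>k. of_real (c k) * (\<integral>t. cis (2 * pi * (\<zeta> k \<bullet> t)) * ?h t \<partial>lborel)"
    have g: "cmod (?g k) \<le> c k * (D * \<langle>\<xi> - \<zeta> k\<rangle> powr (-r))" for k
      unfolding norm_mult norm_fourier_shift[OF \<Phi>] using c D(2)[of "\<zeta> k - \<xi>"]
      by (simp add: mult_left_mono jb_minus_commute)
    have jb1: "\<langle>\<xi> - \<zeta> k\<rangle> powr (-r) \<le> 1" for k
      using powr_mono[of "-r" 0 "\<langle>\<xi> - \<zeta> k\<rangle>"] jb_ge_1[of "\<xi> - \<zeta> k"] by (simp add: r_def)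
    have sm: "summable (\<lambda>k. c k * (D * \<langle>\<xi> - \<zeta> k\<rangle> powr (-r)))"
    proof (rule summable_comparison_test'[OF summable_mult2[OF c(2), of D]])
      show "norm (c k * (D * \<langle>\<xi> - \<zeta> k\<rangle> powr (-r))) \<le> c k * D" for k
        using c(1)[of k] D(1) jb1[of k] by (auto simp: abs_mult intro!: mult_left_mono mult_left_le)
    qed
    have "cmod (STFT \<Phi> ?u z \<xi>) = cmod (\<Sum>k. ?g k)"
      by (simp add: STFT_eq distribution_of_trig_symbol[OF c h])
    also have "\<dots> \<le> (\<Sum>k. c k * (D * \<langle>\<xi> - \<zeta> k\<rangle> powr (-r)))"
      by (rule norm_suminf_le[OF g sm])
    finally have "ennreal (cmod (STFT \<Phi> ?u z \<xi>)) \<le> ennreal (\<Sum>k. c k * (D * \<langle>\<xi> - \<zeta> k\<rangle> powr (-r)))"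
      by (rule ennreal_leI)
    also have "\<dots> = (\<Sum>k. ennreal (c k * (D * \<langle>\<xi> - \<zeta> k\<rangle> powr (-r))))"
      using c D by (intro suminf_ennreal2[symmetric] sm) auto
    also have "\<dots> = (\<Sum>k. ennreal (c k * D) * ennreal (\<langle>\<xi> - \<zeta> k\<rangle> powr (-r)))"
      using c D by (simp add: ennreal_mult mult.assoc)
    finally show ?thesis .
  qed
  have meas: "(\<lambda>z. ennreal (cmod (STFT \<Phi> ?u z \<xi>))) \<in> borel_measurable lborel" for \<xi>
  proof -
    have "(\<lambda>z. STFT \<Phi> ?u (fst (z, \<xi>)) (snd (z, \<xi>))) \<in> borel_measurable borel"
      by (rule measurable_compose[OF _ STFT_measurable[OF u \<Phi>]]) (intro borel_measurable_continuous_onI continuous_intros)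
    then show ?thesis by simp
  qed
  have "(\<integral>\<^sup>+\<xi>. sup_STFT \<Phi> ?u \<xi> \<partial>lborel) \<le> (\<integral>\<^sup>+\<xi>. (\<Sum>k. ennreal (c k * D) * ennreal (\<langle>\<xi> - \<zeta> k\<rangle> powr (-r))) \<partial>lborel)"
    unfolding sup_STFT_def by (intro nn_integral_mono esssup_I meas AE_I2 pt)
  also have "\<dots> = (\<Sum>k. \<integral>\<^sup>+\<xi>. ennreal (c k * D) * ennreal (\<langle>\<xi> - \<zeta> k\<rangle> powr (-r)) \<partial>lborel)"
    by (rule nn_integral_suminf) measurable
  also have "\<dots> = (\<Sum>k. ennreal (c k * D) * (\<integral>\<^sup>+x. ennreal (\<langle>x::'a\<rangle> powr (-r)) \<partial>lborel))"
  proof (rule suminf_cong)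
    fix k
    have "(\<integral>\<^sup>+\<xi>. ennreal (\<langle>\<xi> - \<zeta> k\<rangle> powr (-r)) \<partial>lborel) = (\<integral>\<^sup>+x. ennreal (\<langle>x::'a\<rangle> powr (-r)) \<partial>lborel)"
      using lborel_nn_integral_affine[of "\<lambda>x. ennreal (\<langle>x\<rangle> powr (-r))" 1 "- \<zeta> k"] by simp
    then show "(\<integral>\<^sup>+\<xi>. ennreal (c k * D) * ennreal (\<langle>\<xi> - \<zeta> k\<rangle> powr (-r)) \<partial>lborel)
        = ennreal (c k * D) * (\<integral>\<^sup>+x. ennreal (\<langle>x::'a\<rangle> powr (-r)) \<partial>lborel)"
      by (simp add: nn_integral_cmult)
  qed
  also have "\<dots> \<le> (\<Sum>k. ennreal (c k * D) * ennreal A)"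
    by (intro suminf_le mult_left_mono A summableI) auto
  also have "\<dots> = (\<Sum>k. ennreal (c k * (D * A)))"
    using c D A by (simp add: ennreal_mult mult.assoc)
  also have "\<dots> = ennreal (\<Sum>k. c k * (D * A))"
    using c D A by (intro suminf_ennreal2 summable_mult2) auto
  also have "\<dots> < \<infinity>" by simp
  finally have fin: "(\<integral>\<^sup>+\<xi>. sup_STFT \<Phi> ?u \<xi> \<partial>lborel) < \<infinity>" .
  have "Lp_norm 1 F = (\<integral>\<^sup>+\<zeta>. F \<zeta> \<partial>lborel)" for F :: "'a \<Rightarrow> ennreal"
    by (simp add: Lp_norm_def)
  with fin u show ?thesis
    by (simp add: modulation_space_def modulation_norm_def sup_STFT_def Lp_norm_top)
qed

text \<open>The symbol \<open>z \<mapsto> exp (2 \<pi> i \<zeta> \<bullet> z)\<close> yields a time-frequency shift up to a unimodular factor.\<close>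

lemma integral_character_Wigner:
  fixes f g :: "'a::euclidean_space \<Rightarrow> complex"
  assumes f: "f \<in> schwartz" and g: "g \<in> schwartz"
  shows "(\<integral>Z. cis (2 * pi * ((snd \<omega>, - fst \<omega>) \<bullet> Z)) * cnj (Wigner \<tau> g f Z) \<partial>lborel)
    = cis (- (2 * pi * \<tau> * (snd \<omega> \<bullet> fst \<omega>))) * (\<integral>y. tf_shift \<omega> f y * cnj (g y) \<partial>lborel)"
proof -
  define a b where "a = snd \<omega>" and "b = fst \<omega>"
  define k where "k p = g (fst p + \<tau> *\<^sub>R snd p) * cnj (f (fst p - (1 - \<tau>) *\<^sub>R snd p))" for p
  have k: "k \<in> schwartz" unfolding k_def
    by (intro schwartz_linear_tensor[where C = "2 + \<bar>\<tau>\<bar>" and f = g and g = "\<lambda>x. cnj (f x)"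
        and l = "\<lambda>p. fst p + \<tau> *\<^sub>R snd p" and m = "\<lambda>p. fst p - (1 - \<tau>) *\<^sub>R snd p"] wigner_coordinates)
      (use assms in \<open>auto simp: linear_iff algebra_simps intro: schwartz_cnj\<close>)
  have W: "Wigner \<tau> g f = partial_fourier k"
    by (simp add: Wigner_eq_partial_fourier k_def[abs_def])
  have [measurable]: "f \<in> borel_measurable borel" "g \<in> borel_measurable borel"
    using f g schwartz_measurable by blast+
  have "(\<lambda>Z. cis (2 * pi * ((a, - b) \<bullet> Z)) * cnj (partial_fourier k Z)) \<in> schwartz"
    by (intro schwartz_modulate schwartz_cnj partial_fourier_schwartz k)
  note int = schwartz_integrable[OF this]
  have "(\<integral>Z. cis (2 * pi * ((a, - b) \<bullet> Z)) * cnj (partial_fourier k Z) \<partial>lborel)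
      = (\<integral>X. (\<integral>\<Xi>. cis (2 * pi * ((a, - b) \<bullet> (X, \<Xi>))) * cnj (partial_fourier k (X, \<Xi>)) \<partial>lborel) \<partial>lborel)"
    by (rule lborel_integral_Pair(1)[OF int])
  also have "\<dots> = (\<integral>X. cis (2 * pi * (a \<bullet> X)) * cnj (k (X, b)) \<partial>lborel)"
  proof (rule Bochner_Integration.integral_cong[OF refl])
    fix X
    have "(\<integral>\<Xi>. cis (2 * pi * ((a, - b) \<bullet> (X, \<Xi>))) * cnj (partial_fourier k (X, \<Xi>)) \<partial>lborel)
        = (\<integral>\<Xi>. cis (2 * pi * (a \<bullet> X)) * cnj (partial_fourier k (X, \<Xi>) * cis (2 * pi * (\<Xi> \<bullet> b))) \<partial>lborel)"
    proof (rule Bochner_Integration.integral_cong[OF refl])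
      fix \<Xi>
      have "cis (2 * pi * ((a, - b) \<bullet> (X, \<Xi>))) = cis (2 * pi * (a \<bullet> X)) * cnj (cis (2 * pi * (\<Xi> \<bullet> b)))"
        unfolding cis_cnj cis_mult by (rule arg_cong[where f = cis]) (simp add: inner_commute algebra_simps)
      then show "cis (2 * pi * ((a, - b) \<bullet> (X, \<Xi>))) * cnj (partial_fourier k (X, \<Xi>))
          = cis (2 * pi * (a \<bullet> X)) * cnj (partial_fourier k (X, \<Xi>) * cis (2 * pi * (\<Xi> \<bullet> b)))"
        by (simp add: mult_ac)
    qed
    also have "\<dots> = cis (2 * pi * (a \<bullet> X)) * cnj (k (X, b))"
      by (subst Bochner_Integration.integral_mult_right_zero)
        (simp only: Bochner_Integration.integral_cnj partial_fourier_inversion[OF k])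
    finally show "(\<integral>\<Xi>. cis (2 * pi * ((a, - b) \<bullet> (X, \<Xi>))) * cnj (partial_fourier k (X, \<Xi>)) \<partial>lborel)
        = cis (2 * pi * (a \<bullet> X)) * cnj (k (X, b))" .
  qed
  \<comment> \<open>The displacement by \<open>- \<tau>\<close> times \<open>b\<close> turns the
    kernel into \<open>g y * cnj (f (y - b))\<close>, whatever \<tau> is; \<tau> survives only in
    the phase.\<close>
  also have "\<dots> = (\<integral>y. cis (2 * pi * (a \<bullet> (y + (- \<tau>) *\<^sub>R b))) * cnj (k (y + (- \<tau>) *\<^sub>R b, b)) \<partial>lborel)"
    unfolding k_def by (rule lborel_integral_translate[symmetric]) measurable
  also have "\<dots> = (\<integral>y. cis (- (2 * pi * \<tau> * (a \<bullet> b))) * (tf_shift \<omega> f y * cnj (g y)) \<partial>lborel)"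
  proof (rule Bochner_Integration.integral_cong[OF refl])
    fix y
    have E: "cis (2 * pi * (a \<bullet> (y + (- \<tau>) *\<^sub>R b))) = cis (- (2 * pi * \<tau> * (a \<bullet> b))) * cis (2 * pi * (y \<bullet> a))"
      unfolding cis_mult by (rule arg_cong[where f = cis]) (simp add: inner_simps inner_commute algebra_simps)
    have "y + (- \<tau>) *\<^sub>R b + \<tau> *\<^sub>R b = y" "y + (- \<tau>) *\<^sub>R b - (1 - \<tau>) *\<^sub>R b = y - b"
      by (simp_all add: algebra_simps)
    then have "k (y + (- \<tau>) *\<^sub>R b, b) = g y * cnj (f (y - b))"
      unfolding k_def fst_conv snd_conv by metis
    with E show "cis (2 * pi * (a \<bullet> (y + (- \<tau>) *\<^sub>R b))) * cnj (k (y + (- \<tau>) *\<^sub>R b, b))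
        = cis (- (2 * pi * \<tau> * (a \<bullet> b))) * (tf_shift \<omega> f y * cnj (g y))"
      by (simp add: tf_shift_apply flip: a_def b_def)
  qed
  also have "\<dots> = cis (- (2 * pi * \<tau> * (a \<bullet> b))) * (\<integral>y. tf_shift \<omega> f y * cnj (g y) \<partial>lborel)"
    by (rule Bochner_Integration.integral_mult_right_zero)
  finally show ?thesis by (simp add: a_def b_def W)
qed

text \<open>Through its STFT the image is seen to be a superposition of the shifts
  \<open>tf_shift (\<omega> k) f\<close>. The frequencies are entered as rotated vectors to undo the
  rotation built into the quantisation.\<close>

lemma STFT_OP_trig_symbol:
  fixes f \<phi> :: "'a::euclidean_space \<Rightarrow> complex"
  assumes c: "\<And>k. 0 \<le> c k" "summable c" and f: "f \<in> schwartz" and \<phi>: "\<phi> \<in> schwartz"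
  shows "STFT \<phi> (OP \<tau> (distribution_of (trig_symbol c (\<lambda>k. (snd (\<omega> k), - fst (\<omega> k))))) f) x \<xi>
    = (\<Sum>k. of_real (c k) * (cis (- (2 * pi * \<tau> * (snd (\<omega> k) \<bullet> fst (\<omega> k)))) * stft \<phi> (tf_shift (\<omega> k) f) (x, \<xi>)))"
proof -
  let ?g = "tf_shift (x, \<xi>) \<phi>"
  have g: "?g \<in> schwartz" by (rule tf_shift_schwartz[OF \<phi>])
  have "integrable lborel (\<lambda>Z. cnj (Wigner \<tau> ?g f Z))"
    by (intro schwartz_integrable schwartz_cnj Wigner_schwartz f g)
  note D = distribution_of_trig_symbol[OF c this, of "\<lambda>k. (snd (\<omega> k), - fst (\<omega> k))",
      unfolded integral_character_Wigner[OF f g]]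
  have "STFT \<phi> (OP \<tau> (distribution_of (trig_symbol c (\<lambda>k. (snd (\<omega> k), - fst (\<omega> k))))) f) x \<xi>
    = distribution_of (trig_symbol c (\<lambda>k. (snd (\<omega> k), - fst (\<omega> k)))) (\<lambda>Z. cnj (Wigner \<tau> ?g f Z))"
    by (simp add: STFT_eq OP_def pairing_def)
  then show ?thesis unfolding D by (simp add: stft_eq_integral)
qed

text \<open>Time-frequency shifts form a projective representation; the unimodular factor is its
  cocycle.\<close>

lemma tf_shift_tf_shift:
  "tf_shift w (tf_shift v f) t = cis (- (2 * pi * (fst w \<bullet> snd v))) * tf_shift (w + v) f t"
proof -
  have "cis (2 * pi * (t \<bullet> snd w)) * cis (2 * pi * ((t - fst w) \<bullet> snd v))
      = cis (- (2 * pi * (fst w \<bullet> snd v))) * cis (2 * pi * (t \<bullet> snd (w + v)))"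
    unfolding cis_mult by (rule arg_cong[where f = cis]) (simp add: inner_simps algebra_simps)
  then show ?thesis by (simp add: tf_shift_apply diff_diff_eq mult.assoc[symmetric])
qed

lemma norm_stft_tf_shift:
  fixes \<phi> \<psi> :: "'a::euclidean_space \<Rightarrow> complex"
  assumes \<phi>: "\<phi> \<in> schwartz" and \<psi>: "\<psi> \<in> schwartz"
  shows "cmod (stft \<phi> (tf_shift v \<psi>) w) = cmod (stft \<phi> \<psi> (w - v))"
proof -
  define F where "F t = tf_shift v \<psi> t * cnj (tf_shift w \<phi> t)" for t
  have [measurable]: "\<phi> \<in> borel_measurable borel" "\<psi> \<in> borel_measurable borel"
    using \<phi> \<psi> schwartz_measurable by blast+
  have [measurable]: "F \<in> borel_measurable borel" unfolding F_def tf_shift_apply by measurable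
  have "stft \<phi> (tf_shift v \<psi>) w = (\<integral>t. F t \<partial>lborel)" by (simp add: stft_eq_integral F_def)
  also have "\<dots> = (\<integral>t. F (t + fst v) \<partial>lborel)"
    by (rule lborel_integral_translate[symmetric]) measurable
  also have "\<dots> = (\<integral>t. cis (2 * pi * (fst v \<bullet> (snd v - snd w))) * (\<psi> t * cnj (tf_shift (w - v) \<phi> t)) \<partial>lborel)"
  proof (rule Bochner_Integration.integral_cong[OF refl])
    fix t
    have "cis (2 * pi * ((t + fst v) \<bullet> snd v)) * cis (- (2 * pi * ((t + fst v) \<bullet> snd w)))
        = cis (2 * pi * (fst v \<bullet> (snd v - snd w))) * cis (- (2 * pi * (t \<bullet> (snd w - snd v))))"
      unfolding cis_mult by (rule arg_cong[where f = cis]) (simp add: inner_simps algebra_simps)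
    moreover have "F (t + fst v) = (cis (2 * pi * ((t + fst v) \<bullet> snd v)) * cis (- (2 * pi * ((t + fst v) \<bullet> snd w))))
        * (\<psi> t * cnj (\<phi> (t - (fst w - fst v))))"
      by (simp add: F_def tf_shift_apply cis_cnj diff_diff_eq2)
    ultimately show "F (t + fst v) = cis (2 * pi * (fst v \<bullet> (snd v - snd w))) * (\<psi> t * cnj (tf_shift (w - v) \<phi> t))"
      by (simp add: tf_shift_apply cis_cnj)
  qed
  also have "\<dots> = cis (2 * pi * (fst v \<bullet> (snd v - snd w))) * stft \<phi> \<psi> (w - v)"
    by (simp add: stft_eq_integral)
  finally show ?thesis by (simp add: norm_mult)
qed

subsection \<open>Necessity of the signs of the weight exponents\<close>

text \<open>Mixed norms are multiplicative on products \<open>g x * h \<xi>\<close>. Together with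
  \<open>mixed_norm_product_ge\<close> this is how modulation norms are estimated in the necessity
  part.\<close>

lemma mixed_norm_product_le:
  fixes F :: "'a::euclidean_space \<Rightarrow> 'a \<Rightarrow> ennreal"
  assumes p: "1 \<le> p" and q: "1 \<le> q" and F: "(\<lambda>(\<xi>, x). F x \<xi>) \<in> borel_measurable (borel \<Otimes>\<^sub>M borel)"
    and g[measurable]: "g \<in> borel_measurable borel" and h[measurable]: "h \<in> borel_measurable borel"
    and le: "\<And>x \<xi>. F x \<xi> \<le> g x * h \<xi>"
  shows "Lp_norm q (\<lambda>\<xi>. Lp_norm p (\<lambda>x. F x \<xi>)) \<le> Lp_norm p g * Lp_norm q h"
proof -
  have [measurable]: "(\<lambda>x. F x \<xi>) \<in> borel_measurable borel" for \<xi>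
    using measurable_compose[OF measurable_Pair1'[of \<xi> borel borel] F] by simp
  have meas: "(\<lambda>\<xi>. Lp_norm p (\<lambda>x. F x \<xi>)) \<in> borel_measurable borel"
    by (rule Lp_norm_measurable) (rule F)
  have "Lp_norm p (\<lambda>x. F x \<xi>) \<le> Lp_norm p g * h \<xi>" for \<xi>
  proof -
    have "Lp_norm p (\<lambda>x. F x \<xi>) \<le> Lp_norm p (\<lambda>x. h \<xi> * g x)"
      by (intro Lp_norm_mono) (use le in \<open>auto simp: mult.commute\<close>)
    also have "\<dots> \<le> h \<xi> * Lp_norm p g" by (rule Lp_norm_cmult_le[OF p g])
    finally show ?thesis by (simp add: mult.commute)
  qed
  then have "Lp_norm q (\<lambda>\<xi>. Lp_norm p (\<lambda>x. F x \<xi>)) \<le> Lp_norm q (\<lambda>\<xi>. Lp_norm p g * h \<xi>)"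
    by (intro Lp_norm_mono meas)
  also have "\<dots> \<le> Lp_norm p g * Lp_norm q h" by (rule Lp_norm_cmult_le[OF q h])
  finally show ?thesis .
qed

text \<open>The bracket power is at most 1, so its power with an exponent at least 1 is dominated by
  itself, which is integrable.\<close>

lemma Lp_norm_jb_finite:
  assumes p: "1 \<le> p" and r: "real DIM('a) < r"
  shows "Lp_norm p (\<lambda>x::'a::euclidean_space. ennreal (\<langle>x\<rangle> powr (-r))) < \<infinity>"
proof -
  have jb1: "\<langle>x::'a\<rangle> powr (-r) \<le> 1" for x
    using powr_mono[of "-r" 0 "\<langle>x\<rangle>"] jb_ge_1[of x] r by simp
  show ?thesis
  proof (cases "p = \<infinity>")
    case True
    have "Lp_norm p (\<lambda>x::'a. ennreal (\<langle>x\<rangle> powr (-r))) \<le> 1"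
      unfolding True infinity_ennreal_def Lp_norm_top
      by (intro esssup_I AE_I2) (auto simp: ennreal_le_1 jb1)
    also have "\<dots> < \<infinity>" by simp
    finally show ?thesis .
  next
    case False
    have "(\<integral>\<^sup>+x. ennreal_powr (ennreal (\<langle>x::'a\<rangle> powr (-r))) (enn2real p) \<partial>lborel) \<le> (\<integral>\<^sup>+x. ennreal (\<langle>x::'a\<rangle> powr (-r)) \<partial>lborel)"
    proof (rule nn_integral_mono)
      fix x :: 'a
      have "(\<langle>x\<rangle> powr (-r)) powr enn2real p \<le> (\<langle>x\<rangle> powr (-r)) powr 1"
        using real_exponent[OF p False] jb1[of x] by (intro powr_mono') auto
      then show "ennreal_powr (ennreal (\<langle>x\<rangle> powr (-r))) (enn2real p) \<le> ennreal (\<langle>x\<rangle> powr (-r))"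
        by (simp add: epowr_ennreal ennreal_leI)
    qed
    also have "\<dots> < \<infinity>"
      using jb_integral_real[OF r] by (metis ennreal_less_top infinity_ennreal_def le_less_trans)
    finally show ?thesis
      unfolding Lp_norm_real[OF False] epowr_less_top .
  qed
qed

text \<open>The STFT of the shifted window is, in modulus, a fixed Schwartz function moved to
  \<open>v\<close>. Of its decay, \<open>\<bar>s\<bar>\<close> and \<open>\<bar>t\<bar>\<close>
  powers pay for moving the weights to \<open>v\<close> by Peetre's inequality, and \<open>d\<close>
  powers in each variable remain for integrability.\<close>

lemma modulation_norm_tf_shift_le:
  fixes \<phi> :: "'a::euclidean_space \<Rightarrow> complex"
  assumes p: "1 \<le> p" and q: "1 \<le> q" and \<phi>: "\<phi> \<in> schwartz"
  obtains K where "0 \<le> K"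
    "\<And>v. modulation_norm \<phi> (weight s t) p q (distribution_of (tf_shift v \<phi>))
      \<le> ennreal (K * (\<langle>fst v\<rangle> powr s * \<langle>snd v\<rangle> powr t))"
proof -
  define d where "d = real DIM('a) + 1"
  have fin: "Lp_norm p (\<lambda>x::'a. ennreal (\<langle>x\<rangle> powr (-d))) < \<infinity>" "Lp_norm q (\<lambda>x::'a. ennreal (\<langle>x\<rangle> powr (-d))) < \<infinity>"
    by (intro Lp_norm_jb_finite p q; simp add: d_def)+
  obtain A where A: "0 \<le> A" "Lp_norm p (\<lambda>x::'a. ennreal (\<langle>x\<rangle> powr (-d))) = ennreal A"
    using fin(1) by (metis ennreal_cases_real less_irrefl)
  obtain B where B: "0 \<le> B" "Lp_norm q (\<lambda>x::'a. ennreal (\<langle>x\<rangle> powr (-d))) = ennreal B"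
    using fin(2) by (metis ennreal_cases_real less_irrefl)
  have psi: "stft \<phi> \<phi> \<in> schwartz" by (rule stft_schwartz[OF \<phi> \<phi>])
  obtain D where D: "0 \<le> D" "\<And>w. cmod (stft \<phi> \<phi> w) \<le> D * \<langle>w\<rangle> powr (- ((d + \<bar>s\<bar>) + (d + \<bar>t\<bar>)))"
    using schwartz_decay[OF psi] by blast
  define K where "K = D * 2 powr \<bar>s\<bar> * 2 powr \<bar>t\<bar> * A * B"
  have bound: "modulation_norm \<phi> (weight s t) p q (distribution_of (tf_shift v \<phi>))
      \<le> ennreal (K * (\<langle>fst v\<rangle> powr s * \<langle>snd v\<rangle> powr t))" for v
  proof -
    define g where "g c r y x = ennreal (c * \<langle>y\<rangle> powr r) * ennreal (\<langle>x - y\<rangle> powr (-d))" for c r and y x :: 'a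
    have [measurable]: "g c r y \<in> borel_measurable borel" for c r y
      unfolding g_def[abs_def] by measurable
    have gnorm: "Lp_norm P (g c r y) \<le> ennreal (c * \<langle>y\<rangle> powr r) * Lp_norm P (\<lambda>x::'a. ennreal (\<langle>x\<rangle> powr (-d)))"
      if "1 \<le> P" for P c r and y :: 'a
    proof -
      have "Lp_norm P (g c r y) \<le> ennreal (c * \<langle>y\<rangle> powr r) * Lp_norm P (\<lambda>x. ennreal (\<langle>x - y\<rangle> powr (-d)))"
        unfolding g_def[abs_def] by (rule Lp_norm_cmult_le[OF that]) measurable
      also have "\<dots> \<le> ennreal (c * \<langle>y\<rangle> powr r) * Lp_norm P (\<lambda>x::'a. ennreal (\<langle>x\<rangle> powr (-d)))"
        using Lp_norm_translate[of "\<lambda>x::'a. ennreal (\<langle>x\<rangle> powr (-d))" P "- y"] by (intro mult_left_mono) auto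
      finally show ?thesis .
    qed
    have pe: "\<langle>x - y\<rangle> powr (-(d + \<bar>r\<bar>)) * \<langle>x\<rangle> powr r \<le> 2 powr \<bar>r\<bar> * \<langle>y\<rangle> powr r * \<langle>x - y\<rangle> powr (-d)" for x y :: 'a and r
    proof -
      have "\<langle>x - y\<rangle> powr (-(d + \<bar>r\<bar>)) * \<langle>x\<rangle> powr r \<le> \<langle>x - y\<rangle> powr (-(d + \<bar>r\<bar>)) * (2 powr \<bar>r\<bar> * \<langle>x - y\<rangle> powr \<bar>r\<bar> * \<langle>y\<rangle> powr r)"
        by (intro mult_left_mono jb_peetre) auto
      also have "\<dots> = 2 powr \<bar>r\<bar> * \<langle>y\<rangle> powr r * (\<langle>x - y\<rangle> powr (-(d + \<bar>r\<bar>)) * \<langle>x - y\<rangle> powr \<bar>r\<bar>)" by (simp add: mult_ac)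
      also have "\<langle>x - y\<rangle> powr (-(d + \<bar>r\<bar>)) * \<langle>x - y\<rangle> powr \<bar>r\<bar> = \<langle>x - y\<rangle> powr (-d)"
        by (simp flip: powr_add)
      finally show ?thesis .
    qed
    have "modulation_norm \<phi> (weight s t) p q (distribution_of (tf_shift v \<phi>))
      \<le> Lp_norm p (g (D * 2 powr \<bar>s\<bar>) s (fst v)) * Lp_norm q (g (2 powr \<bar>t\<bar>) t (snd v))"
      unfolding modulation_norm_weight STFT_distribution_of
    proof (rule mixed_norm_product_le[OF p q])
      have [measurable]: "stft \<phi> (tf_shift v \<phi>) \<in> borel_measurable borel"
        by (intro schwartz_measurable stft_schwartz tf_shift_schwartz \<phi>)
      show "(\<lambda>(\<xi>, x). ennreal (cmod (stft \<phi> (tf_shift v \<phi>) (x, \<xi>))) * (ennreal (\<langle>x\<rangle> powr s) * ennreal (\<langle>\<xi>\<rangle> powr t)))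
          \<in> borel_measurable (borel \<Otimes>\<^sub>M borel)"
        by measurable
      fix x \<xi> :: 'a
      have "cmod (stft \<phi> (tf_shift v \<phi>) (x, \<xi>)) * (\<langle>x\<rangle> powr s * \<langle>\<xi>\<rangle> powr t)
        \<le> D * (\<langle>x - fst v\<rangle> powr (-(d + \<bar>s\<bar>)) * \<langle>\<xi> - snd v\<rangle> powr (-(d + \<bar>t\<bar>))) * (\<langle>x\<rangle> powr s * \<langle>\<xi>\<rangle> powr t)"
        unfolding norm_stft_tf_shift[OF \<phi> \<phi>]
        using jb_powr_Pair_le[of "d + \<bar>s\<bar>" "d + \<bar>t\<bar>" "x - fst v" "\<xi> - snd v"] D(1)
        by (intro mult_right_mono order_trans[OF D(2)] mult_left_mono) (auto simp: d_def minus_prod_def)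
      also have "\<dots> = D * ((\<langle>x - fst v\<rangle> powr (-(d + \<bar>s\<bar>)) * \<langle>x\<rangle> powr s) * (\<langle>\<xi> - snd v\<rangle> powr (-(d + \<bar>t\<bar>)) * \<langle>\<xi>\<rangle> powr t))"
        by (simp add: mult_ac)
      also have "\<dots> \<le> D * ((2 powr \<bar>s\<bar> * \<langle>fst v\<rangle> powr s * \<langle>x - fst v\<rangle> powr (-d)) * (2 powr \<bar>t\<bar> * \<langle>snd v\<rangle> powr t * \<langle>\<xi> - snd v\<rangle> powr (-d)))"
        using D(1) by (intro mult_left_mono mult_mono pe) auto
      finally have "ennreal (cmod (stft \<phi> (tf_shift v \<phi>) (x, \<xi>)) * (\<langle>x\<rangle> powr s * \<langle>\<xi>\<rangle> powr t))
        \<le> ennreal ((D * 2 powr \<bar>s\<bar> * \<langle>fst v\<rangle> powr s) * \<langle>x - fst v\<rangle> powr (-d) * ((2 powr \<bar>t\<bar> * \<langle>snd v\<rangle> powr t) * \<langle>\<xi> - snd v\<rangle> powr (-d)))"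
        by (intro ennreal_leI) (simp add: mult_ac)
      then show "ennreal (cmod (stft \<phi> (tf_shift v \<phi>) (x, \<xi>))) * (ennreal (\<langle>x\<rangle> powr s) * ennreal (\<langle>\<xi>\<rangle> powr t))
        \<le> g (D * 2 powr \<bar>s\<bar>) s (fst v) x * g (2 powr \<bar>t\<bar>) t (snd v) \<xi>"
        using D(1) by (simp add: g_def flip: ennreal_mult)
    qed measurable
    also have "\<dots> \<le> (ennreal (D * 2 powr \<bar>s\<bar> * \<langle>fst v\<rangle> powr s) * ennreal A) * (ennreal (2 powr \<bar>t\<bar> * \<langle>snd v\<rangle> powr t) * ennreal B)"
      using gnorm[OF p, of "D * 2 powr \<bar>s\<bar>" s "fst v"] gnorm[OF q, of "2 powr \<bar>t\<bar>" t "snd v"]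
      unfolding A B by (intro mult_mono) auto
    also have "\<dots> = ennreal (K * (\<langle>fst v\<rangle> powr s * \<langle>snd v\<rangle> powr t))"
      using A B D by (simp add: K_def mult_ac flip: ennreal_mult)
    finally show ?thesis .
  qed
  show thesis by (rule that[OF _ bound]) (use A B D in \<open>simp add: K_def\<close>)
qed

text \<open>\<open>Lp_norm_cmult_ge\<close> takes out positive real factors only. This is why the
  norm of \<open>g\<close>, which may be infinite, enters through a real lower bound
  \<open>c\<close>, and why \<open>h\<close> is finite.\<close>

lemma mixed_norm_product_ge:
  fixes F :: "'a::euclidean_space \<Rightarrow> 'a \<Rightarrow> ennreal"
  assumes p: "1 \<le> p" and q: "1 \<le> q"
    and g[measurable]: "g \<in> borel_measurable borel" and h[measurable]: "h \<in> borel_measurable borel"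
    and c: "0 < c" "ennreal c \<le> Lp_norm p g" and h_finite: "\<And>\<xi>. h \<xi> < \<infinity>"
    and le: "\<And>x \<xi>. g x * h \<xi> \<le> F x \<xi>"
  shows "ennreal c * Lp_norm q h \<le> Lp_norm q (\<lambda>\<xi>. Lp_norm p (\<lambda>x. F x \<xi>))"
proof -
  have "ennreal c * Lp_norm q h \<le> Lp_norm q (\<lambda>\<xi>. ennreal c * h \<xi>)"
    by (rule Lp_norm_cmult_ge[OF q h c(1)])
  also have "\<dots> \<le> Lp_norm q (\<lambda>\<xi>. Lp_norm p (\<lambda>x. F x \<xi>))"
  proof (rule Lp_norm_mono)
    fix \<xi>
    show "ennreal c * h \<xi> \<le> Lp_norm p (\<lambda>x. F x \<xi>)"
    proof (cases "h \<xi> = 0")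
      case False
      obtain b where b: "0 \<le> b" "h \<xi> = ennreal b"
        using h_finite[of \<xi>] by (metis ennreal_cases_real less_irrefl)
      with False have "0 < b" by (simp add: less_le)
      have "ennreal c * h \<xi> \<le> ennreal b * Lp_norm p g"
        using c(2) by (simp add: b(2) mult.commute mult_left_mono)
      also have "\<dots> \<le> Lp_norm p (\<lambda>x. ennreal b * g x)"
        by (rule Lp_norm_cmult_ge[OF p g \<open>0 < b\<close>])
      also have "\<dots> \<le> Lp_norm p (\<lambda>x. F x \<xi>)"
        by (rule Lp_norm_mono) (use le[of _ \<xi>] b in \<open>auto simp: mult.commute\<close>)
      finally show ?thesis .
    qed simp
  qed measurable
  finally show ?thesis .
qed

text \<open>A ball has positive measure, so the norm is positive for the centre 0; translation makes
  the constant the same for all centres.\<close>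

lemma Lp_norm_indicator_cball:
  assumes p: "1 \<le> p" and \<delta>: "0 < \<delta>"
  obtains c where "0 < c" "\<And>y::'a::euclidean_space. ennreal c \<le> Lp_norm p (indicator (cball y \<delta>))"
proof -
  have pos: "0 < Lp_norm p (indicator (cball (0::'a) \<delta>))"
  proof (rule ccontr)
    assume "\<not> 0 < Lp_norm p (indicator (cball (0::'a) \<delta>))"
    then have z: "Lp_norm p (indicator (cball (0::'a) \<delta>)) = 0" by simp
    have "AE x::'a in lborel. indicator (cball 0 \<delta>) x = (0::ennreal)"
    proof (cases "p = \<infinity>")
      case True
      have "AE x::'a in lborel. indicator (cball 0 \<delta>) x \<le> esssup lborel (indicator (cball (0::'a) \<delta>) :: 'a \<Rightarrow> ennreal)"
        by (rule esssup_AE)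
      with z show ?thesis by (simp add: True Lp_norm_top)
    next
      case False
      then show ?thesis using z by (intro Lp_norm_0_AE[OF p] borel_measurable_indicator) auto
    qed
    then have "emeasure lborel (cball (0::'a) \<delta>) = 0"
      by (subst AE_iff_measurable[symmetric, where P = "\<lambda>x. x \<notin> cball 0 \<delta>"]) (auto simp: indicator_def)
    with \<delta> show False
      using emeasure_lborel_cball_finite[of "0::'a" \<delta>] content_cball_pos[OF \<delta>, of "0::'a"] by (simp add: measure_def)
  qed
  obtain c where c: "0 < c" "ennreal c \<le> Lp_norm p (indicator (cball (0::'a) \<delta>))"
  proof (cases "Lp_norm p (indicator (cball (0::'a) \<delta>))" rule: ennreal_cases_real)
    case (real a)
    with pos that[of a] show ?thesis by auto
  next
    case top
    with that[of 1] show ?thesis by simp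
  qed
  have "ennreal c \<le> Lp_norm p (indicator (cball y \<delta>))" for y :: 'a
  proof -
    have "(\<lambda>x. indicator (cball y \<delta>) (x + y) :: ennreal) = indicator (cball 0 \<delta>)"
      by (auto simp: indicator_def dist_norm fun_eq_iff)
    moreover have "(indicator (cball y \<delta>) :: 'a \<Rightarrow> ennreal) \<in> borel_measurable borel"
      by (intro borel_measurable_indicator) auto
    ultimately show ?thesis
      using c(2) Lp_norm_translate[of "indicator (cball y \<delta>)" p y] by (metis order_trans)
  qed
  with c(1) that show ?thesis by blast
qed

text \<open>On the two balls the weight is comparable to its value at \<open>w\<close>, which leaves
  the mixed norm of a product of indicators. \<kappa> is fixed before the functional and the centre,
  so it serves for all \<open>l\<close> and \<open>v\<close> at once.\<close>

lemma modulation_norm_hump_ge: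
  assumes p: "1 \<le> p" and q: "1 \<le> q" and \<delta>: "0 < \<delta>" "\<delta> \<le> 1"
  obtains \<kappa> where "0 < \<kappa>"
    "\<And>(\<phi> :: 'a::euclidean_space \<Rightarrow> complex) u \<mu> w. 0 \<le> \<mu> \<Longrightarrow>
      (\<And>x \<xi>. x \<in> cball (fst w) \<delta> \<Longrightarrow> \<xi> \<in> cball (snd w) \<delta> \<Longrightarrow> \<mu> \<le> cmod (STFT \<phi> u x \<xi>)) \<Longrightarrow>
      ennreal (\<kappa> * (\<mu> * (\<langle>fst w\<rangle> powr s * \<langle>snd w\<rangle> powr t))) \<le> modulation_norm \<phi> (weight s t) p q u"
proof -
  obtain a where a: "0 < a" "\<And>y::'a. ennreal a \<le> Lp_norm p (indicator (cball y \<delta>))"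
    using Lp_norm_indicator_cball[OF p \<delta>(1)] by blast
  obtain b where b: "0 < b" "\<And>y::'a. ennreal b \<le> Lp_norm q (indicator (cball y \<delta>))"
    using Lp_norm_indicator_cball[OF q \<delta>(1)] by blast
  define \<kappa> where "\<kappa> = a * b * (4 powr (-\<bar>s\<bar>) * 4 powr (-\<bar>t\<bar>))"
  have "ennreal (\<kappa> * (\<mu> * (\<langle>fst w\<rangle> powr s * \<langle>snd w\<rangle> powr t))) \<le> modulation_norm \<phi> (weight s t) p q u"
    if \<mu>: "0 \<le> \<mu>" and ge: "\<And>x \<xi>. x \<in> cball (fst w) \<delta> \<Longrightarrow> \<xi> \<in> cball (snd w) \<delta> \<Longrightarrow> \<mu> \<le> cmod (STFT \<phi> u x \<xi>)"
    for \<phi> :: "'a \<Rightarrow> complex" and u \<mu> w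
  proof -
    define m where "m = \<mu> * ((4 powr (-\<bar>s\<bar>) * \<langle>fst w\<rangle> powr s) * (4 powr (-\<bar>t\<bar>) * \<langle>snd w\<rangle> powr t))"
    have m0: "0 \<le> m" using \<mu> by (simp add: m_def)
    define h where "h \<xi> = ennreal m * indicator (cball (snd w) \<delta>) \<xi>" for \<xi>
    have [measurable]: "(indicator (cball y \<delta>) :: 'a \<Rightarrow> ennreal) \<in> borel_measurable borel" for y
      by (intro borel_measurable_indicator) auto
    have [measurable]: "h \<in> borel_measurable borel" unfolding h_def[abs_def] by measurable
    have "ennreal (\<kappa> * (\<mu> * (\<langle>fst w\<rangle> powr s * \<langle>snd w\<rangle> powr t))) = ennreal (a * (m * b))"
      by (simp add: \<kappa>_def m_def mult_ac)
    also have "\<dots> \<le> ennreal a * Lp_norm q h"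
    proof (cases "m = 0")
      case False
      then have "0 < m" using m0 by simp
      have "ennreal (a * (m * b)) = ennreal a * (ennreal m * ennreal b)"
        using a b m0 by (simp add: ennreal_mult)
      also have "\<dots> \<le> ennreal a * (ennreal m * Lp_norm q (indicator (cball (snd w) \<delta>)))"
        by (intro mult_left_mono b) auto
      also have "\<dots> \<le> ennreal a * Lp_norm q h"
        unfolding h_def[abs_def] by (intro mult_left_mono Lp_norm_cmult_ge[OF q] \<open>0 < m\<close>) auto
      finally show ?thesis .
    qed simp
    also have "\<dots> \<le> modulation_norm \<phi> (weight s t) p q u"
      unfolding modulation_norm_weight
    proof (rule mixed_norm_product_ge[OF p q _ _ a(1) a(2)[of "fst w"]])
      show "h \<xi> < \<infinity>" for \<xi> by (simp add: h_def indicator_def)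
      fix x \<xi>
      show "indicator (cball (fst w) \<delta>) x * h \<xi>
        \<le> ennreal (cmod (STFT \<phi> u x \<xi>)) * (ennreal (\<langle>x\<rangle> powr s) * ennreal (\<langle>\<xi>\<rangle> powr t))"
      proof (cases "x \<in> cball (fst w) \<delta> \<and> \<xi> \<in> cball (snd w) \<delta>")
        case True
        then have "m \<le> cmod (STFT \<phi> u x \<xi>) * (\<langle>x\<rangle> powr s * \<langle>\<xi>\<rangle> powr t)"
          unfolding m_def using jb_powr_near[OF _ \<delta>(2)] ge \<mu> by (intro mult_mono) auto
        with True show ?thesis
          by (simp add: h_def ennreal_leI flip: ennreal_mult)
      next
        case False
        then show ?thesis by (auto simp: h_def indicator_def)
      qed
    qed measurable
    finally show ?thesis .
  qed
  moreover have "0 < \<kappa>" using a b by (simp add: \<kappa>_def)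
  ultimately show thesis by (rule that[rotated])
qed

text \<open>The remaining terms sum to at most \<open>M\<close> times the sum of all
  \<open>(1/2)^k\<close>, which is 2.\<close>

lemma suminf_norm_ge_term:
  fixes a :: "nat \<Rightarrow> complex"
  assumes sa: "summable (\<lambda>k. cmod (a k))" and M: "0 \<le> M"
    and le: "\<And>k. k \<noteq> l \<Longrightarrow> cmod (a k) \<le> (1/2)^k * M"
  shows "cmod (a l) - 2 * M \<le> cmod (\<Sum>k. a k)"
proof -
  define b where "b k = (if k = l then 0 else a k)" for k
  have "(\<lambda>k. (1/2)^k * M) sums (2 * M)"
    using sums_mult2[OF geometric_sums[of "1/2::real"], of M] by simp
  then have s: "summable (\<lambda>k. (1/2)^k * M)" "(\<Sum>k. (1/2)^k * M) = 2 * M"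
    by (simp_all add: sums_iff)
  have "cmod (\<Sum>k. b k) \<le> (\<Sum>k. (1/2)^k * M)"
    by (rule norm_suminf_le[OF _ s(1)]) (use le M in \<open>auto simp: b_def\<close>)
  moreover have "(\<lambda>k. if k = l then a k else 0) sums a l" by (rule sums_single)
  moreover have "summable b"
    by (rule summable_comparison_test'[OF sa]) (auto simp: b_def)
  ultimately have "(\<lambda>k. (if k = l then a k else 0) + b k) sums (a l + (\<Sum>k. b k))"
    by (intro sums_add summable_sums)
  moreover have "(if k = l then a k else 0) + b k = a k" for k by (simp add: b_def)
  ultimately have "(\<Sum>k. a k) = a l + (\<Sum>k. b k)" by (simp add: sums_iff)
  with \<open>cmod (\<Sum>k. b k) \<le> _\<close> s(2) show ?thesis
    using norm_diff_ineq[of "a l" "\<Sum>k. b k"] by simp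
qed

text \<open>At the origin the transform is the squared norm of \<phi>; continuity keeps at least
  half of it nearby.\<close>

lemma stft_near_0:
  fixes \<phi> :: "'a::euclidean_space \<Rightarrow> complex"
  assumes \<phi>: "\<phi> \<in> schwartz" "\<phi> \<noteq> (\<lambda>_. 0)"
  obtains n \<delta> where "0 < n" "0 < \<delta>" "\<delta> \<le> 1"
    "\<And>x \<xi>. norm x \<le> \<delta> \<Longrightarrow> norm \<xi> \<le> \<delta> \<Longrightarrow> n \<le> cmod (stft \<phi> \<phi> (x, \<xi>))"
proof -
  define N where "N = (\<integral>s. (cmod (\<phi> s))\<^sup>2 \<partial>lborel)"
  have N: "0 < N" unfolding N_def by (rule schwartz_norm2_pos[OF \<phi>])
  have "stft \<phi> \<phi> 0 = (\<integral>s. complex_of_real ((cmod (\<phi> s))\<^sup>2) \<partial>lborel)"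
    unfolding stft_eq_integral tf_shift_apply by (simp add: complex_norm_square[symmetric])
  then have F0: "stft \<phi> \<phi> 0 = of_real N" by (simp only: N_def integral_complex_of_real)
  have "isCont (stft \<phi> \<phi>) 0"
    using schwartz_continuous[OF stft_schwartz[OF \<phi>(1) \<phi>(1)], of UNIV]
    by (simp only: continuous_on_eq_continuous_at[OF open_UNIV] UNIV_I ball_simps)
  then obtain e where e: "0 < e" "\<And>w. dist w 0 < e \<Longrightarrow> dist (stft \<phi> \<phi> w) (stft \<phi> \<phi> 0) < N / 2"
    using N unfolding continuous_at_eps_delta by (metis half_gt_zero)
  define \<delta> where "\<delta> = min 1 (e / 3)"
  have "N / 2 \<le> cmod (stft \<phi> \<phi> (x, \<xi>))" if "norm x \<le> \<delta>" "norm \<xi> \<le> \<delta>" for x \<xi>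
  proof -
    have "norm (x, \<xi>) \<le> norm x + norm \<xi>" using norm_le_fst_snd[of "(x, \<xi>)"] by simp
    also have "\<dots> \<le> e / 3 + e / 3" using that by (intro add_mono) (auto simp: \<delta>_def)
    also have "\<dots> < e" using e(1) by simp
    finally have "dist (stft \<phi> \<phi> (x, \<xi>)) (of_real N) < N / 2"
      using e(2)[of "(x, \<xi>)"] F0 by (simp add: dist_norm)
    then show ?thesis
      using norm_triangle_ineq2[of "of_real N" "stft \<phi> \<phi> (x, \<xi>)"] N by (simp add: dist_norm norm_minus_commute)
  qed
  then show ?thesis using N e(1) by (intro that[of "N / 2" \<delta>]) (auto simp: \<delta>_def)
qed

text \<open>
  The \<open>l\<close>-th time-frequency shift has the small coefficient \<open>2^-l\<close>, but it dominates near its centre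
  because the distance to the other centres is at least of order \<open>R^(l+1)\<close> while the STFT decays.
\<close>

lemma STFT_trig_symbol_hump:
  fixes \<phi> :: "'a::euclidean_space \<Rightarrow> complex"
  assumes \<phi>: "\<phi> \<in> schwartz" "\<phi> \<noteq> (\<lambda>_. 0)"
  obtains n \<delta> R0 where "0 < n" "0 < \<delta>" "\<delta> \<le> 1"
    "\<And>R e l v x \<xi>. R0 \<le> R \<Longrightarrow> norm (e :: 'a \<times> 'a) = 1 \<Longrightarrow>
      x \<in> cball (fst (R^(l+1) *\<^sub>R e + v)) \<delta> \<Longrightarrow> \<xi> \<in> cball (snd (R^(l+1) *\<^sub>R e + v)) \<delta> \<Longrightarrow>
      (1/2)^l * n \<le> cmod (STFT \<phi> (OP \<tau> (distribution_of (trig_symbol (\<lambda>k. (1/2)^k)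
        (\<lambda>k. (snd (R^(k+1) *\<^sub>R e), - fst (R^(k+1) *\<^sub>R e))))) (tf_shift v \<phi>)) x \<xi>)"
proof -
  obtain n \<delta> where n: "0 < n" and \<delta>: "0 < \<delta>" "\<delta> \<le> 1"
    and near: "\<And>x \<xi>. norm x \<le> \<delta> \<Longrightarrow> norm \<xi> \<le> \<delta> \<Longrightarrow> n \<le> cmod (stft \<phi> \<phi> (x, \<xi>))"
    using stft_near_0[OF \<phi>] by blast
  obtain D where D: "0 \<le> D" "\<And>w. cmod (stft \<phi> \<phi> w) \<le> D * \<langle>w\<rangle> powr (-1)"
    using schwartz_decay[OF stft_schwartz[OF \<phi>(1) \<phi>(1)]] by blast
  \<comment> \<open>Ensures \<open>R \<ge> 4\<close> and \<open>D / (R - 3) \<le> n / 4\<close>; all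
    other shifts together then contribute at most half of the main term.\<close>
  define R0 where "R0 = 4 + 4 * D / n"
  have "(1/2)^l * (n / 2) \<le> cmod (STFT \<phi> (OP \<tau> (distribution_of (trig_symbol (\<lambda>k. (1/2)^k)
        (\<lambda>k. (snd (R^(k+1) *\<^sub>R e), - fst (R^(k+1) *\<^sub>R e))))) (tf_shift v \<phi>)) x \<xi>)"
    if R: "R0 \<le> R" and e: "norm (e :: 'a \<times> 'a) = 1"
      and x: "x \<in> cball (fst (R^(l+1) *\<^sub>R e + v)) \<delta>" and \<xi>: "\<xi> \<in> cball (snd (R^(l+1) *\<^sub>R e + v)) \<delta>"
    for R e l v x \<xi>
  proof -
    have R4: "4 \<le> R" using R n D(1) by (simp add: R0_def) (smt (verit) divide_nonneg_pos)
    have RD: "4 * D / n \<le> R - 3" using R by (simp add: R0_def)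
    \<comment> \<open>The offset from the l-th centre, of norm at most 2; seen from the k-th centre
      it is displaced by a multiple of \<open>e\<close>.\<close>
    define u where "u = (x, \<xi>) - (R^(l+1) *\<^sub>R e + v)"
    have u_small: "norm (fst u) \<le> \<delta>" "norm (snd u) \<le> \<delta>"
      using x \<xi> by (auto simp: u_def dist_norm norm_minus_commute)
    then have u2: "norm u \<le> 2" using norm_le_fst_snd[of u] \<delta> by linarith
    define a where "a k = of_real ((1/2)^k) * (cis (- (2 * pi * \<tau> * (snd (R^(k+1) *\<^sub>R e) \<bullet> fst (R^(k+1) *\<^sub>R e))))
      * stft \<phi> (tf_shift (R^(k+1) *\<^sub>R e) (tf_shift v \<phi>)) (x, \<xi>))" for k
    have na: "cmod (a k) = (1/2)^k * cmod (stft \<phi> \<phi> (u + (R^(l+1) - R^(k+1)) *\<^sub>R e))" for k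
    proof -
      have "tf_shift (R^(k+1) *\<^sub>R e) (tf_shift v \<phi>)
        = (\<lambda>t. cis (- (2 * pi * (fst (R^(k+1) *\<^sub>R e) \<bullet> snd v))) * tf_shift (R^(k+1) *\<^sub>R e + v) \<phi> t)"
        by (rule ext) (rule tf_shift_tf_shift)
      then have "cmod (stft \<phi> (tf_shift (R^(k+1) *\<^sub>R e) (tf_shift v \<phi>)) (x, \<xi>))
          = cmod (stft \<phi> (tf_shift (R^(k+1) *\<^sub>R e + v) \<phi>) (x, \<xi>))"
        unfolding stft_eq_integral by (simp add: mult.assoc norm_mult)
      also have "\<dots> = cmod (stft \<phi> \<phi> ((x, \<xi>) - (R^(k+1) *\<^sub>R e + v)))"
        by (rule norm_stft_tf_shift[OF \<phi>(1) \<phi>(1)])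
      also have "(x, \<xi>) - (R^(k+1) *\<^sub>R e + v) = u + (R^(l+1) - R^(k+1)) *\<^sub>R e"
        by (simp add: u_def algebra_simps del: power_Suc)
      finally show ?thesis by (simp add: a_def norm_mult norm_power)
    qed
    have bound: "cmod (stft \<phi> \<phi> w) \<le> D" for w
      using D(2)[of w] D(1) jb_ge_1[of w] powr_mono[of "-1" 0 "\<langle>w\<rangle>"]
      by (metis mult_left_le order_trans powr_zero_eq_one jb_pos less_irrefl less_eq_real_def neg_le_0_iff_le zero_le_one)
    define M where "M = D / (R^l * (R - 3))"
    have "R^l * (R - 3) > 0" using R4 by simp
    have M0: "0 \<le> M" unfolding M_def using D(1) \<open>R^l * (R - 3) > 0\<close> by simp
    have far: "cmod (a k) \<le> (1/2)^k * M" if "k \<noteq> l" for k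
    proof -
      \<comment> \<open>Geometric growth separates the radii: the gap is at least
        \<open>R^(l+1) - R^l\<close> for \<open>k < l\<close>, and at least
        \<open>R^(l+2) - R^(l+1)\<close> for \<open>k > l\<close>. Subtracting the offset leaves
        \<open>R^l * (R - 3)\<close>.\<close>
      have 1: "R^l * (R - 1) \<le> \<bar>R^(l+1) - R^(k+1)\<bar>"
      proof (cases "k < l")
        case True
        then have "R^(k+1) \<le> R^l" using R4 by (intro power_increasing) auto
        then show ?thesis by (simp add: algebra_simps)
      next
        case False
        with that have "R^(l+2) \<le> R^(k+1)" using R4 by (intro power_increasing) auto
        moreover have "R^l * (R - 1) \<le> R^(l+1) * (R - 1)" using R4 by (intro mult_right_mono power_increasing) auto
        ultimately show ?thesis by (simp add: algebra_simps)
      qed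
      have "norm ((R^(l+1) - R^(k+1)) *\<^sub>R e) - norm (- u) \<le> norm ((R^(l+1) - R^(k+1)) *\<^sub>R e - (- u))"
        by (rule norm_triangle_ineq2)
      then have "\<bar>R^(l+1) - R^(k+1)\<bar> - norm u \<le> norm (u + (R^(l+1) - R^(k+1)) *\<^sub>R e)"
        by (simp only: norm_scaleR e norm_minus_cancel diff_minus_eq_add mult_1_right add.commute)
      moreover have "1 \<le> R^l" using R4 by simp
      moreover have "R^l * (R - 3) = R^l * (R - 1) - 2 * R^l" by (simp add: algebra_simps)
      ultimately have "R^l * (R - 3) \<le> norm (u + (R^(l+1) - R^(k+1)) *\<^sub>R e)"
        using 1 u2 by argo
      also have "\<dots> \<le> \<langle>u + (R^(l+1) - R^(k+1)) *\<^sub>R e\<rangle>" by (rule norm_le_jb)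
      finally have "\<langle>u + (R^(l+1) - R^(k+1)) *\<^sub>R e\<rangle> powr (-1) \<le> (R^l * (R - 3)) powr (-1)"
        using \<open>R^l * (R - 3) > 0\<close> by (intro powr_mono2') auto
      also have "\<dots> = inverse (R^l * (R - 3))" using \<open>R^l * (R - 3) > 0\<close> by (simp add: powr_minus)
      finally have "cmod (stft \<phi> \<phi> (u + (R^(l+1) - R^(k+1)) *\<^sub>R e)) \<le> D * inverse (R^l * (R - 3))"
        using D(1) by (intro order_trans[OF D(2)] mult_left_mono)
      then have "cmod (stft \<phi> \<phi> (u + (R^(l+1) - R^(k+1)) *\<^sub>R e)) \<le> M"
        by (simp only: M_def divide_inverse)
      then show ?thesis unfolding na by (rule mult_left_mono) simp
    qed
    have "summable (\<lambda>k. cmod (a k))"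
    proof (rule summable_comparison_test')
      show "summable (\<lambda>k. (1/2)^k * D)" by (intro summable_mult2 summable_geometric) simp
      have "cmod (a k) \<le> (1/2)^k * D" for k unfolding na by (intro mult_left_mono bound) simp
      then show "norm (cmod (a k)) \<le> (1/2)^k * D" for k by (simp only: real_norm_def abs_norm_cancel)
    qed
    from suminf_norm_ge_term[OF this M0 far]
    have "cmod (a l) - 2 * M \<le> cmod (\<Sum>k. a k)" by simp
    moreover have "cmod (a l) \<ge> (1/2)^l * n"
      unfolding na using near[of "fst u" "snd u"] u_small by (intro mult_left_mono) auto
    \<comment> \<open>The factor \<open>1 / R^l\<close> in the error outweighs the small coefficient
      \<open>(1/2)^l\<close> of the main term.\<close>
    moreover have "2 * M \<le> (1/2)^l * (n / 2)"
    proof -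
      have "D / (R - 3) \<le> n / 4" using RD R4 n by (simp add: field_simps)
      moreover have "1 / R^l \<le> (1/2)^l"
        unfolding power_one_over[symmetric] using R4 by (intro power_mono) (auto simp: field_simps)
      ultimately have "1 / R^l * (D / (R - 3)) \<le> (1/2)^l * (n / 4)"
        using D(1) R4 by (intro mult_mono) auto
      then show ?thesis by (simp add: M_def mult.commute[of 4 D])
    qed
    moreover have "STFT \<phi> (OP \<tau> (distribution_of (trig_symbol (\<lambda>k. (1/2)^k)
        (\<lambda>k. (snd (R^(k+1) *\<^sub>R e), - fst (R^(k+1) *\<^sub>R e))))) (tf_shift v \<phi>)) x \<xi> = (\<Sum>k. a k)"
      unfolding a_def
      by (rule STFT_OP_trig_symbol) (auto intro: tf_shift_schwartz \<phi> summable_geometric)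
    ultimately show ?thesis by simp
  qed
  then show ?thesis using n \<delta> by (intro that[of "n / 2" \<delta> R0]) auto
qed

text \<open>Boundedness for one lacunary symbol, tested on \<open>tf_shift v \<phi>\<close> and
  observed near the l-th centre. The constant depends on the symbol, hence on \<open>R\<close> and
  \<open>e\<close>, but not on \<open>l\<close> and \<open>v\<close>.\<close>

lemma OP_bounded_hump:
  fixes \<phi> :: "'a::euclidean_space \<Rightarrow> complex"
  assumes p: "1 \<le> p1" "1 \<le> p2" and q: "1 \<le> q1" "1 \<le> q2"
    and \<phi>: "\<phi> \<in> schwartz" "\<phi> \<noteq> (\<lambda>_. 0)" and \<Phi>: "\<Phi> \<in> schwartz"
    and B: "all_OP_bounded \<phi> \<tau> (modulation_space \<Phi> (\<lambda>_. 1) \<infinity> 1) (weight s1 t1) p1 q1 (weight s2 t2) p2 q2"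
  obtains R0 where "\<And>R e. R0 \<le> R \<Longrightarrow> norm (e :: 'a \<times> 'a) = 1 \<Longrightarrow>
    \<exists>C. \<forall>l v. (1/2)^l * (\<langle>fst (R^(l+1) *\<^sub>R e + v)\<rangle> powr s2 * \<langle>snd (R^(l+1) *\<^sub>R e + v)\<rangle> powr t2)
      \<le> C * (\<langle>fst v\<rangle> powr s1 * \<langle>snd v\<rangle> powr t1)"
proof -
  obtain n \<delta> R0 where n: "0 < n" and \<delta>: "0 < \<delta>" "\<delta> \<le> 1" and hump:
    "\<And>R e l v x \<xi>. R0 \<le> R \<Longrightarrow> norm (e :: 'a \<times> 'a) = 1 \<Longrightarrow>
      x \<in> cball (fst (R^(l+1) *\<^sub>R e + v)) \<delta> \<Longrightarrow> \<xi> \<in> cball (snd (R^(l+1) *\<^sub>R e + v)) \<delta> \<Longrightarrow>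
      (1/2)^l * n \<le> cmod (STFT \<phi> (OP \<tau> (distribution_of (trig_symbol (\<lambda>k. (1/2)^k)
        (\<lambda>k. (snd (R^(k+1) *\<^sub>R e), - fst (R^(k+1) *\<^sub>R e))))) (tf_shift v \<phi>)) x \<xi>)"
    using STFT_trig_symbol_hump[OF \<phi>, of \<tau>] by blast
  obtain \<kappa> where \<kappa>: "0 < \<kappa>" and lower:
    "\<And>(\<phi> :: 'a \<Rightarrow> complex) u \<mu> w. 0 \<le> \<mu> \<Longrightarrow>
      (\<And>x \<xi>. x \<in> cball (fst w) \<delta> \<Longrightarrow> \<xi> \<in> cball (snd w) \<delta> \<Longrightarrow> \<mu> \<le> cmod (STFT \<phi> u x \<xi>)) \<Longrightarrow>
      ennreal (\<kappa> * (\<mu> * (\<langle>fst w\<rangle> powr s2 * \<langle>snd w\<rangle> powr t2))) \<le> modulation_norm \<phi> (weight s2 t2) p2 q2 u"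
    using modulation_norm_hump_ge[OF p(2) q(2) \<delta>, of s2 t2] by blast
  obtain K where K: "0 \<le> K" and upper:
    "\<And>v. modulation_norm \<phi> (weight s1 t1) p1 q1 (distribution_of (tf_shift v \<phi>))
      \<le> ennreal (K * (\<langle>fst v\<rangle> powr s1 * \<langle>snd v\<rangle> powr t1))"
    using modulation_norm_tf_shift_le[OF p(1) q(1) \<phi>(1), of s1 t1] by blast
  show thesis
  proof (rule that[of R0])
    fix R :: real and e :: "'a \<times> 'a"
    assume R: "R0 \<le> R" and e: "norm e = 1"
    let ?\<sigma> = "distribution_of (trig_symbol (\<lambda>k. (1/2)^k) (\<lambda>k. (snd (R^(k+1) *\<^sub>R e), - fst (R^(k+1) *\<^sub>R e))))"
    have "?\<sigma> \<in> modulation_space \<Phi> (\<lambda>_. 1) \<infinity> 1"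
      by (rule trig_symbol_sjoestrand[OF _ _ \<Phi>]) (auto intro: summable_geometric)
    with B obtain C where C: "\<And>f. f \<in> schwartz \<Longrightarrow> modulation_norm \<phi> (weight s2 t2) p2 q2 (OP \<tau> ?\<sigma> f)
        \<le> ennreal C * modulation_norm \<phi> (weight s1 t1) p1 q1 (distribution_of f)"
      unfolding all_OP_bounded_def by blast
    have "(1/2)^l * (\<langle>fst (R^(l+1) *\<^sub>R e + v)\<rangle> powr s2 * \<langle>snd (R^(l+1) *\<^sub>R e + v)\<rangle> powr t2)
      \<le> (\<bar>C\<bar> * K / (\<kappa> * n)) * (\<langle>fst v\<rangle> powr s1 * \<langle>snd v\<rangle> powr t1)" for l v
    proof -
      let ?X = "\<langle>fst (R^(l+1) *\<^sub>R e + v)\<rangle> powr s2 * \<langle>snd (R^(l+1) *\<^sub>R e + v)\<rangle> powr t2"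
      let ?Y = "\<langle>fst v\<rangle> powr s1 * \<langle>snd v\<rangle> powr t1"
      have "ennreal (\<kappa> * ((1/2)^l * n * ?X)) \<le> modulation_norm \<phi> (weight s2 t2) p2 q2 (OP \<tau> ?\<sigma> (tf_shift v \<phi>))"
        by (rule lower) (use hump[OF R e] n in auto)
      also have "\<dots> \<le> ennreal C * modulation_norm \<phi> (weight s1 t1) p1 q1 (distribution_of (tf_shift v \<phi>))"
        by (intro C tf_shift_schwartz \<phi>)
      also have "\<dots> \<le> ennreal \<bar>C\<bar> * ennreal (K * ?Y)"
        by (intro mult_mono ennreal_leI upper) auto
      also have "\<dots> = ennreal (\<bar>C\<bar> * (K * ?Y))"
        using K by (simp add: ennreal_mult)
      finally have "\<kappa> * ((1/2)^l * n * ?X) \<le> \<bar>C\<bar> * (K * ?Y)"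
        using K by (subst (asm) ennreal_le_iff) auto
      then show ?thesis using \<kappa> n by (simp add: field_simps)
    qed
    then show "\<exists>C. \<forall>l v. (1/2)^l * (\<langle>fst (R^(l+1) *\<^sub>R e + v)\<rangle> powr s2 * \<langle>snd (R^(l+1) *\<^sub>R e + v)\<rangle> powr t2)
      \<le> C * (\<langle>fst v\<rangle> powr s1 * \<langle>snd v\<rangle> powr t1)" by blast
  qed
qed

lemma not_power2_bounded: "\<exists>l. (C::real) < 2^l"
  using real_arch_pow[of 2 C] by auto

text \<open>Once \<open>R powr s \<ge> 4\<close>, the weight grows like \<open>4^(l+1)\<close> and
  beats the loss \<open>(1/2)^l\<close>.\<close>

lemma weight_growth_nonpos:
  fixes e :: "'a::euclidean_space"
  assumes "norm e = 1" and R: "0 < R" "4 \<le> R powr s" and s: "0 < s"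
    and C: "\<And>l. (1/2)^l * \<langle>R^(l+1) *\<^sub>R e\<rangle> powr s \<le> C"
  shows False
proof -
  have "2^l \<le> C" for l
  proof -
    have "4^(l+1) \<le> (R powr s)^(l+1)" using R by (intro power_mono) auto
    also have "\<dots> = (R^(l+1)) powr s"
      using R by (simp only: powr_realpow[symmetric] powr_powr zero_less_power powr_gt_zero) (simp add: powr_powr mult.commute)
    also have "\<dots> \<le> \<langle>R^(l+1) *\<^sub>R e\<rangle> powr s"
      using norm_le_jb[of "R^(l+1) *\<^sub>R e"] assms(1) R s by (intro powr_mono2) auto
    finally have "(1/2)^l * 4^(l+1) \<le> (1/2)^l * \<langle>R^(l+1) *\<^sub>R e\<rangle> powr s"
      by (intro mult_left_mono) auto
    also have "\<dots> \<le> C" by (rule C)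
    finally have "(1/2)^l * 4^(l+1) \<le> C" .
    moreover have "(1/2::real)^l * 4^(l+1) = 4 * 2^l"
      by (simp add: power_mult_distrib[symmetric])
    moreover have "(0::real) \<le> 2^l" by simp
    ultimately show ?thesis by linarith
  qed
  with not_power2_bounded[of C] show False by (meson not_less)
qed

text \<open>With \<open>v = 0\<close> the shifts leave the origin and test the target weight far
  out; with \<open>v\<close> the negative of the l-th vector they return to the origin and test the
  source weight. The direction \<open>e\<close> selects position or frequency.\<close>

lemma OP_bounded_signs:
  fixes \<phi> :: "'a::euclidean_space \<Rightarrow> complex"
  assumes p: "1 \<le> p1" "1 \<le> p2" and q: "1 \<le> q1" "1 \<le> q2"
    and \<phi>: "\<phi> \<in> schwartz" "\<phi> \<noteq> (\<lambda>_. 0)" and \<Phi>: "\<Phi> \<in> schwartz"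
    and B: "all_OP_bounded \<phi> \<tau> (modulation_space \<Phi> (\<lambda>_. 1) \<infinity> 1) (weight s1 t1) p1 q1 (weight s2 t2) p2 q2"
  shows "s2 \<le> 0" "0 \<le> s1" "t2 \<le> 0" "0 \<le> t1"
proof -
  obtain R0 where H: "\<And>R e. R0 \<le> R \<Longrightarrow> norm (e :: 'a \<times> 'a) = 1 \<Longrightarrow>
    \<exists>C. \<forall>l v. (1/2)^l * (\<langle>fst (R^(l+1) *\<^sub>R e + v)\<rangle> powr s2 * \<langle>snd (R^(l+1) *\<^sub>R e + v)\<rangle> powr t2)
      \<le> C * (\<langle>fst v\<rangle> powr s1 * \<langle>snd v\<rangle> powr t1)"
    using OP_bounded_hump[OF p q \<phi> \<Phi> B] by blast
  obtain b :: 'a where b: "b \<in> Basis" using nonempty_Basis by blast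
  have nb: "norm b = 1" "norm (b, 0::'a) = 1" "norm (0::'a, b) = 1" using b by auto
  have jb0: "\<langle>0::'a\<rangle> = 1" by (simp add: japanese_bracket_def)
  \<comment> \<open>\<open>OP_bounded_hump\<close> allows every base \<open>R \<ge> R0\<close>, so
    that even a tiny positive exponent reaches the growth rate 4.\<close>
  have R_ex: "\<exists>R. R0 \<le> R \<and> 0 < R \<and> 4 \<le> R powr s" if "0 < s" for s
  proof -
    have "4 = (4 powr (1/s)) powr s" using that by (simp add: powr_powr)
    also have "\<dots> \<le> (max (max 1 R0) (4 powr (1/s))) powr s" using that by (intro powr_mono2) auto
    finally show ?thesis by (intro exI[of _ "max (max 1 R0) (4 powr (1/s))"]) auto
  qed
  have up: "\<exists>C. \<forall>l. (1/2)^l * (\<langle>R^(l+1) *\<^sub>R fst e\<rangle> powr s2 * \<langle>R^(l+1) *\<^sub>R snd e\<rangle> powr t2) \<le> C"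
    if RR: "R0 \<le> R" and e: "norm e = 1" for R and e :: "'a \<times> 'a"
  proof -
    obtain C where C: "\<And>l v. (1/2)^l * (\<langle>fst (R^(l+1) *\<^sub>R e + v)\<rangle> powr s2 * \<langle>snd (R^(l+1) *\<^sub>R e + v)\<rangle> powr t2)
      \<le> C * (\<langle>fst v\<rangle> powr s1 * \<langle>snd v\<rangle> powr t1)" using H[OF RR e] by blast
    from C[of _ 0] show ?thesis by (intro exI[of _ C]) (simp add: jb0 del: power_Suc)
  qed
  have low: "\<exists>C. \<forall>l. (1/2)^l * (\<langle>R^(l+1) *\<^sub>R fst e\<rangle> powr (-s1) * \<langle>R^(l+1) *\<^sub>R snd e\<rangle> powr (-t1)) \<le> C"
    if RR: "R0 \<le> R" and e: "norm e = 1" for R and e :: "'a \<times> 'a"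
  proof -
    obtain C where C: "\<And>l v. (1/2)^l * (\<langle>fst (R^(l+1) *\<^sub>R e + v)\<rangle> powr s2 * \<langle>snd (R^(l+1) *\<^sub>R e + v)\<rangle> powr t2)
      \<le> C * (\<langle>fst v\<rangle> powr s1 * \<langle>snd v\<rangle> powr t1)" using H[OF RR e] by blast
    have "(1/2)^l * (\<langle>R^(l+1) *\<^sub>R fst e\<rangle> powr (-s1) * \<langle>R^(l+1) *\<^sub>R snd e\<rangle> powr (-t1)) \<le> C" for l
    proof -
      have "(1/2)^l \<le> C * (\<langle>R^(l+1) *\<^sub>R fst e\<rangle> powr s1 * \<langle>R^(l+1) *\<^sub>R snd e\<rangle> powr t1)"
        using C[of l "- (R^(l+1) *\<^sub>R e)"] by (simp add: jb0 jb_minus del: power_Suc)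
      moreover have "0 < \<langle>R^(l+1) *\<^sub>R fst e\<rangle> powr s1" "0 < \<langle>R^(l+1) *\<^sub>R snd e\<rangle> powr t1"
        unfolding powr_gt_zero by (rule less_imp_neq[OF jb_pos, symmetric])+
      ultimately show ?thesis unfolding powr_minus by (simp add: field_simps del: power_Suc)
    qed
    then show ?thesis by blast
  qed
  show "s2 \<le> 0"
  proof (rule ccontr)
    assume "\<not> s2 \<le> 0"
    then obtain R where R: "R0 \<le> R" "0 < R" "4 \<le> R powr s2" using R_ex[of s2] by auto
    obtain C where "\<And>l. (1/2)^l * \<langle>R^(l+1) *\<^sub>R b\<rangle> powr s2 \<le> C"
      using up[OF R(1) nb(2)] jb0 by auto
    then show False using weight_growth_nonpos[OF nb(1) R(2,3)] \<open>\<not> s2 \<le> 0\<close> by auto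
  qed
  show "t2 \<le> 0"
  proof (rule ccontr)
    assume "\<not> t2 \<le> 0"
    then obtain R where R: "R0 \<le> R" "0 < R" "4 \<le> R powr t2" using R_ex[of t2] by auto
    obtain C where "\<And>l. (1/2)^l * \<langle>R^(l+1) *\<^sub>R b\<rangle> powr t2 \<le> C"
      using up[OF R(1) nb(3)] jb0 by auto
    then show False using weight_growth_nonpos[OF nb(1) R(2,3)] \<open>\<not> t2 \<le> 0\<close> by auto
  qed
  show "0 \<le> s1"
  proof (rule ccontr)
    assume "\<not> 0 \<le> s1"
    then obtain R where R: "R0 \<le> R" "0 < R" "4 \<le> R powr (-s1)" using R_ex[of "-s1"] by auto
    obtain C where "\<And>l. (1/2)^l * \<langle>R^(l+1) *\<^sub>R b\<rangle> powr (-s1) \<le> C"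
      using low[OF R(1) nb(2)] jb0 by auto
    then show False using weight_growth_nonpos[OF nb(1) R(2,3)] \<open>\<not> 0 \<le> s1\<close> by auto
  qed
  show "0 \<le> t1"
  proof (rule ccontr)
    assume "\<not> 0 \<le> t1"
    then obtain R where R: "R0 \<le> R" "0 < R" "4 \<le> R powr (-t1)" using R_ex[of "-t1"] by auto
    obtain C where "\<And>l. (1/2)^l * \<langle>R^(l+1) *\<^sub>R b\<rangle> powr (-t1) \<le> C"
      using low[OF R(1) nb(3)] jb0 by auto
    then show False using weight_growth_nonpos[OF nb(1) R(2,3)] \<open>\<not> 0 \<le> t1\<close> by auto
  qed
qed

subsection \<open>Necessity of the relation between the exponents\<close>

definition separated :: "real \<Rightarrow> 'a::real_normed_vector set \<Rightarrow> bool" where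
  "separated R K \<longleftrightarrow> finite K \<and> (\<forall>k\<in>K. \<forall>l\<in>K. k \<noteq> l \<longrightarrow> R \<le> norm (k - l))"

lemma separated_mono: "separated R K \<Longrightarrow> r \<le> R \<Longrightarrow> separated r K"
  unfolding separated_def by (meson order_trans)

text \<open>The points of \<open>R \<cdot> \<nat>^d\<close> with coordinates between \<open>R * 2^j\<close> and \<open>R * 2^(j+1)\<close> contribute at least
  a fixed amount for each \<open>j\<close>.\<close>

lemma separated_sum_unbounded:
  fixes R B :: real
  assumes R: "0 < R"
  obtains K :: "'a::euclidean_space set" where "separated R K" "B \<le> (\<Sum>k\<in>K. \<langle>k\<rangle> powr (- real DIM('a)))"
proof -
  define d where "d = DIM('a)"
  define P where "P m = (\<Sum>b\<in>Basis. (R * real (m b)) *\<^sub>R b)" for m :: "'a \<Rightarrow> nat"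
  have Pb: "P m \<bullet> b = R * real (m b)" if "b \<in> Basis" for m b
    using that by (simp add: P_def)
  \<comment> \<open>The \<open>2^(j * d)\<close> multi-indices of the j-th level. Being extensional
    functions, distinct ones differ at some basis vector.\<close>
  define L where "L j = (Basis :: 'a set) \<rightarrow>\<^sub>E {2^j..<2^(j+1)::nat}" for j :: nat
  have L_fin: "finite (L j)" for j unfolding L_def by (intro finite_PiE) auto
  have L_card: "card (L j) = (2^j)^d" for j unfolding L_def d_def by (simp add: card_PiE)
  have L_ext: "m \<in> extensional Basis" if "m \<in> L j" for m j
    using that unfolding L_def by (auto simp: PiE_def)
  have sep: "R \<le> norm (P m - P m')" if m: "m \<in> L i" "m' \<in> L j" "m \<noteq> m'" for m m' i j
  proof -
    obtain b where b: "b \<in> Basis" "m b \<noteq> m' b"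
      using extensionalityI[OF L_ext[OF m(1)] L_ext[OF m(2)]] m(3) by blast
    have "1 \<le> \<bar>real (m b) - real (m' b)\<bar>" using b(2) by linarith
    then have "R * 1 \<le> R * \<bar>real (m b) - real (m' b)\<bar>" using R by (intro mult_left_mono) auto
    also have "\<dots> = \<bar>(P m - P m') \<bullet> b\<bar>"
      using R b(1) by (simp add: inner_diff_left Pb abs_mult flip: right_diff_distrib)
    also have "\<dots> \<le> norm (P m - P m')" by (rule Basis_le_norm[OF b(1)])
    finally show ?thesis by simp
  qed
  define c0 where "c0 = 1 + 2 * real d * R"
  have c0: "0 < c0" using R by (simp add: c0_def add_pos_nonneg)
  have jbP: "\<langle>P m\<rangle> \<le> c0 * 2^j" if "m \<in> L j" for m j
  proof -
    have "norm (P m) \<le> (\<Sum>b\<in>Basis. \<bar>P m \<bullet> b\<bar>)" by (rule norm_le_l1)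
    also have "\<dots> \<le> (\<Sum>b\<in>(Basis::'a set). R * 2^(j+1))"
    proof (rule sum_mono)
      fix b :: 'a assume b: "b \<in> Basis"
      then have "m b < 2^(j+1)" using that unfolding L_def by (auto dest: PiE_mem)
      then have "real (m b) \<le> 2^(j+1)" by (metis less_imp_le of_nat_le_iff of_nat_numeral of_nat_power)
      then show "\<bar>P m \<bullet> b\<bar> \<le> R * 2^(j+1)" using R by (simp add: Pb[OF b] abs_mult)
    qed
    also have "\<dots> = 2 * real d * R * 2^j" by (simp add: d_def)
    finally have "\<langle>P m\<rangle> \<le> 1 + 2 * real d * R * 2^j" using jb_le_norm[of "P m"] by linarith
    also have "\<dots> \<le> 2^j + 2 * real d * R * 2^j" by simp
    finally show ?thesis by (simp add: c0_def algebra_simps)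
  qed
  \<comment> \<open>The \<open>2^(j * d)\<close> points have brackets at most
    \<open>c0 * 2^j\<close>, so the powers of 2 cancel: \<open>- d\<close> is the borderline
    exponent.\<close>
  have level: "c0 powr (- real d) \<le> (\<Sum>m\<in>L j. \<langle>P m\<rangle> powr (- real d))" for j
  proof -
    have "c0 powr (- real d) = (\<Sum>m\<in>L j. (c0 * 2^j) powr (- real d))"
      using c0 by (simp add: L_card powr_mult powr_minus powr_realpow[of "2^j" d])
    also have "\<dots> \<le> (\<Sum>m\<in>L j. \<langle>P m\<rangle> powr (- real d))"
      using jbP by (intro sum_mono powr_mono2') (auto simp: jb_pos)
    finally show ?thesis .
  qed
  obtain J :: nat where J: "B \<le> real J * c0 powr (- real d)"
    using reals_Archimedean3[of "c0 powr (- real d)"] c0 by (auto intro: less_imp_le)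
  define I where "I = (\<Union>j<J. L j)"
  have I_fin: "finite I" unfolding I_def using L_fin by auto
  have I_sep: "R \<le> norm (P m - P m')" if "m \<in> I" "m' \<in> I" "m \<noteq> m'" for m m'
    using that sep unfolding I_def by blast
  have inj: "inj_on P I"
    using I_sep R by (intro inj_onI) (metis diff_self norm_zero not_less)
  obtain b0 :: 'a where b0: "b0 \<in> Basis" using nonempty_Basis by blast
  have disj: "L i \<inter> L j = {}" if "i \<noteq> j" for i j
  proof -
    have "False" if "m \<in> L i" "m \<in> L j" "i < j" for m i j
    proof -
      have "m b0 < 2^(i+1)" "2^j \<le> m b0" using that b0 unfolding L_def by (auto dest: PiE_mem)
      moreover have "(2::nat)^(i+1) \<le> 2^j" using that(3) by (intro power_increasing) auto
      ultimately show False by linarith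
    qed
    with \<open>i \<noteq> j\<close> show ?thesis by (metis disjoint_iff nat_neq_iff)
  qed
  show thesis
  proof (rule that[of "P ` I"])
    show "separated R (P ` I)" unfolding separated_def using I_fin I_sep by auto
    have "B \<le> (\<Sum>j<J. c0 powr (- real d))" using J by simp
    also have "\<dots> \<le> (\<Sum>j<J. \<Sum>m\<in>L j. \<langle>P m\<rangle> powr (- real d))" by (rule sum_mono) (rule level)
    also have "\<dots> = (\<Sum>m\<in>I. \<langle>P m\<rangle> powr (- real d))"
      unfolding I_def by (rule sum.UNION_disjoint[symmetric]) (use L_fin disj in auto)
    also have "\<dots> = (\<Sum>k\<in>P ` I. \<langle>k\<rangle> powr (- real DIM('a)))"
      unfolding sum.reindex[OF inj] by (simp add: d_def)
    finally show "B \<le> (\<Sum>k\<in>P ` I. \<langle>k\<rangle> powr (- real DIM('a)))" .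
  qed
qed

section \<open>Lebesgue norms of sums over separated sets\<close>

lemma borel_measurable_indicator_cball [measurable]:
  "(indicator (cball (k::'a::euclidean_space) \<delta>) :: 'a \<Rightarrow> ennreal) \<in> borel_measurable borel"
  by (intro borel_measurable_indicator borel_closed closed_cball)

text \<open>The balls are disjoint, so only the term of \<open>k\<close> survives.\<close>

lemma separated_sum_indicator_le:
  fixes K :: "'a::real_normed_vector set"
  assumes K: "separated R K" and "2 * \<delta> < R" and k: "k \<in> K" "y \<in> cball k \<delta>"
  shows "(\<Sum>l\<in>K. a l * indicator (cball l \<delta>) y) = (a k :: ennreal)"
proof -
  have "y \<notin> cball l \<delta>" if "l \<in> K" "l \<noteq> k" for l
  proof
    assume "y \<in> cball l \<delta>"
    then have "dist k l \<le> 2 * \<delta>" using k(2) dist_triangle2[of k l y] by (simp add: dist_commute)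
    with K that k(1) \<open>2 * \<delta> < R\<close> show False unfolding separated_def dist_norm by force
  qed
  then have "(\<Sum>l\<in>K. a l * indicator (cball l \<delta>) y) = (\<Sum>l\<in>K. if l = k then a l else 0)"
    using k by (intro sum.cong) (auto simp: indicator_def)
  also have "\<dots> = a k" using K k by (simp add: separated_def)
  finally show ?thesis .
qed

text \<open>Comparison with an integral: the balls of radius 1/2 about the points are disjoint, and
  the bracket power changes by a bounded factor on each. The bound depends neither on
  \<open>x\<close> nor on \<open>K\<close>.\<close>

lemma separated_sum_jb:
  assumes r: "real DIM('a) < r"
  obtains A where "0 < A" "\<And>K x. separated 2 K \<Longrightarrow> (\<Sum>k\<in>K. \<langle>x - k :: 'a::euclidean_space\<rangle> powr (-r)) \<le> A"
proof -
  define V where "V = unit_ball_vol (real DIM('a)) * (1/2)^DIM('a)"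
  have V: "0 < V" by (simp add: V_def)
  obtain A where A: "0 < A" "(\<integral>\<^sup>+x. ennreal (\<langle>x::'a\<rangle> powr (-r)) \<partial>lborel) \<le> ennreal A"
    by (rule jb_integral_real[OF r])
  have "(\<Sum>k\<in>K. \<langle>x - k\<rangle> powr (-r)) \<le> 4 powr r * A / V" if K: "separated 2 K" for K and x :: 'a
  proof -
    have "ennreal ((\<Sum>k\<in>K. \<langle>x - k\<rangle> powr (-r)) * V)
        = (\<Sum>k\<in>K. ennreal (\<langle>x - k\<rangle> powr (-r)) * emeasure lborel (cball k (1/2)))"
      using V by (simp add: emeasure_cball V_def ennreal_mult sum_distrib_right flip: sum_ennreal)
    also have "\<dots> = (\<Sum>k\<in>K. \<integral>\<^sup>+y. ennreal (\<langle>x - k\<rangle> powr (-r)) * indicator (cball k (1/2)) y \<partial>lborel)"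
      by (intro sum.cong refl) (simp add: nn_integral_cmult_indicator)
    also have "\<dots> = (\<integral>\<^sup>+y. (\<Sum>k\<in>K. ennreal (\<langle>x - k\<rangle> powr (-r)) * indicator (cball k (1/2)) y) \<partial>lborel)"
      by (rule nn_integral_sum[symmetric]) measurable
    also have "\<dots> \<le> (\<integral>\<^sup>+y. ennreal (4 powr r) * ennreal (\<langle>x - y\<rangle> powr (-r)) \<partial>lborel)"
    proof (rule nn_integral_mono)
      fix y
      show "(\<Sum>k\<in>K. ennreal (\<langle>x - k\<rangle> powr (-r)) * indicator (cball k (1/2)) y)
          \<le> ennreal (4 powr r) * ennreal (\<langle>x - y\<rangle> powr (-r))"
      proof (cases "\<exists>k\<in>K. y \<in> cball k (1/2)")
        case True
        then obtain k where k: "k \<in> K" "y \<in> cball k (1/2)" by blast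
        have "(\<Sum>k\<in>K. ennreal (\<langle>x - k\<rangle> powr (-r)) * indicator (cball k (1/2)) y) = ennreal (\<langle>x - k\<rangle> powr (-r))"
          by (rule separated_sum_indicator_le[OF K _ k]) simp
        moreover have "4 powr (-\<bar>-r\<bar>) * \<langle>x - k\<rangle> powr (-r) \<le> \<langle>x - y\<rangle> powr (-r)"
          by (rule jb_powr_near[where \<delta> = "1/2"]) (use k(2) in \<open>auto simp: dist_norm norm_minus_commute\<close>)
        then have "4 powr r * (4 powr (-r) * \<langle>x - k\<rangle> powr (-r)) \<le> 4 powr r * \<langle>x - y\<rangle> powr (-r)"
          using r by (intro mult_left_mono) auto
        then have "\<langle>x - k\<rangle> powr (-r) \<le> 4 powr r * \<langle>x - y\<rangle> powr (-r)"
          by (simp only: mult.assoc[symmetric] powr_add[symmetric]) simp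
        ultimately show ?thesis by (simp add: ennreal_leI flip: ennreal_mult)
      next
        case False
        then have "(\<Sum>k\<in>K. ennreal (\<langle>x - k\<rangle> powr (-r)) * indicator (cball k (1/2)) y) = 0"
          by (intro sum.neutral) auto
        then show ?thesis by simp
      qed
    qed
    also have "\<dots> = ennreal (4 powr r) * (\<integral>\<^sup>+y. ennreal (\<langle>x - y\<rangle> powr (-r)) \<partial>lborel)"
      by (rule nn_integral_cmult) measurable
    also have "(\<integral>\<^sup>+y. ennreal (\<langle>x - y\<rangle> powr (-r)) \<partial>lborel) = (\<integral>\<^sup>+y. ennreal (\<langle>y::'a\<rangle> powr (-r)) \<partial>lborel)"
      using lborel_nn_integral_affine[of "\<lambda>y. ennreal (\<langle>y\<rangle> powr (-r))" "-1" x] by simp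
    also have "ennreal (4 powr r) * \<dots> \<le> ennreal (4 powr r) * ennreal A"
      by (intro mult_left_mono A) simp
    also have "\<dots> = ennreal (4 powr r * A)" using A by (simp add: ennreal_mult)
    finally have "(\<Sum>k\<in>K. \<langle>x - k\<rangle> powr (-r)) * V \<le> 4 powr r * A"
      using A by (subst (asm) ennreal_le_iff) auto
    then show ?thesis using V by (simp add: field_simps)
  qed
  then show ?thesis using A V by (intro that[of "4 powr r * A / V"]) auto
qed

text \<open>Jensen's inequality for counting measure with the weights
  \<open>\<langle>x - k\<rangle> powr (-r)\<close>, whose sum is bounded uniformly; the overlap of
  the bumps thus costs only a constant. The P-th powers of the coefficients are the terms of the
  borderline sum \<open>S\<close>.\<close>

lemma Lp_norm_separated_le:
  assumes p: "1 \<le> p" and r: "real DIM('a) < r"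
  obtains A where "0 < A" "\<And>K. separated 2 K \<Longrightarrow> K \<noteq> {} \<Longrightarrow>
    Lp_norm p (\<lambda>x::'a::euclidean_space. \<Sum>k\<in>K. ennreal (\<langle>k\<rangle> powr (-(real DIM('a) * recip p))) * ennreal (\<langle>x - k\<rangle> powr (-r)))
      \<le> ennreal (A * (\<Sum>k\<in>K. \<langle>k\<rangle> powr (- real DIM('a))) powr recip p)"
proof -
  define d where "d = real DIM('a)"
  obtain A0 where A0: "0 < A0" "\<And>K x. separated 2 K \<Longrightarrow> (\<Sum>k\<in>K. \<langle>x - k :: 'a\<rangle> powr (-r)) \<le> A0"
    using separated_sum_jb[OF r] by blast
  obtain A1 where A1: "0 < A1" "(\<integral>\<^sup>+x. ennreal (\<langle>x::'a\<rangle> powr (-r)) \<partial>lborel) \<le> ennreal A1"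
    by (rule jb_integral_real[OF r])
  define A where "A = max A0 A1"
  have A: "0 < A" "A0 \<le> A" "A1 \<le> A" using A0 by (auto simp: A_def)
  have "Lp_norm p (\<lambda>x::'a. \<Sum>k\<in>K. ennreal (\<langle>k\<rangle> powr (-(d * recip p))) * ennreal (\<langle>x - k\<rangle> powr (-r)))
      \<le> ennreal (A * (\<Sum>k\<in>K. \<langle>k\<rangle> powr (-d)) powr recip p)" if K: "separated 2 K" "K \<noteq> {}" for K
  proof -
    have fin: "finite K" using K by (simp add: separated_def)
    define S where "S = (\<Sum>k\<in>K. \<langle>k\<rangle> powr (-d))"
    have S: "0 < S" unfolding S_def using fin K(2) by (intro sum_pos jb_powr_pos)
    show ?thesis
    proof (cases "p = \<infinity>")
      case True
      have "Lp_norm p (\<lambda>x::'a. \<Sum>k\<in>K. ennreal (\<langle>k\<rangle> powr (-(d * recip p))) * ennreal (\<langle>x - k\<rangle> powr (-r))) \<le> ennreal A"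
        unfolding True infinity_ennreal_def Lp_norm_top recip_top
      proof (intro esssup_I AE_I2)
        fix x :: 'a
        have "(\<Sum>k\<in>K. ennreal (\<langle>k\<rangle> powr (-(d * 0))) * ennreal (\<langle>x - k\<rangle> powr (-r))) = ennreal (\<Sum>k\<in>K. \<langle>x - k\<rangle> powr (-r))"
          by (simp add: sum_ennreal less_imp_neq[OF jb_pos, symmetric])
        also have "\<dots> \<le> ennreal A" using A0(2)[OF K(1), of x] A by (intro ennreal_leI) simp
        finally show "(\<Sum>k\<in>K. ennreal (\<langle>k\<rangle> powr (-(d * 0))) * ennreal (\<langle>x - k\<rangle> powr (-r))) \<le> ennreal A" .
      qed measurable
      \<comment> \<open>Here \<open>recip p = 0\<close>. As \<open>0 powr 0\<close> is 0, the factor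
        \<open>S powr 0\<close> equals 1 only because \<open>K\<close> is nonempty.\<close>
      then show ?thesis using S by (simp add: True flip: S_def)
    next
      case False
      note P = real_exponent[OF p False]
      define P where "P = enn2real p"
      have P1: "1 \<le> P" using P by (simp add: P_def)
      let ?b = "\<lambda>k::'a. ennreal (\<langle>k\<rangle> powr (-(d * recip p)))" and ?w = "\<lambda>x k::'a. ennreal (\<langle>x - k\<rangle> powr (-r))"
      have bP: "ennreal_powr (?b k) P = ennreal (\<langle>k\<rangle> powr (-d))" for k
        using P P1 by (simp add: epowr_ennreal powr_powr flip: P_def)
      have J: "ennreal_powr (\<Sum>k\<in>K. ?b k * ?w x k) P \<le> ennreal (A powr (P - 1)) * (\<Sum>k\<in>K. ennreal (\<langle>k\<rangle> powr (-d)) * ?w x k)" for x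
      proof -
        have "(\<integral>\<^sup>+k. ?w x k \<partial>count_space K) \<le> ennreal A"
          using A0(2)[OF K(1), of x] A fin by (simp add: nn_integral_count_space_finite sum_ennreal ennreal_leI)
        from nn_integral_jensen[OF _ _ P1 A(1) this, of ?b] show ?thesis
          using fin by (simp add: nn_integral_count_space_finite bP)
      qed
      show ?thesis
      proof (rule Lp_norm_leI[OF p False], fold P_def S_def)
        have "(\<integral>\<^sup>+x. ennreal_powr (\<Sum>k\<in>K. ?b k * ?w x k) P \<partial>lborel)
          \<le> (\<integral>\<^sup>+x. ennreal (A powr (P - 1)) * (\<Sum>k\<in>K. ennreal (\<langle>k\<rangle> powr (-d)) * ?w x k) \<partial>lborel)"
          by (rule nn_integral_mono) (rule J)
        also have "\<dots> = ennreal (A powr (P - 1)) * (\<Sum>k\<in>K. ennreal (\<langle>k\<rangle> powr (-d)) * (\<integral>\<^sup>+x. ?w x k \<partial>lborel))"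
          by (simp add: nn_integral_cmult nn_integral_sum)
        also have "\<dots> \<le> ennreal (A powr (P - 1)) * (\<Sum>k\<in>K. ennreal (\<langle>k\<rangle> powr (-d)) * ennreal A)"
        proof (intro mult_left_mono sum_mono)
          fix k
          have "(\<integral>\<^sup>+x. ?w x k \<partial>lborel) = (\<integral>\<^sup>+x. ennreal (\<langle>x::'a\<rangle> powr (-r)) \<partial>lborel)"
            using lborel_nn_integral_affine[of "\<lambda>x. ennreal (\<langle>x\<rangle> powr (-r))" 1 "- k"] by simp
          also have "\<dots> \<le> ennreal A" using A1 A by (auto intro: order_trans ennreal_leI)
          finally show "(\<integral>\<^sup>+x. ?w x k \<partial>lborel) \<le> ennreal A" .
        qed auto
        also have "\<dots> = ennreal (A powr (P - 1) * (S * A))"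
          using A by (simp add: S_def ennreal_mult sum_distrib_right sum_nonneg flip: sum_ennreal)
        also have "A powr (P - 1) * (S * A) = A powr P * S" using A by (simp add: powr_diff)
        also have "\<dots> = (A * S powr recip p) powr P"
          using A S P P1 by (simp add: powr_mult powr_powr flip: P_def)
        also have "ennreal \<dots> = ennreal_powr (ennreal (A * S powr recip p)) P"
          using A by (simp add: epowr_ennreal)
        finally show "(\<integral>\<^sup>+x. ennreal_powr (\<Sum>k\<in>K. ?b k * ?w x k) P \<partial>lborel) \<le> ennreal_powr (ennreal (A * S powr recip p)) P" .
      qed
    qed
  qed
  with A(1) show ?thesis unfolding d_def by (rule that)
qed

text \<open>On disjoint balls the power of the sum is the sum of the powers, so the integral is
  computed termwise. \<open>R\<close> is left free because the application needs a large
  separation.\<close>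

lemma Lp_norm_separated_ge:
  assumes p: "1 \<le> p" "p \<noteq> \<infinity>" and \<delta>: "0 < \<delta>" "2 * \<delta> < R"
  obtains c where "0 < c" "\<And>K. separated R K \<Longrightarrow>
    ennreal (c * (\<Sum>k\<in>K. \<langle>k\<rangle> powr (- real DIM('a))) powr recip p)
      \<le> Lp_norm p (\<lambda>x::'a::euclidean_space. \<Sum>k\<in>K. ennreal (\<langle>k\<rangle> powr (-(real DIM('a) * recip p))) * indicator (cball k \<delta>) x)"
proof -
  define d where "d = real DIM('a)"
  define V where "V = unit_ball_vol d * \<delta>^DIM('a)"
  have V: "0 < V" using \<delta> by (simp add: V_def d_def)
  note P = real_exponent[OF p]
  define P where "P = enn2real p"
  have P1: "1 \<le> P" using P by (simp add: P_def)
  have "ennreal (V powr recip p * (\<Sum>k\<in>K. \<langle>k\<rangle> powr (-d)) powr recip p)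
      \<le> Lp_norm p (\<lambda>x::'a. \<Sum>k\<in>K. ennreal (\<langle>k\<rangle> powr (-(d * recip p))) * indicator (cball k \<delta>) x)" if K: "separated R K" for K
  proof -
    have fin: "finite K" using K by (simp add: separated_def)
    define S where "S = (\<Sum>k\<in>K. \<langle>k\<rangle> powr (-d))"
    have S: "0 \<le> S" unfolding S_def by (intro sum_nonneg) simp
    let ?b = "\<lambda>k::'a. ennreal (\<langle>k\<rangle> powr (-(d * recip p)))"
    have bP: "ennreal_powr (?b k) P = ennreal (\<langle>k\<rangle> powr (-d))" for k
      using P P1 by (simp add: epowr_ennreal powr_powr flip: P_def)
    have pw: "(\<Sum>k\<in>K. ennreal (\<langle>k\<rangle> powr (-d)) * indicator (cball k \<delta>) x)
        \<le> ennreal_powr (\<Sum>k\<in>K. ?b k * indicator (cball k \<delta>) x) P" for x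
    proof (cases "\<exists>k\<in>K. x \<in> cball k \<delta>")
      case True
      then obtain k where k: "k \<in> K" "x \<in> cball k \<delta>" by blast
      show ?thesis unfolding separated_sum_indicator_le[OF K \<delta>(2) k] bP ..
    next
      case False
      then have "(\<Sum>k\<in>K. ennreal (\<langle>k\<rangle> powr (-d)) * indicator (cball k \<delta>) x) = 0" by (intro sum.neutral) auto
      then show ?thesis by simp
    qed
    have "ennreal (V * S) = (\<Sum>k\<in>K. ennreal (\<langle>k\<rangle> powr (-d)) * emeasure lborel (cball k \<delta>))"
      using V \<delta> by (simp add: emeasure_cball V_def S_def d_def ennreal_mult sum_distrib_left mult.commute flip: sum_ennreal)
    also have "\<dots> = (\<Sum>k\<in>K. \<integral>\<^sup>+x. ennreal (\<langle>k\<rangle> powr (-d)) * indicator (cball k \<delta>) x \<partial>lborel)"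
      by (intro sum.cong refl) (simp add: nn_integral_cmult_indicator)
    also have "\<dots> = (\<integral>\<^sup>+x. (\<Sum>k\<in>K. ennreal (\<langle>k\<rangle> powr (-d)) * indicator (cball k \<delta>) x) \<partial>lborel)"
      by (rule nn_integral_sum[symmetric]) measurable
    also have "\<dots> \<le> (\<integral>\<^sup>+x. ennreal_powr (\<Sum>k\<in>K. ?b k * indicator (cball k \<delta>) x) P \<partial>lborel)"
      by (rule nn_integral_mono) (rule pw)
    finally have "ennreal_powr (ennreal (V * S)) (1 / P) \<le> Lp_norm p (\<lambda>x::'a. \<Sum>k\<in>K. ?b k * indicator (cball k \<delta>) x)"
      unfolding Lp_norm_real[OF p(2)] P_def[symmetric] using P1 by (intro epowr_mono) auto
    moreover have "ennreal_powr (ennreal (V * S)) (1 / P) = ennreal (V powr recip p * S powr recip p)"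
      using V S P by (simp add: epowr_ennreal powr_mult flip: P_def)
    ultimately show ?thesis by (simp add: S_def)
  qed
  moreover have "0 < V powr recip p" using V by simp
  ultimately show ?thesis unfolding d_def using that by blast
qed

text \<open>Decides whether the lattice runs in position or in frequency, so that one construction
  of test functions serves both index conditions.\<close>

definition tf_pair :: "bool \<Rightarrow> 'a \<Rightarrow> 'a \<Rightarrow> 'a \<times> 'a" where
  "tf_pair b y z = (if b then (y, z) else (z, y))"

lemma tf_pair_diff: "tf_pair b y z - tf_pair b k (0::'a::real_vector) = tf_pair b (y - k) z"
  by (simp add: tf_pair_def minus_prod_def)

lemma jb_powr_tf_pair_le:
  assumes "0 \<le> u" "0 \<le> v"
  shows "\<langle>tf_pair b y z\<rangle> powr (- (u + v)) \<le> \<langle>y\<rangle> powr (- u) * \<langle>z\<rangle> powr (- v)"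
  using jb_powr_Pair_le[OF assms, of y z] jb_powr_Pair_le[OF assms(2,1), of z y]
  by (simp add: tf_pair_def add.commute mult.commute)

lemma schwartz_integrable_mult:
  fixes f g :: "'a::euclidean_space \<Rightarrow> complex"
  assumes "f \<in> schwartz" "g \<in> schwartz"
  shows "integrable lborel (\<lambda>t. f t * g t)"
  by (intro schwartz_integrable schwartz_linear_tensor[OF assms, where C = 1 and l = "\<lambda>t. t" and m = "\<lambda>t. t"])
    (auto simp: linear_iff)

lemma stft_sum:
  fixes f :: "'b \<Rightarrow> 'a::euclidean_space \<Rightarrow> complex"
  assumes f: "\<And>k. f k \<in> schwartz" and \<phi>: "\<phi> \<in> schwartz"
  shows "stft \<phi> (\<lambda>t. \<Sum>k\<in>K. c k * f k t) w = (\<Sum>k\<in>K. c k * stft \<phi> (f k) w)"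
proof -
  have i: "integrable lborel (\<lambda>t. f k t * cnj (tf_shift w \<phi> t))" for k
    by (intro schwartz_integrable_mult f schwartz_cnj tf_shift_schwartz \<phi>)
  show ?thesis
    unfolding stft_eq_integral sum_distrib_right mult.assoc
    by (subst Bochner_Integration.integral_sum) (use i in simp_all)
qed

text \<open>Diagonal dominance: for large separation the term of \<open>k\<close> is, near
  \<open>k\<close>, at least twice the sum of all others. Peetre's inequality compares the
  coefficients at \<open>l\<close> and \<open>k\<close>.\<close>

lemma stft_lattice_ge:
  fixes \<phi> :: "'a::euclidean_space \<Rightarrow> complex"
  assumes \<phi>: "\<phi> \<in> schwartz" "\<phi> \<noteq> (\<lambda>_. 0)" and \<beta>: "0 \<le> \<beta>"
  obtains n \<delta> R where "0 < n" "0 < \<delta>" "\<delta> \<le> 1" "2 < R"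
    "\<And>K k y z. separated R K \<Longrightarrow> k \<in> K \<Longrightarrow> y \<in> cball k \<delta> \<Longrightarrow> z \<in> cball 0 \<delta> \<Longrightarrow>
      n * \<langle>k\<rangle> powr (-\<beta>) \<le> cmod (\<Sum>l\<in>K. of_real (\<langle>l\<rangle> powr (-\<beta>)) * stft \<phi> (tf_shift (tf_pair b l 0) \<phi>) (tf_pair b y z))"
proof -
  define r where "r = real DIM('a) + 1"
  \<comment> \<open>\<beta> powers pay for comparing coefficients, \<open>r\<close> for summing over
    the set, and the last one yields the small factor \<open>1 / R\<close>.\<close>
  define M where "M = \<beta> + r + 1"
  have M0: "0 \<le> M" using \<beta> by (simp add: M_def r_def)
  obtain n \<delta> where n: "0 < n" and \<delta>: "0 < \<delta>" "\<delta> \<le> 1"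
    and near: "\<And>x \<xi>. norm x \<le> \<delta> \<Longrightarrow> norm \<xi> \<le> \<delta> \<Longrightarrow> n \<le> cmod (stft \<phi> \<phi> (x, \<xi>))"
    using stft_near_0[OF \<phi>] by blast
  obtain D where D: "0 \<le> D" "\<And>w. cmod (stft \<phi> \<phi> w) \<le> D * \<langle>w\<rangle> powr (-M)"
    using schwartz_decay[OF stft_schwartz[OF \<phi>(1) \<phi>(1)]] by blast
  obtain A where A: "0 < A" "\<And>K x. separated 2 K \<Longrightarrow> (\<Sum>k\<in>K. \<langle>x - k :: 'a\<rangle> powr (-r)) \<le> A"
    using separated_sum_jb[of r, where 'a = 'a] by (auto simp: r_def)
  define E where "E = D * (2 powr \<beta> * 4 powr M)"
  have E: "0 \<le> E" using D by (simp add: E_def)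
  define R where "R = 3 + 2 * E * A / n"
  have R: "2 < R" "2 * E * A / n \<le> R" using E A n by (auto simp: R_def intro: add_pos_nonneg)
  have "n / 2 * \<langle>k\<rangle> powr (-\<beta>) \<le> cmod (\<Sum>l\<in>K. of_real (\<langle>l\<rangle> powr (-\<beta>)) * stft \<phi> (tf_shift (tf_pair b l 0) \<phi>) (tf_pair b y z))"
    if K: "separated R K" and k: "k \<in> K" and y: "y \<in> cball k \<delta>" and z: "z \<in> cball 0 \<delta>" for K k y z
  proof -
    have fin: "finite K" using K by (simp add: separated_def)
    have K2: "separated 2 K" by (rule separated_mono[OF K]) (use R in simp)
    define a where "a l = of_real (\<langle>l\<rangle> powr (-\<beta>)) * stft \<phi> (tf_shift (tf_pair b l 0) \<phi>) (tf_pair b y z)" for l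
    have na: "cmod (a l) = \<langle>l\<rangle> powr (-\<beta>) * cmod (stft \<phi> \<phi> (tf_pair b (y - l) z))" for l
      by (simp add: a_def norm_mult norm_stft_tf_shift[OF \<phi>(1) \<phi>(1)] tf_pair_diff)
    have "norm (y - k) \<le> \<delta>" "norm z \<le> \<delta>" using y z by (auto simp: dist_norm norm_minus_commute)
    then have "n \<le> cmod (stft \<phi> \<phi> (tf_pair b (y - k) z))" using near by (simp add: tf_pair_def)
    then have ak: "\<langle>k\<rangle> powr (-\<beta>) * n \<le> cmod (a k)" unfolding na by (rule mult_left_mono) simp
    have al: "cmod (a l) \<le> \<langle>k\<rangle> powr (-\<beta>) * (E / R) * \<langle>k - l\<rangle> powr (-r)" if l: "l \<in> K - {k}" for l
    proof -
      have Rl: "R \<le> norm (k - l)" using K k l unfolding separated_def by auto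
      have 1: "\<langle>l\<rangle> powr (-\<beta>) \<le> 2 powr \<beta> * \<langle>k - l\<rangle> powr \<beta> * \<langle>k\<rangle> powr (-\<beta>)"
        using jb_peetre[of l "-\<beta>" k] \<beta> by (simp add: jb_minus_commute)
      have "cmod (stft \<phi> \<phi> (tf_pair b (y - l) z)) \<le> D * \<langle>tf_pair b (y - l) z\<rangle> powr (-(M + 0))"
        using D(2)[of "tf_pair b (y - l) z"] by simp
      also have "\<dots> \<le> D * (\<langle>y - l\<rangle> powr (-M) * \<langle>z\<rangle> powr (-0))"
        using D(1) M0 by (intro mult_left_mono jb_powr_tf_pair_le) auto
      also have "\<langle>z\<rangle> powr (-0) = 1" by (simp add: less_imp_neq[OF jb_pos, symmetric])
      also have "\<langle>y - l\<rangle> powr (-M) \<le> 4 powr M * \<langle>k - l\<rangle> powr (-M)"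
      proof -
        have "4 powr (-\<bar>-M\<bar>) * \<langle>y - l\<rangle> powr (-M) \<le> \<langle>k - l\<rangle> powr (-M)"
          by (rule jb_powr_near[OF _ \<delta>(2)]) (use y in \<open>simp add: dist_norm norm_minus_commute\<close>)
        then have "4 powr M * (4 powr (-M) * \<langle>y - l\<rangle> powr (-M)) \<le> 4 powr M * \<langle>k - l\<rangle> powr (-M)"
          using M0 by (intro mult_left_mono) auto
        then show ?thesis by (simp only: mult.assoc[symmetric] powr_add[symmetric]) simp
      qed
      finally have 2: "cmod (stft \<phi> \<phi> (tf_pair b (y - l) z)) \<le> D * (4 powr M * \<langle>k - l\<rangle> powr (-M))"
        using D(1) by (simp add: mult_left_mono)
      have "cmod (a l) \<le> (2 powr \<beta> * \<langle>k - l\<rangle> powr \<beta> * \<langle>k\<rangle> powr (-\<beta>)) * (D * (4 powr M * \<langle>k - l\<rangle> powr (-M)))"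
        unfolding na by (intro mult_mono 1 2) auto
      also have "\<dots> = \<langle>k\<rangle> powr (-\<beta>) * E * (\<langle>k - l\<rangle> powr \<beta> * \<langle>k - l\<rangle> powr (-M))"
        by (simp add: E_def mult_ac)
      also have "\<langle>k - l\<rangle> powr \<beta> * \<langle>k - l\<rangle> powr (-M) = \<langle>k - l\<rangle> powr (-1) * \<langle>k - l\<rangle> powr (-r)"
        unfolding M_def powr_add[symmetric] by (rule arg_cong[where f = "\<lambda>e. \<langle>k - l\<rangle> powr e"]) simp
      also have "\<langle>k\<rangle> powr (-\<beta>) * E * (\<langle>k - l\<rangle> powr (-1) * \<langle>k - l\<rangle> powr (-r))
          \<le> \<langle>k\<rangle> powr (-\<beta>) * E * (1 / R * \<langle>k - l\<rangle> powr (-r))"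
      proof (intro mult_left_mono mult_right_mono)
        have "\<langle>k - l\<rangle> powr (-1) \<le> R powr (-1)"
          using Rl R(1) norm_le_jb[of "k - l"] by (intro powr_mono2') auto
        then show "\<langle>k - l\<rangle> powr (-1) \<le> 1 / R" using R(1) by (simp add: powr_minus divide_inverse)
      qed (use E in auto)
      finally show ?thesis by simp
    qed
    have "cmod (\<Sum>l\<in>K - {k}. a l) \<le> (\<Sum>l\<in>K - {k}. \<langle>k\<rangle> powr (-\<beta>) * (E / R) * \<langle>k - l\<rangle> powr (-r))"
      by (rule sum_norm_le) (rule al)
    also have "\<dots> \<le> (\<Sum>l\<in>K. \<langle>k\<rangle> powr (-\<beta>) * (E / R) * \<langle>k - l\<rangle> powr (-r))"
      by (rule sum_mono2) (use fin E R in auto)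
    also have "\<dots> = \<langle>k\<rangle> powr (-\<beta>) * (E / R) * (\<Sum>l\<in>K. \<langle>k - l\<rangle> powr (-r))"
      by (rule sum_distrib_left[symmetric])
    also have "\<dots> \<le> \<langle>k\<rangle> powr (-\<beta>) * (E / R) * A"
      using E R by (intro mult_left_mono A(2)[OF K2]) auto
    also have "\<dots> \<le> \<langle>k\<rangle> powr (-\<beta>) * (n / 2)"
    proof -
      have "E / R * A \<le> n / 2" using R n by (simp add: field_simps)
      then show ?thesis unfolding mult.assoc by (rule mult_left_mono) simp
    qed
    finally have "cmod (\<Sum>l\<in>K - {k}. a l) \<le> \<langle>k\<rangle> powr (-\<beta>) * (n / 2)" .
    moreover have "cmod (a k) - cmod (\<Sum>l\<in>K - {k}. a l) \<le> cmod (\<Sum>l\<in>K. a l)"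
      unfolding sum.remove[OF fin k] by (rule norm_diff_ineq)
    ultimately have "\<langle>k\<rangle> powr (-\<beta>) * n - \<langle>k\<rangle> powr (-\<beta>) * (n / 2) \<le> cmod (\<Sum>l\<in>K. a l)"
      using ak by linarith
    then have "n / 2 * \<langle>k\<rangle> powr (-\<beta>) \<le> cmod (\<Sum>l\<in>K. a l)" by (simp add: mult.commute)
    then show ?thesis by (simp only: a_def)
  qed
  moreover have "0 < n / 2" using n by simp
  ultimately show ?thesis using \<delta> R(1) that by blast
qed

text \<open>
  The test function is the sum of \<open>\<langle>k\<rangle>^-\<beta>\<close> times the translate (or modulation) of \<open>\<phi>\<close> by \<open>k\<close>, over a
  separated set. At the borderline exponent \<open>\<beta> = s1 + d / p1\<close> its two norms are bounded above and
  below by powers \<open>1 / p1\<close> and \<open>1 / p2\<close> of the same unbounded sum \<open>S\<close> of the \<open>\<langle>k\<rangle>^-d\<close>.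
\<close>

lemma lattice_test:
  fixes \<phi> :: "'a::euclidean_space \<Rightarrow> complex"
  assumes \<phi>: "\<phi> \<in> schwartz" "\<phi> \<noteq> (\<lambda>_. 0)" and p: "1 \<le> p1" "1 \<le> p2" "p2 \<noteq> \<infinity>" and s1: "0 \<le> s1"
    and idx: "recip p1 + s1 / real DIM('a) \<le> recip p2 + s2 / real DIM('a)"
  obtains c C r \<delta> where "0 < c" "0 < C" "real DIM('a) < r" "0 < \<delta>" "\<delta> \<le> 1"
    "\<And>B. \<exists>f\<in>schwartz. \<exists>G g S. B \<le> S \<and> 0 < S \<and> G \<in> borel_measurable borel \<and> g \<in> borel_measurable borel \<and>
      Lp_norm p1 G \<le> ennreal (C * S powr recip p1) \<and> ennreal (c * S powr recip p2) \<le> Lp_norm p2 g \<and> (\<forall>y. g y < \<infinity>) \<and>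
      (\<forall>y z. ennreal (cmod (stft \<phi> f (tf_pair b y z))) * (ennreal (\<langle>y\<rangle> powr s1) * ennreal (\<langle>z\<rangle> powr t1))
        \<le> G y * (ennreal C * ennreal (\<langle>z\<rangle> powr (-r)))) \<and>
      (\<forall>y z. g y * (ennreal c * indicator (cball 0 \<delta>) z)
        \<le> ennreal (cmod (stft \<phi> f (tf_pair b y z))) * (ennreal (\<langle>y\<rangle> powr s2) * ennreal (\<langle>z\<rangle> powr t2)))"
proof -
  define d where "d = real DIM('a)"
  have d: "0 < d" by (simp add: d_def)
  define r where "r = d + 1"
  define \<beta> where "\<beta> = s1 + d * recip p1"
  have \<beta>: "0 \<le> \<beta>" using s1 recip_bounds(1)[OF p(1)] d by (simp add: \<beta>_def)
  have "d * (recip p1 + s1 / d) \<le> d * (recip p2 + s2 / d)" using idx d by (simp add: d_def)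
  \<comment> \<open>In this form the failed index inequality says that the coefficients, weighted
    with exponent \<open>s2\<close>, are at least the borderline sequence for
    \<open>p2\<close>.\<close>
  then have \<beta>2: "- (d * recip p2) \<le> s2 - \<beta>" using d by (simp add: \<beta>_def distrib_left)
  obtain n \<delta> R where n: "0 < n" and \<delta>: "0 < \<delta>" "\<delta> \<le> 1" and R: "2 < R" and ge:
    "\<And>K k y z. separated R K \<Longrightarrow> k \<in> K \<Longrightarrow> y \<in> cball k \<delta> \<Longrightarrow> z \<in> cball 0 \<delta> \<Longrightarrow>
      n * \<langle>k\<rangle> powr (-\<beta>) \<le> cmod (\<Sum>l\<in>K. of_real (\<langle>l\<rangle> powr (-\<beta>)) * stft \<phi> (tf_shift (tf_pair b l 0) \<phi>) (tf_pair b y z))"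
    using stft_lattice_ge[OF \<phi> \<beta>, of b] by blast
  obtain A where A: "0 < A" "\<And>K. separated 2 K \<Longrightarrow> K \<noteq> {} \<Longrightarrow>
    Lp_norm p1 (\<lambda>x::'a. \<Sum>k\<in>K. ennreal (\<langle>k\<rangle> powr (-(d * recip p1))) * ennreal (\<langle>x - k\<rangle> powr (-r)))
      \<le> ennreal (A * (\<Sum>k\<in>K. \<langle>k\<rangle> powr (- d)) powr recip p1)"
    unfolding d_def using Lp_norm_separated_le[OF p(1), of r, where 'a = 'a] by (auto simp: r_def d_def)
  obtain a where a: "0 < a" "\<And>K. separated R K \<Longrightarrow>
    ennreal (a * (\<Sum>k\<in>K. \<langle>k\<rangle> powr (- d)) powr recip p2)
      \<le> Lp_norm p2 (\<lambda>x::'a. \<Sum>k\<in>K. ennreal (\<langle>k\<rangle> powr (-(d * recip p2))) * indicator (cball k \<delta>) x)"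
    unfolding d_def using Lp_norm_separated_ge[OF p(2,3) \<delta>(1), of R, where 'a = 'a] \<delta>(2) R by auto
  obtain D where D: "0 \<le> D" "\<And>w. cmod (stft \<phi> \<phi> w) \<le> D * \<langle>w\<rangle> powr (- ((r + s1) + (r + \<bar>t1\<bar>)))"
    using schwartz_decay[OF stft_schwartz[OF \<phi>(1) \<phi>(1)]] by blast
  define C where "C = max A (D * 2 powr s1)"
  define m where "m = n * (4 powr (-\<bar>s2\<bar>) * 4 powr (-\<bar>t2\<bar>))"
  have m: "0 < m" using n by (simp add: m_def)
  define c where "c = min a m"
  have cC: "0 < c" "0 < C" using a A m by (auto simp: c_def C_def less_max_iff_disj)
  show thesis
  proof (rule that[of c C r \<delta>])
    fix B :: real
    \<comment> \<open>The maximum with 1 makes the set nonempty and \<open>S\<close>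
      positive.\<close>
    obtain K :: "'a set" where K: "separated R K" "max 1 B \<le> (\<Sum>k\<in>K. \<langle>k\<rangle> powr (-d))"
      using separated_sum_unbounded[of R, where 'a = 'a] R unfolding d_def by (metis less_trans zero_less_numeral)
    have fin: "finite K" using K by (simp add: separated_def)
    have K2: "separated 2 K" by (rule separated_mono[OF K(1)]) (use R in simp)
    have ne: "K \<noteq> {}" using K(2) by auto
    define S where "S = (\<Sum>k\<in>K. \<langle>k\<rangle> powr (-d))"
    define f where "f t = (\<Sum>k\<in>K. of_real (\<langle>k\<rangle> powr (-\<beta>)) * tf_shift (tf_pair b k 0) \<phi> t)" for t
    have f: "f \<in> schwartz"
      unfolding f_def[abs_def] by (intro schwartz_sum schwartz_cmult tf_shift_schwartz \<phi>)
    have Vf: "stft \<phi> f w = (\<Sum>k\<in>K. of_real (\<langle>k\<rangle> powr (-\<beta>)) * stft \<phi> (tf_shift (tf_pair b k 0) \<phi>) w)" for w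
      unfolding f_def[abs_def] by (rule stft_sum) (auto intro: tf_shift_schwartz \<phi>)
    define G where "G y = (\<Sum>k\<in>K. ennreal (\<langle>k\<rangle> powr (-(d * recip p1))) * ennreal (\<langle>y - k\<rangle> powr (-r)))" for y
    define g where "g y = (\<Sum>k\<in>K. ennreal (\<langle>k\<rangle> powr (-(d * recip p2))) * indicator (cball k \<delta>) y)" for y
    have up: "ennreal (cmod (stft \<phi> f (tf_pair b y z))) * (ennreal (\<langle>y\<rangle> powr s1) * ennreal (\<langle>z\<rangle> powr t1))
        \<le> G y * (ennreal C * ennreal (\<langle>z\<rangle> powr (-r)))" for y z
    proof -
      \<comment> \<open>Moving the weight with exponent \<open>s1\<close> from \<open>y\<close> to
        \<open>k\<close> turns the coefficient of order \<beta> into the borderline one for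
        \<open>p1\<close>, at the price of \<open>s1\<close> powers of decay; the other variable
        gives up \<open>\<bar>t1\<bar>\<close> powers.\<close>
      have tm: "\<langle>k\<rangle> powr (-\<beta>) * cmod (stft \<phi> \<phi> (tf_pair b (y - k) z)) * (\<langle>y\<rangle> powr s1 * \<langle>z\<rangle> powr t1)
          \<le> (\<langle>k\<rangle> powr (-(d * recip p1)) * \<langle>y - k\<rangle> powr (-r)) * (D * 2 powr s1 * \<langle>z\<rangle> powr (-r))" for k
      proof -
        have "cmod (stft \<phi> \<phi> (tf_pair b (y - k) z)) \<le> D * (\<langle>y - k\<rangle> powr (-(r + s1)) * \<langle>z\<rangle> powr (-(r + \<bar>t1\<bar>)))"
          using s1 d D(1) by (intro order_trans[OF D(2)] mult_left_mono jb_powr_tf_pair_le) (auto simp: r_def)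
        moreover have "\<langle>y\<rangle> powr s1 \<le> 2 powr s1 * \<langle>y - k\<rangle> powr s1 * \<langle>k\<rangle> powr s1"
          using jb_peetre[of y s1 k] s1 by simp
        moreover have "\<langle>z\<rangle> powr t1 \<le> \<langle>z\<rangle> powr \<bar>t1\<bar>" using jb_ge_1[of z] by (intro powr_mono) auto
        ultimately have "\<langle>k\<rangle> powr (-\<beta>) * cmod (stft \<phi> \<phi> (tf_pair b (y - k) z)) * (\<langle>y\<rangle> powr s1 * \<langle>z\<rangle> powr t1)
          \<le> \<langle>k\<rangle> powr (-\<beta>) * (D * (\<langle>y - k\<rangle> powr (-(r + s1)) * \<langle>z\<rangle> powr (-(r + \<bar>t1\<bar>))))
            * ((2 powr s1 * \<langle>y - k\<rangle> powr s1 * \<langle>k\<rangle> powr s1) * \<langle>z\<rangle> powr \<bar>t1\<bar>)"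
          using D(1) by (intro mult_mono) auto
        also have "\<dots> = (\<langle>k\<rangle> powr (-\<beta>) * \<langle>k\<rangle> powr s1) * (\<langle>y - k\<rangle> powr (-(r + s1)) * \<langle>y - k\<rangle> powr s1)
            * (D * 2 powr s1 * (\<langle>z\<rangle> powr (-(r + \<bar>t1\<bar>)) * \<langle>z\<rangle> powr \<bar>t1\<bar>))" by (simp add: mult_ac)
        also have "\<langle>k\<rangle> powr (-\<beta>) * \<langle>k\<rangle> powr s1 = \<langle>k\<rangle> powr (-(d * recip p1))" by (simp add: \<beta>_def flip: powr_add)
        also have "\<langle>y - k\<rangle> powr (-(r + s1)) * \<langle>y - k\<rangle> powr s1 = \<langle>y - k\<rangle> powr (-r)" by (simp flip: powr_add)
        also have "\<langle>z\<rangle> powr (-(r + \<bar>t1\<bar>)) * \<langle>z\<rangle> powr \<bar>t1\<bar> = \<langle>z\<rangle> powr (-r)" by (simp flip: powr_add)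
        finally show ?thesis .
      qed
      have "cmod (stft \<phi> f (tf_pair b y z)) \<le> (\<Sum>k\<in>K. \<langle>k\<rangle> powr (-\<beta>) * cmod (stft \<phi> \<phi> (tf_pair b (y - k) z)))"
        unfolding Vf
        by (intro sum_norm_le) (simp add: norm_mult norm_stft_tf_shift[OF \<phi>(1) \<phi>(1)] tf_pair_diff)
      then have "cmod (stft \<phi> f (tf_pair b y z)) * (\<langle>y\<rangle> powr s1 * \<langle>z\<rangle> powr t1)
          \<le> (\<Sum>k\<in>K. \<langle>k\<rangle> powr (-\<beta>) * cmod (stft \<phi> \<phi> (tf_pair b (y - k) z))) * (\<langle>y\<rangle> powr s1 * \<langle>z\<rangle> powr t1)"
        by (rule mult_right_mono) simp
      also have "\<dots> \<le> (\<Sum>k\<in>K. (\<langle>k\<rangle> powr (-(d * recip p1)) * \<langle>y - k\<rangle> powr (-r)) * (D * 2 powr s1 * \<langle>z\<rangle> powr (-r)))"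
        unfolding sum_distrib_right by (rule sum_mono) (rule tm)
      also have "\<dots> = (\<Sum>k\<in>K. \<langle>k\<rangle> powr (-(d * recip p1)) * \<langle>y - k\<rangle> powr (-r)) * (D * 2 powr s1 * \<langle>z\<rangle> powr (-r))"
        by (rule sum_distrib_right[symmetric])
      also have "\<dots> \<le> (\<Sum>k\<in>K. \<langle>k\<rangle> powr (-(d * recip p1)) * \<langle>y - k\<rangle> powr (-r)) * (C * \<langle>z\<rangle> powr (-r))"
        by (intro mult_left_mono mult_right_mono sum_nonneg) (auto simp: C_def)
      finally have "ennreal (cmod (stft \<phi> f (tf_pair b y z)) * (\<langle>y\<rangle> powr s1 * \<langle>z\<rangle> powr t1))
          \<le> ennreal ((\<Sum>k\<in>K. \<langle>k\<rangle> powr (-(d * recip p1)) * \<langle>y - k\<rangle> powr (-r)) * (C * \<langle>z\<rangle> powr (-r)))"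
        by (rule ennreal_leI)
      also have "\<dots> = G y * (ennreal C * ennreal (\<langle>z\<rangle> powr (-r)))"
        using cC by (simp add: G_def ennreal_mult sum_nonneg flip: sum_ennreal)
      finally show ?thesis by (simp add: ennreal_mult)
    qed
    have low: "g y * (ennreal c * indicator (cball 0 \<delta>) z)
        \<le> ennreal (cmod (stft \<phi> f (tf_pair b y z))) * (ennreal (\<langle>y\<rangle> powr s2) * ennreal (\<langle>z\<rangle> powr t2))" for y z
    proof (cases "(\<exists>k\<in>K. y \<in> cball k \<delta>) \<and> z \<in> cball 0 \<delta>")
      case True
      then obtain k where k: "k \<in> K" "y \<in> cball k \<delta>" and z: "z \<in> cball 0 \<delta>" by blast
      have gy: "g y = ennreal (\<langle>k\<rangle> powr (-(d * recip p2)))"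
        unfolding g_def by (rule separated_sum_indicator_le[OF K(1) _ k]) (use \<delta> R in simp)
      have 1: "n * \<langle>k\<rangle> powr (-\<beta>) \<le> cmod (stft \<phi> f (tf_pair b y z))"
        unfolding Vf by (rule ge[OF K(1) k z])
      have 2: "4 powr (-\<bar>t2\<bar>) \<le> \<langle>z\<rangle> powr t2"
        using jb_powr_near[OF z \<delta>(2), of t2] by (simp add: japanese_bracket_def)
      have "\<langle>k\<rangle> powr (-(d * recip p2)) \<le> \<langle>k\<rangle> powr (s2 - \<beta>)" using \<beta>2 jb_ge_1[of k] by (intro powr_mono) auto
      also have "\<dots> = \<langle>k\<rangle> powr (-\<beta>) * \<langle>k\<rangle> powr s2" by (simp flip: powr_add)
      finally have "\<langle>k\<rangle> powr (-(d * recip p2)) * c \<le> (\<langle>k\<rangle> powr (-\<beta>) * \<langle>k\<rangle> powr s2) * m"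
        using cC by (intro mult_mono) (auto simp: c_def)
      also have "\<dots> = (n * \<langle>k\<rangle> powr (-\<beta>)) * ((4 powr (-\<bar>s2\<bar>) * \<langle>k\<rangle> powr s2) * 4 powr (-\<bar>t2\<bar>))"
        by (simp add: m_def mult_ac)
      also have "\<dots> \<le> cmod (stft \<phi> f (tf_pair b y z)) * (\<langle>y\<rangle> powr s2 * \<langle>z\<rangle> powr t2)"
        using n by (intro mult_mono 1 2 jb_powr_near[OF k(2) \<delta>(2)]) auto
      finally have "ennreal (\<langle>k\<rangle> powr (-(d * recip p2)) * c) \<le> ennreal (cmod (stft \<phi> f (tf_pair b y z)) * (\<langle>y\<rangle> powr s2 * \<langle>z\<rangle> powr t2))"
        by (rule ennreal_leI)
      then show ?thesis using z cC by (simp add: gy ennreal_mult)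
    next
      case False
      then have "g y * (ennreal c * indicator (cball 0 \<delta>) z) = 0"
        unfolding g_def by (auto intro!: sum.neutral)
      then show ?thesis by (rule ord_eq_le_trans) simp
    qed
    have "G \<in> borel_measurable borel" "g \<in> borel_measurable borel"
      unfolding G_def[abs_def] g_def[abs_def] by measurable
    moreover have "Lp_norm p1 G \<le> ennreal (C * S powr recip p1)"
      using A(2)[OF K2 ne] unfolding G_def[abs_def] S_def
      by (rule order_trans) (intro ennreal_leI mult_right_mono, auto simp: C_def)
    moreover have "ennreal (c * S powr recip p2) \<le> Lp_norm p2 g"
      using a(2)[OF K(1)] unfolding g_def[abs_def] S_def
      by (rule order_trans[rotated]) (intro ennreal_leI mult_right_mono, auto simp: c_def)
    moreover have "g y < \<infinity>" for y
      using fin by (auto simp: g_def indicator_def)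
    ultimately show "\<exists>f\<in>schwartz. \<exists>G g S. B \<le> S \<and> 0 < S \<and> G \<in> borel_measurable borel \<and> g \<in> borel_measurable borel \<and>
      Lp_norm p1 G \<le> ennreal (C * S powr recip p1) \<and> ennreal (c * S powr recip p2) \<le> Lp_norm p2 g \<and> (\<forall>y. g y < \<infinity>) \<and>
      (\<forall>y z. ennreal (cmod (stft \<phi> f (tf_pair b y z))) * (ennreal (\<langle>y\<rangle> powr s1) * ennreal (\<langle>z\<rangle> powr t1))
        \<le> G y * (ennreal C * ennreal (\<langle>z\<rangle> powr (-r)))) \<and>
      (\<forall>y z. g y * (ennreal c * indicator (cball 0 \<delta>) z)
        \<le> ennreal (cmod (stft \<phi> f (tf_pair b y z))) * (ennreal (\<langle>y\<rangle> powr s2) * ennreal (\<langle>z\<rangle> powr t2)))"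
      using f K(2) up low by (intro bexI[of _ f] exI[of _ G] exI[of _ g] exI[of _ S]) (auto simp: S_def)
  qed (use cC \<delta> in \<open>auto simp: r_def d_def\<close>)
qed

text \<open>Division by \<open>S powr b\<close> bounds \<open>S powr (a - b)\<close> by
  \<open>C / c\<close>, and \<open>B\<close> is chosen to exceed that bound.\<close>

lemma powr_growth_contradiction:
  fixes a b c C :: real
  assumes c: "0 < c" and ab: "b < a" and H: "\<And>B. \<exists>S. B \<le> S \<and> 0 < S \<and> c * S powr a \<le> C * S powr b"
  shows False
proof -
  define B where "B = (\<bar>C\<bar> / c + 1) powr (1 / (a - b))"
  obtain S where S: "B \<le> S" "0 < S" "c * S powr a \<le> C * S powr b" using H by blast
  have "\<bar>C\<bar> / c + 1 = B powr (a - b)" using ab c by (simp add: B_def powr_powr add_nonneg_pos)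
  also have "\<dots> \<le> S powr (a - b)" using S ab by (intro powr_mono2) (auto simp: B_def)
  also have "\<dots> \<le> C / c"
    using S(2,3) c by (simp add: powr_diff divide_le_eq le_divide_eq mult.commute)
  also have "\<dots> \<le> \<bar>C\<bar> / c" using c by (intro divide_right_mono) auto
  finally show False by simp
qed

text \<open>With all frequencies 0 the operator is twice the identity, as the coefficients
  \<open>(1/2)^k\<close> sum to 2. The conclusion speaks of lower bounds \<open>L\<close> valid for
  every functional with a larger STFT, because the image is known only through its STFT.\<close>

lemma OP_bounded_identity:
  fixes \<phi> :: "'a::euclidean_space \<Rightarrow> complex"
  assumes \<phi>: "\<phi> \<in> schwartz" and \<Phi>: "\<Phi> \<in> schwartz"
    and B: "all_OP_bounded \<phi> \<tau> (modulation_space \<Phi> (\<lambda>_. 1) \<infinity> 1) (weight s1 t1) p1 q1 (weight s2 t2) p2 q2"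
  obtains C where "0 \<le> C" "\<And>f L. f \<in> schwartz \<Longrightarrow>
      (\<And>u. (\<And>x \<xi>. cmod (stft \<phi> f (x, \<xi>)) \<le> cmod (STFT \<phi> u x \<xi>)) \<Longrightarrow> ennreal L \<le> modulation_norm \<phi> (weight s2 t2) p2 q2 u) \<Longrightarrow>
      ennreal L \<le> ennreal C * modulation_norm \<phi> (weight s1 t1) p1 q1 (distribution_of f)"
proof -
  let ?\<omega> = "\<lambda>k::nat. 0 :: 'a \<times> 'a"
  let ?\<sigma> = "distribution_of (trig_symbol (\<lambda>k. (1/2)^k) (\<lambda>k. (snd (?\<omega> k), - fst (?\<omega> k))))"
  have "?\<sigma> \<in> modulation_space \<Phi> (\<lambda>_. 1) \<infinity> 1"
    by (rule trig_symbol_sjoestrand[OF _ _ \<Phi>]) (auto intro: summable_geometric)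
  with B obtain C where C: "\<And>f. f \<in> schwartz \<Longrightarrow> modulation_norm \<phi> (weight s2 t2) p2 q2 (OP \<tau> ?\<sigma> f)
      \<le> ennreal C * modulation_norm \<phi> (weight s1 t1) p1 q1 (distribution_of f)"
    unfolding all_OP_bounded_def by blast
  have ident: "STFT \<phi> (OP \<tau> ?\<sigma> f) x \<xi> = 2 * stft \<phi> f (x, \<xi>)" if f: "f \<in> schwartz" for f x \<xi>
  proof -
    have "tf_shift (0 :: 'a \<times> 'a) f = f" by (rule ext) (simp add: tf_shift_apply)
    then have "STFT \<phi> (OP \<tau> ?\<sigma> f) x \<xi> = (\<Sum>k. of_real ((1/2)^k) * stft \<phi> f (x, \<xi>))"
      by (subst STFT_OP_trig_symbol[OF _ _ f \<phi>]) (auto intro: summable_geometric)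
    also have "\<dots> = 2 * stft \<phi> f (x, \<xi>)"
      using sums_mult2[OF geometric_sums[of "1/2::complex"], of "stft \<phi> f (x, \<xi>)"] by (simp add: sums_iff)
    finally show ?thesis .
  qed
  show thesis
  proof (rule that[of "\<bar>C\<bar>"])
    fix f L
    assume f: "f \<in> schwartz"
      and L: "\<And>u. (\<And>x \<xi>. cmod (stft \<phi> f (x, \<xi>)) \<le> cmod (STFT \<phi> u x \<xi>)) \<Longrightarrow> ennreal L \<le> modulation_norm \<phi> (weight s2 t2) p2 q2 u"
    have "ennreal L \<le> modulation_norm \<phi> (weight s2 t2) p2 q2 (OP \<tau> ?\<sigma> f)"
      by (rule L) (simp only: ident[OF f], simp add: norm_mult)
    also note C[OF f]
    also have "ennreal C * modulation_norm \<phi> (weight s1 t1) p1 q1 (distribution_of f)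
      \<le> ennreal \<bar>C\<bar> * modulation_norm \<phi> (weight s1 t1) p1 q1 (distribution_of f)"
      by (intro mult_right_mono ennreal_leI) auto
    finally show "ennreal L \<le> ennreal \<bar>C\<bar> * modulation_norm \<phi> (weight s1 t1) p1 q1 (distribution_of f)" .
  qed simp
qed

lemma Lp_norm_const_jb:
  assumes p: "1 \<le> p" and r: "real DIM('a) < r"
  obtains H where "0 \<le> H" "Lp_norm p (\<lambda>z::'a::euclidean_space. ennreal C * ennreal (\<langle>z\<rangle> powr (-r))) \<le> ennreal H"
proof -
  obtain A where A: "0 \<le> A" "Lp_norm p (\<lambda>x::'a. ennreal (\<langle>x\<rangle> powr (-r))) = ennreal A"
    using Lp_norm_jb_finite[OF p r] by (metis ennreal_cases_real less_irrefl)
  have "Lp_norm p (\<lambda>z::'a. ennreal C * ennreal (\<langle>z\<rangle> powr (-r))) \<le> ennreal C * Lp_norm p (\<lambda>x::'a. ennreal (\<langle>x\<rangle> powr (-r)))"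
    by (rule Lp_norm_cmult_le[OF p]) measurable
  also have "\<dots> \<le> ennreal \<bar>C\<bar> * ennreal A" unfolding A(2) by (intro mult_right_mono ennreal_leI) auto
  also have "\<dots> = ennreal (\<bar>C\<bar> * A)" using A by (simp add: ennreal_mult)
  finally show thesis using A(1) by (intro that[of "\<bar>C\<bar> * A"]) auto
qed

lemma Lp_norm_const_indicator:
  assumes p: "1 \<le> p" and \<delta>: "0 < \<delta>" and c: "0 < c"
  obtains h where "0 < h" "ennreal h \<le> Lp_norm p (\<lambda>z::'a::euclidean_space. ennreal c * indicator (cball 0 \<delta>) z)"
proof -
  obtain h where h: "0 < h" "\<And>y::'a. ennreal h \<le> Lp_norm p (indicator (cball y \<delta>))"
    using Lp_norm_indicator_cball[OF p \<delta>] by blast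
  have "ennreal (c * h) = ennreal c * ennreal h" using c h by (simp add: ennreal_mult)
  also have "\<dots> \<le> ennreal c * Lp_norm p (indicator (cball (0::'a) \<delta>))" by (intro mult_left_mono h) auto
  also have "\<dots> \<le> Lp_norm p (\<lambda>z::'a. ennreal c * indicator (cball 0 \<delta>) z)"
    by (rule Lp_norm_cmult_ge[OF p _ c]) measurable
  finally show thesis using c h by (intro that[of "c * h"]) auto
qed

text \<open>If both alternatives fail, the lattice functions have source norm of order at most
  \<open>S powr recip p1\<close> and target norm of order at least \<open>S powr recip p2\<close>,
  where \<open>recip p1 < recip p2\<close>. Letting \<open>S\<close> grow contradicts the
  embedding.\<close>

lemma OP_bounded_exponents:
  fixes \<phi> :: "'a::euclidean_space \<Rightarrow> complex"
  assumes p: "1 \<le> p1" "1 \<le> p2" and q: "1 \<le> q1" "1 \<le> q2"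
    and \<phi>: "\<phi> \<in> schwartz" "\<phi> \<noteq> (\<lambda>_. 0)" and \<Phi>: "\<Phi> \<in> schwartz"
    and B: "all_OP_bounded \<phi> \<tau> (modulation_space \<Phi> (\<lambda>_. 1) \<infinity> 1) (weight s1 t1) p1 q1 (weight s2 t2) p2 q2"
  shows "0 \<le> s1 \<Longrightarrow> p1 \<le> p2 \<or> recip p2 + s2 / real DIM('a) < recip p1 + s1 / real DIM('a)"
    and "0 \<le> t1 \<Longrightarrow> q1 \<le> q2 \<or> recip q2 + t2 / real DIM('a) < recip q1 + t1 / real DIM('a)"
proof -
  obtain M where M: "0 \<le> M" "\<And>f L. f \<in> schwartz \<Longrightarrow>
      (\<And>u. (\<And>x \<xi>. cmod (stft \<phi> f (x, \<xi>)) \<le> cmod (STFT \<phi> u x \<xi>)) \<Longrightarrow> ennreal L \<le> modulation_norm \<phi> (weight s2 t2) p2 q2 u) \<Longrightarrow>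
      ennreal L \<le> ennreal M * modulation_norm \<phi> (weight s1 t1) p1 q1 (distribution_of f)"
    by (rule OP_bounded_identity[OF \<phi>(1) \<Phi> B]) blast
  have meas: "(\<lambda>(\<xi>, x). ennreal (cmod (stft \<phi> f (x, \<xi>))) * (ennreal (\<langle>x\<rangle> powr s1) * ennreal (\<langle>\<xi>\<rangle> powr t1)))
      \<in> borel_measurable (borel \<Otimes>\<^sub>M borel)" if "f \<in> schwartz" for f
  proof -
    have [measurable]: "stft \<phi> f \<in> borel_measurable borel"
      by (intro schwartz_measurable stft_schwartz that \<phi>)
    show ?thesis by measurable
  qed
  show "p1 \<le> p2 \<or> recip p2 + s2 / real DIM('a) < recip p1 + s1 / real DIM('a)" if s1: "0 \<le> s1"
  proof (rule ccontr)
    assume neg: "\<not> ?thesis"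
    then have r12: "recip p1 < recip p2" and idx: "recip p1 + s1 / real DIM('a) \<le> recip p2 + s2 / real DIM('a)"
      using recip_le_iff[OF p] by (auto simp: not_le[symmetric])
    \<comment> \<open>The lower bound over separated sets concerns finite exponents; here
      \<open>recip p2\<close> is positive.\<close>
    have p2: "p2 \<noteq> \<infinity>" using r12 recip_bounds(1)[OF p(1)] by auto
    obtain c C r \<delta> where c: "0 < c" and C: "0 < C" and r: "real DIM('a) < r" and \<delta>: "0 < \<delta>" and T:
      "\<And>B. \<exists>f\<in>schwartz. \<exists>G g S. B \<le> S \<and> 0 < S \<and> G \<in> borel_measurable borel \<and> g \<in> borel_measurable borel \<and>
        Lp_norm p1 G \<le> ennreal (C * S powr recip p1) \<and> ennreal (c * S powr recip p2) \<le> Lp_norm p2 g \<and> (\<forall>y. g y < \<infinity>) \<and>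
        (\<forall>y z. ennreal (cmod (stft \<phi> f (tf_pair True y z))) * (ennreal (\<langle>y\<rangle> powr s1) * ennreal (\<langle>z\<rangle> powr t1))
          \<le> G y * (ennreal C * ennreal (\<langle>z\<rangle> powr (-r)))) \<and>
        (\<forall>y z. g y * (ennreal c * indicator (cball 0 \<delta>) z)
          \<le> ennreal (cmod (stft \<phi> f (tf_pair True y z))) * (ennreal (\<langle>y\<rangle> powr s2) * ennreal (\<langle>z\<rangle> powr t2)))"
      by (rule lattice_test[OF \<phi> p p2 s1 idx, of True t1 t2]) blast
    obtain H where H: "0 \<le> H" "Lp_norm q1 (\<lambda>z::'a. ennreal C * ennreal (\<langle>z\<rangle> powr (-r))) \<le> ennreal H"
      by (rule Lp_norm_const_jb[OF q(1) r])
    obtain h where h: "0 < h" "ennreal h \<le> Lp_norm q2 (\<lambda>z::'a. ennreal c * indicator (cball 0 \<delta>) z)"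
      by (rule Lp_norm_const_indicator[OF q(2) \<delta> c])
    show False
    proof (rule powr_growth_contradiction[OF _ r12])
      show "0 < c * h" using c h by simp
      fix B
      obtain f G g S where f: "f \<in> schwartz" and S: "B \<le> S" "0 < S"
        and [measurable]: "G \<in> borel_measurable borel" "g \<in> borel_measurable borel"
        and G: "Lp_norm p1 G \<le> ennreal (C * S powr recip p1)" and g: "ennreal (c * S powr recip p2) \<le> Lp_norm p2 g"
        and up: "\<And>y z. ennreal (cmod (stft \<phi> f (y, z))) * (ennreal (\<langle>y\<rangle> powr s1) * ennreal (\<langle>z\<rangle> powr t1))
          \<le> G y * (ennreal C * ennreal (\<langle>z\<rangle> powr (-r)))"
        and low: "\<And>y z. g y * (ennreal c * indicator (cball 0 \<delta>) z)
          \<le> ennreal (cmod (stft \<phi> f (y, z))) * (ennreal (\<langle>y\<rangle> powr s2) * ennreal (\<langle>z\<rangle> powr t2))"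
        using T[of B] by (auto simp: tf_pair_def)
      have "ennreal (c * S powr recip p2 * h) \<le> ennreal M * modulation_norm \<phi> (weight s1 t1) p1 q1 (distribution_of f)"
      proof (rule M(2)[OF f])
        fix u assume u: "\<And>x \<xi>. cmod (stft \<phi> f (x, \<xi>)) \<le> cmod (STFT \<phi> u x \<xi>)"
        have "ennreal (c * S powr recip p2 * h) = ennreal (c * S powr recip p2) * ennreal h"
          using c h by (simp add: ennreal_mult)
        also have "\<dots> \<le> ennreal (c * S powr recip p2) * Lp_norm q2 (\<lambda>z::'a. ennreal c * indicator (cball 0 \<delta>) z)"
          by (intro mult_left_mono h) auto
        also have "\<dots> \<le> modulation_norm \<phi> (weight s2 t2) p2 q2 u"
          unfolding modulation_norm_weight
        proof (rule mixed_norm_product_ge[OF p(2) q(2) _ _ _ g])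
          show "0 < c * S powr recip p2" using c S by simp
          show "ennreal c * indicator (cball 0 \<delta>) \<xi> < \<infinity>" for \<xi> :: 'a by (simp add: indicator_def)
          show "g x * (ennreal c * indicator (cball 0 \<delta>) \<xi>)
            \<le> ennreal (cmod (STFT \<phi> u x \<xi>)) * (ennreal (\<langle>x\<rangle> powr s2) * ennreal (\<langle>\<xi>\<rangle> powr t2))" for x \<xi>
            by (rule order_trans[OF low]) (intro mult_right_mono ennreal_leI u, simp)
        qed measurable
        finally show "ennreal (c * S powr recip p2 * h) \<le> modulation_norm \<phi> (weight s2 t2) p2 q2 u" .
      qed
      moreover have "modulation_norm \<phi> (weight s1 t1) p1 q1 (distribution_of f)
          \<le> Lp_norm p1 G * Lp_norm q1 (\<lambda>z::'a. ennreal C * ennreal (\<langle>z\<rangle> powr (-r)))"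
        unfolding modulation_norm_weight STFT_distribution_of
        by (rule mixed_norm_product_le[OF p(1) q(1) meas[OF f] _ _ up]) measurable
      moreover have "\<dots> \<le> ennreal (C * S powr recip p1) * ennreal H" by (intro mult_mono G H) auto
      ultimately have "ennreal (c * S powr recip p2 * h) \<le> ennreal M * (ennreal (C * S powr recip p1) * ennreal H)"
        by (meson mult_left_mono order_trans zero_le)
      then have "ennreal (c * S powr recip p2 * h) \<le> ennreal (M * (C * S powr recip p1 * H))"
        using M(1) C H(1) by (simp add: ennreal_mult)
      then have "c * S powr recip p2 * h \<le> M * (C * S powr recip p1 * H)"
        using M(1) C H(1) by (subst (asm) ennreal_le_iff) auto
      then have "c * h * S powr recip p2 \<le> M * C * H * S powr recip p1" by (simp only: mult_ac)
      with S show "\<exists>S. B \<le> S \<and> 0 < S \<and> c * h * S powr recip p2 \<le> M * C * H * S powr recip p1" by blast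
    qed
  qed
  \<comment> \<open>The same argument with the lattice in frequency: \<open>G\<close> and
    \<open>g\<close> now belong to the outer norm, and the fixed bump in position to the inner
    one.\<close>
  show "q1 \<le> q2 \<or> recip q2 + t2 / real DIM('a) < recip q1 + t1 / real DIM('a)" if t1: "0 \<le> t1"
  proof (rule ccontr)
    assume neg: "\<not> ?thesis"
    then have r12: "recip q1 < recip q2" and idx: "recip q1 + t1 / real DIM('a) \<le> recip q2 + t2 / real DIM('a)"
      using recip_le_iff[OF q] by (auto simp: not_le[symmetric])
    have q2: "q2 \<noteq> \<infinity>" using r12 recip_bounds(1)[OF q(1)] by auto
    obtain c C r \<delta> where c: "0 < c" and C: "0 < C" and r: "real DIM('a) < r" and \<delta>: "0 < \<delta>" and T:
      "\<And>B. \<exists>f\<in>schwartz. \<exists>G g S. B \<le> S \<and> 0 < S \<and> G \<in> borel_measurable borel \<and> g \<in> borel_measurable borel \<and>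
        Lp_norm q1 G \<le> ennreal (C * S powr recip q1) \<and> ennreal (c * S powr recip q2) \<le> Lp_norm q2 g \<and> (\<forall>y. g y < \<infinity>) \<and>
        (\<forall>y z. ennreal (cmod (stft \<phi> f (tf_pair False y z))) * (ennreal (\<langle>y\<rangle> powr t1) * ennreal (\<langle>z\<rangle> powr s1))
          \<le> G y * (ennreal C * ennreal (\<langle>z\<rangle> powr (-r)))) \<and>
        (\<forall>y z. g y * (ennreal c * indicator (cball 0 \<delta>) z)
          \<le> ennreal (cmod (stft \<phi> f (tf_pair False y z))) * (ennreal (\<langle>y\<rangle> powr t2) * ennreal (\<langle>z\<rangle> powr s2)))"
      by (rule lattice_test[OF \<phi> q q2 t1 idx, of False s1 s2]) blast
    obtain H where H: "0 \<le> H" "Lp_norm p1 (\<lambda>z::'a. ennreal C * ennreal (\<langle>z\<rangle> powr (-r))) \<le> ennreal H"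
      by (rule Lp_norm_const_jb[OF p(1) r])
    obtain h where h: "0 < h" "ennreal h \<le> Lp_norm p2 (\<lambda>z::'a. ennreal c * indicator (cball 0 \<delta>) z)"
      by (rule Lp_norm_const_indicator[OF p(2) \<delta> c])
    show False
    proof (rule powr_growth_contradiction[OF _ r12])
      show "0 < c * h" using c h by simp
      fix B
      obtain f G g S where f: "f \<in> schwartz" and S: "B \<le> S" "0 < S"
        and [measurable]: "G \<in> borel_measurable borel" "g \<in> borel_measurable borel"
        and G: "Lp_norm q1 G \<le> ennreal (C * S powr recip q1)" and g: "ennreal (c * S powr recip q2) \<le> Lp_norm q2 g"
        and g_fin: "\<And>y. g y < \<infinity>"
        and up: "\<And>y z. ennreal (cmod (stft \<phi> f (z, y))) * (ennreal (\<langle>y\<rangle> powr t1) * ennreal (\<langle>z\<rangle> powr s1))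
          \<le> G y * (ennreal C * ennreal (\<langle>z\<rangle> powr (-r)))"
        and low: "\<And>y z. g y * (ennreal c * indicator (cball 0 \<delta>) z)
          \<le> ennreal (cmod (stft \<phi> f (z, y))) * (ennreal (\<langle>y\<rangle> powr t2) * ennreal (\<langle>z\<rangle> powr s2))"
        using T[of B] by (auto simp: tf_pair_def)
      have "ennreal (c * S powr recip q2 * h) \<le> ennreal M * modulation_norm \<phi> (weight s1 t1) p1 q1 (distribution_of f)"
      proof (rule M(2)[OF f])
        fix u assume u: "\<And>x \<xi>. cmod (stft \<phi> f (x, \<xi>)) \<le> cmod (STFT \<phi> u x \<xi>)"
        have "ennreal (c * S powr recip q2 * h) = ennreal h * ennreal (c * S powr recip q2)"
          using c h by (simp add: ennreal_mult mult.commute)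
        also have "\<dots> \<le> ennreal h * Lp_norm q2 g" by (intro mult_left_mono g) auto
        also have "\<dots> \<le> modulation_norm \<phi> (weight s2 t2) p2 q2 u"
          unfolding modulation_norm_weight
        proof (rule mixed_norm_product_ge[OF p(2) q(2) _ _ h g_fin])
          show "ennreal c * indicator (cball 0 \<delta>) x * g \<xi>
            \<le> ennreal (cmod (STFT \<phi> u x \<xi>)) * (ennreal (\<langle>x\<rangle> powr s2) * ennreal (\<langle>\<xi>\<rangle> powr t2))" for x \<xi>
          proof -
            have "ennreal c * indicator (cball 0 \<delta>) x * g \<xi> = g \<xi> * (ennreal c * indicator (cball 0 \<delta>) x)"
              by (rule mult.commute)
            also note low
            also have "ennreal (cmod (stft \<phi> f (x, \<xi>))) * (ennreal (\<langle>\<xi>\<rangle> powr t2) * ennreal (\<langle>x\<rangle> powr s2))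
                \<le> ennreal (cmod (STFT \<phi> u x \<xi>)) * (ennreal (\<langle>\<xi>\<rangle> powr t2) * ennreal (\<langle>x\<rangle> powr s2))"
              by (intro mult_right_mono ennreal_leI u) simp
            finally show ?thesis by (simp only: mult.commute[of "ennreal (\<langle>\<xi>\<rangle> powr t2)"])
          qed
        qed measurable
        finally show "ennreal (c * S powr recip q2 * h) \<le> modulation_norm \<phi> (weight s2 t2) p2 q2 u" .
      qed
      moreover have "modulation_norm \<phi> (weight s1 t1) p1 q1 (distribution_of f)
          \<le> Lp_norm p1 (\<lambda>z::'a. ennreal C * ennreal (\<langle>z\<rangle> powr (-r))) * Lp_norm q1 G"
        unfolding modulation_norm_weight STFT_distribution_of
      proof (rule mixed_norm_product_le[OF p(1) q(1) meas[OF f]])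
        show "ennreal (cmod (stft \<phi> f (x, \<xi>))) * (ennreal (\<langle>x\<rangle> powr s1) * ennreal (\<langle>\<xi>\<rangle> powr t1))
          \<le> ennreal C * ennreal (\<langle>x\<rangle> powr (-r)) * G \<xi>" for x \<xi>
          using up[of x \<xi>] by (simp only: mult.commute[of "ennreal (\<langle>x\<rangle> powr s1)"] mult.commute[of _ "G \<xi>"])
      qed measurable
      moreover have "\<dots> \<le> ennreal H * ennreal (C * S powr recip q1)" by (intro mult_mono G H) auto
      ultimately have "ennreal (c * S powr recip q2 * h) \<le> ennreal M * (ennreal H * ennreal (C * S powr recip q1))"
        by (meson mult_left_mono order_trans zero_le)
      then have "ennreal (c * S powr recip q2 * h) \<le> ennreal (M * (H * (C * S powr recip q1)))"
        using M(1) C H(1) by (simp add: ennreal_mult)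
      then have "c * S powr recip q2 * h \<le> M * (H * (C * S powr recip q1))"
        using M(1) C H(1) by (subst (asm) ennreal_le_iff) auto
      then have "c * h * S powr recip q2 \<le> M * C * H * S powr recip q1" by (simp only: mult_ac)
      with S show "\<exists>S. B \<le> S \<and> 0 < S \<and> c * h * S powr recip q2 \<le> M * C * H * S powr recip q1" by blast
    qed
  qed
qed

text \<open>Without weights the strict inequality between reciprocals already implies
  \<open>p1 \<le> p2\<close>.\<close>

lemma index_condition_0_iff:
  assumes "1 \<le> p1" "1 \<le> p2" "0 < d"
  shows "index_condition d p1 0 p2 0 \<longleftrightarrow> p1 \<le> p2"
  unfolding index_condition_iff[OF assms] using recip_le_iff[OF assms(1,2)] by auto

theorem theorem6p6:
  fixes p1 p2 q1 q2 :: ennreal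
    and s1 s2 t1 t2 \<tau> :: real
    and \<phi> :: "real ^ 'n \<Rightarrow> complex"
    and \<Phi> :: "(real ^ 'n) \<times> (real ^ 'n) \<Rightarrow> complex"
  assumes "1 \<le> p1" and "1 \<le> p2" and "1 \<le> q1" and "1 \<le> q2"
    and "0 \<le> \<tau>" and "\<tau> \<le> 1"
    and "\<phi> \<in> schwartz" and "\<phi> \<noteq> (\<lambda>_. 0)"
    and "\<Phi> \<in> schwartz" and "\<Phi> \<noteq> (\<lambda>_. 0)"
  shows "(all_OP_bounded \<phi> \<tau> (modulation_space \<Phi> (\<lambda>_. 1) \<infinity> 1)
            (weight s1 t1) p1 q1 (weight s2 t2) p2 q2
          \<longleftrightarrow> index_condition CARD('n) p1 s1 p2 s2 \<and> index_condition CARD('n) q1 t1 q2 t2)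
       \<and> (s1 = 0 \<and> s2 = 0 \<and> t1 = 0 \<and> t2 = 0 \<longrightarrow>
            (all_OP_bounded \<phi> \<tau> (modulation_space \<Phi> (\<lambda>_. 1) \<infinity> 1)
               (weight s1 t1) p1 q1 (weight s2 t2) p2 q2
             \<longleftrightarrow> p1 \<le> p2 \<and> q1 \<le> q2))"
proof -
  let ?B = "all_OP_bounded \<phi> \<tau> (modulation_space \<Phi> (\<lambda>_. 1) \<infinity> 1) (weight s1 t1) p1 q1 (weight s2 t2) p2 q2"
  note p = assms(1,2) and q = assms(3,4) and \<phi> = assms(7,8) and \<Phi> = assms(9,10)
  have d: "0 < CARD('n)" by simp
  have dim: "DIM(real ^ 'n) = CARD('n)" by simp
  have "index_condition CARD('n) p1 s1 p2 s2 \<and> index_condition CARD('n) q1 t1 q2 t2" if B: ?B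
    unfolding index_condition_iff[OF p d] index_condition_iff[OF q d]
    using OP_bounded_signs[OF p q \<phi> \<Phi>(1) B] OP_bounded_exponents[OF p q \<phi> \<Phi>(1) B, unfolded dim] by blast
  moreover have ?B if "index_condition CARD('n) p1 s1 p2 s2" "index_condition CARD('n) q1 t1 q2 t2"
    unfolding all_OP_bounded_def
  proof
    fix \<sigma> :: "((real ^ 'n) \<times> (real ^ 'n) \<Rightarrow> complex) \<Rightarrow> complex"
    assume \<sigma>: "\<sigma> \<in> modulation_space \<Phi> (\<lambda>_. 1) \<infinity> 1"
    show "\<exists>C. \<forall>f\<in>schwartz. modulation_norm \<phi> (weight s2 t2) p2 q2 (OP \<tau> \<sigma> f)
        \<le> ennreal C * modulation_norm \<phi> (weight s1 t1) p1 q1 (distribution_of f)"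
      by (rule OP_bounded[OF p q \<phi> \<Phi> \<sigma>, unfolded dim])
        (use that in \<open>auto simp: index_condition_iff[OF p d] index_condition_iff[OF q d]\<close>)
  qed
  ultimately have main: "?B \<longleftrightarrow> index_condition CARD('n) p1 s1 p2 s2 \<and> index_condition CARD('n) q1 t1 q2 t2"
    by blast
  then show ?thesis
    using index_condition_0_iff[OF p d] index_condition_0_iff[OF q d] by auto
qed

end
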